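(* Let $I$ and $J$ be small categories and let $C: I\times J\to \mathbf{CAT}$ be a functor. Then there is a faithful functor $$\iota=\iota_{I,J,C}:\ \operatorname{hocolim}_J\operatorname{holim}_I C\longrightarrow \operatorname{holim}_I\operatorname{hocolim}_J C$$ which is natural in all variables involved, i.e. in $I$, $J$ and $C$. If in addition the category $I$ has a pseudo-final object $(e,\epsilon)$, then there also exists a functor $$p=p_{(I,e,\epsilon),J,C}:\ \operatorname{holim}_I\operatorname{hocolim}_J C\longrightarrow \operatorname{hocolim}_J\operatorname{holim}_I C$$ such that $p\,\iota=1$ (the identity functor, strictly), together with a natural transformation $1\to \iota\, p$. The functor $p$ is natural in $J$ and $C$, and for functors $I\to I'$ (between small categories equipped with pseudo-final objects $(e,\epsilon)$ and $(e',\epsilon')$) which preserve the pseudo-final object and its natural map. In particular, if $I$ has a pseudo-final object, the functor $\iota$ is a homotopy equivalence.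
   Context: $\mathbf{CAT}$ is the (large) category of all small categories and functors; functors into $\mathbf{CAT}$ are strict. **Homotopy colimit.** For a small category $I$ and a functor $C:I\to\mathbf{CAT}$, $i\mapsto C_i$, the homotopy colimit is the Grothendieck construction $\operatorname{hocolim}_I C:=\int_I C$. Its objects are pairs $(i,x)$ with $i\in I$ and $x\in C_i$. A map $(i,x)\to(j,y)$ is a pair $(\alpha,\rho)$ with $\alpha:i\to j$ a map in $I$ and $\rho:\alpha x\to y$ a map in $C_j$, where $\alpha x:=C(\alpha)(x)$. Composition is $(\alpha,\rho)(\beta,\mu)=(\alpha\beta,\ \rho\circ\alpha(\mu))$, where $\alpha(\mu):=C(\alpha)(\mu)$. There is a natural projection functor $\pi:\operatorname{hocolim}_I C\to I$, $(i,x)\mapsto i$, $(\alpha,\rho)\mapsto\alpha$. **Homotopy limit.** $\operatorname{holim}_I C$ is the (strict) pullback of categories of $$\operatorname{HOM}(I,\operatorname{hocolim}_I C)\xrightarrow{\ \pi_*\ }\operatorname{HOM}(I,I)\xleftarrow{\ id\ }0,$$ where $\operatorname{HOM}$ denotes the functor category, $\pi_*$ is composition with $\pi$, $0$ is the category with only one map, and $id$ sends the only object of $0$ to the identity functor of $I$. Thus its objects are functors $s:I\to\operatorname{hocolim}_I C$ with $\pi s=1_I$, and its maps are natural transformations $\tau$ between such functors with $\pi(\tau_i)=1_i$ for all $i\in I$. **Iterated constructions.** For $C:I\times J\to\mathbf{CAT}$, $\operatorname{hocolim}_J\operatorname{holim}_I C$ is the homotopy colimit of the functor $J\to\mathbf{CAT}$,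 $j\mapsto\operatorname{holim}_I C(-,j)$, and $\operatorname{holim}_I\operatorname{hocolim}_J C$ is the homotopy limit of the functor $I\to\mathbf{CAT}$, $i\mapsto\operatorname{hocolim}_J C(i,-)$. **Pseudo-final object.** A pseudo-final object in a category $I$ is an object $e\in I$ together with a natural map $\epsilon:1\to e$ from the identity functor of $I$ to the constant functor with value $e$ (i.e. maps $\epsilon_i:i\to e$ with $\epsilon_{i'}\alpha=\epsilon_i$ for every $\alpha:i\to i'$ in $I$; it is not required that $\epsilon_e=1_e$). A functor $u:I\to I'$ preserves pseudo-final objects $(e,\epsilon)$, $(e',\epsilon')$ and their natural maps if $u(e)=e'$ and $u(\epsilon_i)=\epsilon'_{u(i)}$ for all $i\in I$. **Naturality.** Naturality means strict commutativity of the evident squares. In $C$: with respect to natural transformations $C\to D$ of functors $I\times J\to\mathbf{CAT}$. In $J$: for a functor $v:J\to J'$ and $C:I\times J'\to\mathbf{CAT}$, with respect to the functors $\operatorname{hocolim}_J\operatorname{holim}_I C\circ(1\times v)\to\operatorname{hocolim}_{J'}\operatorname{holim}_I C$ and $\operatorname{holim}_I\operatorname{hocolim}_J C\circ(1\times v)\to\operatorname{holim}_I\operatorname{hocolim}_{J'}C$ induced by $v$. In $I$: for a functor $u:I\to I'$ and $C:I'\times J\to\mathbf{CAT}$, with respect to the restriction functors $\operatorname{hocolim}_J\operatorname{holim}_{I'}C\to\operatorname{hocolim}_J\operatorname{holim}_I C\circ(u\times 1)$ and $\operatorname{holim}_{I'}\operatorname{hocolim}_J C\to\operatorname{holim}_I\operatorname{hocolim}_J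 C\circ(u\times1)$ induced by $u$. A functor between small categories is a homotopy equivalence if it induces a homotopy equivalence on classifying spaces (geometric realizations of nerves).
   Formalization: Faithfulness of ι is asserted only for nonempty I: for I empty, ι is the functor from J to the one-arrow category, which is not faithful if J has two distinct parallel maps; small categories in a naturality square are taken over common underlying sets of objects and maps. *)

theory Defs
  imports "HOL-Homology.Homology"
begin

section \<open>Categories, functors, natural transformations\<close>

text \<open>
  A small category is a category whose objects and arrows are elements of HOL types.
  Every arrow has a unique domain and codomain, and \<open>Comp C g f\<close> is
  "first \<open>f\<close>, then \<open>g\<close>". Nothing is required of the operations outside \<open>Obj C\<close> and \<open>Arr C\<close>.
\<close>

record ('o, 'a) cat =
  Obj :: "'o set"
  Arr :: "'a set"
  Dom :: "'a \<Rightarrow> 'o"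
  Cod :: "'a \<Rightarrow> 'o"
  Ident :: "'o \<Rightarrow> 'a"
  Comp :: "'a \<Rightarrow> 'a \<Rightarrow> 'a"

locale category =
  fixes C :: "('o, 'a) cat"
  assumes Dom_in: "f \<in> Arr C \<Longrightarrow> Dom C f \<in> Obj C"
    and Cod_in: "f \<in> Arr C \<Longrightarrow> Cod C f \<in> Obj C"
    and Ident_in: "x \<in> Obj C \<Longrightarrow> Ident C x \<in> Arr C"
    and Dom_Ident: "x \<in> Obj C \<Longrightarrow> Dom C (Ident C x) = x"
    and Cod_Ident: "x \<in> Obj C \<Longrightarrow> Cod C (Ident C x) = x"
    and Comp_in: "\<lbrakk>f \<in> Arr C; g \<in> Arr C; Cod C f = Dom C g\<rbrakk> \<Longrightarrow> Comp C g f \<in> Arr C"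
    and Dom_Comp: "\<lbrakk>f \<in> Arr C; g \<in> Arr C; Cod C f = Dom C g\<rbrakk> \<Longrightarrow> Dom C (Comp C g f) = Dom C f"
    and Cod_Comp: "\<lbrakk>f \<in> Arr C; g \<in> Arr C; Cod C f = Dom C g\<rbrakk> \<Longrightarrow> Cod C (Comp C g f) = Cod C g"
    and Comp_Ident: "f \<in> Arr C \<Longrightarrow> Comp C f (Ident C (Dom C f)) = f"
    and Ident_Comp: "f \<in> Arr C \<Longrightarrow> Comp C (Ident C (Cod C f)) f = f"
    and Comp_assoc: "\<lbrakk>f \<in> Arr C; g \<in> Arr C; h \<in> Arr C; Cod C f = Dom C g; Cod C g = Dom C h\<rbrakk>
      \<Longrightarrow> Comp C h (Comp C g f) = Comp C (Comp C h g) f"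

text \<open>
  Functors and natural transformations carry their source and target, and their maps are
  extensional (\<open>undefined\<close> outside the source category). Hence equality of records is strict
  equality of functors, and functors and transformations can serve as objects and arrows.
\<close>

record ('o, 'a, 'p, 'b) ftr =
  fsrc :: "('o, 'a) cat"
  ftgt :: "('p, 'b) cat"
  fobj :: "'o \<Rightarrow> 'p"
  farr :: "'a \<Rightarrow> 'b"

locale is_functor = A: category A + B: category B
  for A :: "('o, 'a) cat" and B :: "('p, 'b) cat" +
  fixes F :: "('o, 'a, 'p, 'b) ftr"
  assumes fsrc: "fsrc F = A"
    and ftgt: "ftgt F = B"
    and fobj_in: "fobj F \<in> Obj A \<rightarrow>\<^sub>E Obj B"
    and farr_in: "farr F \<in> Arr A \<rightarrow>\<^sub>E Arr B"
    and Dom_farr: "f \<in> Arr A \<Longrightarrow> Dom B (farr F f) = fobj F (Dom A f)"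
    and Cod_farr: "f \<in> Arr A \<Longrightarrow> Cod B (farr F f) = fobj F (Cod A f)"
    and farr_Ident: "x \<in> Obj A \<Longrightarrow> farr F (Ident A x) = Ident B (fobj F x)"
    and farr_Comp: "\<lbrakk>f \<in> Arr A; g \<in> Arr A; Cod A f = Dom A g\<rbrakk>
      \<Longrightarrow> farr F (Comp A g f) = Comp B (farr F g) (farr F f)"

definition id_ftr :: "('o, 'a) cat \<Rightarrow> ('o, 'a, 'o, 'a) ftr" where
  "id_ftr A = \<lparr>fsrc = A, ftgt = A, fobj = (\<lambda>x\<in>Obj A. x), farr = (\<lambda>f\<in>Arr A. f)\<rparr>"

definition const_ftr :: "('o, 'a) cat \<Rightarrow> ('p, 'b) cat \<Rightarrow> 'p \<Rightarrow> ('o, 'a, 'p, 'b) ftr" where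
  "const_ftr A B e =
    \<lparr>fsrc = A, ftgt = B, fobj = (\<lambda>x\<in>Obj A. e), farr = (\<lambda>f\<in>Arr A. Ident B e)\<rparr>"

definition comp_ftr ::
  "('p, 'b, 'q, 'c) ftr \<Rightarrow> ('o, 'a, 'p, 'b) ftr \<Rightarrow> ('o, 'a, 'q, 'c) ftr" (infixl "\<circ>\<^sub>F" 70) where
  "G \<circ>\<^sub>F F = \<lparr>fsrc = fsrc F, ftgt = ftgt G,
    fobj = (\<lambda>x\<in>Obj (fsrc F). fobj G (fobj F x)),
    farr = (\<lambda>f\<in>Arr (fsrc F). farr G (farr F f))\<rparr>"

definition faithful :: "('o, 'a, 'p, 'b) ftr \<Rightarrow> bool" where
  "faithful F \<longleftrightarrow> (\<forall>f\<in>Arr (fsrc F). \<forall>g\<in>Arr (fsrc F).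
    Dom (fsrc F) f = Dom (fsrc F) g \<and> Cod (fsrc F) f = Cod (fsrc F) g \<and> farr F f = farr F g
    \<longrightarrow> f = g)"

record ('o, 'a, 'p, 'b) ntr =
  nsrc :: "('o, 'a, 'p, 'b) ftr"
  ntgt :: "('o, 'a, 'p, 'b) ftr"
  ncomp :: "'o \<Rightarrow> 'b"

locale nat_transf = F: is_functor A B F + G: is_functor A B G
  for A :: "('o, 'a) cat" and B :: "('p, 'b) cat" and F and G +
  fixes \<tau> :: "('o, 'a, 'p, 'b) ntr"
  assumes nsrc: "nsrc \<tau> = F"
    and ntgt: "ntgt \<tau> = G"
    and ncomp_in: "ncomp \<tau> \<in> Obj A \<rightarrow>\<^sub>E Arr B"
    and Dom_ncomp: "x \<in> Obj A \<Longrightarrow> Dom B (ncomp \<tau> x) = fobj F x"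
    and Cod_ncomp: "x \<in> Obj A \<Longrightarrow> Cod B (ncomp \<tau> x) = fobj G x"
    and naturality: "f \<in> Arr A \<Longrightarrow>
      Comp B (ncomp \<tau> (Cod A f)) (farr F f) = Comp B (farr G f) (ncomp \<tau> (Dom A f))"

definition HOM :: "('o, 'a) cat \<Rightarrow> ('p, 'b) cat
    \<Rightarrow> (('o, 'a, 'p, 'b) ftr, ('o, 'a, 'p, 'b) ntr) cat" where
  "HOM A B = \<lparr>Obj = {F. is_functor A B F},
    Arr = {\<tau>. nat_transf A B (nsrc \<tau>) (ntgt \<tau>) \<tau>},
    Dom = nsrc, Cod = ntgt,
    Ident = (\<lambda>F. \<lparr>nsrc = F, ntgt = F, ncomp = (\<lambda>x\<in>Obj A. Ident B (fobj F x))\<rparr>),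
    Comp = (\<lambda>\<sigma> \<tau>. \<lparr>nsrc = nsrc \<tau>, ntgt = ntgt \<sigma>,
      ncomp = (\<lambda>x\<in>Obj A. Comp B (ncomp \<sigma> x) (ncomp \<tau> x))\<rparr>)\<rparr>"

definition whisker ::
  "('p, 'b, 'q, 'c) ftr \<Rightarrow> ('o, 'a, 'p, 'b) ntr \<Rightarrow> ('o, 'a, 'q, 'c) ntr" where
  "whisker H \<tau> = \<lparr>nsrc = H \<circ>\<^sub>F nsrc \<tau>, ntgt = H \<circ>\<^sub>F ntgt \<tau>,
    ncomp = (\<lambda>x\<in>Obj (fsrc (nsrc \<tau>)). farr H (ncomp \<tau> x))\<rparr>"

definition CAT :: "(('o, 'a) cat, ('o, 'a, 'o, 'a) ftr) cat" where
  "CAT = \<lparr>Obj = {A. category A}, Arr = {F. is_functor (fsrc F) (ftgt F) F},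
    Dom = fsrc, Cod = ftgt, Ident = id_ftr, Comp = comp_ftr\<rparr>"

definition prod_cat :: "('i, 'f) cat \<Rightarrow> ('j, 'g) cat \<Rightarrow> ('i \<times> 'j, 'f \<times> 'g) cat" where
  "prod_cat I J = \<lparr>Obj = Obj I \<times> Obj J, Arr = Arr I \<times> Arr J,
    Dom = map_prod (Dom I) (Dom J), Cod = map_prod (Cod I) (Cod J),
    Ident = map_prod (Ident I) (Ident J),
    Comp = (\<lambda>(\<alpha>, \<beta>) (\<alpha>', \<beta>'). (Comp I \<alpha> \<alpha>', Comp J \<beta> \<beta>'))\<rparr>"

definition prod_ftr :: "('i, 'f, 'k, 'h) ftr \<Rightarrow> ('j, 'g, 'l, 'm) ftr
    \<Rightarrow> ('i \<times> 'j, 'f \<times> 'g, 'k \<times> 'l, 'h \<times> 'm) ftr" where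
  "prod_ftr u v = \<lparr>fsrc = prod_cat (fsrc u) (fsrc v), ftgt = prod_cat (ftgt u) (ftgt v),
    fobj = (\<lambda>x\<in>Obj (fsrc u) \<times> Obj (fsrc v). map_prod (fobj u) (fobj v) x),
    farr = (\<lambda>f\<in>Arr (fsrc u) \<times> Arr (fsrc v). map_prod (farr u) (farr v) f)\<rparr>"

definition pseudo_final :: "('i, 'f) cat \<Rightarrow> 'i \<Rightarrow> ('i, 'f, 'i, 'f) ntr \<Rightarrow> bool" where
  "pseudo_final I e \<epsilon> \<longleftrightarrow> e \<in> Obj I \<and> nat_transf I I (id_ftr I) (const_ftr I I e) \<epsilon>"

definition preserves_pseudo_final :: "('i, 'f, 'k, 'h) ftr
    \<Rightarrow> 'i \<Rightarrow> ('i, 'f, 'i, 'f) ntr \<Rightarrow> 'k \<Rightarrow> ('k, 'h, 'k, 'h) ntr \<Rightarrow> bool" where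
  "preserves_pseudo_final u e \<epsilon> e' \<epsilon>' \<longleftrightarrow>
    fobj u e = e' \<and> (\<forall>i\<in>Obj (fsrc u). farr u (ncomp \<epsilon> i) = ncomp \<epsilon>' (fobj u i))"


section \<open>Homotopy colimits and homotopy limits of categories\<close>

text \<open>
  A map \<open>(\<alpha>, \<rho>) : (i, x) \<rightarrow> (j, y)\<close> of the Grothendieck construction is stored as
  \<open>((i, x), (\<alpha>, \<rho>), (j, y))\<close>, because \<open>x\<close> cannot be recovered from \<open>(\<alpha>, \<rho>)\<close>.
\<close>

type_synonym ('i, 'f, 'c, 'd) hcolim_arr = "('i \<times> 'c) \<times> ('f \<times> 'd) \<times> ('i \<times> 'c)"

type_synonym ('i, 'f, 'c, 'd) diagram = "('i, 'f, ('c, 'd) cat, ('c, 'd, 'c, 'd) ftr) ftr"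

type_synonym ('i, 'f, 'c, 'd) diagram_map = "('i, 'f, ('c, 'd) cat, ('c, 'd, 'c, 'd) ftr) ntr"

definition hocolim ::
  "('i, 'f, 'c, 'd) diagram \<Rightarrow> ('i \<times> 'c, ('i, 'f, 'c, 'd) hcolim_arr) cat" where
  "hocolim C = (let I = fsrc C in
    \<lparr>Obj = {(i, x). i \<in> Obj I \<and> x \<in> Obj (fobj C i)},
     Arr = {((i, x), (\<alpha>, \<rho>), (j, y)) | i x \<alpha> \<rho> j y.
       \<alpha> \<in> Arr I \<and> Dom I \<alpha> = i \<and> Cod I \<alpha> = j \<and> x \<in> Obj (fobj C i) \<and> \<rho> \<in> Arr (fobj C j) \<and>
       Dom (fobj C j) \<rho> = fobj (farr C \<alpha>) x \<and> Cod (fobj C j) \<rho> = y},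
     Dom = (\<lambda>(a, r, b). a),
     Cod = (\<lambda>(a, r, b). b),
     Ident = (\<lambda>(i, x). ((i, x), (Ident I i, Ident (fobj C i) x), (i, x))),
     Comp = (\<lambda>(_, (\<alpha>, \<rho>), c) (a, (\<beta>, \<mu>), _).
       (a, (Comp I \<alpha> \<beta>, Comp (fobj C (Cod I \<alpha>)) \<rho> (farr (farr C \<alpha>) \<mu>)), c))\<rparr>)"

definition hocolim_proj ::
  "('i, 'f, 'c, 'd) diagram \<Rightarrow> ('i \<times> 'c, ('i, 'f, 'c, 'd) hcolim_arr, 'i, 'f) ftr" where
  "hocolim_proj C = \<lparr>fsrc = hocolim C, ftgt = fsrc C,
    fobj = (\<lambda>(i, x)\<in>Obj (hocolim C). i),
    farr = (\<lambda>(a, (\<alpha>, \<rho>), b)\<in>Arr (hocolim C). \<alpha>)\<rparr>"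

type_synonym ('i, 'f, 'c, 'd) hlim_obj = "('i, 'f, 'i \<times> 'c, ('i, 'f, 'c, 'd) hcolim_arr) ftr"

type_synonym ('i, 'f, 'c, 'd) hlim_arr = "('i, 'f, 'i \<times> 'c, ('i, 'f, 'c, 'd) hcolim_arr) ntr"

definition holim ::
  "('i, 'f, 'c, 'd) diagram \<Rightarrow> (('i, 'f, 'c, 'd) hlim_obj, ('i, 'f, 'c, 'd) hlim_arr) cat" where
  "holim C = (let I = fsrc C; H = HOM I (hocolim C);
      S = {s \<in> Obj H. hocolim_proj C \<circ>\<^sub>F s = id_ftr I} in
    H\<lparr>Obj := S,
      Arr := {\<tau> \<in> Arr H. nsrc \<tau> \<in> S \<and> ntgt \<tau> \<in> S \<and>
        (\<forall>i\<in>Obj I. farr (hocolim_proj C) (ncomp \<tau> i) = Ident I i)}\<rparr>)"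

text \<open>Functoriality in the diagram, for \<open>\<phi> : C \<rightarrow> D\<close>.\<close>

definition hocolim_map :: "('i, 'f, 'c, 'd) diagram_map
    \<Rightarrow> ('i \<times> 'c, ('i, 'f, 'c, 'd) hcolim_arr, 'i \<times> 'c, ('i, 'f, 'c, 'd) hcolim_arr) ftr" where
  "hocolim_map \<phi> = \<lparr>fsrc = hocolim (nsrc \<phi>), ftgt = hocolim (ntgt \<phi>),
    fobj = (\<lambda>(i, x)\<in>Obj (hocolim (nsrc \<phi>)). (i, fobj (ncomp \<phi> i) x)),
    farr = (\<lambda>((i, x), (\<alpha>, \<rho>), (j, y))\<in>Arr (hocolim (nsrc \<phi>)).
      ((i, fobj (ncomp \<phi> i) x), (\<alpha>, farr (ncomp \<phi> j) \<rho>), (j, fobj (ncomp \<phi> j) y)))\<rparr>"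

definition holim_map :: "('i, 'f, 'c, 'd) diagram_map
    \<Rightarrow> (('i, 'f, 'c, 'd) hlim_obj, ('i, 'f, 'c, 'd) hlim_arr,
        ('i, 'f, 'c, 'd) hlim_obj, ('i, 'f, 'c, 'd) hlim_arr) ftr" where
  "holim_map \<phi> = \<lparr>fsrc = holim (nsrc \<phi>), ftgt = holim (ntgt \<phi>),
    fobj = (\<lambda>s\<in>Obj (holim (nsrc \<phi>)). hocolim_map \<phi> \<circ>\<^sub>F s),
    farr = (\<lambda>\<tau>\<in>Arr (holim (nsrc \<phi>)). whisker (hocolim_map \<phi>) \<tau>)\<rparr>"

text \<open>Functoriality in the index category: \<open>hocolim (C \<circ>\<^sub>F v) \<rightarrow> hocolim C\<close> and
  \<open>holim C \<rightarrow> holim (C \<circ>\<^sub>F u)\<close>.\<close>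

definition hocolim_reindex :: "('j, 'g, 'k, 'h) ftr \<Rightarrow> ('k, 'h, 'c, 'd) diagram
    \<Rightarrow> ('j \<times> 'c, ('j, 'g, 'c, 'd) hcolim_arr, 'k \<times> 'c, ('k, 'h, 'c, 'd) hcolim_arr) ftr" where
  "hocolim_reindex v C = \<lparr>fsrc = hocolim (C \<circ>\<^sub>F v), ftgt = hocolim C,
    fobj = (\<lambda>(j, x)\<in>Obj (hocolim (C \<circ>\<^sub>F v)). (fobj v j, x)),
    farr = (\<lambda>((j, x), (\<beta>, \<rho>), (k, y))\<in>Arr (hocolim (C \<circ>\<^sub>F v)).
      ((fobj v j, x), (farr v \<beta>, \<rho>), (fobj v k, y)))\<rparr>"

text \<open>
  The restriction of a section \<open>s\<close> along \<open>u\<close> is the section with the same second components as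
  \<open>s \<circ>\<^sub>F u\<close>; that is, the section corresponding to \<open>s \<circ>\<^sub>F u\<close> under the identification of
  \<open>hocolim (C \<circ>\<^sub>F u)\<close> with the pullback of \<open>hocolim C\<close> along \<open>u\<close>.
\<close>

definition restrict_section ::
  "('i, 'f, 'k, 'h) ftr \<Rightarrow> ('k, 'h, 'c, 'd) diagram
    \<Rightarrow> ('k, 'h, 'c, 'd) hlim_obj \<Rightarrow> ('i, 'f, 'c, 'd) hlim_obj" where
  "restrict_section u C s = (let I = fsrc u in
    \<lparr>fsrc = I, ftgt = hocolim (C \<circ>\<^sub>F u),
     fobj = (\<lambda>i\<in>Obj I. (i, snd (fobj s (fobj u i)))),
     farr = (\<lambda>\<alpha>\<in>Arr I. case farr s (farr u \<alpha>) of ((_, x), (_, \<rho>), (_, y)) \<Rightarrow>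
       ((Dom I \<alpha>, x), (\<alpha>, \<rho>), (Cod I \<alpha>, y)))\<rparr>)"

definition holim_restrict :: "('i, 'f, 'k, 'h) ftr \<Rightarrow> ('k, 'h, 'c, 'd) diagram
    \<Rightarrow> (('k, 'h, 'c, 'd) hlim_obj, ('k, 'h, 'c, 'd) hlim_arr,
        ('i, 'f, 'c, 'd) hlim_obj, ('i, 'f, 'c, 'd) hlim_arr) ftr" where
  "holim_restrict u C = (let I = fsrc u in
    \<lparr>fsrc = holim C, ftgt = holim (C \<circ>\<^sub>F u),
     fobj = (\<lambda>s\<in>Obj (holim C). restrict_section u C s),
     farr = (\<lambda>\<tau>\<in>Arr (holim C).
       \<lparr>nsrc = restrict_section u C (nsrc \<tau>), ntgt = restrict_section u C (ntgt \<tau>),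
        ncomp = (\<lambda>i\<in>Obj I. case ncomp \<tau> (fobj u i) of ((_, x), (_, \<rho>), (_, y)) \<Rightarrow>
          ((i, x), (Ident I i, \<rho>), (i, y)))\<rparr>)\<rparr>)"


section \<open>Iterated constructions\<close>

definition slice_fst ::
  "('j, 'g) cat \<Rightarrow> ('i, 'f) cat \<Rightarrow> ('i \<times> 'j, 'f \<times> 'g, 'p, 'b) ftr \<Rightarrow> 'i \<Rightarrow> ('j, 'g, 'p, 'b) ftr"
  where \<comment> \<open>\<open>C(i, -)\<close>\<close>
  "slice_fst J I C i = \<lparr>fsrc = J, ftgt = ftgt C,
    fobj = (\<lambda>j\<in>Obj J. fobj C (i, j)), farr = (\<lambda>\<beta>\<in>Arr J. farr C (Ident I i, \<beta>))\<rparr>"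

definition slice_snd ::
  "('i, 'f) cat \<Rightarrow> ('j, 'g) cat \<Rightarrow> ('i \<times> 'j, 'f \<times> 'g, 'p, 'b) ftr \<Rightarrow> 'j \<Rightarrow> ('i, 'f, 'p, 'b) ftr"
  where \<comment> \<open>\<open>C(-, j)\<close>\<close>
  "slice_snd I J C j = \<lparr>fsrc = I, ftgt = ftgt C,
    fobj = (\<lambda>i\<in>Obj I. fobj C (i, j)), farr = (\<lambda>\<alpha>\<in>Arr I. farr C (\<alpha>, Ident J j))\<rparr>"

definition slice_fst_ntr ::
  "('j, 'g) cat \<Rightarrow> ('i, 'f) cat \<Rightarrow> ('i \<times> 'j, 'f \<times> 'g, 'p, 'b) ftr \<Rightarrow> 'f \<Rightarrow> ('j, 'g, 'p, 'b) ntr"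
  where \<comment> \<open>\<open>C(\<alpha>, -)\<close>\<close>
  "slice_fst_ntr J I C \<alpha> =
    \<lparr>nsrc = slice_fst J I C (Dom I \<alpha>), ntgt = slice_fst J I C (Cod I \<alpha>),
     ncomp = (\<lambda>j\<in>Obj J. farr C (\<alpha>, Ident J j))\<rparr>"

definition slice_snd_ntr ::
  "('i, 'f) cat \<Rightarrow> ('j, 'g) cat \<Rightarrow> ('i \<times> 'j, 'f \<times> 'g, 'p, 'b) ftr \<Rightarrow> 'g \<Rightarrow> ('i, 'f, 'p, 'b) ntr"
  where \<comment> \<open>\<open>C(-, \<beta>)\<close>\<close>
  "slice_snd_ntr I J C \<beta> =
    \<lparr>nsrc = slice_snd I J C (Dom J \<beta>), ntgt = slice_snd I J C (Cod J \<beta>),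
     ncomp = (\<lambda>i\<in>Obj I. farr C (Ident I i, \<beta>))\<rparr>"

definition holim_fst :: "('i, 'f) cat \<Rightarrow> ('j, 'g) cat \<Rightarrow> ('i \<times> 'j, 'f \<times> 'g, 'c, 'd) diagram
    \<Rightarrow> ('j, 'g, ('i, 'f, 'c, 'd) hlim_obj, ('i, 'f, 'c, 'd) hlim_arr) diagram"
  where \<comment> \<open>the functor \<open>j \<mapsto> holim\<^sub>I C(-, j)\<close>\<close>
  "holim_fst I J C = \<lparr>fsrc = J, ftgt = CAT,
    fobj = (\<lambda>j\<in>Obj J. holim (slice_snd I J C j)),
    farr = (\<lambda>\<beta>\<in>Arr J. holim_map (slice_snd_ntr I J C \<beta>))\<rparr>"

definition hocolim_snd :: "('i, 'f) cat \<Rightarrow> ('j, 'g) cat \<Rightarrow> ('i \<times> 'j, 'f \<times> 'g, 'c, 'd) diagram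
    \<Rightarrow> ('i, 'f, 'j \<times> 'c, ('j, 'g, 'c, 'd) hcolim_arr) diagram"
  where \<comment> \<open>the functor \<open>i \<mapsto> hocolim\<^sub>J C(i, -)\<close>\<close>
  "hocolim_snd I J C = \<lparr>fsrc = I, ftgt = CAT,
    fobj = (\<lambda>i\<in>Obj I. hocolim (slice_fst J I C i)),
    farr = (\<lambda>\<alpha>\<in>Arr I. hocolim_map (slice_fst_ntr J I C \<alpha>))\<rparr>"

abbreviation hocolim_holim where
  "hocolim_holim I J C \<equiv> hocolim (holim_fst I J C)"

abbreviation holim_hocolim where
  "holim_hocolim I J C \<equiv> holim (hocolim_snd I J C)"

type_synonym ('i, 'f, 'j, 'g, 'c, 'd) hocolim_holim_obj = "'j \<times> ('i, 'f, 'c, 'd) hlim_obj"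

type_synonym ('i, 'f, 'j, 'g, 'c, 'd) hocolim_holim_arr =
  "('j, 'g, ('i, 'f, 'c, 'd) hlim_obj, ('i, 'f, 'c, 'd) hlim_arr) hcolim_arr"

type_synonym ('i, 'f, 'j, 'g, 'c, 'd) holim_hocolim_obj =
  "('i, 'f, 'j \<times> 'c, ('j, 'g, 'c, 'd) hcolim_arr) hlim_obj"

type_synonym ('i, 'f, 'j, 'g, 'c, 'd) holim_hocolim_arr =
  "('i, 'f, 'j \<times> 'c, ('j, 'g, 'c, 'd) hcolim_arr) hlim_arr"

text \<open>The functors induced by a natural transformation \<open>\<phi> : C \<rightarrow> D\<close> of functors on \<open>I \<times> J\<close>.\<close>

definition hocolim_holim_map where
  "hocolim_holim_map I J \<phi> = hocolim_map
    \<lparr>nsrc = holim_fst I J (nsrc \<phi>), ntgt = holim_fst I J (ntgt \<phi>),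
     ncomp = (\<lambda>j\<in>Obj J. holim_map
       \<lparr>nsrc = slice_snd I J (nsrc \<phi>) j, ntgt = slice_snd I J (ntgt \<phi>) j,
        ncomp = (\<lambda>i\<in>Obj I. ncomp \<phi> (i, j))\<rparr>)\<rparr>"

definition holim_hocolim_map where
  "holim_hocolim_map I J \<phi> = holim_map
    \<lparr>nsrc = hocolim_snd I J (nsrc \<phi>), ntgt = hocolim_snd I J (ntgt \<phi>),
     ncomp = (\<lambda>i\<in>Obj I. hocolim_map
       \<lparr>nsrc = slice_fst J I (nsrc \<phi>) i, ntgt = slice_fst J I (ntgt \<phi>) i,
        ncomp = (\<lambda>j\<in>Obj J. ncomp \<phi> (i, j))\<rparr>)\<rparr>"

text \<open>The functors induced by \<open>v : J \<rightarrow> J'\<close>, for \<open>C\<close> on \<open>I \<times> J'\<close>. The domain of the first one,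
  \<open>hocolim (holim_fst I J' C \<circ>\<^sub>F v)\<close>, is \<open>hocolim_holim I J (C \<circ>\<^sub>F prod_ftr (id_ftr I) v)\<close>.\<close>

definition hocolim_holim_reindex where
  "hocolim_holim_reindex I v C = hocolim_reindex v (holim_fst I (ftgt v) C)"

definition holim_hocolim_reindex where
  "holim_hocolim_reindex I v C = holim_map
    \<lparr>nsrc = hocolim_snd I (fsrc v) (C \<circ>\<^sub>F prod_ftr (id_ftr I) v), ntgt = hocolim_snd I (ftgt v) C,
     ncomp = (\<lambda>i\<in>Obj I. hocolim_reindex v (slice_fst (ftgt v) I C i))\<rparr>"

text \<open>The functors induced by \<open>u : I \<rightarrow> I'\<close>, for \<open>C\<close> on \<open>I' \<times> J\<close>. The codomain of the second one,
  \<open>holim (hocolim_snd I' J C \<circ>\<^sub>F u)\<close>, is \<open>holim_hocolim I J (C \<circ>\<^sub>F prod_ftr u (id_ftr J))\<close>.\<close>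

definition hocolim_holim_restrict where
  "hocolim_holim_restrict u J C = hocolim_map
    \<lparr>nsrc = holim_fst (ftgt u) J C, ntgt = holim_fst (fsrc u) J (C \<circ>\<^sub>F prod_ftr u (id_ftr J)),
     ncomp = (\<lambda>j\<in>Obj J. holim_restrict u (slice_snd (ftgt u) J C j))\<rparr>"

definition holim_hocolim_restrict where
  "holim_hocolim_restrict u J C = holim_restrict u (hocolim_snd (ftgt u) J C)"


section \<open>Classifying spaces\<close>

definition ord_cat :: "nat \<Rightarrow> (nat, nat \<times> nat) cat" where
  "ord_cat n = \<lparr>Obj = {..n}, Arr = {(i, j). i \<le> j \<and> j \<le> n}, Dom = fst, Cod = snd,
    Ident = (\<lambda>i. (i, i)), Comp = (\<lambda>(_, k) (i, _). (i, k))\<rparr>"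

type_synonym ('o, 'a) simplex = "(nat, nat \<times> nat, 'o, 'a) ftr"

type_synonym ('o, 'a) nerve_point = "(nat \<times> ('o, 'a) simplex) \<times> (nat \<Rightarrow> real)"

definition nerve :: "('o, 'a) cat \<Rightarrow> nat \<Rightarrow> ('o, 'a) simplex set" where
  "nerve C n = {\<sigma>. is_functor (ord_cat n) C \<sigma>}"

text \<open>The disjoint union of the \<open>nerve C n \<times> \<Delta>\<^sup>n\<close>, with \<open>nerve C n\<close> discrete.\<close>

definition nerve_coproduct :: "('o, 'a) cat \<Rightarrow> ('o, 'a) nerve_point topology" where
  "nerve_coproduct C =
    sum_topology (\<lambda>(n, \<sigma>). subtopology (powertop_real UNIV) (standard_simplex n))
      (SIGMA n:UNIV. nerve C n)"

definition simplex_push :: "nat \<Rightarrow> (nat \<Rightarrow> nat) \<Rightarrow> (nat \<Rightarrow> real) \<Rightarrow> nat \<Rightarrow> real" where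
  "simplex_push m \<theta> t = (\<lambda>j. \<Sum>i | i \<le> m \<and> \<theta> i = j. t i)"

inductive nerve_glue :: "('o, 'a) cat \<Rightarrow> ('o, 'a) nerve_point \<Rightarrow> ('o, 'a) nerve_point \<Rightarrow> bool"
  for C where
  "\<lbrakk>\<sigma> \<in> nerve C n; is_functor (ord_cat m) (ord_cat n) \<theta>; t \<in> standard_simplex m\<rbrakk>
    \<Longrightarrow> nerve_glue C ((m, \<sigma> \<circ>\<^sub>F \<theta>), t) ((n, \<sigma>), simplex_push m (fobj \<theta>) t)"

definition realization_rel :: "('o, 'a) cat \<Rightarrow> (('o, 'a) nerve_point \<times> ('o, 'a) nerve_point) set"
  where
  "realization_rel C = {(p, q). p \<in> topspace (nerve_coproduct C) \<and>
    q \<in> topspace (nerve_coproduct C) \<and> equivclp (nerve_glue C) p q}"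

definition quotient_topology :: "'x topology \<Rightarrow> ('x \<times> 'x) set \<Rightarrow> 'x set topology" where
  "quotient_topology X R = topology (\<lambda>U. U \<subseteq> topspace X // R \<and> openin X (\<Union>U))"

lemma openin_quotient_topology:
  assumes R: "equiv (topspace X) R"
  shows "openin (quotient_topology X R) U \<longleftrightarrow> U \<subseteq> topspace X // R \<and> openin X (\<Union>U)"
proof -
  have inter: "\<Union>(U \<inter> V) = \<Union>U \<inter> \<Union>V" if "U \<subseteq> topspace X // R" "V \<subseteq> topspace X // R" for U V
  proof
    show "\<Union>U \<inter> \<Union>V \<subseteq> \<Union>(U \<inter> V)"
    proof
      fix x assume "x \<in> \<Union>U \<inter> \<Union>V"
      then obtain A B where AB: "A \<in> U" "x \<in> A" "B \<in> V" "x \<in> B" by auto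
      then have "A \<in> topspace X // R" "B \<in> topspace X // R" "A \<inter> B \<noteq> {}"
        using that by blast+
      then have "A = B" using quotient_disj[OF R] by meson
      then show "x \<in> \<Union>(U \<inter> V)" using AB by blast
    qed
  qed auto
  have "istopology (\<lambda>U. U \<subseteq> topspace X // R \<and> openin X (\<Union>U))"
    unfolding istopology_def
  proof (intro conjI allI impI)
    fix S T assume "S \<subseteq> topspace X // R \<and> openin X (\<Union>S)" "T \<subseteq> topspace X // R \<and> openin X (\<Union>T)"
    then show "S \<inter> T \<subseteq> topspace X // R" "openin X (\<Union>(S \<inter> T))"
      by (blast, simp add: inter openin_Int)
  next
    fix \<K> assume K: "\<forall>K\<in>\<K>. K \<subseteq> topspace X // R \<and> openin X (\<Union>K)"
    then show "\<Union>\<K> \<subseteq> topspace X // R" by auto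
    have "\<Union>(\<Union>\<K>) = (\<Union>K\<in>\<K>. \<Union>K)" by blast
    moreover have "openin X (\<Union>K\<in>\<K>. \<Union>K)" using K by (intro openin_Union) blast
    ultimately show "openin X (\<Union>(\<Union>\<K>))" by simp
  qed
  then show ?thesis by (simp add: quotient_topology_def)
qed

definition classifying_space :: "('o, 'a) cat \<Rightarrow> ('o, 'a) nerve_point set topology" where
  "classifying_space C = quotient_topology (nerve_coproduct C) (realization_rel C)"

text \<open>The induced map sends the class of \<open>((n, \<sigma>), t)\<close> to the class of \<open>((n, F \<circ>\<^sub>F \<sigma>), t)\<close>.\<close>

definition classifying_map :: "('o, 'a, 'p, 'b) ftr
    \<Rightarrow> ('o, 'a) nerve_point set \<Rightarrow> ('p, 'b) nerve_point set" where
  "classifying_map F c = realization_rel (ftgt F) `` ((\<lambda>((n, \<sigma>), t). ((n, F \<circ>\<^sub>F \<sigma>), t)) ` c)"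

text \<open>A map witnessing \<^const>\<open>homotopy_equivalent_space\<close>.\<close>

definition homotopy_equivalence_map :: "'x topology \<Rightarrow> 'y topology \<Rightarrow> ('x \<Rightarrow> 'y) \<Rightarrow> bool" where
  "homotopy_equivalence_map X Y f \<longleftrightarrow> continuous_map X Y f \<and>
    (\<exists>g. continuous_map Y X g \<and>
      homotopic_with (\<lambda>x. True) X X (g \<circ> f) id \<and>
      homotopic_with (\<lambda>x. True) Y Y (f \<circ> g) id)"

definition homotopy_equivalence :: "('o, 'a, 'p, 'b) ftr \<Rightarrow> bool" where
  "homotopy_equivalence F \<longleftrightarrow>
    homotopy_equivalence_map (classifying_space (fsrc F)) (classifying_space (ftgt F))
      (classifying_map F)"

end

theory Submission
  imports Defs "HOL-Analysis.Abstract_Topological_Spaces"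
begin

text \<open>
Write \<open>C(\<alpha>, \<beta>)\<close> for the functor that a diagram \<open>C\<close> on \<open>I \<times> J\<close> assigns to a pair of arrows. Unwinding the
definitions, an object of \<open>hocolim\<^sub>J holim\<^sub>I C\<close> is an object \<open>j\<close> of \<open>J\<close>, a family \<open>x i\<close> in \<open>C(i, j)\<close> and a
compatible family of maps \<open>\<rho> \<alpha> : C(\<alpha>, 1) (x i) \<rightarrow> x i'\<close>, one for each \<open>\<alpha> : i \<rightarrow> i'\<close>. An object of \<open>holim\<^sub>I hocolim\<^sub>J C\<close> is the same kind
of family, except that the coordinate in \<open>J\<close> moves with \<open>i\<close>: a functor \<open>i \<mapsto> j i\<close>, \<open>\<alpha> \<mapsto> \<beta> \<alpha>\<close> from \<open>I\<close> to
\<open>J\<close>, objects \<open>y i\<close> in \<open>C(i, j i)\<close> and maps \<open>\<mu> \<alpha> : C(\<alpha>, \<beta> \<alpha>) (y i) \<rightarrow> y i'\<close>. The comparison functor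
\<open>\<iota>\<close> regards a fixed coordinate as a constant moving one. On arrows it keeps the map in \<open>J\<close> and all the maps
in the fibres, so it is faithful as soon as \<open>I\<close> has an object at which the map in \<open>J\<close> can be read off.

If \<open>I\<close> has a pseudo-final object \<open>(e, \<epsilon>)\<close>, the moving coordinate can be pushed along \<open>\<beta> (\<epsilon> i) : j i \<rightarrow> j e\<close>
to the single object \<open>j e\<close>. The retraction \<open>p\<close> sends \<open>(j, y, \<beta>, \<mu>)\<close> to the family
\<open>C(1, \<beta> (\<epsilon> i)) (y i)\<close> with fixed coordinate \<open>j e\<close>. This family is compatible because
\<open>\<beta> (\<epsilon> i') \<circ> \<beta> \<alpha> = \<beta> (\<epsilon> i)\<close>, which is the naturality of \<open>\<epsilon>\<close>. For a constant coordinate all pushes are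
along identities, so \<open>p \<circ> \<iota> = 1\<close>; in general the pushes themselves form the transformation \<open>1 \<rightarrow> \<iota> \<circ> p\<close>.
All of these formulas mention only the structure that is respected by maps of diagrams and by changes of
the index categories, so the naturality squares hold on the nose.

The proof therefore translates between functors and data. Lemmas \<open>holim_objE\<close> and
\<open>holim_arr_eq_mk_smap\<close> do so for a homotopy limit, \<open>fixed_objE\<close>, \<open>fixed_arr_exhaust\<close>, \<open>moving_objE\<close>
and \<open>moving_arr_exhaust\<close> for the two iterated constructions; all constructed functors are then computed on data.

For the homotopy equivalence it remains to see that a natural transformation \<open>\<tau> : F \<rightarrow> G\<close> makes the
induced maps of classifying spaces homotopic (\<open>homotopic_classifying_maps\<close>). Think of a point of an
\<open>n\<close>-simplex with coordinates \<open>t\<close> as a division of the unit interval into pieces of lengths \<open>t 0, \<dots>, t n\<close>,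
the \<open>i\<close>-th piece being labelled by the \<open>i\<close>-th vertex of a chain in \<open>A\<close>. At time \<open>s\<close>, apply \<open>F\<close> to the labels
below the height \<open>s\<close> and \<open>G\<close> to the labels above it. If the cut falls into piece \<open>k\<close>, that piece is split in
two, and the chain becomes \<open>F x\<^sub>0, \<dots>, F x\<^sub>k, G x\<^sub>k, \<dots>, G x\<^sub>n\<close>, where \<open>\<tau>\<close> supplies the map in the middle. This
description is visibly compatible with faces and degeneracies, and is continuous because it is so on each of
the finitely many closed sets where \<open>k\<close> is constant.
\<close>

section \<open>Functors\<close>

lemma is_functorI:
  assumes "category A" "category B" "fsrc F = A" "ftgt F = B"
    and "fobj F \<in> extensional (Obj A)" "farr F \<in> extensional (Arr A)"
    and "\<And>x. x \<in> Obj A \<Longrightarrow> fobj F x \<in> Obj B"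
    and "\<And>f. f \<in> Arr A \<Longrightarrow> farr F f \<in> Arr B"
    and "\<And>f. f \<in> Arr A \<Longrightarrow> Dom B (farr F f) = fobj F (Dom A f)"
    and "\<And>f. f \<in> Arr A \<Longrightarrow> Cod B (farr F f) = fobj F (Cod A f)"
    and "\<And>x. x \<in> Obj A \<Longrightarrow> farr F (Ident A x) = Ident B (fobj F x)"
    and "\<And>f g. \<lbrakk>f \<in> Arr A; g \<in> Arr A; Cod A f = Dom A g\<rbrakk>
      \<Longrightarrow> farr F (Comp A g f) = Comp B (farr F g) (farr F f)"
  shows "is_functor A B F"
  using assms by (auto simp: is_functor_def is_functor_axioms_def PiE_iff)

lemma ftr_eqI:
  fixes F G :: "('o, 'a, 'p, 'b) ftr"
  assumes "fsrc F = fsrc G" "ftgt F = ftgt G"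
    and "fobj F \<in> extensional (Obj (fsrc F))" "fobj G \<in> extensional (Obj (fsrc F))"
    and "farr F \<in> extensional (Arr (fsrc F))" "farr G \<in> extensional (Arr (fsrc F))"
    and "\<And>x. x \<in> Obj (fsrc F) \<Longrightarrow> fobj F x = fobj G x"
    and "\<And>f. f \<in> Arr (fsrc F) \<Longrightarrow> farr F f = farr G f"
  shows "F = G"
proof -
  have "fobj F = fobj G" "farr F = farr G"
    using assms by (auto intro: extensionalityI)
  with assms(1,2) show ?thesis by simp
qed

context is_functor
begin

lemma fobj_closed: "x \<in> Obj A \<Longrightarrow> fobj F x \<in> Obj B"
  using fobj_in by (rule PiE_mem)

lemma farr_closed: "f \<in> Arr A \<Longrightarrow> farr F f \<in> Arr B"
  using farr_in by (rule PiE_mem)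

lemma fobj_ext: "fobj F \<in> extensional (Obj A)"
  using fobj_in by (simp add: PiE_iff)

lemma farr_ext: "farr F \<in> extensional (Arr A)"
  using farr_in by (simp add: PiE_iff)

end

lemma functor_eqI:
  assumes "is_functor A B F" "is_functor A B G"
    and "\<And>x. x \<in> Obj A \<Longrightarrow> fobj F x = fobj G x"
    and "\<And>f. f \<in> Arr A \<Longrightarrow> farr F f = farr G f"
  shows "F = G"
proof -
  interpret F: is_functor A B F by fact
  interpret G: is_functor A B G by fact
  show ?thesis
    by (rule ftr_eqI)
      (use assms(3,4) F.fobj_ext G.fobj_ext F.farr_ext G.farr_ext in
        \<open>simp_all add: F.fsrc G.fsrc F.ftgt G.ftgt\<close>)
qed

lemma comp_ftr_simps [simp]:
  "fsrc (G \<circ>\<^sub>F F) = fsrc F" "ftgt (G \<circ>\<^sub>F F) = ftgt G"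
  "x \<in> Obj (fsrc F) \<Longrightarrow> fobj (G \<circ>\<^sub>F F) x = fobj G (fobj F x)"
  "f \<in> Arr (fsrc F) \<Longrightarrow> farr (G \<circ>\<^sub>F F) f = farr G (farr F f)"
  "fsrc F = A \<Longrightarrow> fobj (G \<circ>\<^sub>F F) \<in> extensional (Obj A)"
  "fsrc F = A \<Longrightarrow> farr (G \<circ>\<^sub>F F) \<in> extensional (Arr A)"
  by (auto simp: comp_ftr_def)

lemma id_ftr_simps [simp]:
  "fsrc (id_ftr A) = A" "ftgt (id_ftr A) = A"
  "x \<in> Obj A \<Longrightarrow> fobj (id_ftr A) x = x"
  "f \<in> Arr A \<Longrightarrow> farr (id_ftr A) f = f"
  "fobj (id_ftr A) \<in> extensional (Obj A)" "farr (id_ftr A) \<in> extensional (Arr A)"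
  by (simp_all add: id_ftr_def)

text \<open>
A composite is cut down to the source category. A square of functors can therefore be checked on the
objects and arrows of its initial corner.
\<close>

lemma comp_ftr_eqI:
  assumes "fsrc F = fsrc F'" "ftgt G = ftgt G'"
    and "\<And>x. x \<in> Obj (fsrc F) \<Longrightarrow> fobj G (fobj F x) = fobj G' (fobj F' x)"
    and "\<And>f. f \<in> Arr (fsrc F) \<Longrightarrow> farr G (farr F f) = farr G' (farr F' f)"
  shows "G \<circ>\<^sub>F F = G' \<circ>\<^sub>F F'"
  using assms by (auto simp: comp_ftr_def restrict_def)

lemma is_functor_id_ftr:
  assumes "category A"
  shows "is_functor A A (id_ftr A)"
proof -
  interpret category A by fact
  show ?thesis
    by (rule is_functorI) (simp_all add: assms Dom_in Cod_in Ident_in Comp_in)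
qed

lemma is_functor_comp_ftr:
  assumes "is_functor A B F" "is_functor B C G"
  shows "is_functor A C (G \<circ>\<^sub>F F)"
proof -
  interpret F: is_functor A B F by fact
  interpret G: is_functor B C G by fact
  show ?thesis
    by (rule is_functorI)
      (simp_all add: F.A.category_axioms G.B.category_axioms F.fsrc G.ftgt
        F.fobj_closed G.fobj_closed F.farr_closed G.farr_closed
        F.A.Dom_in F.A.Cod_in F.A.Ident_in F.A.Comp_in
        F.Dom_farr F.Cod_farr G.Dom_farr G.Cod_farr F.farr_Ident G.farr_Ident
        F.farr_Comp G.farr_Comp extensional_def comp_ftr_def)
qed

lemma comp_ftr_assoc:
  assumes "is_functor A B F" "fsrc G = B"
  shows "H \<circ>\<^sub>F (G \<circ>\<^sub>F F) = (H \<circ>\<^sub>F G) \<circ>\<^sub>F F"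
proof -
  interpret F: is_functor A B F by fact
  show ?thesis
    by (rule comp_ftr_eqI)
      (simp_all add: F.fsrc assms(2) F.fobj_closed F.farr_closed)
qed

lemma comp_ftr_id [simp]:
  assumes "is_functor A B F"
  shows "F \<circ>\<^sub>F id_ftr A = F" "id_ftr B \<circ>\<^sub>F F = F"
proof -
  interpret F: is_functor A B F by fact
  note id = is_functor_id_ftr[OF F.A.category_axioms] is_functor_id_ftr[OF F.B.category_axioms]
  show "F \<circ>\<^sub>F id_ftr A = F"
    by (rule functor_eqI[OF is_functor_comp_ftr[OF id(1) assms] assms]) simp_all
  show "id_ftr B \<circ>\<^sub>F F = F"
    by (rule functor_eqI[OF is_functor_comp_ftr[OF assms id(2)] assms])
      (simp_all add: F.fsrc F.fobj_closed F.farr_closed)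
qed

lemma CAT_simps [simp]:
  "A \<in> Obj CAT \<longleftrightarrow> category A"
  "F \<in> Arr CAT \<longleftrightarrow> is_functor (fsrc F) (ftgt F) F"
  "Dom CAT = fsrc" "Cod CAT = ftgt" "Ident CAT = id_ftr" "Comp CAT = comp_ftr"
  by (simp_all add: CAT_def)

lemma category_CAT: "category CAT"
proof
  fix F G H :: "('a, 'b, 'a, 'b) ftr"
  show "F \<in> Arr CAT \<Longrightarrow> Dom CAT F \<in> Obj CAT" "F \<in> Arr CAT \<Longrightarrow> Cod CAT F \<in> Obj CAT"
    by (auto simp: is_functor_def)
  show "F \<in> Arr CAT \<Longrightarrow> G \<in> Arr CAT \<Longrightarrow> Cod CAT F = Dom CAT G \<Longrightarrow> Comp CAT G F \<in> Arr CAT"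
    by (auto intro: is_functor_comp_ftr)
  show "F \<in> Arr CAT \<Longrightarrow> G \<in> Arr CAT \<Longrightarrow> H \<in> Arr CAT \<Longrightarrow> Cod CAT F = Dom CAT G \<Longrightarrow>
    Cod CAT G = Dom CAT H \<Longrightarrow> Comp CAT H (Comp CAT G F) = Comp CAT (Comp CAT H G) F"
    by (auto intro: comp_ftr_assoc)
qed (auto simp: is_functor_id_ftr)

section \<open>Sections of the Grothendieck construction\<close>

text \<open>
The simplification rules of this locale let the domain or codomain of an arrow of \<open>I\<close> be a variable that is
pinned down by an equation such as \<open>Cod I \<alpha> = j\<close>. Goals mention the fibre over \<open>j\<close>, because the simplifier has
normally replaced \<open>Cod I \<alpha>\<close> by then, and a rule about the fibre over \<open>Cod I \<alpha>\<close> would no longer match.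
\<close>

locale diagram = is_functor I CAT D
  for I :: "('i, 'f) cat" and D :: "('i, 'f, 'c, 'd) diagram"
begin

lemma category_fibre: "i \<in> Obj I \<Longrightarrow> category (fobj D i)"
  using fobj_closed by simp

lemma functor_transport:
  assumes "\<alpha> \<in> Arr I"
  shows "is_functor (fobj D (Dom I \<alpha>)) (fobj D (Cod I \<alpha>)) (farr D \<alpha>)"
  using farr_closed[OF assms] Dom_farr[OF assms] Cod_farr[OF assms] by simp

lemma fibre_simps [simp]:
  "\<lbrakk>i \<in> Obj I; f \<in> Arr (fobj D i)\<rbrakk> \<Longrightarrow> Dom (fobj D i) f \<in> Obj (fobj D i)"
  "\<lbrakk>i \<in> Obj I; f \<in> Arr (fobj D i)\<rbrakk> \<Longrightarrow> Cod (fobj D i) f \<in> Obj (fobj D i)"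
  "\<lbrakk>i \<in> Obj I; x \<in> Obj (fobj D i)\<rbrakk> \<Longrightarrow> Ident (fobj D i) x \<in> Arr (fobj D i)"
  "\<lbrakk>i \<in> Obj I; x \<in> Obj (fobj D i)\<rbrakk> \<Longrightarrow> Dom (fobj D i) (Ident (fobj D i) x) = x"
  "\<lbrakk>i \<in> Obj I; x \<in> Obj (fobj D i)\<rbrakk> \<Longrightarrow> Cod (fobj D i) (Ident (fobj D i) x) = x"
  "\<lbrakk>i \<in> Obj I; f \<in> Arr (fobj D i); g \<in> Arr (fobj D i); Cod (fobj D i) f = Dom (fobj D i) g\<rbrakk>
    \<Longrightarrow> Comp (fobj D i) g f \<in> Arr (fobj D i)"
  "\<lbrakk>i \<in> Obj I; f \<in> Arr (fobj D i); g \<in> Arr (fobj D i); Cod (fobj D i) f = Dom (fobj D i) g\<rbrakk>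
    \<Longrightarrow> Dom (fobj D i) (Comp (fobj D i) g f) = Dom (fobj D i) f"
  "\<lbrakk>i \<in> Obj I; f \<in> Arr (fobj D i); g \<in> Arr (fobj D i); Cod (fobj D i) f = Dom (fobj D i) g\<rbrakk>
    \<Longrightarrow> Cod (fobj D i) (Comp (fobj D i) g f) = Cod (fobj D i) g"
  "\<lbrakk>i \<in> Obj I; f \<in> Arr (fobj D i); Dom (fobj D i) f = x\<rbrakk>
    \<Longrightarrow> Comp (fobj D i) f (Ident (fobj D i) x) = f"
  "\<lbrakk>i \<in> Obj I; f \<in> Arr (fobj D i); Cod (fobj D i) f = x\<rbrakk>
    \<Longrightarrow> Comp (fobj D i) (Ident (fobj D i) x) f = f"
  using category_fibre[of i]
  by (auto simp: category.Dom_in category.Cod_in category.Ident_in category.Dom_Ident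
      category.Cod_Ident category.Comp_in category.Dom_Comp category.Cod_Comp
      category.Comp_Ident category.Ident_Comp)

lemma fibre_assoc:
  "\<lbrakk>i \<in> Obj I; f \<in> Arr (fobj D i); g \<in> Arr (fobj D i); h \<in> Arr (fobj D i);
    Cod (fobj D i) f = Dom (fobj D i) g; Cod (fobj D i) g = Dom (fobj D i) h\<rbrakk>
    \<Longrightarrow> Comp (fobj D i) (Comp (fobj D i) h g) f = Comp (fobj D i) h (Comp (fobj D i) g f)"
  using category_fibre[of i] by (simp add: category.Comp_assoc)

lemma transport_simps [simp]:
  "\<lbrakk>\<alpha> \<in> Arr I; Cod I \<alpha> = j; x \<in> Obj (fobj D (Dom I \<alpha>))\<rbrakk> \<Longrightarrow> fobj (farr D \<alpha>) x \<in> Obj (fobj D j)"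
  "\<lbrakk>\<alpha> \<in> Arr I; Cod I \<alpha> = j; f \<in> Arr (fobj D (Dom I \<alpha>))\<rbrakk> \<Longrightarrow> farr (farr D \<alpha>) f \<in> Arr (fobj D j)"
  "\<lbrakk>\<alpha> \<in> Arr I; Cod I \<alpha> = j; f \<in> Arr (fobj D (Dom I \<alpha>))\<rbrakk>
    \<Longrightarrow> Dom (fobj D j) (farr (farr D \<alpha>) f) = fobj (farr D \<alpha>) (Dom (fobj D (Dom I \<alpha>)) f)"
  "\<lbrakk>\<alpha> \<in> Arr I; Cod I \<alpha> = j; f \<in> Arr (fobj D (Dom I \<alpha>))\<rbrakk>
    \<Longrightarrow> Cod (fobj D j) (farr (farr D \<alpha>) f) = fobj (farr D \<alpha>) (Cod (fobj D (Dom I \<alpha>)) f)"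
  "\<lbrakk>\<alpha> \<in> Arr I; Dom I \<alpha> = i; x \<in> Obj (fobj D i)\<rbrakk>
    \<Longrightarrow> farr (farr D \<alpha>) (Ident (fobj D i) x) = Ident (fobj D (Cod I \<alpha>)) (fobj (farr D \<alpha>) x)"
  "\<lbrakk>\<alpha> \<in> Arr I; Dom I \<alpha> = i; f \<in> Arr (fobj D i); g \<in> Arr (fobj D i);
    Cod (fobj D i) f = Dom (fobj D i) g\<rbrakk>
    \<Longrightarrow> farr (farr D \<alpha>) (Comp (fobj D i) g f) =
      Comp (fobj D (Cod I \<alpha>)) (farr (farr D \<alpha>) g) (farr (farr D \<alpha>) f)"
  using functor_transport[of \<alpha>]
  by (auto simp: is_functor.fobj_closed is_functor.farr_closed is_functor.Dom_farr
      is_functor.Cod_farr is_functor.farr_Ident is_functor.farr_Comp)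

lemma transport_Ident [simp]:
  "\<lbrakk>i \<in> Obj I; x \<in> Obj (fobj D i)\<rbrakk> \<Longrightarrow> fobj (farr D (Ident I i)) x = x"
  "\<lbrakk>i \<in> Obj I; f \<in> Arr (fobj D i)\<rbrakk> \<Longrightarrow> farr (farr D (Ident I i)) f = f"
  by (simp_all add: farr_Ident)

lemma transport_Comp [simp]:
  "\<lbrakk>\<alpha> \<in> Arr I; \<beta> \<in> Arr I; Cod I \<alpha> = Dom I \<beta>; x \<in> Obj (fobj D (Dom I \<alpha>))\<rbrakk>
    \<Longrightarrow> fobj (farr D (Comp I \<beta> \<alpha>)) x = fobj (farr D \<beta>) (fobj (farr D \<alpha>) x)"
  "\<lbrakk>\<alpha> \<in> Arr I; \<beta> \<in> Arr I; Cod I \<alpha> = Dom I \<beta>; f \<in> Arr (fobj D (Dom I \<alpha>))\<rbrakk>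
    \<Longrightarrow> farr (farr D (Comp I \<beta> \<alpha>)) f = farr (farr D \<beta>) (farr (farr D \<alpha>) f)"
  using functor_transport[of \<alpha>] by (simp_all add: farr_Comp is_functor.fsrc)

declare A.Dom_in [simp] A.Cod_in [simp] A.Ident_in [simp] A.Dom_Ident [simp] A.Cod_Ident [simp]
  A.Comp_in [simp] A.Dom_Comp [simp] A.Cod_Comp [simp]

lemma base_Comp_Ident [simp]:
  "\<lbrakk>f \<in> Arr I; Dom I f = i\<rbrakk> \<Longrightarrow> Comp I f (Ident I i) = f"
  "\<lbrakk>f \<in> Arr I; Cod I f = i\<rbrakk> \<Longrightarrow> Comp I (Ident I i) f = f"
  using A.Comp_Ident A.Ident_Comp by auto

lemma hocolim_simps [simp]:
  "(i, x) \<in> Obj (hocolim D) \<longleftrightarrow> i \<in> Obj I \<and> x \<in> Obj (fobj D i)"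
  "((i, x), (\<alpha>, \<rho>), (j, y)) \<in> Arr (hocolim D) \<longleftrightarrow>
    \<alpha> \<in> Arr I \<and> Dom I \<alpha> = i \<and> Cod I \<alpha> = j \<and> x \<in> Obj (fobj D i) \<and> \<rho> \<in> Arr (fobj D j) \<and>
    Dom (fobj D j) \<rho> = fobj (farr D \<alpha>) x \<and> Cod (fobj D j) \<rho> = y"
  "Dom (hocolim D) (a, r, b) = a" "Cod (hocolim D) (a, r, b) = b"
  "Ident (hocolim D) (i, x) = ((i, x), (Ident I i, Ident (fobj D i) x), (i, x))"
  "Comp (hocolim D) (b', (\<alpha>, \<rho>), c) (a, (\<beta>, \<mu>), b) =
    (a, (Comp I \<alpha> \<beta>, Comp (fobj D (Cod I \<alpha>)) \<rho> (farr (farr D \<alpha>) \<mu>)), c)"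
  by (auto simp: hocolim_def Let_def fsrc)

lemma hocolim_objE:
  assumes "a \<in> Obj (hocolim D)"
  obtains i x where "a = (i, x)" "i \<in> Obj I" "x \<in> Obj (fobj D i)"
  using assms by (cases a) simp

lemma hocolim_arrE:
  assumes "h \<in> Arr (hocolim D)"
  obtains i x \<alpha> \<rho> j y where "h = ((i, x), (\<alpha>, \<rho>), (j, y))"
    "\<alpha> \<in> Arr I" "Dom I \<alpha> = i" "Cod I \<alpha> = j" "i \<in> Obj I" "j \<in> Obj I" "x \<in> Obj (fobj D i)"
    "\<rho> \<in> Arr (fobj D j)" "Dom (fobj D j) \<rho> = fobj (farr D \<alpha>) x" "Cod (fobj D j) \<rho> = y"
    "y \<in> Obj (fobj D j)"
proof -
  obtain i x \<alpha> \<rho> j y where h: "h = ((i, x), (\<alpha>, \<rho>), (j, y))" by (cases h) auto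
  show ?thesis using assms by (intro that[OF h]) (auto simp: h)
qed

lemma category_hocolim: "category (hocolim D)"
proof
  fix f g h
  assume f: "f \<in> Arr (hocolim D)"
  then show "Dom (hocolim D) f \<in> Obj (hocolim D)" "Cod (hocolim D) f \<in> Obj (hocolim D)"
    by (auto elim!: hocolim_arrE)
  show "Comp (hocolim D) f (Ident (hocolim D) (Dom (hocolim D) f)) = f"
    "Comp (hocolim D) (Ident (hocolim D) (Cod (hocolim D) f)) f = f"
    using f by (auto elim!: hocolim_arrE)
  assume g: "g \<in> Arr (hocolim D)" and fg: "Cod (hocolim D) f = Dom (hocolim D) g"
  show "Comp (hocolim D) g f \<in> Arr (hocolim D)"
    "Dom (hocolim D) (Comp (hocolim D) g f) = Dom (hocolim D) f"
    "Cod (hocolim D) (Comp (hocolim D) g f) = Cod (hocolim D) g"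
    using f g fg by (auto elim!: hocolim_arrE)
  assume h: "h \<in> Arr (hocolim D)" and gh: "Cod (hocolim D) g = Dom (hocolim D) h"
  show "Comp (hocolim D) h (Comp (hocolim D) g f) = Comp (hocolim D) (Comp (hocolim D) h g) f"
  proof -
    obtain i x \<alpha> \<rho> j y where f': "f = ((i, x), (\<alpha>, \<rho>), (j, y))"
      "\<alpha> \<in> Arr I" "Dom I \<alpha> = i" "Cod I \<alpha> = j" "i \<in> Obj I" "j \<in> Obj I" "x \<in> Obj (fobj D i)"
      "\<rho> \<in> Arr (fobj D j)" "Dom (fobj D j) \<rho> = fobj (farr D \<alpha>) x" "Cod (fobj D j) \<rho> = y"
      using f by (rule hocolim_arrE)
    obtain j' y' \<beta> \<sigma> k z where g': "g = ((j', y'), (\<beta>, \<sigma>), (k, z))"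
      "\<beta> \<in> Arr I" "Dom I \<beta> = j'" "Cod I \<beta> = k" "k \<in> Obj I"
      "\<sigma> \<in> Arr (fobj D k)" "Dom (fobj D k) \<sigma> = fobj (farr D \<beta>) y'" "Cod (fobj D k) \<sigma> = z"
      using g by (rule hocolim_arrE)
    obtain k' z' \<gamma> \<tau> l w where h': "h = ((k', z'), (\<gamma>, \<tau>), (l, w))"
      "\<gamma> \<in> Arr I" "Dom I \<gamma> = k'" "Cod I \<gamma> = l" "l \<in> Obj I"
      "\<tau> \<in> Arr (fobj D l)" "Dom (fobj D l) \<tau> = fobj (farr D \<gamma>) z'" "Cod (fobj D l) \<tau> = w"
      using h by (rule hocolim_arrE)
    have eq: "j' = j" "y' = y" "k' = k" "z' = z" using fg gh by (simp_all add: f'(1) g'(1) h'(1))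
    show ?thesis
      using f'(2-) g'(2-) h'(2-) unfolding f'(1) g'(1) h'(1) eq
      by (simp add: fibre_assoc A.Comp_assoc[symmetric])
  qed
next
  fix x assume "x \<in> Obj (hocolim D)"
  then show "Ident (hocolim D) x \<in> Arr (hocolim D)" "Dom (hocolim D) (Ident (hocolim D) x) = x"
    "Cod (hocolim D) (Ident (hocolim D) x) = x"
    by (auto elim!: hocolim_objE)
qed

end

text \<open>
An object of \<open>holim D\<close> is a section of the projection from the Grothendieck construction. It is determined by
its second components, an object \<open>x i\<close> of each fibre and a map \<open>\<rho> \<alpha>\<close> from the transported object to the object
over the codomain for each arrow \<open>\<alpha>\<close>.
\<close>

definition mk_section :: "('i, 'f, 'c, 'd) diagram \<Rightarrow> ('i \<Rightarrow> 'c) \<Rightarrow> ('f \<Rightarrow> 'd) \<Rightarrow> ('i, 'f, 'c, 'd) hlim_obj" where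
  "mk_section D x \<rho> = (let I = fsrc D in
    \<lparr>fsrc = I, ftgt = hocolim D, fobj = (\<lambda>i\<in>Obj I. (i, x i)),
     farr = (\<lambda>\<alpha>\<in>Arr I. ((Dom I \<alpha>, x (Dom I \<alpha>)), (\<alpha>, \<rho> \<alpha>), (Cod I \<alpha>, x (Cod I \<alpha>))))\<rparr>)"

definition mk_smap :: "('i, 'f, 'c, 'd) diagram \<Rightarrow> ('i, 'f, 'c, 'd) hlim_obj \<Rightarrow> ('i, 'f, 'c, 'd) hlim_obj
    \<Rightarrow> ('i \<Rightarrow> 'd) \<Rightarrow> ('i, 'f, 'c, 'd) hlim_arr" where
  "mk_smap D s s' m = \<lparr>nsrc = s, ntgt = s',
    ncomp = (\<lambda>i\<in>Obj (fsrc D). (fobj s i, (Ident (fsrc D) i, m i), fobj s' i))\<rparr>"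

text \<open>
The functor laws of a section, written for its second components: \<open>\<rho>\<close> is normalised and satisfies the cocycle
identity \<open>\<rho> (\<beta> \<circ> \<alpha>) = \<rho> \<beta> \<circ> D(\<beta>) (\<rho> \<alpha>)\<close>, which comes from the composition in the Grothendieck construction.
\<close>

definition section_data :: "('i, 'f, 'c, 'd) diagram \<Rightarrow> ('i \<Rightarrow> 'c) \<Rightarrow> ('f \<Rightarrow> 'd) \<Rightarrow> bool" where
  "section_data D x \<rho> \<longleftrightarrow> (let I = fsrc D in
    (\<forall>i\<in>Obj I. x i \<in> Obj (fobj D i)) \<and>
    (\<forall>\<alpha>\<in>Arr I. \<rho> \<alpha> \<in> Arr (fobj D (Cod I \<alpha>)) \<and>
      Dom (fobj D (Cod I \<alpha>)) (\<rho> \<alpha>) = fobj (farr D \<alpha>) (x (Dom I \<alpha>)) \<and>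
      Cod (fobj D (Cod I \<alpha>)) (\<rho> \<alpha>) = x (Cod I \<alpha>)) \<and>
    (\<forall>i\<in>Obj I. \<rho> (Ident I i) = Ident (fobj D i) (x i)) \<and>
    (\<forall>\<alpha>\<in>Arr I. \<forall>\<beta>\<in>Arr I. Cod I \<alpha> = Dom I \<beta> \<longrightarrow>
      \<rho> (Comp I \<beta> \<alpha>) = Comp (fobj D (Cod I \<beta>)) (\<rho> \<beta>) (farr (farr D \<beta>) (\<rho> \<alpha>))))"

definition smap_data :: "('i, 'f, 'c, 'd) diagram \<Rightarrow> ('i \<Rightarrow> 'c) \<Rightarrow> ('f \<Rightarrow> 'd) \<Rightarrow>
    ('i \<Rightarrow> 'c) \<Rightarrow> ('f \<Rightarrow> 'd) \<Rightarrow> ('i \<Rightarrow> 'd) \<Rightarrow> bool" where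
  "smap_data D x \<rho> x' \<rho>' m \<longleftrightarrow> (let I = fsrc D in
    (\<forall>i\<in>Obj I. m i \<in> Arr (fobj D i) \<and> Dom (fobj D i) (m i) = x i \<and> Cod (fobj D i) (m i) = x' i) \<and>
    (\<forall>\<alpha>\<in>Arr I. Comp (fobj D (Cod I \<alpha>)) (m (Cod I \<alpha>)) (\<rho> \<alpha>) =
      Comp (fobj D (Cod I \<alpha>)) (\<rho>' \<alpha>) (farr (farr D \<alpha>) (m (Dom I \<alpha>)))))"

definition sec_val :: "('i, 'f, 'c, 'd) hlim_obj \<Rightarrow> 'i \<Rightarrow> 'c" where
  "sec_val s i = snd (fobj s i)"

definition sec_mor :: "('i, 'f, 'c, 'd) hlim_obj \<Rightarrow> 'f \<Rightarrow> 'd" where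
  "sec_mor s \<alpha> = snd (fst (snd (farr s \<alpha>)))"

definition smap_val :: "('i, 'f, 'c, 'd) hlim_arr \<Rightarrow> 'i \<Rightarrow> 'd" where
  "smap_val \<tau> i = snd (fst (snd (ncomp \<tau> i)))"

context diagram
begin

lemma mk_section_simps [simp]:
  "fsrc (mk_section D x \<rho>) = I" "ftgt (mk_section D x \<rho>) = hocolim D"
  "i \<in> Obj I \<Longrightarrow> fobj (mk_section D x \<rho>) i = (i, x i)"
  "\<alpha> \<in> Arr I \<Longrightarrow> farr (mk_section D x \<rho>) \<alpha> =
    ((Dom I \<alpha>, x (Dom I \<alpha>)), (\<alpha>, \<rho> \<alpha>), (Cod I \<alpha>, x (Cod I \<alpha>)))"
  "fobj (mk_section D x \<rho>) \<in> extensional (Obj I)"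
  "farr (mk_section D x \<rho>) \<in> extensional (Arr I)"
  "i \<in> Obj I \<Longrightarrow> sec_val (mk_section D x \<rho>) i = x i"
  "\<alpha> \<in> Arr I \<Longrightarrow> sec_mor (mk_section D x \<rho>) \<alpha> = \<rho> \<alpha>"
  by (simp_all add: mk_section_def Let_def fsrc sec_val_def sec_mor_def)

lemma mk_smap_simps [simp]:
  "nsrc (mk_smap D s s' m) = s" "ntgt (mk_smap D s s' m) = s'"
  "i \<in> Obj I \<Longrightarrow> ncomp (mk_smap D s s' m) i = (fobj s i, (Ident I i, m i), fobj s' i)"
  "ncomp (mk_smap D s s' m) \<in> extensional (Obj I)"
  "i \<in> Obj I \<Longrightarrow> smap_val (mk_smap D s s' m) i = m i"
  by (simp_all add: mk_smap_def fsrc smap_val_def)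

lemma section_dataD:
  assumes "section_data D x \<rho>"
  shows "i \<in> Obj I \<Longrightarrow> x i \<in> Obj (fobj D i)"
    "\<lbrakk>\<alpha> \<in> Arr I; Cod I \<alpha> = j\<rbrakk> \<Longrightarrow> \<rho> \<alpha> \<in> Arr (fobj D j)"
    "\<lbrakk>\<alpha> \<in> Arr I; Cod I \<alpha> = j\<rbrakk> \<Longrightarrow> Dom (fobj D j) (\<rho> \<alpha>) = fobj (farr D \<alpha>) (x (Dom I \<alpha>))"
    "\<lbrakk>\<alpha> \<in> Arr I; Cod I \<alpha> = j\<rbrakk> \<Longrightarrow> Cod (fobj D j) (\<rho> \<alpha>) = x j"
    "i \<in> Obj I \<Longrightarrow> \<rho> (Ident I i) = Ident (fobj D i) (x i)"
    "\<lbrakk>\<alpha> \<in> Arr I; \<beta> \<in> Arr I; Cod I \<alpha> = Dom I \<beta>\<rbrakk> \<Longrightarrow>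
      \<rho> (Comp I \<beta> \<alpha>) = Comp (fobj D (Cod I \<beta>)) (\<rho> \<beta>) (farr (farr D \<beta>) (\<rho> \<alpha>))"
  using assms by (auto simp: section_data_def Let_def fsrc)

lemma section_dataI:
  assumes "\<And>i. i \<in> Obj I \<Longrightarrow> x i \<in> Obj (fobj D i)"
    "\<And>\<alpha>. \<alpha> \<in> Arr I \<Longrightarrow> \<rho> \<alpha> \<in> Arr (fobj D (Cod I \<alpha>))"
    "\<And>\<alpha>. \<alpha> \<in> Arr I \<Longrightarrow> Dom (fobj D (Cod I \<alpha>)) (\<rho> \<alpha>) = fobj (farr D \<alpha>) (x (Dom I \<alpha>))"
    "\<And>\<alpha>. \<alpha> \<in> Arr I \<Longrightarrow> Cod (fobj D (Cod I \<alpha>)) (\<rho> \<alpha>) = x (Cod I \<alpha>)"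
    "\<And>i. i \<in> Obj I \<Longrightarrow> \<rho> (Ident I i) = Ident (fobj D i) (x i)"
    "\<And>\<alpha> \<beta>. \<lbrakk>\<alpha> \<in> Arr I; \<beta> \<in> Arr I; Cod I \<alpha> = Dom I \<beta>\<rbrakk> \<Longrightarrow>
      \<rho> (Comp I \<beta> \<alpha>) = Comp (fobj D (Cod I \<beta>)) (\<rho> \<beta>) (farr (farr D \<beta>) (\<rho> \<alpha>))"
  shows "section_data D x \<rho>"
  using assms by (simp add: section_data_def Let_def fsrc)

lemma smap_dataD:
  assumes "smap_data D x \<rho> x' \<rho>' m"
  shows "i \<in> Obj I \<Longrightarrow> m i \<in> Arr (fobj D i)"
    "i \<in> Obj I \<Longrightarrow> Dom (fobj D i) (m i) = x i"
    "i \<in> Obj I \<Longrightarrow> Cod (fobj D i) (m i) = x' i"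
    "\<alpha> \<in> Arr I \<Longrightarrow> Comp (fobj D (Cod I \<alpha>)) (m (Cod I \<alpha>)) (\<rho> \<alpha>) =
      Comp (fobj D (Cod I \<alpha>)) (\<rho>' \<alpha>) (farr (farr D \<alpha>) (m (Dom I \<alpha>)))"
  using assms by (auto simp: smap_data_def Let_def fsrc)

lemma smap_dataI:
  assumes "\<And>i. i \<in> Obj I \<Longrightarrow> m i \<in> Arr (fobj D i)"
    "\<And>i. i \<in> Obj I \<Longrightarrow> Dom (fobj D i) (m i) = x i"
    "\<And>i. i \<in> Obj I \<Longrightarrow> Cod (fobj D i) (m i) = x' i"
    "\<And>\<alpha>. \<alpha> \<in> Arr I \<Longrightarrow> Comp (fobj D (Cod I \<alpha>)) (m (Cod I \<alpha>)) (\<rho> \<alpha>) =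
      Comp (fobj D (Cod I \<alpha>)) (\<rho>' \<alpha>) (farr (farr D \<alpha>) (m (Dom I \<alpha>)))"
  shows "smap_data D x \<rho> x' \<rho>' m"
  using assms by (simp add: smap_data_def Let_def fsrc)

text \<open>
Sections are extensional records, so equal data on \<open>I\<close> give equal sections. Together with its analogues below,
this is how strict equality of objects and arrows is obtained everywhere.
\<close>

lemma mk_section_cong:
  assumes "\<And>i. i \<in> Obj I \<Longrightarrow> x i = x' i" "\<And>\<alpha>. \<alpha> \<in> Arr I \<Longrightarrow> \<rho> \<alpha> = \<rho>' \<alpha>"
  shows "mk_section D x \<rho> = mk_section D x' \<rho>'"
  by (rule ftr_eqI) (simp_all add: assms)

lemma mk_smap_cong:
  assumes "\<And>i. i \<in> Obj I \<Longrightarrow> m i = m' i" "s = t" "s' = t'"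
  shows "mk_smap D s s' m = mk_smap D t t' m'"
  using assms by (auto simp: mk_smap_def fsrc restrict_def)

lemma hocolim_proj_simps [simp]:
  "fsrc (hocolim_proj D) = hocolim D" "ftgt (hocolim_proj D) = I"
  "a \<in> Obj (hocolim D) \<Longrightarrow> fobj (hocolim_proj D) a = fst a"
  "h \<in> Arr (hocolim D) \<Longrightarrow> farr (hocolim_proj D) h = fst (fst (snd h))"
  by (auto simp: hocolim_proj_def fsrc split: prod.splits)

lemma holim_simps [simp]:
  "s \<in> Obj (holim D) \<longleftrightarrow> is_functor I (hocolim D) s \<and> hocolim_proj D \<circ>\<^sub>F s = id_ftr I"
  "\<tau> \<in> Arr (holim D) \<longleftrightarrow> nat_transf I (hocolim D) (nsrc \<tau>) (ntgt \<tau>) \<tau> \<and>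
    nsrc \<tau> \<in> Obj (holim D) \<and> ntgt \<tau> \<in> Obj (holim D) \<and>
    (\<forall>i\<in>Obj I. farr (hocolim_proj D) (ncomp \<tau> i) = Ident I i)"
  "Dom (holim D) = nsrc" "Cod (holim D) = ntgt"
  by (auto simp: holim_def HOM_def Let_def fsrc)

lemma is_functor_mk_section:
  assumes "section_data D x \<rho>"
  shows "is_functor I (hocolim D) (mk_section D x \<rho>)"
  by (rule is_functorI) (auto simp: A.category_axioms category_hocolim section_dataD[OF assms])

lemma mk_section_in_holim:
  assumes "section_data D x \<rho>"
  shows "mk_section D x \<rho> \<in> Obj (holim D)"
proof -
  have "hocolim_proj D \<circ>\<^sub>F mk_section D x \<rho> = id_ftr I"
    by (rule ftr_eqI) (simp_all add: section_dataD[OF assms])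
  then show ?thesis by (simp add: is_functor_mk_section[OF assms])
qed

text \<open>
The equation \<open>\<pi> \<circ> s = 1\<close> dictates the first components of the values of \<open>s\<close>, and compatibility with domains and
codomains dictates the end points of its values on arrows. Only the second components remain.
\<close>

lemma holim_objE:
  assumes "s \<in> Obj (holim D)"
  obtains x \<rho> where "section_data D x \<rho>" "s = mk_section D x \<rho>"
proof
  have s: "is_functor I (hocolim D) s" and proj: "hocolim_proj D \<circ>\<^sub>F s = id_ftr I"
    using assms by auto
  interpret S: is_functor I "hocolim D" s by fact
  have obj: "fobj s i = (i, sec_val s i) \<and> sec_val s i \<in> Obj (fobj D i)" if "i \<in> Obj I" for i
  proof -
    have "fobj (hocolim_proj D \<circ>\<^sub>F s) i = i" using that by (simp add: proj)
    then have "fst (fobj s i) = i" using that S.fobj_closed[OF that] by (simp add: S.fsrc)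
    then show ?thesis
      using S.fobj_closed[OF that] by (cases "fobj s i") (auto simp: sec_val_def)
  qed
  have arr: "farr s \<alpha> = ((Dom I \<alpha>, sec_val s (Dom I \<alpha>)), (\<alpha>, sec_mor s \<alpha>), (Cod I \<alpha>, sec_val s (Cod I \<alpha>)))"
    "((Dom I \<alpha>, sec_val s (Dom I \<alpha>)), (\<alpha>, sec_mor s \<alpha>), (Cod I \<alpha>, sec_val s (Cod I \<alpha>))) \<in> Arr (hocolim D)"
    if "\<alpha> \<in> Arr I" for \<alpha>
  proof -
    have "farr (hocolim_proj D \<circ>\<^sub>F s) \<alpha> = \<alpha>" using that by (simp add: proj)
    then have 1: "fst (fst (snd (farr s \<alpha>))) = \<alpha>" using that S.farr_closed[OF that] by (simp add: S.fsrc)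
    have 2: "Dom (hocolim D) (farr s \<alpha>) = (Dom I \<alpha>, sec_val s (Dom I \<alpha>))"
      "Cod (hocolim D) (farr s \<alpha>) = (Cod I \<alpha>, sec_val s (Cod I \<alpha>))"
      using that S.Dom_farr[OF that] S.Cod_farr[OF that] obj by auto
    show *: "farr s \<alpha> = ((Dom I \<alpha>, sec_val s (Dom I \<alpha>)), (\<alpha>, sec_mor s \<alpha>), (Cod I \<alpha>, sec_val s (Cod I \<alpha>)))"
      using 1 2 by (cases "farr s \<alpha>") (auto simp: sec_mor_def)
    show "((Dom I \<alpha>, sec_val s (Dom I \<alpha>)), (\<alpha>, sec_mor s \<alpha>), (Cod I \<alpha>, sec_val s (Cod I \<alpha>))) \<in> Arr (hocolim D)"
      using S.farr_closed[OF that] by (simp only: *)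
  qed
  show "s = mk_section D (sec_val s) (sec_mor s)"
    by (rule ftr_eqI) (simp_all add: S.fsrc S.ftgt S.fobj_ext S.farr_ext obj arr)
  show "section_data D (sec_val s) (sec_mor s)"
  proof (rule section_dataI)
    show "sec_mor s (Ident I i) = Ident (fobj D i) (sec_val s i)" if "i \<in> Obj I" for i
      using S.farr_Ident[OF that] that by (simp add: arr obj)
    show "sec_mor s (Comp I \<beta> \<alpha>) = Comp (fobj D (Cod I \<beta>)) (sec_mor s \<beta>) (farr (farr D \<beta>) (sec_mor s \<alpha>))"
      if "\<alpha> \<in> Arr I" "\<beta> \<in> Arr I" "Cod I \<alpha> = Dom I \<beta>" for \<alpha> \<beta>
      using S.farr_Comp[OF that] that by (simp add: arr)
  qed (use obj arr(2) in auto)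
qed

lemma mk_smap_in_holim:
  assumes "section_data D x \<rho>" "section_data D x' \<rho>'" "smap_data D x \<rho> x' \<rho>' m"
  shows "mk_smap D (mk_section D x \<rho>) (mk_section D x' \<rho>') m \<in> Arr (holim D)"
proof -
  note s = section_dataD[OF assms(1)] section_dataD[OF assms(2)] smap_dataD[OF assms(3)]
  let ?t = "mk_smap D (mk_section D x \<rho>) (mk_section D x' \<rho>') m"
  have closed: "ncomp ?t i \<in> Arr (hocolim D)" if "i \<in> Obj I" for i
    using that by (simp add: s)
  have "nat_transf I (hocolim D) (mk_section D x \<rho>) (mk_section D x' \<rho>') ?t"
    unfolding nat_transf_def nat_transf_axioms_def
    using closed
    by (auto simp: PiE_iff is_functor_mk_section assms s)
  then show ?thesis
    using mk_section_in_holim[OF assms(1)] mk_section_in_holim[OF assms(2)] closed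
    by (auto simp del: mk_section_simps(1))
qed

text \<open>
The data of the two end points are prescribed rather than obtained: the same section is given by many pairs
\<open>(x, \<rho>)\<close>, which differ outside \<open>I\<close>, and two composable arrows must be written with the same pair in the middle.
\<close>

lemma holim_arr_eq_mk_smap:
  assumes "\<tau> \<in> Arr (holim D)" and s: "section_data D x \<rho>" "nsrc \<tau> = mk_section D x \<rho>"
    and s': "section_data D x' \<rho>'" "ntgt \<tau> = mk_section D x' \<rho>'"
  shows "smap_data D x \<rho> x' \<rho>' (smap_val \<tau>)"
    and "\<tau> = mk_smap D (mk_section D x \<rho>) (mk_section D x' \<rho>') (smap_val \<tau>)"
proof -
  have \<tau>: "nat_transf I (hocolim D) (nsrc \<tau>) (ntgt \<tau>) \<tau>"
    and proj: "\<And>i. i \<in> Obj I \<Longrightarrow> farr (hocolim_proj D) (ncomp \<tau> i) = Ident I i"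
    using assms(1) by auto
  interpret T: nat_transf I "hocolim D" "nsrc \<tau>" "ntgt \<tau>" \<tau> by fact
  have comp: "ncomp \<tau> i = ((i, x i), (Ident I i, smap_val \<tau> i), (i, x' i))"
    "((i, x i), (Ident I i, smap_val \<tau> i), (i, x' i)) \<in> Arr (hocolim D)" if "i \<in> Obj I" for i
  proof -
    have closed: "ncomp \<tau> i \<in> Arr (hocolim D)" using T.ncomp_in that by (rule PiE_mem)
    show *: "ncomp \<tau> i = ((i, x i), (Ident I i, smap_val \<tau> i), (i, x' i))"
      using closed proj[OF that] T.Dom_ncomp[OF that] T.Cod_ncomp[OF that] that
      by (cases "ncomp \<tau> i") (auto simp: smap_val_def s s')
    show "((i, x i), (Ident I i, smap_val \<tau> i), (i, x' i)) \<in> Arr (hocolim D)"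
      using closed by (simp only: *)
  qed
  note sd = section_dataD[OF s(1)] section_dataD[OF s'(1)]
  show "smap_data D x \<rho> x' \<rho>' (smap_val \<tau>)"
  proof (rule smap_dataI)
    fix \<alpha> assume \<alpha>: "\<alpha> \<in> Arr I"
    have "smap_val \<tau> (Dom I \<alpha>) \<in> Arr (fobj D (Dom I \<alpha>))"
      using comp(2)[of "Dom I \<alpha>"] \<alpha> by auto
    then show "Comp (fobj D (Cod I \<alpha>)) (smap_val \<tau> (Cod I \<alpha>)) (\<rho> \<alpha>) =
        Comp (fobj D (Cod I \<alpha>)) (\<rho>' \<alpha>) (farr (farr D \<alpha>) (smap_val \<tau> (Dom I \<alpha>)))"
      using T.naturality[OF \<alpha>] \<alpha> by (simp add: comp(1) s s' sd)
  qed (use comp(2) sd in auto)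
  have "ncomp \<tau> = ncomp (mk_smap D (mk_section D x \<rho>) (mk_section D x' \<rho>') (smap_val \<tau>))"
    by (rule extensionalityI[of _ "Obj I"])
      (use T.ncomp_in in \<open>simp_all add: comp(1) PiE_iff\<close>)
  then show "\<tau> = mk_smap D (mk_section D x \<rho>) (mk_section D x' \<rho>') (smap_val \<tau>)"
    by (simp add: s s')
qed

lemma holim_arrE:
  assumes "\<tau> \<in> Arr (holim D)"
  obtains x \<rho> x' \<rho>' m where "section_data D x \<rho>" "section_data D x' \<rho>'" "smap_data D x \<rho> x' \<rho>' m"
    "\<tau> = mk_smap D (mk_section D x \<rho>) (mk_section D x' \<rho>') m"
proof -
  have "nsrc \<tau> \<in> Obj (holim D)" "ntgt \<tau> \<in> Obj (holim D)" using assms by auto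
  then obtain x \<rho> x' \<rho>' where "section_data D x \<rho>" "nsrc \<tau> = mk_section D x \<rho>"
    "section_data D x' \<rho>'" "ntgt \<tau> = mk_section D x' \<rho>'"
    by (metis holim_objE)
  with holim_arr_eq_mk_smap[OF assms this] show ?thesis by (intro that)
qed

lemma holim_Ident [simp]:
  "Ident (holim D) (mk_section D x \<rho>) =
    mk_smap D (mk_section D x \<rho>) (mk_section D x \<rho>) (\<lambda>i. Ident (fobj D i) (x i))"
  by (auto simp: holim_def HOM_def Let_def fsrc mk_smap_def restrict_def)

lemma holim_Comp:
  assumes "section_data D x \<rho>" "section_data D x' \<rho>'" "smap_data D x \<rho> x' \<rho>' m"
  shows "Comp (holim D) (mk_smap D t (mk_section D x'' \<rho>'') n)
      (mk_smap D (mk_section D x \<rho>) (mk_section D x' \<rho>') m) =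
    mk_smap D (mk_section D x \<rho>) (mk_section D x'' \<rho>'') (\<lambda>i. Comp (fobj D i) (n i) (m i))"
  using smap_dataD(1)[OF assms(3)]
  by (auto simp: holim_def HOM_def Let_def fsrc mk_smap_def restrict_def)

lemma smap_data_Ident:
  assumes "section_data D x \<rho>"
  shows "smap_data D x \<rho> x \<rho> (\<lambda>i. Ident (fobj D i) (x i))"
  by (rule smap_dataI) (simp_all add: section_dataD[OF assms])

lemma smap_data_Comp:
  assumes "section_data D x \<rho>" "section_data D x' \<rho>'" "section_data D x'' \<rho>''"
    "smap_data D x \<rho> x' \<rho>' m" "smap_data D x' \<rho>' x'' \<rho>'' n"
  shows "smap_data D x \<rho> x'' \<rho>'' (\<lambda>i. Comp (fobj D i) (n i) (m i))"
proof (rule smap_dataI)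
  note s = section_dataD[OF assms(1)] section_dataD[OF assms(2)] section_dataD[OF assms(3)]
    smap_dataD(1-3)[OF assms(4)] smap_dataD(1-3)[OF assms(5)]
  fix \<alpha> assume \<alpha>: "\<alpha> \<in> Arr I"
  let ?D = "fobj D (Cod I \<alpha>)"
  let ?a = "Dom I \<alpha>" let ?b = "Cod I \<alpha>"
  have "Comp ?D (Comp ?D (n ?b) (m ?b)) (\<rho> \<alpha>) = Comp ?D (n ?b) (Comp ?D (m ?b) (\<rho> \<alpha>))"
    using \<alpha> by (simp add: fibre_assoc s)
  also have "\<dots> = Comp ?D (n ?b) (Comp ?D (\<rho>' \<alpha>) (farr (farr D \<alpha>) (m ?a)))"
    by (simp add: smap_dataD(4)[OF assms(4) \<alpha>])
  also have "\<dots> = Comp ?D (Comp ?D (n ?b) (\<rho>' \<alpha>)) (farr (farr D \<alpha>) (m ?a))"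
    using \<alpha> by (simp add: fibre_assoc s)
  also have "\<dots> = Comp ?D (Comp ?D (\<rho>'' \<alpha>) (farr (farr D \<alpha>) (n ?a))) (farr (farr D \<alpha>) (m ?a))"
    by (simp add: smap_dataD(4)[OF assms(5) \<alpha>])
  also have "\<dots> = Comp ?D (\<rho>'' \<alpha>) (farr (farr D \<alpha>) (Comp (fobj D ?a) (n ?a) (m ?a)))"
    using \<alpha> by (simp add: fibre_assoc s)
  finally show "Comp ?D (Comp ?D (n ?b) (m ?b)) (\<rho> \<alpha>) =
    Comp ?D (\<rho>'' \<alpha>) (farr (farr D \<alpha>) (Comp (fobj D ?a) (n ?a) (m ?a)))" .
qed (use smap_dataD(1-3)[OF assms(4)] smap_dataD(1-3)[OF assms(5)] in simp_all)

lemma category_holim: "category (holim D)"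
proof
  fix f g h
  assume f: "f \<in> Arr (holim D)"
  then show "Dom (holim D) f \<in> Obj (holim D)" "Cod (holim D) f \<in> Obj (holim D)"
    by (simp_all del: holim_simps(1))
  then obtain x0 \<rho>0 x1 \<rho>1 where s: "section_data D x0 \<rho>0" "nsrc f = mk_section D x0 \<rho>0"
    "section_data D x1 \<rho>1" "ntgt f = mk_section D x1 \<rho>1"
    unfolding holim_simps(3,4) by (metis holim_objE)
  note f' = holim_arr_eq_mk_smap[OF f s]
  \<comment> \<open>Named, so that the equation that expresses \<open>f\<close> by its components does not rewrite its own right-hand side.\<close>
  define m where "m = smap_val f"
  note f'' = f'[folded m_def]
  note m = smap_dataD[OF f''(1)]
  show "Comp (holim D) f (Ident (holim D) (Dom (holim D) f)) = f"
    unfolding f''(2)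
    by (simp add: s holim_Comp[OF s(1) s(1) smap_data_Ident[OF s(1)]] m cong: mk_smap_cong)
  show "Comp (holim D) (Ident (holim D) (Cod (holim D) f)) f = f"
    unfolding f''(2)
    by (simp add: s holim_Comp[OF s(1,3) f''(1)] m cong: mk_smap_cong)
  assume g: "g \<in> Arr (holim D)" and fg: "Cod (holim D) f = Dom (holim D) g"
  have "ntgt g \<in> Obj (holim D)" using g by (simp del: holim_simps(1))
  then obtain x2 \<rho>2 where s2: "section_data D x2 \<rho>2" "ntgt g = mk_section D x2 \<rho>2"
    by (rule holim_objE)
  define n where "n = smap_val g"
  have "nsrc g = mk_section D x1 \<rho>1" using fg s by simp
  note g' = holim_arr_eq_mk_smap[OF g s(3) this s2, folded n_def]
  note gf = holim_Comp[OF s(1,3) f''(1)] and gf_data = smap_data_Comp[OF s(1,3) s2(1) f''(1) g'(1)]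
  show "Comp (holim D) g f \<in> Arr (holim D)"
    unfolding f''(2) g'(2) gf using s(1) s2(1) gf_data by (rule mk_smap_in_holim)
  show "Dom (holim D) (Comp (holim D) g f) = Dom (holim D) f"
    "Cod (holim D) (Comp (holim D) g f) = Cod (holim D) g"
    unfolding f''(2) g'(2) gf by simp_all
  assume h: "h \<in> Arr (holim D)" and gh: "Cod (holim D) g = Dom (holim D) h"
  have "ntgt h \<in> Obj (holim D)" using h by (simp del: holim_simps(1))
  then obtain x3 \<rho>3 where s3: "section_data D x3 \<rho>3" "ntgt h = mk_section D x3 \<rho>3"
    by (rule holim_objE)
  have "nsrc h = mk_section D x2 \<rho>2" using gh s2 by simp
  define l where "l = smap_val h"
  note h' = holim_arr_eq_mk_smap[OF h s2(1) \<open>nsrc h = _\<close> s3, folded l_def]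
  show "Comp (holim D) h (Comp (holim D) g f) = Comp (holim D) (Comp (holim D) h g) f"
    unfolding f''(2) g'(2) h'(2) gf holim_Comp[OF s(1) s2(1) gf_data] holim_Comp[OF s(3) s2(1) g'(1)]
    using m(1-3) smap_dataD(1-3)[OF g'(1)] smap_dataD(1-3)[OF h'(1)]
    by (intro mk_smap_cong) (simp_all add: fibre_assoc)
next
  fix s assume "s \<in> Obj (holim D)"
  then obtain x \<rho> where s: "section_data D x \<rho>" "s = mk_section D x \<rho>" by (rule holim_objE)
  show "Ident (holim D) s \<in> Arr (holim D)"
    unfolding s(2) holim_Ident using s(1) s(1) smap_data_Ident[OF s(1)] by (rule mk_smap_in_holim)
  show "Dom (holim D) (Ident (holim D) s) = s" "Cod (holim D) (Ident (holim D) s) = s"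
    by (simp_all add: s(2))
qed

text \<open>
The induced maps of the iterated constructions are values of \<open>holim_map\<close> on records that are assembled from functors
between the fibres. The formula is therefore stated for a record \<open>\<phi>\<close>: whiskering a section applies these functors to
the data, one fibre at a time.
\<close>

lemma fobj_holim_map:
  assumes \<phi>: "nsrc \<phi> = D" "fsrc (ntgt \<phi>) = I" and s: "section_data D x \<rho>"
  shows "fobj (holim_map \<phi>) (mk_section D x \<rho>) =
    mk_section (ntgt \<phi>) (\<lambda>i. fobj (ncomp \<phi> i) (x i)) (\<lambda>\<alpha>. farr (ncomp \<phi> (Cod I \<alpha>)) (\<rho> \<alpha>))"
proof -
  note sd = section_dataD[OF s]
  have "fobj (holim_map \<phi>) (mk_section D x \<rho>) = hocolim_map \<phi> \<circ>\<^sub>F mk_section D x \<rho>"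
    using mk_section_in_holim[OF s] by (simp add: holim_map_def \<phi> del: holim_simps)
  also have "\<dots> = mk_section (ntgt \<phi>) (\<lambda>i. fobj (ncomp \<phi> i) (x i)) (\<lambda>\<alpha>. farr (ncomp \<phi> (Cod I \<alpha>)) (\<rho> \<alpha>))"
    by (rule ftr_eqI) (simp_all add: hocolim_map_def mk_section_def[of "ntgt \<phi>"] \<phi> sd)
  finally show ?thesis .
qed

lemma farr_holim_map:
  assumes \<phi>: "nsrc \<phi> = D" "fsrc (ntgt \<phi>) = I"
    and s: "section_data D x \<rho>" "section_data D x' \<rho>'" "smap_data D x \<rho> x' \<rho>' m"
  shows "farr (holim_map \<phi>) (mk_smap D (mk_section D x \<rho>) (mk_section D x' \<rho>') m) =
    mk_smap (ntgt \<phi>) (fobj (holim_map \<phi>) (mk_section D x \<rho>)) (fobj (holim_map \<phi>) (mk_section D x' \<rho>'))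
      (\<lambda>i. farr (ncomp \<phi> i) (m i))"
proof -
  note sd = section_dataD[OF s(1)] section_dataD[OF s(2)] smap_dataD(1-3)[OF s(3)]
  have obj: "fobj (holim_map \<phi>) (mk_section D x \<rho>) = hocolim_map \<phi> \<circ>\<^sub>F mk_section D x \<rho>"
    if "section_data D x \<rho>" for x \<rho>
    using mk_section_in_holim[OF that] by (simp add: holim_map_def \<phi> del: holim_simps)
  have "farr (holim_map \<phi>) (mk_smap D (mk_section D x \<rho>) (mk_section D x' \<rho>') m) =
      whisker (hocolim_map \<phi>) (mk_smap D (mk_section D x \<rho>) (mk_section D x' \<rho>') m)"
    using mk_smap_in_holim[OF s] by (simp add: holim_map_def \<phi> del: holim_simps)
  also have "\<dots> = mk_smap (ntgt \<phi>) (fobj (holim_map \<phi>) (mk_section D x \<rho>))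
      (fobj (holim_map \<phi>) (mk_section D x' \<rho>')) (\<lambda>i. farr (ncomp \<phi> i) (m i))"
    unfolding whisker_def mk_smap_def obj[OF s(1)] obj[OF s(2)]
    by (auto simp: sd fsrc \<phi> restrict_def hocolim_map_def)
  finally show ?thesis .
qed

end

section \<open>Maps of diagrams\<close>

locale diagram_map = nat_transf I CAT C D \<phi>
  for I :: "('i, 'f) cat" and C D :: "('i, 'f, 'c, 'd) diagram" and \<phi>
begin

sublocale S: diagram I C by unfold_locales
sublocale T: diagram I D by unfold_locales

lemma functor_ncomp: "i \<in> Obj I \<Longrightarrow> is_functor (fobj C i) (fobj D i) (ncomp \<phi> i)"
  using PiE_mem[OF ncomp_in, of i] Dom_ncomp[of i] Cod_ncomp[of i] by simp

lemma ncomp_simps [simp]: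
  "\<lbrakk>i \<in> Obj I; x \<in> Obj (fobj C i)\<rbrakk> \<Longrightarrow> fobj (ncomp \<phi> i) x \<in> Obj (fobj D i)"
  "\<lbrakk>i \<in> Obj I; f \<in> Arr (fobj C i)\<rbrakk> \<Longrightarrow> farr (ncomp \<phi> i) f \<in> Arr (fobj D i)"
  "\<lbrakk>i \<in> Obj I; f \<in> Arr (fobj C i)\<rbrakk>
    \<Longrightarrow> Dom (fobj D i) (farr (ncomp \<phi> i) f) = fobj (ncomp \<phi> i) (Dom (fobj C i) f)"
  "\<lbrakk>i \<in> Obj I; f \<in> Arr (fobj C i)\<rbrakk>
    \<Longrightarrow> Cod (fobj D i) (farr (ncomp \<phi> i) f) = fobj (ncomp \<phi> i) (Cod (fobj C i) f)"
  "\<lbrakk>i \<in> Obj I; x \<in> Obj (fobj C i)\<rbrakk>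
    \<Longrightarrow> farr (ncomp \<phi> i) (Ident (fobj C i) x) = Ident (fobj D i) (fobj (ncomp \<phi> i) x)"
  "\<lbrakk>i \<in> Obj I; f \<in> Arr (fobj C i); g \<in> Arr (fobj C i); Cod (fobj C i) f = Dom (fobj C i) g\<rbrakk>
    \<Longrightarrow> farr (ncomp \<phi> i) (Comp (fobj C i) g f) =
      Comp (fobj D i) (farr (ncomp \<phi> i) g) (farr (ncomp \<phi> i) f)"
  using functor_ncomp[of i]
  by (auto simp: is_functor.fobj_closed is_functor.farr_closed is_functor.Dom_farr
      is_functor.Cod_farr is_functor.farr_Ident is_functor.farr_Comp)

text \<open>
Naturality on elements, oriented so that the simplifier moves the components of \<open>\<phi>\<close> inwards, past all transports.
\<close>

lemma ncomp_transport [simp]: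
  "\<lbrakk>\<alpha> \<in> Arr I; Cod I \<alpha> = j; x \<in> Obj (fobj C (Dom I \<alpha>))\<rbrakk>
    \<Longrightarrow> fobj (ncomp \<phi> j) (fobj (farr C \<alpha>) x) = fobj (farr D \<alpha>) (fobj (ncomp \<phi> (Dom I \<alpha>)) x)"
  "\<lbrakk>\<alpha> \<in> Arr I; Cod I \<alpha> = j; f \<in> Arr (fobj C (Dom I \<alpha>))\<rbrakk>
    \<Longrightarrow> farr (ncomp \<phi> j) (farr (farr C \<alpha>) f) = farr (farr D \<alpha>) (farr (ncomp \<phi> (Dom I \<alpha>)) f)"
proof -
  assume \<alpha>: "\<alpha> \<in> Arr I" "Cod I \<alpha> = j"
  have nat: "ncomp \<phi> j \<circ>\<^sub>F farr C \<alpha> = farr D \<alpha> \<circ>\<^sub>F ncomp \<phi> (Dom I \<alpha>)"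
    using naturality[OF \<alpha>(1)] \<alpha>(2) by simp
  interpret c: is_functor "fobj C (Dom I \<alpha>)" "fobj C (Cod I \<alpha>)" "farr C \<alpha>"
    using \<alpha>(1) by (rule S.functor_transport)
  interpret p: is_functor "fobj C (Dom I \<alpha>)" "fobj D (Dom I \<alpha>)" "ncomp \<phi> (Dom I \<alpha>)"
    using \<alpha>(1) by (intro functor_ncomp) simp
  show "x \<in> Obj (fobj C (Dom I \<alpha>)) \<Longrightarrow>
      fobj (ncomp \<phi> j) (fobj (farr C \<alpha>) x) = fobj (farr D \<alpha>) (fobj (ncomp \<phi> (Dom I \<alpha>)) x)"
    using arg_cong[OF nat, of "\<lambda>F. fobj F x"] by (simp add: c.fsrc p.fsrc)
  show "f \<in> Arr (fobj C (Dom I \<alpha>)) \<Longrightarrow>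
      farr (ncomp \<phi> j) (farr (farr C \<alpha>) f) = farr (farr D \<alpha>) (farr (ncomp \<phi> (Dom I \<alpha>)) f)"
    using arg_cong[OF nat, of "\<lambda>F. farr F f"] by (simp add: c.fsrc p.fsrc)
qed

lemma hocolim_map_simps [simp]:
  "fsrc (hocolim_map \<phi>) = hocolim C" "ftgt (hocolim_map \<phi>) = hocolim D"
  "\<lbrakk>i \<in> Obj I; x \<in> Obj (fobj C i)\<rbrakk> \<Longrightarrow> fobj (hocolim_map \<phi>) (i, x) = (i, fobj (ncomp \<phi> i) x)"
  "((i, x), (\<alpha>, \<rho>), (j, y)) \<in> Arr (hocolim C) \<Longrightarrow> farr (hocolim_map \<phi>) ((i, x), (\<alpha>, \<rho>), (j, y)) =
    ((i, fobj (ncomp \<phi> i) x), (\<alpha>, farr (ncomp \<phi> j) \<rho>), (j, fobj (ncomp \<phi> j) y))"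
  "fobj (hocolim_map \<phi>) \<in> extensional (Obj (hocolim C))"
  "farr (hocolim_map \<phi>) \<in> extensional (Arr (hocolim C))"
  by (simp_all add: hocolim_map_def nsrc ntgt del: S.hocolim_simps(2))

lemma is_functor_hocolim_map: "is_functor (hocolim C) (hocolim D) (hocolim_map \<phi>)"
proof (rule is_functorI)
  fix f assume f: "f \<in> Arr (hocolim C)"
  then obtain i x \<alpha> \<rho> j y where f': "f = ((i, x), (\<alpha>, \<rho>), (j, y))"
    "\<alpha> \<in> Arr I" "Dom I \<alpha> = i" "Cod I \<alpha> = j" "i \<in> Obj I" "j \<in> Obj I" "x \<in> Obj (fobj C i)"
    "\<rho> \<in> Arr (fobj C j)" "Dom (fobj C j) \<rho> = fobj (farr C \<alpha>) x" "Cod (fobj C j) \<rho> = y"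
    "y \<in> Obj (fobj C j)"
    by (rule S.hocolim_arrE)
  then show "farr (hocolim_map \<phi>) f \<in> Arr (hocolim D)"
    "Dom (hocolim D) (farr (hocolim_map \<phi>) f) = fobj (hocolim_map \<phi>) (Dom (hocolim C) f)"
    "Cod (hocolim D) (farr (hocolim_map \<phi>) f) = fobj (hocolim_map \<phi>) (Cod (hocolim C) f)"
    by simp_all
  fix g assume "g \<in> Arr (hocolim C)" and fg: "Cod (hocolim C) f = Dom (hocolim C) g"
  then obtain j' y' \<beta> \<sigma> k z where g': "g = ((j', y'), (\<beta>, \<sigma>), (k, z))"
    "\<beta> \<in> Arr I" "Dom I \<beta> = j'" "Cod I \<beta> = k" "k \<in> Obj I"
    "\<sigma> \<in> Arr (fobj C k)" "Dom (fobj C k) \<sigma> = fobj (farr C \<beta>) y'" "Cod (fobj C k) \<sigma> = z"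
    by (auto elim: S.hocolim_arrE)
  have eq: "j' = j" "y' = y" using fg by (simp_all add: f' g')
  show "farr (hocolim_map \<phi>) (Comp (hocolim C) g f) =
      Comp (hocolim D) (farr (hocolim_map \<phi>) g) (farr (hocolim_map \<phi>) f)"
    using f'(2-) g'(2-) unfolding f'(1) g'(1) eq by simp
qed (auto simp: S.category_hocolim T.category_hocolim elim!: S.hocolim_objE)

lemma section_data_map:
  assumes "section_data C x \<rho>"
  shows "section_data D (\<lambda>i. fobj (ncomp \<phi> i) (x i)) (\<lambda>\<alpha>. farr (ncomp \<phi> (Cod I \<alpha>)) (\<rho> \<alpha>))"
  by (rule T.section_dataI) (simp_all add: S.section_dataD[OF assms])

lemma holim_map_mk_section [simp]:
  assumes "section_data C x \<rho>"
  shows "fobj (holim_map \<phi>) (mk_section C x \<rho>) =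
    mk_section D (\<lambda>i. fobj (ncomp \<phi> i) (x i)) (\<lambda>\<alpha>. farr (ncomp \<phi> (Cod I \<alpha>)) (\<rho> \<alpha>))"
  using S.fobj_holim_map[OF nsrc _ assms] by (simp add: ntgt G.fsrc)

lemma smap_data_map:
  assumes "section_data C x \<rho>" "section_data C x' \<rho>'" "smap_data C x \<rho> x' \<rho>' m"
  shows "smap_data D (\<lambda>i. fobj (ncomp \<phi> i) (x i)) (\<lambda>\<alpha>. farr (ncomp \<phi> (Cod I \<alpha>)) (\<rho> \<alpha>))
    (\<lambda>i. fobj (ncomp \<phi> i) (x' i)) (\<lambda>\<alpha>. farr (ncomp \<phi> (Cod I \<alpha>)) (\<rho>' \<alpha>))
    (\<lambda>i. farr (ncomp \<phi> i) (m i))"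
proof (rule T.smap_dataI)
  note s = S.section_dataD[OF assms(1)] S.section_dataD[OF assms(2)] S.smap_dataD(1-3)[OF assms(3)]
  fix \<alpha> assume \<alpha>: "\<alpha> \<in> Arr I"
  let ?p = "farr (ncomp \<phi> (Cod I \<alpha>))"
  have "Comp (fobj D (Cod I \<alpha>)) (?p (m (Cod I \<alpha>))) (?p (\<rho> \<alpha>)) =
      ?p (Comp (fobj C (Cod I \<alpha>)) (m (Cod I \<alpha>)) (\<rho> \<alpha>))"
    using \<alpha> by (simp add: s)
  also have "\<dots> = ?p (Comp (fobj C (Cod I \<alpha>)) (\<rho>' \<alpha>) (farr (farr C \<alpha>) (m (Dom I \<alpha>))))"
    by (simp add: S.smap_dataD(4)[OF assms(3) \<alpha>])
  also have "\<dots> = Comp (fobj D (Cod I \<alpha>)) (?p (\<rho>' \<alpha>)) (farr (farr D \<alpha>) (farr (ncomp \<phi> (Dom I \<alpha>)) (m (Dom I \<alpha>))))"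
    using \<alpha> by (simp add: s)
  finally show "Comp (fobj D (Cod I \<alpha>)) (?p (m (Cod I \<alpha>))) (?p (\<rho> \<alpha>)) =
    Comp (fobj D (Cod I \<alpha>)) (?p (\<rho>' \<alpha>)) (farr (farr D \<alpha>) (farr (ncomp \<phi> (Dom I \<alpha>)) (m (Dom I \<alpha>))))" .
qed (simp_all add: S.section_dataD[OF assms(1)] S.section_dataD[OF assms(2)] S.smap_dataD(1-3)[OF assms(3)])

lemma holim_map_mk_smap [simp]:
  assumes "section_data C x \<rho>" "section_data C x' \<rho>'" "smap_data C x \<rho> x' \<rho>' m"
  shows "farr (holim_map \<phi>) (mk_smap C (mk_section C x \<rho>) (mk_section C x' \<rho>') m) =
    mk_smap D (fobj (holim_map \<phi>) (mk_section C x \<rho>)) (fobj (holim_map \<phi>) (mk_section C x' \<rho>'))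
      (\<lambda>i. farr (ncomp \<phi> i) (m i))"
  using S.farr_holim_map[OF nsrc _ assms] by (simp add: ntgt G.fsrc)

lemma holim_map_simps [simp]:
  "fsrc (holim_map \<phi>) = holim C" "ftgt (holim_map \<phi>) = holim D"
  "fobj (holim_map \<phi>) \<in> extensional (Obj (holim C))"
  "farr (holim_map \<phi>) \<in> extensional (Arr (holim C))"
  by (simp_all add: holim_map_def nsrc ntgt del: S.holim_simps)

lemma is_functor_holim_map: "is_functor (holim C) (holim D) (holim_map \<phi>)"
proof (rule is_functorI)
  fix s assume "s \<in> Obj (holim C)"
  then obtain x \<rho> where s: "section_data C x \<rho>" "s = mk_section C x \<rho>" by (rule S.holim_objE)
  show "fobj (holim_map \<phi>) s \<in> Obj (holim D)"
    unfolding s(2) holim_map_mk_section[OF s(1)] by (rule T.mk_section_in_holim[OF section_data_map[OF s(1)]])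
  show "farr (holim_map \<phi>) (Ident (holim C) s) = Ident (holim D) (fobj (holim_map \<phi>) s)"
    unfolding s(2) S.holim_Ident holim_map_mk_smap[OF s(1,1) S.smap_data_Ident[OF s(1)]]
      holim_map_mk_section[OF s(1)] T.holim_Ident
    by (rule T.mk_smap_cong) (simp_all add: S.section_dataD[OF s(1)])
next
  fix f assume f: "f \<in> Arr (holim C)"
  then obtain x0 \<rho>0 x1 \<rho>1 m where s: "section_data C x0 \<rho>0" "section_data C x1 \<rho>1"
      "smap_data C x0 \<rho>0 x1 \<rho>1 m" "f = mk_smap C (mk_section C x0 \<rho>0) (mk_section C x1 \<rho>1) m"
    by (rule S.holim_arrE)
  note sD = section_data_map[OF s(1)] section_data_map[OF s(2)] smap_data_map[OF s(1-3)]
  show "farr (holim_map \<phi>) f \<in> Arr (holim D)"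
    unfolding s(4) holim_map_mk_smap[OF s(1-3)] holim_map_mk_section[OF s(1)] holim_map_mk_section[OF s(2)]
    using sD by (rule T.mk_smap_in_holim)
  show "Dom (holim D) (farr (holim_map \<phi>) f) = fobj (holim_map \<phi>) (Dom (holim C) f)"
    "Cod (holim D) (farr (holim_map \<phi>) f) = fobj (holim_map \<phi>) (Cod (holim C) f)"
    unfolding s(4) holim_map_mk_smap[OF s(1-3)] by simp_all
  fix g assume g: "g \<in> Arr (holim C)" and fg: "Cod (holim C) f = Dom (holim C) g"
  have "ntgt g \<in> Obj (holim C)" using g by (simp del: S.holim_simps(1))
  then obtain x2 \<rho>2 where s2: "section_data C x2 \<rho>2" "ntgt g = mk_section C x2 \<rho>2"
    by (rule S.holim_objE)
  have "nsrc g = mk_section C x1 \<rho>1" using fg s by simp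
  from S.holim_arr_eq_mk_smap[OF g s(2) this s2]
  obtain n where n: "smap_data C x1 \<rho>1 x2 \<rho>2 n" "g = mk_smap C (mk_section C x1 \<rho>1) (mk_section C x2 \<rho>2) n"
    by blast
  show "farr (holim_map \<phi>) (Comp (holim C) g f) =
      Comp (holim D) (farr (holim_map \<phi>) g) (farr (holim_map \<phi>) f)"
    unfolding s(4) n(2) S.holim_Comp[OF s(1-3)] holim_map_mk_smap[OF s(1-3)]
      holim_map_mk_smap[OF s(2) s2(1) n(1)] holim_map_mk_section[OF s(1)] holim_map_mk_section[OF s(2)]
      holim_map_mk_section[OF s2(1)] T.holim_Comp[OF sD]
      holim_map_mk_smap[OF s(1) s2(1) S.smap_data_Comp[OF s(1,2) s2(1) s(3) n(1)]]
    by (rule T.mk_smap_cong) (simp_all add: S.smap_dataD[OF s(3)] S.smap_dataD[OF n(1)])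
qed (simp_all add: S.category_holim T.category_holim del: S.holim_simps)

end

section \<open>Diagrams on a product\<close>

lemma prod_cat_simps [simp]:
  "(i, j) \<in> Obj (prod_cat I J) \<longleftrightarrow> i \<in> Obj I \<and> j \<in> Obj J"
  "(\<alpha>, \<beta>) \<in> Arr (prod_cat I J) \<longleftrightarrow> \<alpha> \<in> Arr I \<and> \<beta> \<in> Arr J"
  "Dom (prod_cat I J) (\<alpha>, \<beta>) = (Dom I \<alpha>, Dom J \<beta>)"
  "Cod (prod_cat I J) (\<alpha>, \<beta>) = (Cod I \<alpha>, Cod J \<beta>)"
  "Ident (prod_cat I J) (i, j) = (Ident I i, Ident J j)"
  "Comp (prod_cat I J) (\<alpha>, \<beta>) (\<alpha>', \<beta>') = (Comp I \<alpha> \<alpha>', Comp J \<beta> \<beta>')"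
  by (simp_all add: prod_cat_def)

lemma slice_simps [simp]:
  "fsrc (slice_fst J I C i) = J" "ftgt (slice_fst J I C i) = ftgt C"
  "j \<in> Obj J \<Longrightarrow> fobj (slice_fst J I C i) j = fobj C (i, j)"
  "\<beta> \<in> Arr J \<Longrightarrow> farr (slice_fst J I C i) \<beta> = farr C (Ident I i, \<beta>)"
  "fobj (slice_fst J I C i) \<in> extensional (Obj J)"
  "farr (slice_fst J I C i) \<in> extensional (Arr J)"
  "fsrc (slice_snd I J C j) = I" "ftgt (slice_snd I J C j) = ftgt C"
  "i \<in> Obj I \<Longrightarrow> fobj (slice_snd I J C j) i = fobj C (i, j)"
  "\<alpha> \<in> Arr I \<Longrightarrow> farr (slice_snd I J C j) \<alpha> = farr C (\<alpha>, Ident J j)"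
  "fobj (slice_snd I J C j) \<in> extensional (Obj I)"
  "farr (slice_snd I J C j) \<in> extensional (Arr I)"
  by (simp_all add: slice_fst_def slice_snd_def)

lemma slice_ntr_simps [simp]:
  "nsrc (slice_fst_ntr J I C \<alpha>) = slice_fst J I C (Dom I \<alpha>)"
  "ntgt (slice_fst_ntr J I C \<alpha>) = slice_fst J I C (Cod I \<alpha>)"
  "j \<in> Obj J \<Longrightarrow> ncomp (slice_fst_ntr J I C \<alpha>) j = farr C (\<alpha>, Ident J j)"
  "ncomp (slice_fst_ntr J I C \<alpha>) \<in> extensional (Obj J)"
  "nsrc (slice_snd_ntr I J C \<beta>) = slice_snd I J C (Dom J \<beta>)"
  "ntgt (slice_snd_ntr I J C \<beta>) = slice_snd I J C (Cod J \<beta>)"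
  "i \<in> Obj I \<Longrightarrow> ncomp (slice_snd_ntr I J C \<beta>) i = farr C (Ident I i, \<beta>)"
  "ncomp (slice_snd_ntr I J C \<beta>) \<in> extensional (Obj I)"
  by (simp_all add: slice_fst_ntr_def slice_snd_ntr_def)

lemma iterated_simps [simp]:
  "fsrc (holim_fst I J C) = J" "ftgt (holim_fst I J C) = CAT"
  "j \<in> Obj J \<Longrightarrow> fobj (holim_fst I J C) j = holim (slice_snd I J C j)"
  "\<beta> \<in> Arr J \<Longrightarrow> farr (holim_fst I J C) \<beta> = holim_map (slice_snd_ntr I J C \<beta>)"
  "fobj (holim_fst I J C) \<in> extensional (Obj J)"
  "farr (holim_fst I J C) \<in> extensional (Arr J)"
  "fsrc (hocolim_snd I J C) = I" "ftgt (hocolim_snd I J C) = CAT"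
  "i \<in> Obj I \<Longrightarrow> fobj (hocolim_snd I J C) i = hocolim (slice_fst J I C i)"
  "\<alpha> \<in> Arr I \<Longrightarrow> farr (hocolim_snd I J C) \<alpha> = hocolim_map (slice_fst_ntr J I C \<alpha>)"
  "fobj (hocolim_snd I J C) \<in> extensional (Obj I)"
  "farr (hocolim_snd I J C) \<in> extensional (Arr I)"
  by (simp_all add: holim_fst_def hocolim_snd_def)

locale bidiagram = I: category I + J: category J + diagram "prod_cat I J" C
  for I :: "('i, 'f) cat" and J :: "('j, 'g) cat" and C :: "('i \<times> 'j, 'f \<times> 'g, 'c, 'd) diagram"
begin

text \<open>
The two iterated constructions, the diagrams \<open>C(-, j)\<close> and \<open>C(i, -)\<close>, and the maps \<open>C(-, \<beta>)\<close> and \<open>C(\<alpha>, -)\<close> between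
them.
\<close>

abbreviation "HL \<equiv> hocolim_holim I J C"
abbreviation "LH \<equiv> holim_hocolim I J C"
abbreviation "at_snd \<equiv> slice_snd I J C"
abbreviation "at_fst \<equiv> slice_fst J I C"
abbreviation "at_snd_map \<equiv> slice_snd_ntr I J C"
abbreviation "at_fst_map \<equiv> slice_fst_ntr J I C"

declare I.Dom_in [simp] I.Cod_in [simp] I.Ident_in [simp] I.Dom_Ident [simp] I.Cod_Ident [simp]
  I.Comp_in [simp] I.Dom_Comp [simp] I.Cod_Comp [simp]
  J.Dom_in [simp] J.Cod_in [simp] J.Ident_in [simp] J.Dom_Ident [simp] J.Cod_Ident [simp]
  J.Comp_in [simp] J.Dom_Comp [simp] J.Cod_Comp [simp]

lemma factor_Comp_Ident [simp]:
  "\<lbrakk>f \<in> Arr I; Dom I f = i\<rbrakk> \<Longrightarrow> Comp I f (Ident I i) = f"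
  "\<lbrakk>f \<in> Arr I; Cod I f = i\<rbrakk> \<Longrightarrow> Comp I (Ident I i) f = f"
  "\<lbrakk>g \<in> Arr J; Dom J g = j\<rbrakk> \<Longrightarrow> Comp J g (Ident J j) = g"
  "\<lbrakk>g \<in> Arr J; Cod J g = j\<rbrakk> \<Longrightarrow> Comp J (Ident J j) g = g"
  using I.Comp_Ident I.Ident_Comp J.Comp_Ident J.Ident_Comp by auto

text \<open>
Iterated transports are merged into one along the composite arrow. With identities cancelled, every transport then has
a normal form, and the many identities between transports become identities between arrows. The rule that
splits composites would run in the opposite direction.
\<close>

declare transport_Comp [simp del]

lemma transport_merge [simp]:
  "\<lbrakk>\<alpha> \<in> Arr I; \<alpha>' \<in> Arr I; Cod I \<alpha> = Dom I \<alpha>'; \<beta> \<in> Arr J; \<beta>' \<in> Arr J; Cod J \<beta> = Dom J \<beta>';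
    x \<in> Obj (fobj C (Dom I \<alpha>, Dom J \<beta>))\<rbrakk>
    \<Longrightarrow> fobj (farr C (\<alpha>', \<beta>')) (fobj (farr C (\<alpha>, \<beta>)) x) = fobj (farr C (Comp I \<alpha>' \<alpha>, Comp J \<beta>' \<beta>)) x"
  "\<lbrakk>\<alpha> \<in> Arr I; \<alpha>' \<in> Arr I; Cod I \<alpha> = Dom I \<alpha>'; \<beta> \<in> Arr J; \<beta>' \<in> Arr J; Cod J \<beta> = Dom J \<beta>';
    f \<in> Arr (fobj C (Dom I \<alpha>, Dom J \<beta>))\<rbrakk>
    \<Longrightarrow> farr (farr C (\<alpha>', \<beta>')) (farr (farr C (\<alpha>, \<beta>)) f) = farr (farr C (Comp I \<alpha>' \<alpha>, Comp J \<beta>' \<beta>)) f"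
  using transport_Comp[of "(\<alpha>, \<beta>)" "(\<alpha>', \<beta>')"] by simp_all

lemma transport_Ident_pair [simp]:
  "\<lbrakk>i \<in> Obj I; j \<in> Obj J; x \<in> Obj (fobj C (i, j))\<rbrakk> \<Longrightarrow> fobj (farr C (Ident I i, Ident J j)) x = x"
  "\<lbrakk>i \<in> Obj I; j \<in> Obj J; f \<in> Arr (fobj C (i, j))\<rbrakk> \<Longrightarrow> farr (farr C (Ident I i, Ident J j)) f = f"
  using transport_Ident[of "(i, j)"] by simp_all

lemma functor_transport_pair:
  "\<lbrakk>\<alpha> \<in> Arr I; \<beta> \<in> Arr J; Dom I \<alpha> = i; Dom J \<beta> = j; Cod I \<alpha> = i'; Cod J \<beta> = j'\<rbrakk>
    \<Longrightarrow> is_functor (fobj C (i, j)) (fobj C (i', j')) (farr C (\<alpha>, \<beta>))"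
  using functor_transport[of "(\<alpha>, \<beta>)"] by auto

lemma transport_Comp_ftr:
  "\<lbrakk>\<alpha> \<in> Arr I; \<alpha>' \<in> Arr I; Cod I \<alpha> = Dom I \<alpha>'; \<beta> \<in> Arr J; \<beta>' \<in> Arr J; Cod J \<beta> = Dom J \<beta>'\<rbrakk>
    \<Longrightarrow> farr C (\<alpha>', \<beta>') \<circ>\<^sub>F farr C (\<alpha>, \<beta>) = farr C (Comp I \<alpha>' \<alpha>, Comp J \<beta>' \<beta>)"
  using farr_Comp[of "(\<alpha>, \<beta>)" "(\<alpha>', \<beta>')"] by simp

lemma transport_Ident_ftr:
  "\<lbrakk>i \<in> Obj I; j \<in> Obj J\<rbrakk> \<Longrightarrow> farr C (Ident I i, Ident J j) = id_ftr (fobj C (i, j))"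
  using farr_Ident[of "(i, j)"] by simp

lemma transport_ftr_simps:
  "\<lbrakk>\<alpha> \<in> Arr I; \<beta> \<in> Arr J\<rbrakk> \<Longrightarrow> fsrc (farr C (\<alpha>, \<beta>)) = fobj C (Dom I \<alpha>, Dom J \<beta>)"
  "\<lbrakk>\<alpha> \<in> Arr I; \<beta> \<in> Arr J\<rbrakk> \<Longrightarrow> ftgt (farr C (\<alpha>, \<beta>)) = fobj C (Cod I \<alpha>, Cod J \<beta>)"
  using functor_transport_pair[of \<alpha> \<beta>] is_functor.fsrc is_functor.ftgt by blast+

lemma diagram_slice_snd:
  assumes "j \<in> Obj J"
  shows "diagram I (at_snd j)"
  unfolding diagram_def
  by (rule is_functorI)
    (use assms in \<open>simp_all add: I.category_axioms category_CAT ftgt category_fibre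
      functor_transport_pair transport_ftr_simps transport_Ident_ftr transport_Comp_ftr\<close>)

lemma diagram_slice_fst:
  assumes "i \<in> Obj I"
  shows "diagram J (at_fst i)"
  unfolding diagram_def
  by (rule is_functorI)
    (use assms in \<open>simp_all add: J.category_axioms category_CAT ftgt category_fibre
      functor_transport_pair transport_ftr_simps transport_Ident_ftr transport_Comp_ftr\<close>)

lemma diagram_map_slice_snd:
  assumes "\<beta> \<in> Arr J"
  shows "diagram_map I (at_snd (Dom J \<beta>)) (at_snd (Cod J \<beta>)) (at_snd_map \<beta>)"
  unfolding diagram_map_def nat_transf_def nat_transf_axioms_def
  using assms diagram_slice_snd[of "Dom J \<beta>"] diagram_slice_snd[of "Cod J \<beta>"]
  by (simp add: diagram_def PiE_iff functor_transport_pair transport_ftr_simps transport_Comp_ftr)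

lemma diagram_map_slice_fst:
  assumes "\<alpha> \<in> Arr I"
  shows "diagram_map J (at_fst (Dom I \<alpha>)) (at_fst (Cod I \<alpha>)) (at_fst_map \<alpha>)"
  unfolding diagram_map_def nat_transf_def nat_transf_axioms_def
  using assms diagram_slice_fst[of "Dom I \<alpha>"] diagram_slice_fst[of "Cod I \<alpha>"]
  by (simp add: diagram_def PiE_iff functor_transport_pair transport_ftr_simps transport_Comp_ftr)

text \<open>
The section conditions of the slice \<open>C(-, j)\<close>, spelled out in terms of \<open>C\<close> itself. The arrows of \<open>I\<close> act
through \<open>C(\<alpha>, 1)\<close>.
\<close>

lemma row_dataD:
  assumes "j \<in> Obj J" "section_data (at_snd j) x \<rho>"
  shows "i \<in> Obj I \<Longrightarrow> x i \<in> Obj (fobj C (i, j))"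
    "\<lbrakk>\<alpha> \<in> Arr I; Cod I \<alpha> = i\<rbrakk> \<Longrightarrow> \<rho> \<alpha> \<in> Arr (fobj C (i, j))"
    "\<lbrakk>\<alpha> \<in> Arr I; Cod I \<alpha> = i\<rbrakk> \<Longrightarrow> Dom (fobj C (i, j)) (\<rho> \<alpha>) = fobj (farr C (\<alpha>, Ident J j)) (x (Dom I \<alpha>))"
    "\<lbrakk>\<alpha> \<in> Arr I; Cod I \<alpha> = i\<rbrakk> \<Longrightarrow> Cod (fobj C (i, j)) (\<rho> \<alpha>) = x i"
    "i \<in> Obj I \<Longrightarrow> \<rho> (Ident I i) = Ident (fobj C (i, j)) (x i)"
    "\<lbrakk>\<alpha> \<in> Arr I; \<alpha>' \<in> Arr I; Cod I \<alpha> = Dom I \<alpha>'\<rbrakk> \<Longrightarrow>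
      \<rho> (Comp I \<alpha>' \<alpha>) = Comp (fobj C (Cod I \<alpha>', j)) (\<rho> \<alpha>') (farr (farr C (\<alpha>', Ident J j)) (\<rho> \<alpha>))"
  using assms by (auto simp: section_data_def Let_def)

lemma row_smapD:
  assumes "j \<in> Obj J" "smap_data (at_snd j) x \<rho> x' \<rho>' m"
  shows "i \<in> Obj I \<Longrightarrow> m i \<in> Arr (fobj C (i, j))"
    "i \<in> Obj I \<Longrightarrow> Dom (fobj C (i, j)) (m i) = x i"
    "i \<in> Obj I \<Longrightarrow> Cod (fobj C (i, j)) (m i) = x' i"
    "\<alpha> \<in> Arr I \<Longrightarrow> Comp (fobj C (Cod I \<alpha>, j)) (m (Cod I \<alpha>)) (\<rho> \<alpha>) =
      Comp (fobj C (Cod I \<alpha>, j)) (\<rho>' \<alpha>) (farr (farr C (\<alpha>, Ident J j)) (m (Dom I \<alpha>)))"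
  using assms by (auto simp: smap_data_def Let_def)

text \<open>
On data, \<open>C(-, \<beta>)\<close> sends \<open>(x, \<rho>)\<close> to \<open>(C(1, \<beta>) x, C(1, \<beta>) \<rho>)\<close>. The functor laws in \<open>\<beta>\<close> are thus those of \<open>C\<close>,
applied in each fibre.
\<close>

lemma diagram_holim_fst: "diagram J (holim_fst I J C)"
  unfolding diagram_def
proof (rule is_functorI)
  fix j assume j: "j \<in> Obj J"
  interpret R: diagram I "at_snd j" using j by (rule diagram_slice_snd)
  show "fobj (holim_fst I J C) j \<in> Obj CAT"
    using j by (simp add: R.category_holim)
  interpret M: diagram_map I "at_snd j" "at_snd j" "at_snd_map (Ident J j)"
    using diagram_map_slice_snd[of "Ident J j"] j by simp
  have "holim_map (at_snd_map (Ident J j)) = id_ftr (holim (at_snd j))"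
  proof (rule functor_eqI[OF M.is_functor_holim_map is_functor_id_ftr[OF R.category_holim]])
    fix s assume s: "s \<in> Obj (holim (at_snd j))"
    then obtain x \<rho> where x: "section_data (at_snd j) x \<rho>" "s = mk_section (at_snd j) x \<rho>"
      by (rule R.holim_objE)
    show "fobj (holim_map (at_snd_map (Ident J j))) s = fobj (id_ftr (holim (at_snd j))) s"
      unfolding id_ftr_simps(3)[OF s] unfolding x(2) M.holim_map_mk_section[OF x(1)]
      by (rule R.mk_section_cong) (simp_all add: j row_dataD[OF j x(1)])
  next
    fix \<tau> assume t: "\<tau> \<in> Arr (holim (at_snd j))"
    then obtain x \<rho> x' \<rho>' m where x: "section_data (at_snd j) x \<rho>"
        "section_data (at_snd j) x' \<rho>'" "smap_data (at_snd j) x \<rho> x' \<rho>' m"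
        "\<tau> = mk_smap (at_snd j) (mk_section (at_snd j) x \<rho>) (mk_section (at_snd j) x' \<rho>') m"
      by (rule R.holim_arrE)
    show "farr (holim_map (at_snd_map (Ident J j))) \<tau> = farr (id_ftr (holim (at_snd j))) \<tau>"
      unfolding id_ftr_simps(4)[OF t] unfolding x(4) M.holim_map_mk_smap[OF x(1-3)]
        M.holim_map_mk_section[OF x(1)] M.holim_map_mk_section[OF x(2)]
      by (intro R.mk_smap_cong R.mk_section_cong)
        (simp_all add: j row_dataD[OF j x(1)] row_dataD[OF j x(2)] row_smapD[OF j x(3)])
  qed
  then show "farr (holim_fst I J C) (Ident J j) = Ident CAT (fobj (holim_fst I J C) j)"
    using j by simp
next
  fix \<beta> assume \<beta>: "\<beta> \<in> Arr J"
  interpret M: diagram_map I "at_snd (Dom J \<beta>)" "at_snd (Cod J \<beta>)" "at_snd_map \<beta>"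
    using \<beta> by (rule diagram_map_slice_snd)
  show "farr (holim_fst I J C) \<beta> \<in> Arr CAT"
    "Dom CAT (farr (holim_fst I J C) \<beta>) = fobj (holim_fst I J C) (Dom J \<beta>)"
    "Cod CAT (farr (holim_fst I J C) \<beta>) = fobj (holim_fst I J C) (Cod J \<beta>)"
    using \<beta> by (simp_all add: M.is_functor_holim_map)
  fix \<beta>' assume \<beta>': "\<beta>' \<in> Arr J" "Cod J \<beta> = Dom J \<beta>'"
  interpret M': diagram_map I "at_snd (Cod J \<beta>)" "at_snd (Cod J \<beta>')" "at_snd_map \<beta>'"
    using diagram_map_slice_snd[OF \<beta>'(1)] by (simp add: \<beta>'(2))
  interpret M'': diagram_map I "at_snd (Dom J \<beta>)" "at_snd (Cod J \<beta>')"
      "at_snd_map (Comp J \<beta>' \<beta>)"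
    using diagram_map_slice_snd[of "Comp J \<beta>' \<beta>"] \<beta> \<beta>' by simp
  have j: "Dom J \<beta> \<in> Obj J" "Cod J \<beta> \<in> Obj J" using \<beta> by auto
  have "holim_map (at_snd_map (Comp J \<beta>' \<beta>)) =
      holim_map (at_snd_map \<beta>') \<circ>\<^sub>F holim_map (at_snd_map \<beta>)"
  proof (rule functor_eqI[OF M''.is_functor_holim_map
        is_functor_comp_ftr[OF M.is_functor_holim_map M'.is_functor_holim_map]])
    fix s assume s: "s \<in> Obj (holim (at_snd (Dom J \<beta>)))"
    then obtain x \<rho> where x: "section_data (at_snd (Dom J \<beta>)) x \<rho>"
        "s = mk_section (at_snd (Dom J \<beta>)) x \<rho>"
      by (rule M.S.holim_objE)
    show "fobj (holim_map (at_snd_map (Comp J \<beta>' \<beta>))) s =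
        fobj (holim_map (at_snd_map \<beta>') \<circ>\<^sub>F holim_map (at_snd_map \<beta>)) s"
      unfolding comp_ftr_simps(3)[of s "holim_map (at_snd_map \<beta>)",
          unfolded M.holim_map_simps(1), OF s]
      unfolding x(2) M''.holim_map_mk_section[OF x(1)] M.holim_map_mk_section[OF x(1)]
        M'.holim_map_mk_section[OF M.section_data_map[OF x(1)]]
      by (rule M'.T.mk_section_cong) (use \<beta> \<beta>' in \<open>simp_all add: row_dataD[OF j(1) x(1)]\<close>)
  next
    fix \<tau> assume t: "\<tau> \<in> Arr (holim (at_snd (Dom J \<beta>)))"
    then obtain x \<rho> x' \<rho>' m where x: "section_data (at_snd (Dom J \<beta>)) x \<rho>"
        "section_data (at_snd (Dom J \<beta>)) x' \<rho>'" "smap_data (at_snd (Dom J \<beta>)) x \<rho> x' \<rho>' m"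
        "\<tau> = mk_smap (at_snd (Dom J \<beta>)) (mk_section (at_snd (Dom J \<beta>)) x \<rho>)
          (mk_section (at_snd (Dom J \<beta>)) x' \<rho>') m"
      by (rule M.S.holim_arrE)
    note x' = M.section_data_map[OF x(1)] M.section_data_map[OF x(2)] M.smap_data_map[OF x(1-3)]
    show "farr (holim_map (at_snd_map (Comp J \<beta>' \<beta>))) \<tau> =
        farr (holim_map (at_snd_map \<beta>') \<circ>\<^sub>F holim_map (at_snd_map \<beta>)) \<tau>"
      unfolding comp_ftr_simps(4)[of \<tau> "holim_map (at_snd_map \<beta>)",
          unfolded M.holim_map_simps(1), OF t]
      unfolding x(4) M''.holim_map_mk_smap[OF x(1-3)] M.holim_map_mk_smap[OF x(1-3)]
        M.holim_map_mk_section[OF x(1)] M.holim_map_mk_section[OF x(2)]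
        M''.holim_map_mk_section[OF x(1)] M''.holim_map_mk_section[OF x(2)]
        M'.holim_map_mk_smap[OF x'] M'.holim_map_mk_section[OF x'(1)] M'.holim_map_mk_section[OF x'(2)]
      by (intro M'.T.mk_smap_cong M'.T.mk_section_cong)
        (use \<beta> \<beta>' in \<open>simp_all add: row_dataD[OF j(1) x(1)] row_dataD[OF j(1) x(2)] row_smapD[OF j(1) x(3)]\<close>)
  qed
  then show "farr (holim_fst I J C) (Comp J \<beta>' \<beta>) =
      Comp CAT (farr (holim_fst I J C) \<beta>') (farr (holim_fst I J C) \<beta>)"
    using \<beta> \<beta>' by simp
qed (simp_all add: J.category_axioms category_CAT)

text \<open>
The value at \<open>i\<close> of the diagram \<open>hocolim_snd I J C\<close>, described in terms of \<open>C\<close>: an arrow is a map \<open>\<beta>\<close> of \<open>J\<close>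
together with a map \<open>\<mu>\<close> out of \<open>C(1, \<beta>) y\<close>.
\<close>

lemma column_simps [simp]:
  assumes "i \<in> Obj I"
  shows "(j, y) \<in> Obj (hocolim (at_fst i)) \<longleftrightarrow> j \<in> Obj J \<and> y \<in> Obj (fobj C (i, j))"
    "((j, y), (\<beta>, \<mu>), (j', y')) \<in> Arr (hocolim (at_fst i)) \<longleftrightarrow>
      \<beta> \<in> Arr J \<and> Dom J \<beta> = j \<and> Cod J \<beta> = j' \<and> y \<in> Obj (fobj C (i, j)) \<and> \<mu> \<in> Arr (fobj C (i, j')) \<and>
      Dom (fobj C (i, j')) \<mu> = fobj (farr C (Ident I i, \<beta>)) y \<and> Cod (fobj C (i, j')) \<mu> = y'"
    "Dom (hocolim (at_fst i)) (a, r, b) = a" "Cod (hocolim (at_fst i)) (a, r, b) = b"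
    "j \<in> Obj J \<Longrightarrow> Ident (hocolim (at_fst i)) (j, y) = ((j, y), (Ident J j, Ident (fobj C (i, j)) y), (j, y))"
    "\<beta> \<in> Arr J \<Longrightarrow> Comp (hocolim (at_fst i)) (b', (\<beta>, \<rho>), c) (a, (\<beta>', \<mu>), b) =
      (a, (Comp J \<beta> \<beta>', Comp (fobj C (i, Cod J \<beta>)) \<rho> (farr (farr C (Ident I i, \<beta>)) \<mu>)), c)"
  using diagram.hocolim_simps[OF diagram_slice_fst[OF assms]] J.Cod_in J.Dom_in by auto

lemma column_transport [simp]:
  assumes "\<alpha> \<in> Arr I"
  shows "\<lbrakk>j \<in> Obj J; y \<in> Obj (fobj C (Dom I \<alpha>, j))\<rbrakk> \<Longrightarrow>
      fobj (hocolim_map (at_fst_map \<alpha>)) (j, y) = (j, fobj (farr C (\<alpha>, Ident J j)) y)"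
    "((j, y), (\<beta>, \<mu>), (j', y')) \<in> Arr (hocolim (at_fst (Dom I \<alpha>))) \<Longrightarrow>
      farr (hocolim_map (at_fst_map \<alpha>)) ((j, y), (\<beta>, \<mu>), (j', y')) =
        ((j, fobj (farr C (\<alpha>, Ident J j)) y), (\<beta>, farr (farr C (\<alpha>, Ident J j')) \<mu>),
         (j', fobj (farr C (\<alpha>, Ident J j')) y'))"
proof -
  interpret M: diagram_map J "at_fst (Dom I \<alpha>)" "at_fst (Cod I \<alpha>)" "at_fst_map \<alpha>"
    using assms by (rule diagram_map_slice_fst)
  show "\<lbrakk>j \<in> Obj J; y \<in> Obj (fobj C (Dom I \<alpha>, j))\<rbrakk> \<Longrightarrow>
      fobj (hocolim_map (at_fst_map \<alpha>)) (j, y) = (j, fobj (farr C (\<alpha>, Ident J j)) y)"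
    by simp
  assume a: "((j, y), (\<beta>, \<mu>), (j', y')) \<in> Arr (hocolim (at_fst (Dom I \<alpha>)))"
  then have "j \<in> Obj J" "j' \<in> Obj J" using assms by auto
  then show "farr (hocolim_map (at_fst_map \<alpha>)) ((j, y), (\<beta>, \<mu>), (j', y')) =
        ((j, fobj (farr C (\<alpha>, Ident J j)) y), (\<beta>, farr (farr C (\<alpha>, Ident J j')) \<mu>),
         (j', fobj (farr C (\<alpha>, Ident J j')) y'))"
    by (simp only: M.hocolim_map_simps(4)[OF a] slice_ntr_simps)
qed

lemma diagram_hocolim_snd: "diagram I (hocolim_snd I J C)"
  unfolding diagram_def
proof (rule is_functorI)
  fix i assume i: "i \<in> Obj I"
  interpret R: diagram J "at_fst i" using i by (rule diagram_slice_fst)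
  show "fobj (hocolim_snd I J C) i \<in> Obj CAT"
    using i by (simp add: R.category_hocolim)
  interpret M: diagram_map J "at_fst i" "at_fst i" "at_fst_map (Ident I i)"
    using diagram_map_slice_fst[of "Ident I i"] i by simp
  have "hocolim_map (at_fst_map (Ident I i)) = id_ftr (hocolim (at_fst i))"
  proof (rule functor_eqI[OF M.is_functor_hocolim_map is_functor_id_ftr[OF R.category_hocolim]])
    fix a assume "a \<in> Obj (hocolim (at_fst i))"
    then show "fobj (hocolim_map (at_fst_map (Ident I i))) a = fobj (id_ftr (hocolim (at_fst i))) a"
      using i by (cases a) auto
  next
    fix h assume "h \<in> Arr (hocolim (at_fst i))"
    moreover obtain j y \<beta> \<mu> j' y' where "h = ((j, y), (\<beta>, \<mu>), (j', y'))" by (cases h) auto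
    ultimately show "farr (hocolim_map (at_fst_map (Ident I i))) h = farr (id_ftr (hocolim (at_fst i))) h"
      using i by (auto simp del: M.hocolim_map_simps)
  qed
  then show "farr (hocolim_snd I J C) (Ident I i) = Ident CAT (fobj (hocolim_snd I J C) i)"
    using i by simp
next
  fix \<alpha> assume \<alpha>: "\<alpha> \<in> Arr I"
  interpret M: diagram_map J "at_fst (Dom I \<alpha>)" "at_fst (Cod I \<alpha>)" "at_fst_map \<alpha>"
    using \<alpha> by (rule diagram_map_slice_fst)
  show "farr (hocolim_snd I J C) \<alpha> \<in> Arr CAT"
    "Dom CAT (farr (hocolim_snd I J C) \<alpha>) = fobj (hocolim_snd I J C) (Dom I \<alpha>)"
    "Cod CAT (farr (hocolim_snd I J C) \<alpha>) = fobj (hocolim_snd I J C) (Cod I \<alpha>)"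
    using \<alpha> by (simp_all add: M.is_functor_hocolim_map)
  fix \<alpha>' assume \<alpha>': "\<alpha>' \<in> Arr I" "Cod I \<alpha> = Dom I \<alpha>'"
  interpret M': diagram_map J "at_fst (Cod I \<alpha>)" "at_fst (Cod I \<alpha>')" "at_fst_map \<alpha>'"
    using diagram_map_slice_fst[OF \<alpha>'(1)] by (simp add: \<alpha>'(2))
  interpret M'': diagram_map J "at_fst (Dom I \<alpha>)" "at_fst (Cod I \<alpha>')"
      "at_fst_map (Comp I \<alpha>' \<alpha>)"
    using diagram_map_slice_fst[of "Comp I \<alpha>' \<alpha>"] \<alpha> \<alpha>' by simp
  have "hocolim_map (at_fst_map (Comp I \<alpha>' \<alpha>)) =
      hocolim_map (at_fst_map \<alpha>') \<circ>\<^sub>F hocolim_map (at_fst_map \<alpha>)"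
  proof (rule functor_eqI[OF M''.is_functor_hocolim_map
        is_functor_comp_ftr[OF M.is_functor_hocolim_map M'.is_functor_hocolim_map]])
    fix a assume "a \<in> Obj (hocolim (at_fst (Dom I \<alpha>)))"
    then show "fobj (hocolim_map (at_fst_map (Comp I \<alpha>' \<alpha>))) a =
        fobj (hocolim_map (at_fst_map \<alpha>') \<circ>\<^sub>F hocolim_map (at_fst_map \<alpha>)) a"
      using \<alpha> \<alpha>' by (cases a) auto
  next
    fix h assume "h \<in> Arr (hocolim (at_fst (Dom I \<alpha>)))"
    moreover obtain j y \<beta> \<mu> j' y' where "h = ((j, y), (\<beta>, \<mu>), (j', y'))" by (cases h) auto
    ultimately show "farr (hocolim_map (at_fst_map (Comp I \<alpha>' \<alpha>))) h =
        farr (hocolim_map (at_fst_map \<alpha>') \<circ>\<^sub>F hocolim_map (at_fst_map \<alpha>)) h"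
      using \<alpha> \<alpha>' by auto
  qed
  then show "farr (hocolim_snd I J C) (Comp I \<alpha>' \<alpha>) =
      Comp CAT (farr (hocolim_snd I J C) \<alpha>') (farr (hocolim_snd I J C) \<alpha>)"
    using \<alpha> \<alpha>' by simp
qed (simp_all add: I.category_axioms category_CAT)

end

section \<open>Sections with fixed and with moving second coordinate\<close>

text \<open>
The section of \<open>hocolim_snd I J C\<close> with coordinate \<open>(j, \<beta>)\<close> in \<open>J\<close> and components \<open>(y, \<mu>)\<close>. Its value on \<open>\<alpha>\<close>
is an arrow of the fibre over the codomain, where \<open>y\<close> has already been transported by \<open>C(\<alpha>, 1)\<close>; this explains the
first entry.
\<close>

definition moving_obj where
  "moving_obj I J C j y \<beta> \<mu> = mk_section (hocolim_snd I J C) (\<lambda>i. (j i, y i))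
    (\<lambda>\<alpha>. ((j (Dom I \<alpha>), fobj (farr C (\<alpha>, Ident J (j (Dom I \<alpha>)))) (y (Dom I \<alpha>))),
      (\<beta> \<alpha>, \<mu> \<alpha>), (j (Cod I \<alpha>), y (Cod I \<alpha>))))"

definition moving_arr where
  "moving_arr I J C T T' \<gamma> \<nu> = mk_smap (hocolim_snd I J C) T T'
    (\<lambda>i. (sec_val T i, (\<gamma> i, \<nu> i), sec_val T' i))"

text \<open>
The coordinate \<open>(j, \<beta>)\<close> is a functor from \<open>I\<close> to \<open>J\<close>, and \<open>(y, \<mu>)\<close> is a section of the diagram on \<open>I\<close> obtained
by pulling \<open>C\<close> back along \<open>(1, (j, \<beta>))\<close>.
\<close>

definition moving_data :: "('i, 'f) cat \<Rightarrow> ('j, 'g) cat \<Rightarrow> ('i \<times> 'j, 'f \<times> 'g, 'c, 'd) diagram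
    \<Rightarrow> ('i \<Rightarrow> 'j) \<Rightarrow> ('i \<Rightarrow> 'c) \<Rightarrow> ('f \<Rightarrow> 'g) \<Rightarrow> ('f \<Rightarrow> 'd) \<Rightarrow> bool" where
  "moving_data I J C j y \<beta> \<mu> \<longleftrightarrow>
    (\<forall>i\<in>Obj I. j i \<in> Obj J \<and> y i \<in> Obj (fobj C (i, j i)) \<and>
      \<beta> (Ident I i) = Ident J (j i) \<and> \<mu> (Ident I i) = Ident (fobj C (i, j i)) (y i)) \<and>
    (\<forall>\<alpha>\<in>Arr I. \<beta> \<alpha> \<in> Arr J \<and> Dom J (\<beta> \<alpha>) = j (Dom I \<alpha>) \<and> Cod J (\<beta> \<alpha>) = j (Cod I \<alpha>) \<and>
      \<mu> \<alpha> \<in> Arr (fobj C (Cod I \<alpha>, j (Cod I \<alpha>))) \<and>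
      Dom (fobj C (Cod I \<alpha>, j (Cod I \<alpha>))) (\<mu> \<alpha>) = fobj (farr C (\<alpha>, \<beta> \<alpha>)) (y (Dom I \<alpha>)) \<and>
      Cod (fobj C (Cod I \<alpha>, j (Cod I \<alpha>))) (\<mu> \<alpha>) = y (Cod I \<alpha>)) \<and>
    (\<forall>\<alpha>\<in>Arr I. \<forall>\<alpha>'\<in>Arr I. Cod I \<alpha> = Dom I \<alpha>' \<longrightarrow>
      \<beta> (Comp I \<alpha>' \<alpha>) = Comp J (\<beta> \<alpha>') (\<beta> \<alpha>) \<and>
      \<mu> (Comp I \<alpha>' \<alpha>) =
        Comp (fobj C (Cod I \<alpha>', j (Cod I \<alpha>'))) (\<mu> \<alpha>') (farr (farr C (\<alpha>', \<beta> \<alpha>')) (\<mu> \<alpha>)))"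

text \<open>
A map of such sections is a natural transformation \<open>\<gamma>\<close> of the coordinates together with maps \<open>\<nu> i\<close> out of
\<open>C(1, \<gamma> i) (y i)\<close>. The last equation compares two maps out of
\<open>C(\<alpha>, \<gamma> i' \<circ> \<beta> \<alpha>) (y i) = C(\<alpha>, \<beta>' \<alpha> \<circ> \<gamma> i) (y i)\<close>.
\<close>

definition moving_map_data :: "('i, 'f) cat \<Rightarrow> ('j, 'g) cat \<Rightarrow> ('i \<times> 'j, 'f \<times> 'g, 'c, 'd) diagram
    \<Rightarrow> ('i \<Rightarrow> 'j) \<Rightarrow> ('i \<Rightarrow> 'c) \<Rightarrow> ('f \<Rightarrow> 'g) \<Rightarrow> ('f \<Rightarrow> 'd)
    \<Rightarrow> ('i \<Rightarrow> 'j) \<Rightarrow> ('i \<Rightarrow> 'c) \<Rightarrow> ('f \<Rightarrow> 'g) \<Rightarrow> ('f \<Rightarrow> 'd) \<Rightarrow> ('i \<Rightarrow> 'g) \<Rightarrow> ('i \<Rightarrow> 'd) \<Rightarrow> bool" where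
  "moving_map_data I J C j y \<beta> \<mu> j' y' \<beta>' \<mu>' \<gamma> \<nu> \<longleftrightarrow>
    (\<forall>i\<in>Obj I. \<gamma> i \<in> Arr J \<and> Dom J (\<gamma> i) = j i \<and> Cod J (\<gamma> i) = j' i \<and>
      \<nu> i \<in> Arr (fobj C (i, j' i)) \<and>
      Dom (fobj C (i, j' i)) (\<nu> i) = fobj (farr C (Ident I i, \<gamma> i)) (y i) \<and>
      Cod (fobj C (i, j' i)) (\<nu> i) = y' i) \<and>
    (\<forall>\<alpha>\<in>Arr I. Comp J (\<gamma> (Cod I \<alpha>)) (\<beta> \<alpha>) = Comp J (\<beta>' \<alpha>) (\<gamma> (Dom I \<alpha>)) \<and>
      Comp (fobj C (Cod I \<alpha>, j' (Cod I \<alpha>))) (\<nu> (Cod I \<alpha>))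
          (farr (farr C (Ident I (Cod I \<alpha>), \<gamma> (Cod I \<alpha>))) (\<mu> \<alpha>)) =
        Comp (fobj C (Cod I \<alpha>, j' (Cod I \<alpha>))) (\<mu>' \<alpha>) (farr (farr C (\<alpha>, \<beta>' \<alpha>)) (\<nu> (Dom I \<alpha>))))"

definition fixed_obj where
  "fixed_obj I J C j x \<rho> = (j, mk_section (slice_snd I J C j) x \<rho>)"

text \<open>
The second component of an arrow over \<open>\<beta>\<close> is a map of sections out of the section that has been transported along
\<open>\<beta>\<close>. It is written out here, so that an arrow is determined by its end points, \<open>\<beta>\<close> and \<open>m\<close>.
\<close>

definition fixed_arr where
  "fixed_arr I J C a b \<beta> m = (a, (\<beta>, mk_smap (slice_snd I J C (fst b))
    (mk_section (slice_snd I J C (fst b)) (\<lambda>i. fobj (farr C (Ident I i, \<beta>)) (sec_val (snd a) i))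
      (\<lambda>\<alpha>. farr (farr C (Ident I (Cod I \<alpha>), \<beta>)) (sec_mor (snd a) \<alpha>))) (snd b) m), b)"

definition fixed_data :: "('i, 'f) cat \<Rightarrow> ('j, 'g) cat \<Rightarrow> ('i \<times> 'j, 'f \<times> 'g, 'c, 'd) diagram
    \<Rightarrow> 'j \<Rightarrow> ('i \<Rightarrow> 'c) \<Rightarrow> ('f \<Rightarrow> 'd) \<Rightarrow> bool" where
  "fixed_data I J C j x \<rho> \<longleftrightarrow> j \<in> Obj J \<and>
    (\<forall>i\<in>Obj I. x i \<in> Obj (fobj C (i, j)) \<and> \<rho> (Ident I i) = Ident (fobj C (i, j)) (x i)) \<and>
    (\<forall>\<alpha>\<in>Arr I. \<rho> \<alpha> \<in> Arr (fobj C (Cod I \<alpha>, j)) \<and>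
      Dom (fobj C (Cod I \<alpha>, j)) (\<rho> \<alpha>) = fobj (farr C (\<alpha>, Ident J j)) (x (Dom I \<alpha>)) \<and>
      Cod (fobj C (Cod I \<alpha>, j)) (\<rho> \<alpha>) = x (Cod I \<alpha>)) \<and>
    (\<forall>\<alpha>\<in>Arr I. \<forall>\<alpha>'\<in>Arr I. Cod I \<alpha> = Dom I \<alpha>' \<longrightarrow>
      \<rho> (Comp I \<alpha>' \<alpha>) = Comp (fobj C (Cod I \<alpha>', j)) (\<rho> \<alpha>') (farr (farr C (\<alpha>', Ident J j)) (\<rho> \<alpha>)))"

definition fixed_map_data :: "('i, 'f) cat \<Rightarrow> ('j, 'g) cat \<Rightarrow> ('i \<times> 'j, 'f \<times> 'g, 'c, 'd) diagram
    \<Rightarrow> 'j \<Rightarrow> ('i \<Rightarrow> 'c) \<Rightarrow> ('f \<Rightarrow> 'd) \<Rightarrow> 'j \<Rightarrow> ('i \<Rightarrow> 'c) \<Rightarrow> ('f \<Rightarrow> 'd) \<Rightarrow> 'g \<Rightarrow> ('i \<Rightarrow> 'd) \<Rightarrow> bool" where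
  "fixed_map_data I J C j x \<rho> j' x' \<rho>' \<beta> m \<longleftrightarrow> \<beta> \<in> Arr J \<and> Dom J \<beta> = j \<and> Cod J \<beta> = j' \<and>
    (\<forall>i\<in>Obj I. m i \<in> Arr (fobj C (i, j')) \<and>
      Dom (fobj C (i, j')) (m i) = fobj (farr C (Ident I i, \<beta>)) (x i) \<and> Cod (fobj C (i, j')) (m i) = x' i) \<and>
    (\<forall>\<alpha>\<in>Arr I. Comp (fobj C (Cod I \<alpha>, j')) (m (Cod I \<alpha>)) (farr (farr C (Ident I (Cod I \<alpha>), \<beta>)) (\<rho> \<alpha>)) =
      Comp (fobj C (Cod I \<alpha>, j')) (\<rho>' \<alpha>) (farr (farr C (\<alpha>, Ident J j')) (m (Dom I \<alpha>))))"

text \<open>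
For a section \<open>T\<close> of \<open>hocolim_snd I J C\<close> and a map \<open>\<tau>\<close> of such sections, these read off the coordinate in \<open>J\<close> and the
component in the fibre, on objects and on arrows.
\<close>

abbreviation pos where "pos T i \<equiv> fst (sec_val T i)"
abbreviation val where "val T i \<equiv> snd (sec_val T i)"
abbreviation pos_arr where "pos_arr T \<alpha> \<equiv> fst (fst (snd (sec_mor T \<alpha>)))"
abbreviation val_arr where "val_arr T \<alpha> \<equiv> snd (fst (snd (sec_mor T \<alpha>)))"
abbreviation pos_map where "pos_map \<tau> i \<equiv> fst (fst (snd (smap_val \<tau> i)))"
abbreviation val_map where "val_map \<tau> i \<equiv> snd (fst (snd (smap_val \<tau> i)))"

context bidiagram
begin

sublocale LH: diagram I "hocolim_snd I J C" by (rule diagram_hocolim_snd)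
sublocale HL: diagram J "holim_fst I J C" by (rule diagram_holim_fst)

lemma moving_dataD:
  assumes "moving_data I J C j y \<beta> \<mu>"
  shows "i \<in> Obj I \<Longrightarrow> j i \<in> Obj J" "i \<in> Obj I \<Longrightarrow> y i \<in> Obj (fobj C (i, j i))"
    "i \<in> Obj I \<Longrightarrow> \<beta> (Ident I i) = Ident J (j i)"
    "i \<in> Obj I \<Longrightarrow> \<mu> (Ident I i) = Ident (fobj C (i, j i)) (y i)"
    "\<alpha> \<in> Arr I \<Longrightarrow> \<beta> \<alpha> \<in> Arr J" "\<alpha> \<in> Arr I \<Longrightarrow> Dom J (\<beta> \<alpha>) = j (Dom I \<alpha>)"
    "\<alpha> \<in> Arr I \<Longrightarrow> Cod J (\<beta> \<alpha>) = j (Cod I \<alpha>)"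
    "\<lbrakk>\<alpha> \<in> Arr I; Cod I \<alpha> = i\<rbrakk> \<Longrightarrow> \<mu> \<alpha> \<in> Arr (fobj C (i, j i))"
    "\<lbrakk>\<alpha> \<in> Arr I; Cod I \<alpha> = i\<rbrakk> \<Longrightarrow> Dom (fobj C (i, j i)) (\<mu> \<alpha>) = fobj (farr C (\<alpha>, \<beta> \<alpha>)) (y (Dom I \<alpha>))"
    "\<lbrakk>\<alpha> \<in> Arr I; Cod I \<alpha> = i\<rbrakk> \<Longrightarrow> Cod (fobj C (i, j i)) (\<mu> \<alpha>) = y i"
    "\<lbrakk>\<alpha> \<in> Arr I; \<alpha>' \<in> Arr I; Cod I \<alpha> = Dom I \<alpha>'\<rbrakk> \<Longrightarrow> \<beta> (Comp I \<alpha>' \<alpha>) = Comp J (\<beta> \<alpha>') (\<beta> \<alpha>)"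
    "\<lbrakk>\<alpha> \<in> Arr I; \<alpha>' \<in> Arr I; Cod I \<alpha> = Dom I \<alpha>'\<rbrakk> \<Longrightarrow> \<mu> (Comp I \<alpha>' \<alpha>) =
        Comp (fobj C (Cod I \<alpha>', j (Cod I \<alpha>'))) (\<mu> \<alpha>') (farr (farr C (\<alpha>', \<beta> \<alpha>')) (\<mu> \<alpha>))"
  using assms by (auto simp: moving_data_def)

lemma moving_map_dataD:
  assumes "moving_map_data I J C j y \<beta> \<mu> j' y' \<beta>' \<mu>' \<gamma> \<nu>"
  shows "i \<in> Obj I \<Longrightarrow> \<gamma> i \<in> Arr J" "i \<in> Obj I \<Longrightarrow> Dom J (\<gamma> i) = j i" "i \<in> Obj I \<Longrightarrow> Cod J (\<gamma> i) = j' i"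
    "i \<in> Obj I \<Longrightarrow> \<nu> i \<in> Arr (fobj C (i, j' i))"
    "i \<in> Obj I \<Longrightarrow> Dom (fobj C (i, j' i)) (\<nu> i) = fobj (farr C (Ident I i, \<gamma> i)) (y i)"
    "i \<in> Obj I \<Longrightarrow> Cod (fobj C (i, j' i)) (\<nu> i) = y' i"
    "\<lbrakk>\<alpha> \<in> Arr I; Cod I \<alpha> = i\<rbrakk> \<Longrightarrow> Comp J (\<gamma> i) (\<beta> \<alpha>) = Comp J (\<beta>' \<alpha>) (\<gamma> (Dom I \<alpha>))"
    "\<lbrakk>\<alpha> \<in> Arr I; Cod I \<alpha> = i\<rbrakk> \<Longrightarrow> Comp (fobj C (i, j' i)) (\<nu> i) (farr (farr C (Ident I i, \<gamma> i)) (\<mu> \<alpha>)) =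
        Comp (fobj C (i, j' i)) (\<mu>' \<alpha>) (farr (farr C (\<alpha>, \<beta>' \<alpha>)) (\<nu> (Dom I \<alpha>)))"
  using assms by (auto simp: moving_map_data_def)

text \<open>
An arrow of \<open>hocolim\<^sub>J C(i', -)\<close> from \<open>(j i, C(\<alpha>, 1) (y i))\<close> to \<open>(j i', y i')\<close> is a map \<open>\<beta> \<alpha>\<close> with a map out of
\<open>C(1, \<beta> \<alpha>) (C(\<alpha>, 1) (y i))\<close>. Since this object is \<open>C(\<alpha>, \<beta> \<alpha>) (y i)\<close>, the section laws turn into those of
\<open>moving_data\<close>.
\<close>

lemma moving_section_data_iff:
  "section_data (hocolim_snd I J C) (\<lambda>i. (j i, y i))
    (\<lambda>\<alpha>. ((j (Dom I \<alpha>), fobj (farr C (\<alpha>, Ident J (j (Dom I \<alpha>)))) (y (Dom I \<alpha>))),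
      (\<beta> \<alpha>, \<mu> \<alpha>), (j (Cod I \<alpha>), y (Cod I \<alpha>)))) \<longleftrightarrow> moving_data I J C j y \<beta> \<mu>" (is "?L \<longleftrightarrow> ?R")
proof
  assume R: ?R
  show ?L
    by (rule LH.section_dataI) (simp_all add: moving_dataD[OF R])
next
  assume L: ?L
  note s = LH.section_dataD[OF this]
  have obj: "j i \<in> Obj J" "y i \<in> Obj (fobj C (i, j i))" if "i \<in> Obj I" for i
    using s(1)[OF that] that by simp_all
  have arr: "\<beta> \<alpha> \<in> Arr J" "Dom J (\<beta> \<alpha>) = j (Dom I \<alpha>)" "Cod J (\<beta> \<alpha>) = j (Cod I \<alpha>)"
    "\<mu> \<alpha> \<in> Arr (fobj C (Cod I \<alpha>, j (Cod I \<alpha>)))"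
    "Dom (fobj C (Cod I \<alpha>, j (Cod I \<alpha>))) (\<mu> \<alpha>) = fobj (farr C (\<alpha>, \<beta> \<alpha>)) (y (Dom I \<alpha>))"
    "Cod (fobj C (Cod I \<alpha>, j (Cod I \<alpha>))) (\<mu> \<alpha>) = y (Cod I \<alpha>)" if "\<alpha> \<in> Arr I" for \<alpha>
    using s(2)[OF that refl] that by (auto simp: obj)
  show ?R
    unfolding moving_data_def
  proof (intro conjI ballI impI)
    fix i assume "i \<in> Obj I"
    then show "\<beta> (Ident I i) = Ident J (j i)" "\<mu> (Ident I i) = Ident (fobj C (i, j i)) (y i)"
      using s(5)[of i] by (simp_all add: obj)
  next
    fix \<alpha> \<alpha>' assume \<alpha>: "\<alpha> \<in> Arr I" "\<alpha>' \<in> Arr I" "Cod I \<alpha> = Dom I \<alpha>'"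
    then show "\<beta> (Comp I \<alpha>' \<alpha>) = Comp J (\<beta> \<alpha>') (\<beta> \<alpha>)"
      "\<mu> (Comp I \<alpha>' \<alpha>) =
        Comp (fobj C (Cod I \<alpha>', j (Cod I \<alpha>'))) (\<mu> \<alpha>') (farr (farr C (\<alpha>', \<beta> \<alpha>')) (\<mu> \<alpha>))"
      using s(6)[OF \<alpha>] arr[OF \<alpha>(1)] arr[OF \<alpha>(2)] by (simp_all add: obj)
  qed (use obj arr in simp_all)
qed

lemma moving_obj_simps [simp]:
  "i \<in> Obj I \<Longrightarrow> sec_val (moving_obj I J C j y \<beta> \<mu>) i = (j i, y i)"
  "\<alpha> \<in> Arr I \<Longrightarrow> sec_mor (moving_obj I J C j y \<beta> \<mu>) \<alpha> =
    ((j (Dom I \<alpha>), fobj (farr C (\<alpha>, Ident J (j (Dom I \<alpha>)))) (y (Dom I \<alpha>))),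
      (\<beta> \<alpha>, \<mu> \<alpha>), (j (Cod I \<alpha>), y (Cod I \<alpha>)))"
  by (simp_all add: moving_obj_def)

lemma moving_arr_simps [simp]:
  "nsrc (moving_arr I J C T T' \<gamma> \<nu>) = T" "ntgt (moving_arr I J C T T' \<gamma> \<nu>) = T'"
  "i \<in> Obj I \<Longrightarrow> smap_val (moving_arr I J C T T' \<gamma> \<nu>) i = (sec_val T i, (\<gamma> i, \<nu> i), sec_val T' i)"
  by (simp_all add: moving_arr_def)

lemma moving_obj_cong:
  assumes "\<And>i. i \<in> Obj I \<Longrightarrow> j i = j' i" "\<And>i. i \<in> Obj I \<Longrightarrow> y i = y' i"
    "\<And>\<alpha>. \<alpha> \<in> Arr I \<Longrightarrow> \<beta> \<alpha> = \<beta>' \<alpha>" "\<And>\<alpha>. \<alpha> \<in> Arr I \<Longrightarrow> \<mu> \<alpha> = \<mu>' \<alpha>"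
  shows "moving_obj I J C j y \<beta> \<mu> = moving_obj I J C j' y' \<beta>' \<mu>'"
  unfolding moving_obj_def by (rule LH.mk_section_cong) (simp_all add: assms)

lemma moving_arr_cong:
  assumes "\<And>i. i \<in> Obj I \<Longrightarrow> \<gamma> i = \<gamma>' i" "\<And>i. i \<in> Obj I \<Longrightarrow> \<nu> i = \<nu>' i" "T = U" "T' = U'"
  shows "moving_arr I J C T T' \<gamma> \<nu> = moving_arr I J C U U' \<gamma>' \<nu>'"
  unfolding moving_arr_def by (rule LH.mk_smap_cong) (simp_all add: assms)

lemma moving_obj_in: "moving_data I J C j y \<beta> \<mu> \<Longrightarrow> moving_obj I J C j y \<beta> \<mu> \<in> Obj LH"
  unfolding moving_obj_def by (rule LH.mk_section_in_holim) (simp add: moving_section_data_iff)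

lemma moving_objE:
  assumes "T \<in> Obj LH"
  obtains j y \<beta> \<mu> where "moving_data I J C j y \<beta> \<mu>" "T = moving_obj I J C j y \<beta> \<mu>"
proof -
  obtain x \<rho> where x: "section_data (hocolim_snd I J C) x \<rho>" "T = mk_section (hocolim_snd I J C) x \<rho>"
    using assms by (rule LH.holim_objE)
  note s = LH.section_dataD[OF x(1)]
  define j where "j = fst \<circ> x"
  define y where "y = snd \<circ> x"
  define \<beta> where "\<beta> \<alpha> = fst (fst (snd (\<rho> \<alpha>)))" for \<alpha>
  define \<mu> where "\<mu> \<alpha> = snd (fst (snd (\<rho> \<alpha>)))" for \<alpha>
  have xi: "x i = (j i, y i)" for i by (simp add: j_def y_def)
  have obj: "j i \<in> Obj J" "y i \<in> Obj (fobj C (i, j i))" if "i \<in> Obj I" for i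
    using s(1)[OF that] that by (simp_all add: xi)
  have \<rho>\<alpha>: "\<rho> \<alpha> = ((j (Dom I \<alpha>), fobj (farr C (\<alpha>, Ident J (j (Dom I \<alpha>)))) (y (Dom I \<alpha>))),
      (\<beta> \<alpha>, \<mu> \<alpha>), (j (Cod I \<alpha>), y (Cod I \<alpha>)))" if "\<alpha> \<in> Arr I" for \<alpha>
    using s(3,4)[OF that refl] that
    by (cases "\<rho> \<alpha>") (auto simp: \<beta>_def \<mu>_def xi obj)
  have T: "T = moving_obj I J C j y \<beta> \<mu>"
    unfolding x(2) moving_obj_def by (rule LH.mk_section_cong) (simp_all add: xi \<rho>\<alpha>)
  have "section_data (hocolim_snd I J C) (\<lambda>i. (j i, y i))
    (\<lambda>\<alpha>. ((j (Dom I \<alpha>), fobj (farr C (\<alpha>, Ident J (j (Dom I \<alpha>)))) (y (Dom I \<alpha>))),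
      (\<beta> \<alpha>, \<mu> \<alpha>), (j (Cod I \<alpha>), y (Cod I \<alpha>))))"
    using x(1) by (simp add: section_data_def Let_def xi \<rho>\<alpha> cong: conj_cong)
  then show ?thesis using T that by (simp add: moving_section_data_iff)
qed

lemma moving_smap_data_iff:
  assumes "moving_data I J C j y \<beta> \<mu>" "moving_data I J C j' y' \<beta>' \<mu>'"
  shows "smap_data (hocolim_snd I J C) (\<lambda>i. (j i, y i))
    (\<lambda>\<alpha>. ((j (Dom I \<alpha>), fobj (farr C (\<alpha>, Ident J (j (Dom I \<alpha>)))) (y (Dom I \<alpha>))),
      (\<beta> \<alpha>, \<mu> \<alpha>), (j (Cod I \<alpha>), y (Cod I \<alpha>))))
    (\<lambda>i. (j' i, y' i))
    (\<lambda>\<alpha>. ((j' (Dom I \<alpha>), fobj (farr C (\<alpha>, Ident J (j' (Dom I \<alpha>)))) (y' (Dom I \<alpha>))),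
      (\<beta>' \<alpha>, \<mu>' \<alpha>), (j' (Cod I \<alpha>), y' (Cod I \<alpha>))))
    (\<lambda>i. ((j i, y i), (\<gamma> i, \<nu> i), (j' i, y' i))) \<longleftrightarrow>
    moving_map_data I J C j y \<beta> \<mu> j' y' \<beta>' \<mu>' \<gamma> \<nu>" (is "?L \<longleftrightarrow> ?R")
proof
  note d = moving_dataD[OF assms(1)] moving_dataD[OF assms(2)]
  {
    assume R: ?R
    note m = moving_map_dataD[OF this]
    show ?L
      by (rule LH.smap_dataI) (simp_all add: d m)
  next
    assume L: ?L
    note s = LH.smap_dataD[OF this]
    have obj: "\<gamma> i \<in> Arr J" "Dom J (\<gamma> i) = j i" "Cod J (\<gamma> i) = j' i"
      "\<nu> i \<in> Arr (fobj C (i, j' i))"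
      "Dom (fobj C (i, j' i)) (\<nu> i) = fobj (farr C (Ident I i, \<gamma> i)) (y i)"
      "Cod (fobj C (i, j' i)) (\<nu> i) = y' i" if "i \<in> Obj I" for i
      using s(1)[OF that] that by simp_all
    show ?R
      unfolding moving_map_data_def
    proof (intro conjI ballI)
      fix \<alpha> assume \<alpha>: "\<alpha> \<in> Arr I"
      show "Comp J (\<gamma> (Cod I \<alpha>)) (\<beta> \<alpha>) = Comp J (\<beta>' \<alpha>) (\<gamma> (Dom I \<alpha>))"
        "Comp (fobj C (Cod I \<alpha>, j' (Cod I \<alpha>))) (\<nu> (Cod I \<alpha>))
          (farr (farr C (Ident I (Cod I \<alpha>), \<gamma> (Cod I \<alpha>))) (\<mu> \<alpha>)) =
        Comp (fobj C (Cod I \<alpha>, j' (Cod I \<alpha>))) (\<mu>' \<alpha>) (farr (farr C (\<alpha>, \<beta>' \<alpha>)) (\<nu> (Dom I \<alpha>)))"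
        using s(4)[OF \<alpha>] \<alpha> by (simp_all add: d obj)
    qed (use obj in simp_all)
  }
qed

lemma moving_arr_in:
  assumes "moving_data I J C j y \<beta> \<mu>" "moving_data I J C j' y' \<beta>' \<mu>'"
    "moving_map_data I J C j y \<beta> \<mu> j' y' \<beta>' \<mu>' \<gamma> \<nu>"
  shows "moving_arr I J C (moving_obj I J C j y \<beta> \<mu>) (moving_obj I J C j' y' \<beta>' \<mu>') \<gamma> \<nu>
    \<in> Arr LH"
proof -
  have "moving_arr I J C (moving_obj I J C j y \<beta> \<mu>) (moving_obj I J C j' y' \<beta>' \<mu>') \<gamma> \<nu> =
    mk_smap (hocolim_snd I J C) (moving_obj I J C j y \<beta> \<mu>) (moving_obj I J C j' y' \<beta>' \<mu>')
      (\<lambda>i. ((j i, y i), (\<gamma> i, \<nu> i), (j' i, y' i)))"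
    unfolding moving_arr_def by (rule LH.mk_smap_cong) simp_all
  also have "\<dots> \<in> Arr LH"
    unfolding moving_obj_def
    by (rule LH.mk_smap_in_holim)
      (use assms in \<open>simp_all add: moving_section_data_iff moving_smap_data_iff[OF assms(1,2)]\<close>)
  finally show ?thesis .
qed

lemma moving_arr_exhaust:
  assumes \<tau>: "\<tau> \<in> Arr LH"
    and s: "moving_data I J C j y \<beta> \<mu>" "nsrc \<tau> = moving_obj I J C j y \<beta> \<mu>"
    and s': "moving_data I J C j' y' \<beta>' \<mu>'" "ntgt \<tau> = moving_obj I J C j' y' \<beta>' \<mu>'"
  obtains \<gamma> \<nu> where "moving_map_data I J C j y \<beta> \<mu> j' y' \<beta>' \<mu>' \<gamma> \<nu>"
    "\<tau> = moving_arr I J C (moving_obj I J C j y \<beta> \<mu>) (moving_obj I J C j' y' \<beta>' \<mu>') \<gamma> \<nu>"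
proof -
  note e = LH.holim_arr_eq_mk_smap[OF \<tau> moving_section_data_iff[THEN iffD2, OF s(1)]
      s(2)[unfolded moving_obj_def] moving_section_data_iff[THEN iffD2, OF s'(1)] s'(2)[unfolded moving_obj_def]]
  define \<gamma> where "\<gamma> = pos_map \<tau>"
  define \<nu> where "\<nu> = val_map \<tau>"
  note m = LH.smap_dataD[OF e(1)]
  have val: "smap_val \<tau> i = ((j i, y i), (\<gamma> i, \<nu> i), (j' i, y' i))" if "i \<in> Obj I" for i
    using m(2,3)[OF that] that by (cases "smap_val \<tau> i") (auto simp: \<gamma>_def \<nu>_def)
  show ?thesis
  proof (rule that)
    show "moving_map_data I J C j y \<beta> \<mu> j' y' \<beta>' \<mu>' \<gamma> \<nu>"
      unfolding moving_smap_data_iff[OF s(1) s'(1), symmetric]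
      using e(1) by (simp add: smap_data_def Let_def val cong: conj_cong)
    show "\<tau> = moving_arr I J C (moving_obj I J C j y \<beta> \<mu>) (moving_obj I J C j' y' \<beta>' \<mu>') \<gamma> \<nu>"
      by (subst e(2)) (auto simp: moving_arr_def moving_obj_def[symmetric] val intro!: LH.mk_smap_cong)
  qed
qed

lemma moving_arrE:
  assumes \<tau>: "\<tau> \<in> Arr LH"
  obtains j y \<beta> \<mu> j' y' \<beta>' \<mu>' \<gamma> \<nu> where "moving_data I J C j y \<beta> \<mu>" "moving_data I J C j' y' \<beta>' \<mu>'"
    "moving_map_data I J C j y \<beta> \<mu> j' y' \<beta>' \<mu>' \<gamma> \<nu>"
    "\<tau> = moving_arr I J C (moving_obj I J C j y \<beta> \<mu>) (moving_obj I J C j' y' \<beta>' \<mu>') \<gamma> \<nu>"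
proof -
  obtain j y \<beta> \<mu> where s: "moving_data I J C j y \<beta> \<mu>" "nsrc \<tau> = moving_obj I J C j y \<beta> \<mu>"
    using category.Dom_in[OF LH.category_holim \<tau>] unfolding LH.holim_simps(3) by (rule moving_objE)
  obtain j' y' \<beta>' \<mu>' where s': "moving_data I J C j' y' \<beta>' \<mu>'" "ntgt \<tau> = moving_obj I J C j' y' \<beta>' \<mu>'"
    using category.Cod_in[OF LH.category_holim \<tau>] unfolding LH.holim_simps(4) by (rule moving_objE)
  show ?thesis
    using moving_arr_exhaust[OF \<tau> s s'] that s(1) s'(1) by metis
qed

lemma moving_arr_eq:
  "moving_arr I J C (moving_obj I J C j y \<beta> \<mu>) (moving_obj I J C j' y' \<beta>' \<mu>') \<gamma> \<nu> =
    mk_smap (hocolim_snd I J C) (moving_obj I J C j y \<beta> \<mu>) (moving_obj I J C j' y' \<beta>' \<mu>')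
      (\<lambda>i. ((j i, y i), (\<gamma> i, \<nu> i), (j' i, y' i)))"
  unfolding moving_arr_def by (rule LH.mk_smap_cong) simp_all

lemma moving_Ident:
  assumes "moving_data I J C j y \<beta> \<mu>"
  shows "Ident LH (moving_obj I J C j y \<beta> \<mu>) =
    moving_arr I J C (moving_obj I J C j y \<beta> \<mu>) (moving_obj I J C j y \<beta> \<mu>)
      (\<lambda>i. Ident J (j i)) (\<lambda>i. Ident (fobj C (i, j i)) (y i))"
  unfolding moving_arr_def
  by (subst moving_obj_def, subst LH.holim_Ident, fold moving_obj_def)
    (rule LH.mk_smap_cong; simp add: moving_dataD[OF assms])

lemma moving_Comp:
  assumes d: "moving_data I J C j y \<beta> \<mu>" "moving_data I J C j' y' \<beta>' \<mu>'" "moving_data I J C j'' y'' \<beta>'' \<mu>''"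
    and m: "moving_map_data I J C j y \<beta> \<mu> j' y' \<beta>' \<mu>' \<gamma> \<nu>"
      "moving_map_data I J C j' y' \<beta>' \<mu>' j'' y'' \<beta>'' \<mu>'' \<gamma>' \<nu>'"
  shows "Comp LH
      (moving_arr I J C (moving_obj I J C j' y' \<beta>' \<mu>') (moving_obj I J C j'' y'' \<beta>'' \<mu>'') \<gamma>' \<nu>')
      (moving_arr I J C (moving_obj I J C j y \<beta> \<mu>) (moving_obj I J C j' y' \<beta>' \<mu>') \<gamma> \<nu>) =
    moving_arr I J C (moving_obj I J C j y \<beta> \<mu>) (moving_obj I J C j'' y'' \<beta>'' \<mu>'')
      (\<lambda>i. Comp J (\<gamma>' i) (\<gamma> i))
      (\<lambda>i. Comp (fobj C (i, j'' i)) (\<nu>' i) (farr (farr C (Ident I i, \<gamma>' i)) (\<nu> i)))"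
  unfolding moving_arr_eq unfolding moving_obj_def
  by (subst LH.holim_Comp)
    (simp_all add: moving_section_data_iff moving_smap_data_iff d m,
     rule LH.mk_smap_cong, simp_all add: moving_map_dataD[OF m(1)] moving_map_dataD[OF m(2)])

lemma fixed_data_iff: "fixed_data I J C j x \<rho> \<longleftrightarrow> j \<in> Obj J \<and> section_data (at_snd j) x \<rho>"
  by (auto simp: fixed_data_def section_data_def Let_def)

lemma fixed_map_data_iff:
  "fixed_map_data I J C j x \<rho> j' x' \<rho>' \<beta> m \<longleftrightarrow> \<beta> \<in> Arr J \<and> Dom J \<beta> = j \<and> Cod J \<beta> = j' \<and>
    smap_data (at_snd j') (\<lambda>i. fobj (farr C (Ident I i, \<beta>)) (x i))
      (\<lambda>\<alpha>. farr (farr C (Ident I (Cod I \<alpha>), \<beta>)) (\<rho> \<alpha>)) x' \<rho>' m"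
  by (auto simp: fixed_map_data_def smap_data_def Let_def)

lemma fixed_dataD:
  assumes "fixed_data I J C j x \<rho>"
  shows "j \<in> Obj J" "i \<in> Obj I \<Longrightarrow> x i \<in> Obj (fobj C (i, j))"
    "\<lbrakk>\<alpha> \<in> Arr I; Cod I \<alpha> = i\<rbrakk> \<Longrightarrow> \<rho> \<alpha> \<in> Arr (fobj C (i, j))"
    "\<lbrakk>\<alpha> \<in> Arr I; Cod I \<alpha> = i\<rbrakk> \<Longrightarrow> Dom (fobj C (i, j)) (\<rho> \<alpha>) = fobj (farr C (\<alpha>, Ident J j)) (x (Dom I \<alpha>))"
    "\<lbrakk>\<alpha> \<in> Arr I; Cod I \<alpha> = i\<rbrakk> \<Longrightarrow> Cod (fobj C (i, j)) (\<rho> \<alpha>) = x i"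
    "i \<in> Obj I \<Longrightarrow> \<rho> (Ident I i) = Ident (fobj C (i, j)) (x i)"
    "\<lbrakk>\<alpha> \<in> Arr I; \<alpha>' \<in> Arr I; Cod I \<alpha> = Dom I \<alpha>'\<rbrakk> \<Longrightarrow>
      \<rho> (Comp I \<alpha>' \<alpha>) = Comp (fobj C (Cod I \<alpha>', j)) (\<rho> \<alpha>') (farr (farr C (\<alpha>', Ident J j)) (\<rho> \<alpha>))"
  using assms by (auto simp: fixed_data_def)

lemma fixed_map_dataD:
  assumes "fixed_map_data I J C j x \<rho> j' x' \<rho>' \<beta> m"
  shows "\<beta> \<in> Arr J" "Dom J \<beta> = j" "Cod J \<beta> = j'" "i \<in> Obj I \<Longrightarrow> m i \<in> Arr (fobj C (i, j'))"
    "i \<in> Obj I \<Longrightarrow> Dom (fobj C (i, j')) (m i) = fobj (farr C (Ident I i, \<beta>)) (x i)"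
    "i \<in> Obj I \<Longrightarrow> Cod (fobj C (i, j')) (m i) = x' i"
    "\<lbrakk>\<alpha> \<in> Arr I; Cod I \<alpha> = i\<rbrakk> \<Longrightarrow> Comp (fobj C (i, j')) (m i) (farr (farr C (Ident I i, \<beta>)) (\<rho> \<alpha>)) =
      Comp (fobj C (i, j')) (\<rho>' \<alpha>) (farr (farr C (\<alpha>, Ident J j')) (m (Dom I \<alpha>)))"
  using assms by (auto simp: fixed_map_data_def)

lemma fixed_obj_in:
  assumes "fixed_data I J C j x \<rho>"
  shows "fixed_obj I J C j x \<rho> \<in> Obj HL"
proof -
  have j: "j \<in> Obj J" and s: "section_data (at_snd j) x \<rho>"
    using assms by (simp_all add: fixed_data_iff)
  show ?thesis
    using j diagram.mk_section_in_holim[OF diagram_slice_snd[OF j] s] by (simp add: fixed_obj_def)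
qed

lemma fixed_objE:
  assumes "a \<in> Obj HL"
  obtains j x \<rho> where "fixed_data I J C j x \<rho>" "a = fixed_obj I J C j x \<rho>"
proof -
  obtain j s where a: "a = (j, s)" "j \<in> Obj J" "s \<in> Obj (holim (at_snd j))"
    using assms by (cases a) auto
  obtain x \<rho> where "section_data (at_snd j) x \<rho>" "s = mk_section (at_snd j) x \<rho>"
    using diagram.holim_objE[OF diagram_slice_snd[OF a(2)] a(3)] .
  then show ?thesis using a that by (simp add: fixed_data_iff fixed_obj_def)
qed

lemma fixed_obj_simps [simp]:
  "fst (fixed_obj I J C j x \<rho>) = j"
  "\<lbrakk>j \<in> Obj J; i \<in> Obj I\<rbrakk> \<Longrightarrow> sec_val (snd (fixed_obj I J C j x \<rho>)) i = x i"
  "\<lbrakk>j \<in> Obj J; \<alpha> \<in> Arr I\<rbrakk> \<Longrightarrow> sec_mor (snd (fixed_obj I J C j x \<rho>)) \<alpha> = \<rho> \<alpha>"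
  by (simp_all add: fixed_obj_def diagram.mk_section_simps[OF diagram_slice_snd])

lemma fixed_obj_cong:
  assumes "j \<in> Obj J" "\<And>i. i \<in> Obj I \<Longrightarrow> x i = x' i" "\<And>\<alpha>. \<alpha> \<in> Arr I \<Longrightarrow> \<rho> \<alpha> = \<rho>' \<alpha>"
  shows "fixed_obj I J C j x \<rho> = fixed_obj I J C j x' \<rho>'"
  unfolding fixed_obj_def
  using diagram.mk_section_cong[OF diagram_slice_snd[OF assms(1)] assms(2,3)] by simp

lemma fixed_arr_simps [simp]:
  "Dom HL (fixed_arr I J C a b \<beta> m) = a"
  "Cod HL (fixed_arr I J C a b \<beta> m) = b"
  "fst (fixed_arr I J C a b \<beta> m) = a" "snd (snd (fixed_arr I J C a b \<beta> m)) = b"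
  "fst (fst (snd (fixed_arr I J C a b \<beta> m))) = \<beta>"
  "\<lbrakk>fst b \<in> Obj J; i \<in> Obj I\<rbrakk> \<Longrightarrow> smap_val (snd (fst (snd (fixed_arr I J C a b \<beta> m)))) i = m i"
  by (simp_all add: fixed_arr_def diagram.mk_smap_simps[OF diagram_slice_snd])

lemma fixed_arr_cong:
  assumes "fst b \<in> Obj J" "\<And>i. i \<in> Obj I \<Longrightarrow> m i = m' i" "\<beta> = \<beta>'" "a = a'" "b = b'"
  shows "fixed_arr I J C a b \<beta> m = fixed_arr I J C a' b' \<beta>' m'"
  using diagram.mk_smap_cong[OF diagram_slice_snd[OF assms(1)] assms(2) refl refl]
  unfolding fixed_arr_def assms(3-5)[symmetric] by simp

text \<open>
Transport along \<open>\<beta>\<close>, on data. The cocycle identity is preserved because \<open>C(1, \<beta>)\<close> commutes with \<open>C(\<alpha>, 1)\<close>.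
\<close>

lemma fixed_transport:
  assumes "fixed_data I J C j x \<rho>" "\<beta> \<in> Arr J" "Dom J \<beta> = j" "Cod J \<beta> = j'"
  shows "fixed_data I J C j' (\<lambda>i. fobj (farr C (Ident I i, \<beta>)) (x i))
      (\<lambda>\<alpha>. farr (farr C (Ident I (Cod I \<alpha>), \<beta>)) (\<rho> \<alpha>))"
    and "fobj (holim_map (at_snd_map \<beta>)) (mk_section (at_snd j) x \<rho>) =
      mk_section (at_snd j') (\<lambda>i. fobj (farr C (Ident I i, \<beta>)) (x i))
      (\<lambda>\<alpha>. farr (farr C (Ident I (Cod I \<alpha>), \<beta>)) (\<rho> \<alpha>))"
proof -
  show d: "fixed_data I J C j' (\<lambda>i. fobj (farr C (Ident I i, \<beta>)) (x i))
      (\<lambda>\<alpha>. farr (farr C (Ident I (Cod I \<alpha>), \<beta>)) (\<rho> \<alpha>))"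
    unfolding fixed_data_def
    using assms(2-4) fixed_dataD[OF assms(1)] by auto
  have j: "j \<in> Obj J" "j' \<in> Obj J" and s: "section_data (at_snd j) x \<rho>"
    using assms by (auto simp: fixed_data_iff)
  show "fobj (holim_map (at_snd_map \<beta>)) (mk_section (at_snd j) x \<rho>) =
      mk_section (at_snd j') (\<lambda>i. fobj (farr C (Ident I i, \<beta>)) (x i))
      (\<lambda>\<alpha>. farr (farr C (Ident I (Cod I \<alpha>), \<beta>)) (\<rho> \<alpha>))"
  proof (rule trans)
    show "fobj (holim_map (at_snd_map \<beta>)) (mk_section (at_snd j) x \<rho>) =
        mk_section (at_snd j') (\<lambda>i. fobj (ncomp (at_snd_map \<beta>) i) (x i))
          (\<lambda>\<alpha>. farr (ncomp (at_snd_map \<beta>) (Cod I \<alpha>)) (\<rho> \<alpha>))"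
      using diagram.fobj_holim_map[OF diagram_slice_snd[OF j(1)] _ _ s, of "at_snd_map \<beta>"]
      by (simp add: assms(3,4))
  qed (rule diagram.mk_section_cong[OF diagram_slice_snd[OF j(2)]]; simp)
qed

lemma fixed_arr_eq:
  assumes "fixed_data I J C j x \<rho>" "\<beta> \<in> Arr J" "Dom J \<beta> = j" "Cod J \<beta> = j'"
  shows "fixed_arr I J C (fixed_obj I J C j x \<rho>) (fixed_obj I J C j' x' \<rho>') \<beta> m =
    ((j, mk_section (at_snd j) x \<rho>), (\<beta>, mk_smap (at_snd j')
      (fobj (holim_map (at_snd_map \<beta>)) (mk_section (at_snd j) x \<rho>))
      (mk_section (at_snd j') x' \<rho>') m), (j', mk_section (at_snd j') x' \<rho>'))"
proof -
  have j: "j \<in> Obj J" "j' \<in> Obj J" using assms by (auto simp: fixed_data_def)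
  have "mk_section (at_snd j')
      (\<lambda>i. fobj (farr C (Ident I i, \<beta>)) (sec_val (snd (fixed_obj I J C j x \<rho>)) i))
      (\<lambda>\<alpha>. farr (farr C (Ident I (Cod I \<alpha>), \<beta>)) (sec_mor (snd (fixed_obj I J C j x \<rho>)) \<alpha>)) =
    fobj (holim_map (at_snd_map \<beta>)) (mk_section (at_snd j) x \<rho>)"
    unfolding fixed_transport(2)[OF assms]
    by (rule diagram.mk_section_cong[OF diagram_slice_snd[OF j(2)]]) (simp_all add: j)
  then show ?thesis by (simp add: fixed_arr_def) (simp add: fixed_obj_def)
qed

lemma fixed_arr_in:
  assumes "fixed_data I J C j x \<rho>" "fixed_data I J C j' x' \<rho>'" "fixed_map_data I J C j x \<rho> j' x' \<rho>' \<beta> m"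
  shows "fixed_arr I J C (fixed_obj I J C j x \<rho>) (fixed_obj I J C j' x' \<rho>') \<beta> m \<in> Arr HL"
proof -
  note \<beta> = fixed_map_dataD(1-3)[OF assms(3)]
  have j: "j \<in> Obj J" "j' \<in> Obj J" using assms by (auto simp: fixed_data_def)
  note tr = fixed_transport[OF assms(1) \<beta>]
  have m: "mk_smap (at_snd j')
      (fobj (holim_map (at_snd_map \<beta>)) (mk_section (at_snd j) x \<rho>))
      (mk_section (at_snd j') x' \<rho>') m \<in> Arr (holim (at_snd j'))"
    unfolding tr(2)
    by (rule diagram.mk_smap_in_holim[OF diagram_slice_snd[OF j(2)]])
      (use tr(1) assms in \<open>simp_all add: fixed_data_iff fixed_map_data_iff\<close>)
  have x: "mk_section (at_snd j) x \<rho> \<in> Obj (holim (at_snd j))"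
    by (rule diagram.mk_section_in_holim[OF diagram_slice_snd[OF j(1)]])
      (use assms(1) in \<open>simp add: fixed_data_iff\<close>)
  show ?thesis
    unfolding fixed_arr_eq[OF assms(1) \<beta>]
    using j \<beta> m x
    by (simp add: diagram.holim_simps(3,4)[OF diagram_slice_snd[OF j(2)]]
        diagram.mk_smap_simps[OF diagram_slice_snd[OF j(2)]])
qed

lemma fixed_arr_exhaust:
  assumes h: "h \<in> Arr HL"
    and s: "fixed_data I J C j x \<rho>" "Dom HL h = fixed_obj I J C j x \<rho>"
    and s': "fixed_data I J C j' x' \<rho>'" "Cod HL h = fixed_obj I J C j' x' \<rho>'"
  obtains \<beta> m where "fixed_map_data I J C j x \<rho> j' x' \<rho>' \<beta> m"
    "h = fixed_arr I J C (fixed_obj I J C j x \<rho>) (fixed_obj I J C j' x' \<rho>') \<beta> m"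
proof -
  have j: "j \<in> Obj J" "j' \<in> Obj J" using s s' by (auto simp: fixed_data_def)
  note R = diagram_slice_snd[OF j(2)]
  \<comment> \<open>The source of the second component is the transport of the source along \<open>\<beta>\<close>.\<close>
  obtain \<beta> \<sigma> where h': "h = (fixed_obj I J C j x \<rho>, (\<beta>, \<sigma>), fixed_obj I J C j' x' \<rho>')"
    using s(2) s'(2) by (cases h) auto
  have \<beta>: "\<beta> \<in> Arr J" "Dom J \<beta> = j" "Cod J \<beta> = j'" and \<sigma>: "\<sigma> \<in> Arr (holim (at_snd j'))"
    "nsrc \<sigma> = fobj (holim_map (at_snd_map \<beta>)) (mk_section (at_snd j) x \<rho>)"
    "ntgt \<sigma> = mk_section (at_snd j') x' \<rho>'"
    using h j by (auto simp: h' fixed_obj_def diagram.holim_simps(3,4)[OF R])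
  note tr = fixed_transport[OF s(1) \<beta>]
  have s2: "section_data (at_snd j') (\<lambda>i. fobj (farr C (Ident I i, \<beta>)) (x i))
      (\<lambda>\<alpha>. farr (farr C (Ident I (Cod I \<alpha>), \<beta>)) (\<rho> \<alpha>))" "section_data (at_snd j') x' \<rho>'"
    using tr(1) s'(1) by (simp_all add: fixed_data_iff)
  note e = diagram.holim_arr_eq_mk_smap[OF R \<sigma>(1) s2(1) \<sigma>(2)[unfolded tr(2)] s2(2) \<sigma>(3)]
  show ?thesis
  proof (rule that)
    show "fixed_map_data I J C j x \<rho> j' x' \<rho>' \<beta> (smap_val \<sigma>)"
      using e(1) \<beta> by (simp add: fixed_map_data_iff)
    show "h = fixed_arr I J C (fixed_obj I J C j x \<rho>) (fixed_obj I J C j' x' \<rho>') \<beta> (smap_val \<sigma>)"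
      unfolding fixed_arr_eq[OF s(1) \<beta>] unfolding h' tr(2) e(2)[symmetric] by (simp add: fixed_obj_def)
  qed
qed

lemma fixed_arrE:
  assumes h: "h \<in> Arr HL"
  obtains j x \<rho> j' x' \<rho>' \<beta> m where "fixed_data I J C j x \<rho>" "fixed_data I J C j' x' \<rho>'"
    "fixed_map_data I J C j x \<rho> j' x' \<rho>' \<beta> m"
    "h = fixed_arr I J C (fixed_obj I J C j x \<rho>) (fixed_obj I J C j' x' \<rho>') \<beta> m"
proof -
  obtain j x \<rho> where s: "fixed_data I J C j x \<rho>" "Dom HL h = fixed_obj I J C j x \<rho>"
    using category.Dom_in[OF HL.category_hocolim h] by (rule fixed_objE)
  obtain j' x' \<rho>' where s': "fixed_data I J C j' x' \<rho>'" "Cod HL h = fixed_obj I J C j' x' \<rho>'"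
    using category.Cod_in[OF HL.category_hocolim h] by (rule fixed_objE)
  show ?thesis
    using fixed_arr_exhaust[OF h s s'] that s(1) s'(1) by metis
qed

lemma fixed_Ident:
  assumes "fixed_data I J C j x \<rho>"
  shows "Ident HL (fixed_obj I J C j x \<rho>) =
    fixed_arr I J C (fixed_obj I J C j x \<rho>) (fixed_obj I J C j x \<rho>) (Ident J j) (\<lambda>i. Ident (fobj C (i, j)) (x i))"
proof -
  have j: "j \<in> Obj J" using assms by (simp add: fixed_data_def)
  note R = diagram_slice_snd[OF j]
  have "fobj (holim_map (at_snd_map (Ident J j))) (mk_section (at_snd j) x \<rho>) =
      mk_section (at_snd j) x \<rho>"
    using assms j by (subst fixed_transport(2)[OF assms])
      (auto intro!: diagram.mk_section_cong[OF R] simp: fixed_dataD[OF assms])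
  then show ?thesis
    unfolding fixed_arr_eq[OF assms J.Ident_in[OF j] J.Dom_Ident[OF j] J.Cod_Ident[OF j]]
    unfolding fixed_obj_def HL.hocolim_simps(5) iterated_simps(3)[OF j] diagram.holim_Ident[OF R] prod.inject
    by (intro conjI refl diagram.mk_smap_cong[OF R]) (simp_all add: j)
qed

lemma fixed_Comp:
  assumes d: "fixed_data I J C j x \<rho>" "fixed_data I J C j' x' \<rho>'" "fixed_data I J C j'' x'' \<rho>''"
    and m: "fixed_map_data I J C j x \<rho> j' x' \<rho>' \<beta> m" "fixed_map_data I J C j' x' \<rho>' j'' x'' \<rho>'' \<beta>' m'"
  shows "Comp HL
      (fixed_arr I J C (fixed_obj I J C j' x' \<rho>') (fixed_obj I J C j'' x'' \<rho>'') \<beta>' m')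
      (fixed_arr I J C (fixed_obj I J C j x \<rho>) (fixed_obj I J C j' x' \<rho>') \<beta> m) =
    fixed_arr I J C (fixed_obj I J C j x \<rho>) (fixed_obj I J C j'' x'' \<rho>'') (Comp J \<beta>' \<beta>)
      (\<lambda>i. Comp (fobj C (i, j'')) (m' i) (farr (farr C (Ident I i, \<beta>')) (m i)))"
proof -
  note \<beta> = fixed_map_dataD(1-3)[OF m(1)] and \<beta>' = fixed_map_dataD(1-3)[OF m(2)]
  have j: "j \<in> Obj J" "j' \<in> Obj J" "j'' \<in> Obj J" using d by (auto simp: fixed_data_def)
  have \<beta>\<beta>: "Comp J \<beta>' \<beta> \<in> Arr J" "Dom J (Comp J \<beta>' \<beta>) = j" "Cod J (Comp J \<beta>' \<beta>) = j''"
    using \<beta> \<beta>' by simp_all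
  interpret M: diagram_map I "at_snd j'" "at_snd j''" "at_snd_map \<beta>'"
    using diagram_map_slice_snd[OF \<beta>'(1)] by (simp add: \<beta>')
  note tr = fixed_transport[OF d(1) \<beta>]
  have s: "section_data (at_snd j') (\<lambda>i. fobj (farr C (Ident I i, \<beta>)) (x i))
      (\<lambda>\<alpha>. farr (farr C (Ident I (Cod I \<alpha>), \<beta>)) (\<rho> \<alpha>))"
    "section_data (at_snd j') x' \<rho>'"
    "smap_data (at_snd j') (\<lambda>i. fobj (farr C (Ident I i, \<beta>)) (x i))
      (\<lambda>\<alpha>. farr (farr C (Ident I (Cod I \<alpha>), \<beta>)) (\<rho> \<alpha>)) x' \<rho>' m"
    using tr(1) d(2) m(1) by (simp_all add: fixed_data_iff fixed_map_data_iff)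
  note sT = M.section_data_map[OF s(1)] M.section_data_map[OF s(2)] M.smap_data_map[OF s]
  show ?thesis
    unfolding fixed_arr_eq[OF d(1) \<beta>] fixed_arr_eq[OF d(2) \<beta>'] fixed_arr_eq[OF d(1) \<beta>\<beta>]
      HL.hocolim_simps(6) tr(2) fixed_transport(2)[OF d(1) \<beta>\<beta>]
    unfolding iterated_simps(3)[OF j(3)] iterated_simps(4)[OF \<beta>'(1)] \<beta>'(3)
      M.holim_map_mk_smap[OF s] M.holim_map_mk_section[OF s(1)] M.holim_map_mk_section[OF s(2)]
      M.T.holim_Comp[OF sT] prod.inject
    by (intro conjI refl M.T.mk_smap_cong M.T.mk_section_cong)
      (use \<beta> \<beta>' in \<open>simp_all add: fixed_dataD[OF d(1)] fixed_map_dataD[OF m(1)] fixed_map_dataD[OF m(2)]\<close>)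
qed

end

section \<open>The comparison functor and its retraction\<close>

text \<open>
A fixed coordinate is a constant moving one, with identities for the maps between its values.
\<close>

definition comparison_obj where
  "comparison_obj I J C a =
    moving_obj I J C (\<lambda>_. fst a) (sec_val (snd a)) (\<lambda>_. Ident J (fst a)) (sec_mor (snd a))"

definition comparison_arr where
  "comparison_arr I J C h = moving_arr I J C (comparison_obj I J C (fst h)) (comparison_obj I J C (snd (snd h)))
    (\<lambda>_. fst (fst (snd h))) (smap_val (snd (fst (snd h))))"

definition comparison where
  "comparison I J C = \<lparr>fsrc = hocolim_holim I J C, ftgt = holim_hocolim I J C,
    fobj = (\<lambda>a\<in>Obj (hocolim_holim I J C). comparison_obj I J C a),
    farr = (\<lambda>h\<in>Arr (hocolim_holim I J C). comparison_arr I J C h)\<rparr>"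

text \<open>
Everything is pushed to the coordinate over \<open>e\<close>. The component at \<open>i\<close> is pushed along the value of the section on
\<open>\<epsilon> i : i \<rightarrow> e\<close>, and a map over \<open>\<alpha>\<close> along the value that belongs to the codomain of \<open>\<alpha>\<close>.
\<close>

definition retraction_obj where
  "retraction_obj I e \<epsilon> J C T = fixed_obj I J C (pos T e)
    (\<lambda>i. fobj (farr C (Ident I i, pos_arr T (ncomp \<epsilon> i))) (val T i))
    (\<lambda>\<alpha>. farr (farr C (Ident I (Cod I \<alpha>), pos_arr T (ncomp \<epsilon> (Cod I \<alpha>)))) (val_arr T \<alpha>))"

definition retraction_arr where
  "retraction_arr I e \<epsilon> J C \<tau> = fixed_arr I J C (retraction_obj I e \<epsilon> J C (nsrc \<tau>))
    (retraction_obj I e \<epsilon> J C (ntgt \<tau>)) (pos_map \<tau> e)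
    (\<lambda>i. farr (farr C (Ident I i, pos_arr (ntgt \<tau>) (ncomp \<epsilon> i))) (val_map \<tau> i))"

definition final_retraction where
  "final_retraction I e \<epsilon> J C = \<lparr>fsrc = holim_hocolim I J C, ftgt = hocolim_holim I J C,
    fobj = (\<lambda>T\<in>Obj (holim_hocolim I J C). retraction_obj I e \<epsilon> J C T),
    farr = (\<lambda>\<tau>\<in>Arr (holim_hocolim I J C). retraction_arr I e \<epsilon> J C \<tau>)\<rparr>"

context bidiagram
begin

abbreviation "iota \<equiv> comparison I J C"

lemma comparison_simps [simp]:
  "fsrc iota = HL" "ftgt iota = LH"
  "fobj iota \<in> extensional (Obj HL)"
  "farr iota \<in> extensional (Arr HL)"
  by (simp_all add: comparison_def)

lemma comparison_fixed_obj:
  assumes "fixed_data I J C j x \<rho>"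
  shows "comparison_obj I J C (fixed_obj I J C j x \<rho>) = moving_obj I J C (\<lambda>_. j) x (\<lambda>_. Ident J j) \<rho>"
    and "fobj iota (fixed_obj I J C j x \<rho>) = moving_obj I J C (\<lambda>_. j) x (\<lambda>_. Ident J j) \<rho>"
proof -
  show "comparison_obj I J C (fixed_obj I J C j x \<rho>) = moving_obj I J C (\<lambda>_. j) x (\<lambda>_. Ident J j) \<rho>"
    unfolding comparison_obj_def
    by (rule moving_obj_cong) (simp_all add: fixed_dataD(1)[OF assms])
  then show "fobj iota (fixed_obj I J C j x \<rho>) = moving_obj I J C (\<lambda>_. j) x (\<lambda>_. Ident J j) \<rho>"
    using fixed_obj_in[OF assms] by (simp add: comparison_def)
qed

lemma comparison_fixed_arr:
  assumes "fixed_data I J C j x \<rho>" "fixed_data I J C j' x' \<rho>'" "fixed_map_data I J C j x \<rho> j' x' \<rho>' \<beta> m"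
  shows "farr iota (fixed_arr I J C (fixed_obj I J C j x \<rho>) (fixed_obj I J C j' x' \<rho>') \<beta> m) =
    moving_arr I J C (moving_obj I J C (\<lambda>_. j) x (\<lambda>_. Ident J j) \<rho>)
      (moving_obj I J C (\<lambda>_. j') x' (\<lambda>_. Ident J j') \<rho>') (\<lambda>_. \<beta>) m"
proof -
  let ?h = "fixed_arr I J C (fixed_obj I J C j x \<rho>) (fixed_obj I J C j' x' \<rho>') \<beta> m"
  have "farr iota ?h = comparison_arr I J C ?h"
    using fixed_arr_in[OF assms] by (simp add: comparison_def)
  also have "\<dots> = moving_arr I J C (moving_obj I J C (\<lambda>_. j) x (\<lambda>_. Ident J j) \<rho>)
      (moving_obj I J C (\<lambda>_. j') x' (\<lambda>_. Ident J j') \<rho>') (\<lambda>_. \<beta>) m"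
    unfolding comparison_arr_def
    by (rule moving_arr_cong)
      (simp_all add: comparison_fixed_obj(1)[OF assms(1)] comparison_fixed_obj(1)[OF assms(2)]
        fixed_dataD(1)[OF assms(2)])
  finally show ?thesis .
qed

lemma moving_data_of_fixed:
  assumes "fixed_data I J C j x \<rho>"
  shows "moving_data I J C (\<lambda>_. j) x (\<lambda>_. Ident J j) \<rho>"
  unfolding moving_data_def by (auto simp: fixed_dataD[OF assms])

lemma moving_map_data_of_fixed:
  assumes "fixed_data I J C j x \<rho>" "fixed_data I J C j' x' \<rho>'" "fixed_map_data I J C j x \<rho> j' x' \<rho>' \<beta> m"
  shows "moving_map_data I J C (\<lambda>_. j) x (\<lambda>_. Ident J j) \<rho> (\<lambda>_. j') x' (\<lambda>_. Ident J j') \<rho>' (\<lambda>_. \<beta>) m"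
  unfolding moving_map_data_def
  by (auto simp: fixed_dataD[OF assms(1)] fixed_dataD[OF assms(2)] fixed_map_dataD[OF assms(3)])

lemma is_functor_comparison: "is_functor HL LH iota"
proof (rule is_functorI)
  fix a assume "a \<in> Obj HL"
  then obtain j x \<rho> where a: "fixed_data I J C j x \<rho>" "a = fixed_obj I J C j x \<rho>"
    by (rule fixed_objE)
  note md = moving_data_of_fixed[OF a(1)]
  show "fobj iota a \<in> Obj LH"
    unfolding a(2) comparison_fixed_obj(2)[OF a(1)] by (rule moving_obj_in[OF md])
  have "fixed_map_data I J C j x \<rho> j x \<rho> (Ident J j) (\<lambda>i. Ident (fobj C (i, j)) (x i))"
    unfolding fixed_map_data_def by (auto simp: fixed_dataD[OF a(1)])
  then show "farr iota (Ident HL a) =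
      Ident LH (fobj iota a)"
    unfolding a(2) fixed_Ident[OF a(1)] comparison_fixed_obj(2)[OF a(1)] moving_Ident[OF md]
    by (rule comparison_fixed_arr[OF a(1,1)])
next
  fix f assume f: "f \<in> Arr HL"
  obtain j x \<rho> where a: "fixed_data I J C j x \<rho>" "Dom HL f = fixed_obj I J C j x \<rho>"
    using category.Dom_in[OF HL.category_hocolim f] by (rule fixed_objE)
  obtain j' x' \<rho>' where b: "fixed_data I J C j' x' \<rho>'" "Cod HL f = fixed_obj I J C j' x' \<rho>'"
    using category.Cod_in[OF HL.category_hocolim f] by (rule fixed_objE)
  obtain \<beta> m where m: "fixed_map_data I J C j x \<rho> j' x' \<rho>' \<beta> m"
    "f = fixed_arr I J C (fixed_obj I J C j x \<rho>) (fixed_obj I J C j' x' \<rho>') \<beta> m"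
    using f a b by (rule fixed_arr_exhaust)
  note md = moving_data_of_fixed[OF a(1)] moving_data_of_fixed[OF b(1)]
    moving_map_data_of_fixed[OF a(1) b(1) m(1)]
  show "farr iota f \<in> Arr LH"
    unfolding m(2) comparison_fixed_arr[OF a(1) b(1) m(1)] using md by (rule moving_arr_in)
  show "Dom LH (farr iota f) =
      fobj iota (Dom HL f)"
    "Cod LH (farr iota f) =
      fobj iota (Cod HL f)"
    unfolding m(2) comparison_fixed_arr[OF a(1) b(1) m(1)]
    by (simp_all add: comparison_fixed_obj[OF a(1)] comparison_fixed_obj[OF b(1)])
  fix g assume g: "g \<in> Arr HL" and
    fg: "Cod HL f = Dom HL g"
  obtain j'' x'' \<rho>'' where c: "fixed_data I J C j'' x'' \<rho>''" "Cod HL g = fixed_obj I J C j'' x'' \<rho>''"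
    using category.Cod_in[OF HL.category_hocolim g] by (rule fixed_objE)
  obtain \<beta>' m' where m': "fixed_map_data I J C j' x' \<rho>' j'' x'' \<rho>'' \<beta>' m'"
    "g = fixed_arr I J C (fixed_obj I J C j' x' \<rho>') (fixed_obj I J C j'' x'' \<rho>'') \<beta>' m'"
    using g b(1) fg[symmetric, unfolded b(2)] c by (rule fixed_arr_exhaust)
  note md' = moving_data_of_fixed[OF c(1)] moving_map_data_of_fixed[OF b(1) c(1) m'(1)]
  let ?gf = "fixed_arr I J C (fixed_obj I J C j x \<rho>) (fixed_obj I J C j'' x'' \<rho>'') (Comp J \<beta>' \<beta>)
      (\<lambda>i. Comp (fobj C (i, j'')) (m' i) (farr (farr C (Ident I i, \<beta>')) (m i)))"
  have gf: "Comp HL g f = ?gf"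
    unfolding m(2) m'(2) by (rule fixed_Comp[OF a(1) b(1) c(1) m(1) m'(1)])
  have "?gf \<in> Arr HL"
    unfolding gf[symmetric] using f g fg by (rule category.Comp_in[OF HL.category_hocolim])
  then have "farr iota ?gf = comparison_arr I J C ?gf"
    by (simp add: comparison_def)
  also have "\<dots> = moving_arr I J C (moving_obj I J C (\<lambda>_. j) x (\<lambda>_. Ident J j) \<rho>)
      (moving_obj I J C (\<lambda>_. j'') x'' (\<lambda>_. Ident J j'') \<rho>'') (\<lambda>_. Comp J \<beta>' \<beta>)
      (\<lambda>i. Comp (fobj C (i, j'')) (m' i) (farr (farr C (Ident I i, \<beta>')) (m i)))"
    unfolding comparison_arr_def
    by (rule moving_arr_cong)
      (simp_all add: comparison_fixed_obj(1)[OF a(1)] comparison_fixed_obj(1)[OF c(1)]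
        fixed_dataD(1)[OF c(1)])
  also have "\<dots> = Comp LH (farr iota g) (farr iota f)"
    unfolding m(2) m'(2) comparison_fixed_arr[OF a(1) b(1) m(1)] comparison_fixed_arr[OF b(1) c(1) m'(1)]
    by (rule moving_Comp[OF md(1,2) md'(1) md(3) md'(2), symmetric])
  finally show "farr iota (Comp HL g f) =
      Comp LH (farr iota g) (farr iota f)"
    unfolding gf .
qed (simp_all add: HL.category_hocolim LH.category_holim)

text \<open>
The component at \<open>i\<close> of the image of an arrow contains both its map in \<open>J\<close> and its map in the fibre over \<open>i\<close>. The
former is the same for every \<open>i\<close>, and one object of \<open>I\<close> suffices to recover it.
\<close>

lemma faithful_comparison:
  assumes "Obj I \<noteq> {}"
  shows "faithful iota"
  unfolding faithful_def comparison_simps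
proof (intro ballI impI, elim conjE)
  fix f g
  assume f: "f \<in> Arr HL" and g: "g \<in> Arr HL"
    and par: "Dom HL f = Dom HL g"
      "Cod HL f = Cod HL g"
    and eq: "farr iota f = farr iota g"
  obtain j x \<rho> where a: "fixed_data I J C j x \<rho>" "Dom HL f = fixed_obj I J C j x \<rho>"
    using category.Dom_in[OF HL.category_hocolim f] by (rule fixed_objE)
  obtain j' x' \<rho>' where b: "fixed_data I J C j' x' \<rho>'" "Cod HL f = fixed_obj I J C j' x' \<rho>'"
    using category.Cod_in[OF HL.category_hocolim f] by (rule fixed_objE)
  obtain \<beta> m where m: "fixed_map_data I J C j x \<rho> j' x' \<rho>' \<beta> m"
    "f = fixed_arr I J C (fixed_obj I J C j x \<rho>) (fixed_obj I J C j' x' \<rho>') \<beta> m"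
    using f a b by (rule fixed_arr_exhaust)
  obtain \<beta>' m' where m': "fixed_map_data I J C j x \<rho> j' x' \<rho>' \<beta>' m'"
    "g = fixed_arr I J C (fixed_obj I J C j x \<rho>) (fixed_obj I J C j' x' \<rho>') \<beta>' m'"
    using g a(1) par(1)[symmetric, unfolded a(2)] b(1) par(2)[symmetric, unfolded b(2)]
    by (rule fixed_arr_exhaust)
  have val: "\<beta> = \<beta>' \<and> m i = m' i" if "i \<in> Obj I" for i
    using arg_cong[OF eq, of "\<lambda>\<tau>. smap_val \<tau> i"] that
    unfolding m(2) m'(2) comparison_fixed_arr[OF a(1) b(1) m(1)] comparison_fixed_arr[OF a(1) b(1) m'(1)]
    by simp
  show "f = g"
    unfolding m(2) m'(2)
    by (rule fixed_arr_cong) (use val assms fixed_dataD(1)[OF b(1)] in auto)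
qed

end

locale bidiagram_final = bidiagram I J C
  for I :: "('i, 'f) cat" and J :: "('j, 'g) cat" and C :: "('i \<times> 'j, 'f \<times> 'g, 'c, 'd) diagram" +
  fixes e :: 'i and \<epsilon> :: "('i, 'f, 'i, 'f) ntr"
  assumes final: "pseudo_final I e \<epsilon>"
begin

abbreviation "retract \<equiv> final_retraction I e \<epsilon> J C"

lemma e_in [simp]: "e \<in> Obj I"
  using final by (simp add: pseudo_final_def)

lemma eps_simps [simp]:
  "i \<in> Obj I \<Longrightarrow> ncomp \<epsilon> i \<in> Arr I" "i \<in> Obj I \<Longrightarrow> Dom I (ncomp \<epsilon> i) = i" "i \<in> Obj I \<Longrightarrow> Cod I (ncomp \<epsilon> i) = e"
  and eps_natural: "\<alpha> \<in> Arr I \<Longrightarrow> Comp I (ncomp \<epsilon> (Cod I \<alpha>)) \<alpha> = ncomp \<epsilon> (Dom I \<alpha>)"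
proof -
  interpret \<epsilon>: nat_transf I I "id_ftr I" "const_ftr I I e" \<epsilon>
    using final by (simp add: pseudo_final_def)
  show in_arr: "i \<in> Obj I \<Longrightarrow> ncomp \<epsilon> i \<in> Arr I" and "i \<in> Obj I \<Longrightarrow> Dom I (ncomp \<epsilon> i) = i" and
    cod: "i \<in> Obj I \<Longrightarrow> Cod I (ncomp \<epsilon> i) = e" for i
    using PiE_mem[OF \<epsilon>.ncomp_in, of i] \<epsilon>.Dom_ncomp[of i] \<epsilon>.Cod_ncomp[of i]
    by (simp_all add: const_ftr_def)
  show "Comp I (ncomp \<epsilon> (Cod I \<alpha>)) \<alpha> = ncomp \<epsilon> (Dom I \<alpha>)" if "\<alpha> \<in> Arr I"
    using \<epsilon>.naturality[OF that] that by (simp add: const_ftr_def in_arr cod)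
qed

text \<open>
This is where the naturality of \<open>\<epsilon>\<close> enters: \<open>\<epsilon> i' \<circ> \<alpha> = \<epsilon> i\<close>, and the coordinate is a functor. The pushes to the
coordinate over \<open>e\<close> absorb the maps of the coordinate.
\<close>

lemma pos_eps:
  assumes "moving_data I J C j y \<beta> \<mu>" "\<alpha> \<in> Arr I" "Cod I \<alpha> = i"
  shows "Comp J (\<beta> (ncomp \<epsilon> i)) (\<beta> \<alpha>) = \<beta> (ncomp \<epsilon> (Dom I \<alpha>))"
  using moving_dataD(11)[OF assms(1,2), of "ncomp \<epsilon> i"] eps_natural[OF assms(2)] assms(2,3) by auto

text \<open>
The same for maps of sections: \<open>\<gamma>\<close> is natural at the arrow \<open>\<epsilon> i : i \<rightarrow> e\<close>.
\<close>

lemma pos_map_eps: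
  assumes "moving_map_data I J C j y \<beta> \<mu> j' y' \<beta>' \<mu>' \<gamma> \<nu>" "i \<in> Obj I"
  shows "Comp J (\<gamma> e) (\<beta> (ncomp \<epsilon> i)) = Comp J (\<beta>' (ncomp \<epsilon> i)) (\<gamma> i)"
  using moving_map_dataD(7)[OF assms(1), of "ncomp \<epsilon> i" e] assms(2) by simp

lemma retraction_simps [simp]:
  "fsrc retract = LH" "ftgt retract = HL"
  "fobj retract \<in> extensional (Obj LH)"
  "farr retract \<in> extensional (Arr LH)"
  by (simp_all add: final_retraction_def)

lemma retraction_moving_obj:
  assumes "moving_data I J C j y \<beta> \<mu>"
  shows "retraction_obj I e \<epsilon> J C (moving_obj I J C j y \<beta> \<mu>) =
      fixed_obj I J C (j e) (\<lambda>i. fobj (farr C (Ident I i, \<beta> (ncomp \<epsilon> i))) (y i))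
        (\<lambda>\<alpha>. farr (farr C (Ident I (Cod I \<alpha>), \<beta> (ncomp \<epsilon> (Cod I \<alpha>)))) (\<mu> \<alpha>))"
    and "fobj retract (moving_obj I J C j y \<beta> \<mu>) =
      fixed_obj I J C (j e) (\<lambda>i. fobj (farr C (Ident I i, \<beta> (ncomp \<epsilon> i))) (y i))
        (\<lambda>\<alpha>. farr (farr C (Ident I (Cod I \<alpha>), \<beta> (ncomp \<epsilon> (Cod I \<alpha>)))) (\<mu> \<alpha>))"
proof -
  have "retraction_obj I e \<epsilon> J C (moving_obj I J C j y \<beta> \<mu>) =
      fixed_obj I J C (j e) (\<lambda>i. fobj (farr C (Ident I i, pos_arr (moving_obj I J C j y \<beta> \<mu>) (ncomp \<epsilon> i)))
          (val (moving_obj I J C j y \<beta> \<mu>) i))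
        (\<lambda>\<alpha>. farr (farr C (Ident I (Cod I \<alpha>), pos_arr (moving_obj I J C j y \<beta> \<mu>) (ncomp \<epsilon> (Cod I \<alpha>))))
          (val_arr (moving_obj I J C j y \<beta> \<mu>) \<alpha>))"
    by (simp add: retraction_obj_def)
  also have "\<dots> = fixed_obj I J C (j e) (\<lambda>i. fobj (farr C (Ident I i, \<beta> (ncomp \<epsilon> i))) (y i))
        (\<lambda>\<alpha>. farr (farr C (Ident I (Cod I \<alpha>), \<beta> (ncomp \<epsilon> (Cod I \<alpha>)))) (\<mu> \<alpha>))"
    by (rule fixed_obj_cong) (simp_all add: moving_dataD[OF assms])
  finally show obj: "retraction_obj I e \<epsilon> J C (moving_obj I J C j y \<beta> \<mu>) =
      fixed_obj I J C (j e) (\<lambda>i. fobj (farr C (Ident I i, \<beta> (ncomp \<epsilon> i))) (y i))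
        (\<lambda>\<alpha>. farr (farr C (Ident I (Cod I \<alpha>), \<beta> (ncomp \<epsilon> (Cod I \<alpha>)))) (\<mu> \<alpha>))" .
  then show "fobj retract (moving_obj I J C j y \<beta> \<mu>) =
      fixed_obj I J C (j e) (\<lambda>i. fobj (farr C (Ident I i, \<beta> (ncomp \<epsilon> i))) (y i))
        (\<lambda>\<alpha>. farr (farr C (Ident I (Cod I \<alpha>), \<beta> (ncomp \<epsilon> (Cod I \<alpha>)))) (\<mu> \<alpha>))"
    using moving_obj_in[OF assms] by (simp add: final_retraction_def del: LH.holim_simps)
qed

text \<open>
The maps over \<open>\<alpha>\<close> start at \<open>C(1, \<beta> (\<epsilon> i')) (C(\<alpha>, \<beta> \<alpha>) (y i)) = C(\<alpha>, \<beta> (\<epsilon> i)) (y i)\<close>, which is \<open>C(\<alpha>, 1)\<close> applied to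
the pushed object over \<open>i\<close>, as it should be.
\<close>

lemma fixed_data_retraction:
  assumes "moving_data I J C j y \<beta> \<mu>"
  shows "fixed_data I J C (j e) (\<lambda>i. fobj (farr C (Ident I i, \<beta> (ncomp \<epsilon> i))) (y i))
    (\<lambda>\<alpha>. farr (farr C (Ident I (Cod I \<alpha>), \<beta> (ncomp \<epsilon> (Cod I \<alpha>)))) (\<mu> \<alpha>))"
  unfolding fixed_data_def
  by (auto simp: moving_dataD[OF assms] pos_eps[OF assms])

text \<open>
The compatibility of the pushed map is the image, under the push at the codomain of \<open>\<alpha>\<close>, of the compatibility of the
given one; the pushes at both ends are matched by \<open>pos_eps\<close> and \<open>pos_map_eps\<close>.
\<close>

lemma fixed_map_data_retraction:
  assumes "moving_data I J C j y \<beta> \<mu>" "moving_data I J C j' y' \<beta>' \<mu>'"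
    "moving_map_data I J C j y \<beta> \<mu> j' y' \<beta>' \<mu>' \<gamma> \<nu>"
  shows "fixed_map_data I J C (j e) (\<lambda>i. fobj (farr C (Ident I i, \<beta> (ncomp \<epsilon> i))) (y i))
    (\<lambda>\<alpha>. farr (farr C (Ident I (Cod I \<alpha>), \<beta> (ncomp \<epsilon> (Cod I \<alpha>)))) (\<mu> \<alpha>))
    (j' e) (\<lambda>i. fobj (farr C (Ident I i, \<beta>' (ncomp \<epsilon> i))) (y' i))
    (\<lambda>\<alpha>. farr (farr C (Ident I (Cod I \<alpha>), \<beta>' (ncomp \<epsilon> (Cod I \<alpha>)))) (\<mu>' \<alpha>))
    (\<gamma> e) (\<lambda>i. farr (farr C (Ident I i, \<beta>' (ncomp \<epsilon> i))) (\<nu> i))"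
  unfolding fixed_map_data_def
proof (intro conjI ballI)
  note d = moving_dataD[OF assms(1)] moving_dataD[OF assms(2)] moving_map_dataD(1-6)[OF assms(3)]
    pos_map_eps[OF assms(3)]
  fix \<alpha> assume \<alpha>: "\<alpha> \<in> Arr I"
  let ?i = "Cod I \<alpha>"
  let ?F = "farr (farr C (Ident I ?i, \<beta>' (ncomp \<epsilon> ?i)))"
  have "Comp (fobj C (?i, j' e)) (?F (\<nu> ?i)) (farr (farr C (Ident I ?i, \<gamma> e)) (farr (farr C (Ident I ?i, \<beta> (ncomp \<epsilon> ?i))) (\<mu> \<alpha>)))
    = ?F (Comp (fobj C (?i, j' ?i)) (\<nu> ?i) (farr (farr C (Ident I ?i, \<gamma> ?i)) (\<mu> \<alpha>)))"
    using \<alpha> by (simp add: d)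
  also have "\<dots> = ?F (Comp (fobj C (?i, j' ?i)) (\<mu>' \<alpha>) (farr (farr C (\<alpha>, \<beta>' \<alpha>)) (\<nu> (Dom I \<alpha>))))"
    using \<alpha> by (simp add: moving_map_dataD(8)[OF assms(3)])
  also have "\<dots> = Comp (fobj C (?i, j' e)) (?F (\<mu>' \<alpha>))
      (farr (farr C (\<alpha>, Ident J (j' e))) (farr (farr C (Ident I (Dom I \<alpha>), \<beta>' (ncomp \<epsilon> (Dom I \<alpha>)))) (\<nu> (Dom I \<alpha>))))"
    using \<alpha> by (simp add: d pos_eps[OF assms(2)])
  finally show "Comp (fobj C (?i, j' e)) (?F (\<nu> ?i)) (farr (farr C (Ident I ?i, \<gamma> e)) (farr (farr C (Ident I ?i, \<beta> (ncomp \<epsilon> ?i))) (\<mu> \<alpha>)))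
    = Comp (fobj C (?i, j' e)) (?F (\<mu>' \<alpha>))
      (farr (farr C (\<alpha>, Ident J (j' e))) (farr (farr C (Ident I (Dom I \<alpha>), \<beta>' (ncomp \<epsilon> (Dom I \<alpha>)))) (\<nu> (Dom I \<alpha>))))" .
qed (simp_all add: moving_dataD[OF assms(1)] moving_dataD[OF assms(2)] moving_map_dataD(1-6)[OF assms(3)]
    pos_map_eps[OF assms(3)])

lemma retraction_moving_arr:
  assumes d: "moving_data I J C j y \<beta> \<mu>" "moving_data I J C j' y' \<beta>' \<mu>'"
    and \<tau>: "moving_arr I J C (moving_obj I J C j y \<beta> \<mu>) (moving_obj I J C j' y' \<beta>' \<mu>') \<gamma> \<nu>
      \<in> Arr LH"
  shows "farr retract
      (moving_arr I J C (moving_obj I J C j y \<beta> \<mu>) (moving_obj I J C j' y' \<beta>' \<mu>') \<gamma> \<nu>) =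
    fixed_arr I J C (fobj retract (moving_obj I J C j y \<beta> \<mu>))
      (fobj retract (moving_obj I J C j' y' \<beta>' \<mu>')) (\<gamma> e)
      (\<lambda>i. farr (farr C (Ident I i, \<beta>' (ncomp \<epsilon> i))) (\<nu> i))"
proof -
  let ?t = "moving_arr I J C (moving_obj I J C j y \<beta> \<mu>) (moving_obj I J C j' y' \<beta>' \<mu>') \<gamma> \<nu>"
  have "farr retract ?t = retraction_arr I e \<epsilon> J C ?t"
    using \<tau> by (simp add: final_retraction_def del: LH.holim_simps)
  also have "\<dots> = fixed_arr I J C (fobj retract (moving_obj I J C j y \<beta> \<mu>))
      (fobj retract (moving_obj I J C j' y' \<beta>' \<mu>')) (\<gamma> e)
      (\<lambda>i. farr (farr C (Ident I i, \<beta>' (ncomp \<epsilon> i))) (\<nu> i))"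
    unfolding retraction_arr_def
    by (rule fixed_arr_cong) (simp_all add: retraction_moving_obj d moving_dataD[OF d(2)])
  finally show ?thesis .
qed

lemma is_functor_retraction: "is_functor LH HL retract"
proof (rule is_functorI)
  fix T assume T: "T \<in> Obj LH"
  then obtain j y \<beta> \<mu> where a: "moving_data I J C j y \<beta> \<mu>" "T = moving_obj I J C j y \<beta> \<mu>"
    by (rule moving_objE)
  note fd = fixed_data_retraction[OF a(1)]
  show "fobj retract T \<in> Obj HL"
    unfolding a(2) retraction_moving_obj(2)[OF a(1)] by (rule fixed_obj_in[OF fd])
  have "Ident LH T \<in> Arr LH"
    using T by (rule category.Ident_in[OF LH.category_holim])
  note id = this[unfolded a(2) moving_Ident[OF a(1)]]
  show "farr retract (Ident LH T) =
      Ident HL (fobj retract T)"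
    unfolding a(2) moving_Ident[OF a(1)] retraction_moving_arr[OF a(1,1) id]
      retraction_moving_obj(2)[OF a(1)] fixed_Ident[OF fd]
    by (rule fixed_arr_cong) (simp_all add: moving_dataD[OF a(1)])
next
  fix f assume f: "f \<in> Arr LH"
  obtain j y \<beta> \<mu> where a: "moving_data I J C j y \<beta> \<mu>" "nsrc f = moving_obj I J C j y \<beta> \<mu>"
    using category.Dom_in[OF LH.category_holim f] unfolding LH.holim_simps(3) by (rule moving_objE)
  obtain j' y' \<beta>' \<mu>' where b: "moving_data I J C j' y' \<beta>' \<mu>'" "ntgt f = moving_obj I J C j' y' \<beta>' \<mu>'"
    using category.Cod_in[OF LH.category_holim f] unfolding LH.holim_simps(4) by (rule moving_objE)
  obtain \<gamma> \<nu> where m: "moving_map_data I J C j y \<beta> \<mu> j' y' \<beta>' \<mu>' \<gamma> \<nu>"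
    "f = moving_arr I J C (moving_obj I J C j y \<beta> \<mu>) (moving_obj I J C j' y' \<beta>' \<mu>') \<gamma> \<nu>"
    using f a b by (rule moving_arr_exhaust)
  note fd = fixed_data_retraction[OF a(1)] fixed_data_retraction[OF b(1)]
    fixed_map_data_retraction[OF a(1) b(1) m(1)]
  note f' = retraction_moving_arr[OF a(1) b(1) f[unfolded m(2)]]
  show "farr retract f \<in> Arr HL"
    unfolding m(2) f' retraction_moving_obj(2)[OF a(1)] retraction_moving_obj(2)[OF b(1)]
    using fd by (rule fixed_arr_in)
  show "Dom HL (farr retract f) =
      fobj retract (Dom LH f)"
    "Cod HL (farr retract f) =
      fobj retract (Cod LH f)"
    unfolding m(2) f' by simp_all
  fix g assume g: "g \<in> Arr LH" and
    fg: "Cod LH f = Dom LH g"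
  obtain j'' y'' \<beta>'' \<mu>'' where c: "moving_data I J C j'' y'' \<beta>'' \<mu>''" "ntgt g = moving_obj I J C j'' y'' \<beta>'' \<mu>''"
    using category.Cod_in[OF LH.category_holim g] unfolding LH.holim_simps(4) by (rule moving_objE)
  have src: "nsrc g = moving_obj I J C j' y' \<beta>' \<mu>'" using fg b by simp
  obtain \<gamma>' \<nu>' where m': "moving_map_data I J C j' y' \<beta>' \<mu>' j'' y'' \<beta>'' \<mu>'' \<gamma>' \<nu>'"
    "g = moving_arr I J C (moving_obj I J C j' y' \<beta>' \<mu>') (moving_obj I J C j'' y'' \<beta>'' \<mu>'') \<gamma>' \<nu>'"
    using g b(1) src c by (rule moving_arr_exhaust)
  note fd' = fixed_data_retraction[OF c(1)] fixed_map_data_retraction[OF b(1) c(1) m'(1)]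
  note g' = retraction_moving_arr[OF b(1) c(1) g[unfolded m'(2)]]
  note gf = moving_Comp[OF a(1) b(1) c(1) m(1) m'(1)]
  have "Comp LH g f \<in> Arr LH"
    using f g fg by (rule category.Comp_in[OF LH.category_holim])
  note gf' = retraction_moving_arr[OF a(1) c(1) this[unfolded m(2) m'(2) gf]]
  note d = moving_dataD[OF c(1)] moving_map_dataD(1-6)[OF m(1)] moving_map_dataD(1-6)[OF m'(1)]
    pos_map_eps[OF m'(1)]
  show "farr retract (Comp LH g f) =
      Comp HL (farr retract g) (farr retract f)"
    unfolding m(2) m'(2) gf gf' f' g' retraction_moving_obj(2)[OF a(1)] retraction_moving_obj(2)[OF b(1)]
      retraction_moving_obj(2)[OF c(1)] fixed_Comp[OF fd(1,2) fd'(1) fd(3) fd'(2)]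
    by (rule fixed_arr_cong) (simp_all add: d moving_dataD[OF b(1)])
qed (simp_all add: HL.category_hocolim LH.category_holim)

text \<open>
For a constant coordinate every push is \<open>C(1, 1)\<close>, an identity functor.
\<close>

lemma retraction_comparison: "retract \<circ>\<^sub>F iota = id_ftr HL"
proof (rule functor_eqI[OF is_functor_comp_ftr[OF is_functor_comparison is_functor_retraction]
      is_functor_id_ftr[OF HL.category_hocolim]])
  have obj: "fobj retract (moving_obj I J C (\<lambda>_. j) x (\<lambda>_. Ident J j) \<rho>) = fixed_obj I J C j x \<rho>"
    if "fixed_data I J C j x \<rho>" for j x \<rho>
    unfolding retraction_moving_obj(2)[OF moving_data_of_fixed[OF that]]
    by (rule fixed_obj_cong) (simp_all add: fixed_dataD[OF that])
  fix a assume a: "a \<in> Obj HL"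
  then obtain j x \<rho> where a': "fixed_data I J C j x \<rho>" "a = fixed_obj I J C j x \<rho>"
    by (rule fixed_objE)
  have "fobj (retract \<circ>\<^sub>F iota) a = a"
    using a by (simp add: a'(2) comparison_fixed_obj[OF a'(1)] obj[OF a'(1)])
  then show "fobj (retract \<circ>\<^sub>F iota) a = fobj (id_ftr HL) a"
    using a by simp
next
  have obj: "fobj retract (moving_obj I J C (\<lambda>_. j) x (\<lambda>_. Ident J j) \<rho>) = fixed_obj I J C j x \<rho>"
    if "fixed_data I J C j x \<rho>" for j x \<rho>
    unfolding retraction_moving_obj(2)[OF moving_data_of_fixed[OF that]]
    by (rule fixed_obj_cong) (simp_all add: fixed_dataD[OF that])
  fix f assume f: "f \<in> Arr HL"
  obtain j x \<rho> where a: "fixed_data I J C j x \<rho>" "Dom HL f = fixed_obj I J C j x \<rho>"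
    using category.Dom_in[OF HL.category_hocolim f] by (rule fixed_objE)
  obtain j' x' \<rho>' where b: "fixed_data I J C j' x' \<rho>'" "Cod HL f = fixed_obj I J C j' x' \<rho>'"
    using category.Cod_in[OF HL.category_hocolim f] by (rule fixed_objE)
  obtain \<beta> m where m: "fixed_map_data I J C j x \<rho> j' x' \<rho>' \<beta> m"
    "f = fixed_arr I J C (fixed_obj I J C j x \<rho>) (fixed_obj I J C j' x' \<rho>') \<beta> m"
    using f a b by (rule fixed_arr_exhaust)
  note md = moving_data_of_fixed[OF a(1)] moving_data_of_fixed[OF b(1)]
    moving_map_data_of_fixed[OF a(1) b(1) m(1)]
  have "farr retract (farr iota f) = f"
    unfolding m(2) comparison_fixed_arr[OF a(1) b(1) m(1)]
      retraction_moving_arr[OF md(1,2) moving_arr_in[OF md]] obj[OF a(1)] obj[OF b(1)]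
    by (rule fixed_arr_cong) (simp_all add: fixed_dataD[OF b(1)] fixed_map_dataD[OF m(1)])
  then show "farr (retract \<circ>\<^sub>F iota) f = farr (id_ftr HL) f"
    using f by simp
qed

text \<open>
The transformation \<open>1 \<rightarrow> \<iota> \<circ> p\<close>: its component moves the coordinate along the push and is the identity in the fibres,
where the pushed object has been chosen as the target.
\<close>

definition unit :: "(('i, 'f, 'j, 'g, 'c, 'd) holim_hocolim_obj, ('i, 'f, 'j, 'g, 'c, 'd) holim_hocolim_arr,
    ('i, 'f, 'j, 'g, 'c, 'd) holim_hocolim_obj, ('i, 'f, 'j, 'g, 'c, 'd) holim_hocolim_arr) ntr" where
  "unit = \<lparr>nsrc = id_ftr LH, ntgt = iota \<circ>\<^sub>F retract,
    ncomp = (\<lambda>T\<in>Obj LH.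
      moving_arr I J C T (fobj iota (fobj retract T))
        (\<lambda>i. pos_arr T (ncomp \<epsilon> i))
        (\<lambda>i. Ident (fobj C (i, pos T e)) (fobj (farr C (Ident I i, pos_arr T (ncomp \<epsilon> i))) (val T i))))\<rparr>"

text \<open>
On coordinates, naturality with respect to a map with coordinate \<open>\<gamma>\<close> says \<open>\<beta>' (\<epsilon> i) \<circ> \<gamma> i = \<gamma> e \<circ> \<beta> (\<epsilon> i)\<close>,
which is \<open>pos_map_eps\<close>. In the fibres both composites are the pushed map, composed with an identity.
\<close>

lemma nat_transf_unit:
  "nat_transf LH LH (id_ftr LH)
    (iota \<circ>\<^sub>F retract) unit"
proof -
  let ?x = "\<lambda>y \<beta> i. fobj (farr C (Ident I i, \<beta> (ncomp \<epsilon> i))) (y i)"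
  let ?r = "\<lambda>\<beta> \<mu> \<alpha>. farr (farr C (Ident I (Cod I \<alpha>), \<beta> (ncomp \<epsilon> (Cod I \<alpha>)))) (\<mu> \<alpha>)"
  let ?cr = "\<lambda>j y \<beta> \<mu>. moving_obj I J C (\<lambda>_. j e) (?x y \<beta>) (\<lambda>_. Ident J (j e)) (?r \<beta> \<mu>)"
  have target: "fobj iota (fobj retract (moving_obj I J C j y \<beta> \<mu>)) = ?cr j y \<beta> \<mu>"
    if "moving_data I J C j y \<beta> \<mu>" for j y \<beta> \<mu>
    unfolding retraction_moving_obj(2)[OF that]
    by (rule comparison_fixed_obj(2)[OF fixed_data_retraction[OF that]])
  have unit: "ncomp unit (moving_obj I J C j y \<beta> \<mu>) = moving_arr I J C (moving_obj I J C j y \<beta> \<mu>) (?cr j y \<beta> \<mu>)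
      (\<lambda>i. \<beta> (ncomp \<epsilon> i)) (\<lambda>i. Ident (fobj C (i, j e)) (?x y \<beta> i))"
    if d: "moving_data I J C j y \<beta> \<mu>" for j y \<beta> \<mu>
  proof -
    have "ncomp unit (moving_obj I J C j y \<beta> \<mu>) =
        moving_arr I J C (moving_obj I J C j y \<beta> \<mu>) (?cr j y \<beta> \<mu>)
        (\<lambda>i. pos_arr (moving_obj I J C j y \<beta> \<mu>) (ncomp \<epsilon> i))
        (\<lambda>i. Ident (fobj C (i, pos (moving_obj I J C j y \<beta> \<mu>) e))
          (fobj (farr C (Ident I i, pos_arr (moving_obj I J C j y \<beta> \<mu>) (ncomp \<epsilon> i))) (val (moving_obj I J C j y \<beta> \<mu>) i)))"
      using moving_obj_in[OF d] target[OF d] by (simp add: unit_def del: LH.holim_simps moving_obj_simps)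
    also have "\<dots> = moving_arr I J C (moving_obj I J C j y \<beta> \<mu>) (?cr j y \<beta> \<mu>)
      (\<lambda>i. \<beta> (ncomp \<epsilon> i)) (\<lambda>i. Ident (fobj C (i, j e)) (?x y \<beta> i))"
      by (rule moving_arr_cong) simp_all
    finally show ?thesis .
  qed
  have data: "moving_map_data I J C j y \<beta> \<mu> (\<lambda>_. j e) (?x y \<beta>) (\<lambda>_. Ident J (j e)) (?r \<beta> \<mu>)
      (\<lambda>i. \<beta> (ncomp \<epsilon> i)) (\<lambda>i. Ident (fobj C (i, j e)) (?x y \<beta> i))"
    if d: "moving_data I J C j y \<beta> \<mu>" for j y \<beta> \<mu>
    unfolding moving_map_data_def by (auto simp: moving_dataD[OF d] pos_eps[OF d])
  have cd: "moving_data I J C (\<lambda>_. j e) (?x y \<beta>) (\<lambda>_. Ident J (j e)) (?r \<beta> \<mu>)"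
    if "moving_data I J C j y \<beta> \<mu>" for j y \<beta> \<mu>
    by (rule moving_data_of_fixed[OF fixed_data_retraction[OF that]])
  have closed: "ncomp unit T \<in> Arr LH" "nsrc (ncomp unit T) = T"
    "ntgt (ncomp unit T) = fobj iota (fobj retract T)"
    if T: "T \<in> Obj LH" for T
  proof -
    obtain j y \<beta> \<mu> where a: "moving_data I J C j y \<beta> \<mu>" "T = moving_obj I J C j y \<beta> \<mu>"
      using T by (rule moving_objE)
    show "ncomp unit T \<in> Arr LH"
      unfolding a(2) unit[OF a(1)] using a(1) cd[OF a(1)] data[OF a(1)] by (rule moving_arr_in)
    show "nsrc (ncomp unit T) = T"
      "ntgt (ncomp unit T) = fobj iota (fobj retract T)"
      unfolding a(2) unit[OF a(1)] target[OF a(1)] by simp_all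
  qed
  have natural: "Comp LH (ncomp unit (ntgt f)) f =
      Comp LH (farr iota (farr retract f)) (ncomp unit (nsrc f))"
    if f: "f \<in> Arr LH" for f
  proof -
    obtain j y \<beta> \<mu> where a: "moving_data I J C j y \<beta> \<mu>" "nsrc f = moving_obj I J C j y \<beta> \<mu>"
      using category.Dom_in[OF LH.category_holim f] unfolding LH.holim_simps(3) by (rule moving_objE)
    obtain j' y' \<beta>' \<mu>' where b: "moving_data I J C j' y' \<beta>' \<mu>'" "ntgt f = moving_obj I J C j' y' \<beta>' \<mu>'"
      using category.Cod_in[OF LH.category_holim f] unfolding LH.holim_simps(4) by (rule moving_objE)
    obtain \<gamma> \<nu> where m: "moving_map_data I J C j y \<beta> \<mu> j' y' \<beta>' \<mu>' \<gamma> \<nu>"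
      "f = moving_arr I J C (moving_obj I J C j y \<beta> \<mu>) (moving_obj I J C j' y' \<beta>' \<mu>') \<gamma> \<nu>"
      using f a b by (rule moving_arr_exhaust)
    note fd = fixed_data_retraction[OF a(1)] fixed_data_retraction[OF b(1)]
      fixed_map_data_retraction[OF a(1) b(1) m(1)]
    have cr: "farr iota (farr retract f) =
      moving_arr I J C (?cr j y \<beta> \<mu>) (?cr j' y' \<beta>' \<mu>') (\<lambda>_. \<gamma> e)
        (\<lambda>i. farr (farr C (Ident I i, \<beta>' (ncomp \<epsilon> i))) (\<nu> i))"
      unfolding m(2) retraction_moving_arr[OF a(1) b(1) f[unfolded m(2)]]
        retraction_moving_obj(2)[OF a(1)] retraction_moving_obj(2)[OF b(1)]
      by (rule comparison_fixed_arr[OF fd])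
    show ?thesis
      unfolding a(2) b(2) cr unit[OF a(1)] unit[OF b(1)]
      unfolding m(2) moving_Comp[OF a(1) b(1) cd[OF b(1)] m(1) data[OF b(1)]]
        moving_Comp[OF a(1) cd[OF a(1)] cd[OF b(1)] data[OF a(1)] moving_map_data_of_fixed[OF fd]]
      by (rule moving_arr_cong)
        (simp_all add: moving_dataD[OF a(1)] moving_dataD[OF b(1)] moving_map_dataD(1-6)[OF m(1)] pos_map_eps[OF m(1)])
  qed
  show ?thesis
    unfolding nat_transf_def nat_transf_axioms_def
  proof (intro conjI allI impI)
    show "is_functor LH LH (id_ftr LH)"
      by (rule is_functor_id_ftr[OF LH.category_holim])
    show "is_functor LH LH (iota \<circ>\<^sub>F retract)"
      by (rule is_functor_comp_ftr[OF is_functor_retraction is_functor_comparison])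
    show "ncomp unit \<in> Obj LH \<rightarrow>\<^sub>E Arr LH"
      unfolding PiE_iff using closed(1) by (auto simp: unit_def simp del: LH.holim_simps)
  next
    fix T assume T: "T \<in> Obj LH"
    show "Dom LH (ncomp unit T) = fobj (id_ftr LH) T"
      "Cod LH (ncomp unit T) = fobj (iota \<circ>\<^sub>F retract) T"
      using closed(2,3)[OF T] T by (simp_all del: LH.holim_simps(1,2))
  next
    fix f assume f: "f \<in> Arr LH"
    show "Comp LH (ncomp unit (Cod LH f)) (farr (id_ftr LH) f) =
      Comp LH (farr (iota \<circ>\<^sub>F retract) f) (ncomp unit (Dom LH f))"
      using natural[OF f] f by (simp del: LH.holim_simps(1,2))
  qed (simp_all add: unit_def)
qed

end

section \<open>Naturality in the diagram\<close>

context bidiagram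
begin

text \<open>
This lemma and the next are the instances of the general formula for \<open>holim_map\<close> that serve both maps of diagrams and functors of the
second index category.
\<close>

lemma holim_map_moving_obj:
  assumes "nsrc \<phi> = hocolim_snd I J C" "fsrc (ntgt \<phi>) = I" and d: "moving_data I J C j y \<beta> \<mu>"
  shows "fobj (holim_map \<phi>) (moving_obj I J C j y \<beta> \<mu>) =
    mk_section (ntgt \<phi>) (\<lambda>i. fobj (ncomp \<phi> i) (j i, y i))
      (\<lambda>\<alpha>. farr (ncomp \<phi> (Cod I \<alpha>)) ((j (Dom I \<alpha>), fobj (farr C (\<alpha>, Ident J (j (Dom I \<alpha>)))) (y (Dom I \<alpha>))),
        (\<beta> \<alpha>, \<mu> \<alpha>), (j (Cod I \<alpha>), y (Cod I \<alpha>))))"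
  unfolding moving_obj_def by (rule LH.fobj_holim_map) (simp_all add: assms moving_section_data_iff)

lemma holim_map_moving_arr:
  assumes \<phi>: "nsrc \<phi> = hocolim_snd I J C" "fsrc (ntgt \<phi>) = I"
    and d: "moving_data I J C j y \<beta> \<mu>" "moving_data I J C j' y' \<beta>' \<mu>'"
    and m: "moving_map_data I J C j y \<beta> \<mu> j' y' \<beta>' \<mu>' \<gamma> \<nu>"
  shows "farr (holim_map \<phi>)
      (moving_arr I J C (moving_obj I J C j y \<beta> \<mu>) (moving_obj I J C j' y' \<beta>' \<mu>') \<gamma> \<nu>) =
    mk_smap (ntgt \<phi>) (fobj (holim_map \<phi>) (moving_obj I J C j y \<beta> \<mu>))
      (fobj (holim_map \<phi>) (moving_obj I J C j' y' \<beta>' \<mu>'))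
      (\<lambda>i. farr (ncomp \<phi> i) ((j i, y i), (\<gamma> i, \<nu> i), (j' i, y' i)))"
  unfolding moving_arr_eq unfolding moving_obj_def
  by (rule LH.farr_holim_map) (simp_all add: \<phi> moving_section_data_iff moving_smap_data_iff d m)

end

locale bidiagram_map = I: category I + J: category J + diagram_map "prod_cat I J" C D \<phi>
  for I :: "('i, 'f) cat" and J :: "('j, 'g) cat" and C D :: "('i \<times> 'j, 'f \<times> 'g, 'c, 'd) diagram" and \<phi>
begin

sublocale C: bidiagram I J C by unfold_locales
sublocale D: bidiagram I J D by unfold_locales

lemma fixed_data_map:
  assumes "fixed_data I J C j x \<rho>"
  shows "fixed_data I J D j (\<lambda>i. fobj (ncomp \<phi> (i, j)) (x i)) (\<lambda>\<alpha>. farr (ncomp \<phi> (Cod I \<alpha>, j)) (\<rho> \<alpha>))"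
  unfolding fixed_data_def by (auto simp: C.fixed_dataD[OF assms])

lemma fixed_map_data_map:
  assumes "fixed_data I J C j x \<rho>" "fixed_data I J C j' x' \<rho>'" "fixed_map_data I J C j x \<rho> j' x' \<rho>' \<beta> m"
  shows "fixed_map_data I J D j (\<lambda>i. fobj (ncomp \<phi> (i, j)) (x i)) (\<lambda>\<alpha>. farr (ncomp \<phi> (Cod I \<alpha>, j)) (\<rho> \<alpha>))
    j' (\<lambda>i. fobj (ncomp \<phi> (i, j')) (x' i)) (\<lambda>\<alpha>. farr (ncomp \<phi> (Cod I \<alpha>, j')) (\<rho>' \<alpha>))
    \<beta> (\<lambda>i. farr (ncomp \<phi> (i, j')) (m i))"
  unfolding fixed_map_data_def
proof (intro conjI ballI)
  note d = C.fixed_dataD[OF assms(1)] C.fixed_dataD[OF assms(2)] C.fixed_map_dataD(1-6)[OF assms(3)]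
  fix \<alpha> assume \<alpha>: "\<alpha> \<in> Arr I"
  let ?i = "Cod I \<alpha>" let ?p = "farr (ncomp \<phi> (Cod I \<alpha>, j'))"
  have "Comp (fobj D (?i, j')) (?p (m ?i)) (farr (farr D (Ident I ?i, \<beta>)) (farr (ncomp \<phi> (?i, j)) (\<rho> \<alpha>))) =
      ?p (Comp (fobj C (?i, j')) (m ?i) (farr (farr C (Ident I ?i, \<beta>)) (\<rho> \<alpha>)))"
    using \<alpha> by (simp add: d)
  also have "\<dots> = ?p (Comp (fobj C (?i, j')) (\<rho>' \<alpha>) (farr (farr C (\<alpha>, Ident J j')) (m (Dom I \<alpha>))))"
    using \<alpha> by (simp add: C.fixed_map_dataD(7)[OF assms(3)])
  also have "\<dots> = Comp (fobj D (?i, j')) (?p (\<rho>' \<alpha>))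
      (farr (farr D (\<alpha>, Ident J j')) (farr (ncomp \<phi> (Dom I \<alpha>, j')) (m (Dom I \<alpha>))))"
    using \<alpha> by (simp add: d)
  finally show "Comp (fobj D (?i, j')) (?p (m ?i)) (farr (farr D (Ident I ?i, \<beta>)) (farr (ncomp \<phi> (?i, j)) (\<rho> \<alpha>))) =
    Comp (fobj D (?i, j')) (?p (\<rho>' \<alpha>))
      (farr (farr D (\<alpha>, Ident J j')) (farr (ncomp \<phi> (Dom I \<alpha>, j')) (m (Dom I \<alpha>))))" .
qed (simp_all add: C.fixed_dataD[OF assms(1)] C.fixed_dataD[OF assms(2)] C.fixed_map_dataD(1-6)[OF assms(3)])

lemma moving_data_map:
  assumes "moving_data I J C j y \<beta> \<mu>"
  shows "moving_data I J D j (\<lambda>i. fobj (ncomp \<phi> (i, j i)) (y i)) \<beta>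
    (\<lambda>\<alpha>. farr (ncomp \<phi> (Cod I \<alpha>, j (Cod I \<alpha>))) (\<mu> \<alpha>))"
  unfolding moving_data_def by (auto simp: C.moving_dataD[OF assms])

lemma moving_map_data_map:
  assumes "moving_data I J C j y \<beta> \<mu>" "moving_data I J C j' y' \<beta>' \<mu>'"
    "moving_map_data I J C j y \<beta> \<mu> j' y' \<beta>' \<mu>' \<gamma> \<nu>"
  shows "moving_map_data I J D
    j (\<lambda>i. fobj (ncomp \<phi> (i, j i)) (y i)) \<beta> (\<lambda>\<alpha>. farr (ncomp \<phi> (Cod I \<alpha>, j (Cod I \<alpha>))) (\<mu> \<alpha>))
    j' (\<lambda>i. fobj (ncomp \<phi> (i, j' i)) (y' i)) \<beta>' (\<lambda>\<alpha>. farr (ncomp \<phi> (Cod I \<alpha>, j' (Cod I \<alpha>))) (\<mu>' \<alpha>))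
    \<gamma> (\<lambda>i. farr (ncomp \<phi> (i, j' i)) (\<nu> i))"
  unfolding moving_map_data_def
proof (intro conjI ballI)
  note d = C.moving_dataD[OF assms(1)] C.moving_dataD[OF assms(2)] C.moving_map_dataD(1-6)[OF assms(3)]
  fix \<alpha> assume \<alpha>: "\<alpha> \<in> Arr I"
  let ?i = "Cod I \<alpha>" let ?p = "farr (ncomp \<phi> (Cod I \<alpha>, j' (Cod I \<alpha>)))"
  have "Comp (fobj D (?i, j' ?i)) (?p (\<nu> ?i)) (farr (farr D (Ident I ?i, \<gamma> ?i)) (farr (ncomp \<phi> (?i, j ?i)) (\<mu> \<alpha>))) =
      ?p (Comp (fobj C (?i, j' ?i)) (\<nu> ?i) (farr (farr C (Ident I ?i, \<gamma> ?i)) (\<mu> \<alpha>)))"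
    using \<alpha> by (simp add: d)
  also have "\<dots> = ?p (Comp (fobj C (?i, j' ?i)) (\<mu>' \<alpha>) (farr (farr C (\<alpha>, \<beta>' \<alpha>)) (\<nu> (Dom I \<alpha>))))"
    using \<alpha> by (simp add: C.moving_map_dataD(8)[OF assms(3)])
  also have "\<dots> = Comp (fobj D (?i, j' ?i)) (?p (\<mu>' \<alpha>))
      (farr (farr D (\<alpha>, \<beta>' \<alpha>)) (farr (ncomp \<phi> (Dom I \<alpha>, j' (Dom I \<alpha>))) (\<nu> (Dom I \<alpha>))))"
    using \<alpha> by (simp add: d)
  finally show "Comp (fobj D (?i, j' ?i)) (?p (\<nu> ?i)) (farr (farr D (Ident I ?i, \<gamma> ?i)) (farr (ncomp \<phi> (?i, j ?i)) (\<mu> \<alpha>))) =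
    Comp (fobj D (?i, j' ?i)) (?p (\<mu>' \<alpha>))
      (farr (farr D (\<alpha>, \<beta>' \<alpha>)) (farr (ncomp \<phi> (Dom I \<alpha>, j' (Dom I \<alpha>))) (\<nu> (Dom I \<alpha>))))" .
  show "Comp J (\<gamma> ?i) (\<beta> \<alpha>) = Comp J (\<beta>' \<alpha>) (\<gamma> (Dom I \<alpha>))"
    using \<alpha> by (simp add: C.moving_map_dataD(7)[OF assms(3)])
qed (simp_all add: C.moving_dataD[OF assms(1)] C.moving_dataD[OF assms(2)] C.moving_map_dataD(1-6)[OF assms(3)])

text \<open>
The lemmas from here to \<open>holim_hocolim_map_moving_arr\<close> say that the induced functors apply the components of \<open>\<phi>\<close> to the data and leave the
coordinate alone. The second conclusion is the same fact before the coordinate is added; it is needed for the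
transported section inside an arrow.
\<close>

lemma hocolim_holim_map_fixed_obj:
  assumes "fixed_data I J C j x \<rho>"
  shows "fobj (hocolim_holim_map I J \<phi>) (fixed_obj I J C j x \<rho>) =
    fixed_obj I J D j (\<lambda>i. fobj (ncomp \<phi> (i, j)) (x i)) (\<lambda>\<alpha>. farr (ncomp \<phi> (Cod I \<alpha>, j)) (\<rho> \<alpha>))"
    and "fobj (holim_map \<lparr>nsrc = slice_snd I J C j, ntgt = slice_snd I J D j, ncomp = \<lambda>i\<in>Obj I. ncomp \<phi> (i, j)\<rparr>)
        (mk_section (slice_snd I J C j) x \<rho>) =
      mk_section (slice_snd I J D j) (\<lambda>i. fobj (ncomp \<phi> (i, j)) (x i)) (\<lambda>\<alpha>. farr (ncomp \<phi> (Cod I \<alpha>, j)) (\<rho> \<alpha>))"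
proof -
  let ?\<phi> = "\<lparr>nsrc = slice_snd I J C j, ntgt = slice_snd I J D j, ncomp = \<lambda>i\<in>Obj I. ncomp \<phi> (i, j)\<rparr>"
  have j: "j \<in> Obj J" and s: "section_data (slice_snd I J C j) x \<rho>"
    using assms by (simp_all add: C.fixed_data_iff)
  show *: "fobj (holim_map ?\<phi>) (mk_section (slice_snd I J C j) x \<rho>) =
      mk_section (slice_snd I J D j) (\<lambda>i. fobj (ncomp \<phi> (i, j)) (x i)) (\<lambda>\<alpha>. farr (ncomp \<phi> (Cod I \<alpha>, j)) (\<rho> \<alpha>))"
  proof (rule trans)
    show "fobj (holim_map ?\<phi>) (mk_section (slice_snd I J C j) x \<rho>) = mk_section (slice_snd I J D j)
        (\<lambda>i. fobj (ncomp ?\<phi> i) (x i)) (\<lambda>\<alpha>. farr (ncomp ?\<phi> (Cod I \<alpha>)) (\<rho> \<alpha>))"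
      using diagram.fobj_holim_map[OF C.diagram_slice_snd[OF j] _ _ s, of ?\<phi>] by simp
  qed (rule diagram.mk_section_cong[OF D.diagram_slice_snd[OF j]]; simp)
  show "fobj (hocolim_holim_map I J \<phi>) (fixed_obj I J C j x \<rho>) =
    fixed_obj I J D j (\<lambda>i. fobj (ncomp \<phi> (i, j)) (x i)) (\<lambda>\<alpha>. farr (ncomp \<phi> (Cod I \<alpha>, j)) (\<rho> \<alpha>))"
    using C.fixed_obj_in[OF assms] j
    by (simp add: hocolim_holim_map_def hocolim_map_def nsrc ntgt)
      (simp add: fixed_obj_def *)
qed

lemma hocolim_holim_map_fixed_arr:
  assumes d: "fixed_data I J C j x \<rho>" "fixed_data I J C j' x' \<rho>'" and m: "fixed_map_data I J C j x \<rho> j' x' \<rho>' \<beta> m"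
  shows "farr (hocolim_holim_map I J \<phi>) (fixed_arr I J C (fixed_obj I J C j x \<rho>) (fixed_obj I J C j' x' \<rho>') \<beta> m) =
    fixed_arr I J D (fobj (hocolim_holim_map I J \<phi>) (fixed_obj I J C j x \<rho>))
      (fobj (hocolim_holim_map I J \<phi>) (fixed_obj I J C j' x' \<rho>')) \<beta> (\<lambda>i. farr (ncomp \<phi> (i, j')) (m i))"
proof -
  let ?\<phi> = "\<lambda>j. \<lparr>nsrc = slice_snd I J C j, ntgt = slice_snd I J D j, ncomp = \<lambda>i\<in>Obj I. ncomp \<phi> (i, j)\<rparr>"
  let ?s = "mk_section (slice_snd I J C j) x \<rho>" let ?s' = "mk_section (slice_snd I J C j') x' \<rho>'"
  let ?t = "mk_section (slice_snd I J C j') (\<lambda>i. fobj (farr C (Ident I i, \<beta>)) (x i))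
      (\<lambda>\<alpha>. farr (farr C (Ident I (Cod I \<alpha>), \<beta>)) (\<rho> \<alpha>))"
  note \<beta> = C.fixed_map_dataD(1-3)[OF m]
  have j: "j \<in> Obj J" "j' \<in> Obj J" using d by (auto simp: fixed_data_def)
  note tr = C.fixed_transport[OF d(1) \<beta>]
  have s: "section_data (slice_snd I J C j') (\<lambda>i. fobj (farr C (Ident I i, \<beta>)) (x i))
      (\<lambda>\<alpha>. farr (farr C (Ident I (Cod I \<alpha>), \<beta>)) (\<rho> \<alpha>))" "section_data (slice_snd I J C j') x' \<rho>'"
    "smap_data (slice_snd I J C j') (\<lambda>i. fobj (farr C (Ident I i, \<beta>)) (x i))
      (\<lambda>\<alpha>. farr (farr C (Ident I (Cod I \<alpha>), \<beta>)) (\<rho> \<alpha>)) x' \<rho>' m"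
    using tr(1) d(2) m by (simp_all add: C.fixed_data_iff C.fixed_map_data_iff)
  have arr: "farr (holim_map (?\<phi> j')) (mk_smap (slice_snd I J C j') ?t ?s' m) =
      mk_smap (slice_snd I J D j') (fobj (holim_map (?\<phi> j')) ?t) (fobj (holim_map (?\<phi> j')) ?s')
        (\<lambda>i. farr (ncomp \<phi> (i, j')) (m i))"
  proof (rule trans)
    show "farr (holim_map (?\<phi> j')) (mk_smap (slice_snd I J C j') ?t ?s' m) =
      mk_smap (slice_snd I J D j') (fobj (holim_map (?\<phi> j')) ?t) (fobj (holim_map (?\<phi> j')) ?s')
        (\<lambda>i. farr (ncomp (?\<phi> j') i) (m i))"
      using diagram.farr_holim_map[OF C.diagram_slice_snd[OF j(2)] _ _ s, of "?\<phi> j'"] by simp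
  qed (rule diagram.mk_smap_cong[OF D.diagram_slice_snd[OF j(2)]]; simp)
  have "farr (hocolim_holim_map I J \<phi>) (fixed_arr I J C (fixed_obj I J C j x \<rho>) (fixed_obj I J C j' x' \<rho>') \<beta> m) =
    ((j, fobj (holim_map (?\<phi> j)) ?s), (\<beta>, farr (holim_map (?\<phi> j')) (mk_smap (slice_snd I J C j') ?t ?s' m)),
      (j', fobj (holim_map (?\<phi> j')) ?s'))"
    using C.fixed_arr_in[OF d m] j unfolding C.fixed_arr_eq[OF d(1) \<beta>] tr(2)
    by (simp add: hocolim_holim_map_def hocolim_map_def nsrc ntgt del: C.HL.hocolim_simps D.HL.hocolim_simps)
  also have "\<dots> = fixed_arr I J D (fobj (hocolim_holim_map I J \<phi>) (fixed_obj I J C j x \<rho>))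
      (fobj (hocolim_holim_map I J \<phi>) (fixed_obj I J C j' x' \<rho>')) \<beta> (\<lambda>i. farr (ncomp \<phi> (i, j')) (m i))"
    unfolding hocolim_holim_map_fixed_obj(1)[OF d(1)] hocolim_holim_map_fixed_obj(1)[OF d(2)]
      D.fixed_arr_eq[OF fixed_data_map[OF d(1)] \<beta>] D.fixed_transport(2)[OF fixed_data_map[OF d(1)] \<beta>]
      arr hocolim_holim_map_fixed_obj(2)[OF tr(1)]
      hocolim_holim_map_fixed_obj(2)[OF d(1)] hocolim_holim_map_fixed_obj(2)[OF d(2)] prod.inject
    by (intro conjI refl diagram.mk_smap_cong[OF D.diagram_slice_snd[OF j(2)]]
        diagram.mk_section_cong[OF D.diagram_slice_snd[OF j(2)]])
      (use \<beta> in \<open>simp_all add: C.fixed_dataD[OF d(1)]\<close>)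
  finally show ?thesis .
qed

lemma column_map:
  assumes "i \<in> Obj I"
  shows "\<lbrakk>j \<in> Obj J; y \<in> Obj (fobj C (i, j))\<rbrakk> \<Longrightarrow>
      fobj (hocolim_map \<lparr>nsrc = slice_fst J I C i, ntgt = slice_fst J I D i, ncomp = \<lambda>j\<in>Obj J. ncomp \<phi> (i, j)\<rparr>) (j, y) =
        (j, fobj (ncomp \<phi> (i, j)) y)"
    "\<lbrakk>j \<in> Obj J; j' \<in> Obj J; ((j, y), (\<beta>, \<mu>), (j', y')) \<in> Arr (hocolim (slice_fst J I C i))\<rbrakk> \<Longrightarrow>
      farr (hocolim_map \<lparr>nsrc = slice_fst J I C i, ntgt = slice_fst J I D i, ncomp = \<lambda>j\<in>Obj J. ncomp \<phi> (i, j)\<rparr>)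
        ((j, y), (\<beta>, \<mu>), (j', y')) =
        ((j, fobj (ncomp \<phi> (i, j)) y), (\<beta>, farr (ncomp \<phi> (i, j')) \<mu>), (j', fobj (ncomp \<phi> (i, j')) y'))"
  using assms by (simp_all add: hocolim_map_def)

lemma holim_hocolim_map_moving_obj:
  assumes d: "moving_data I J C j y \<beta> \<mu>"
  shows "fobj (holim_hocolim_map I J \<phi>) (moving_obj I J C j y \<beta> \<mu>) =
    moving_obj I J D j (\<lambda>i. fobj (ncomp \<phi> (i, j i)) (y i)) \<beta>
      (\<lambda>\<alpha>. farr (ncomp \<phi> (Cod I \<alpha>, j (Cod I \<alpha>))) (\<mu> \<alpha>))"
  unfolding holim_hocolim_map_def nsrc ntgt
  by (subst C.holim_map_moving_obj[OF _ _ d])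
    (auto intro!: D.LH.mk_section_cong simp: moving_obj_def column_map C.moving_dataD[OF d])

lemma holim_hocolim_map_moving_arr:
  assumes d: "moving_data I J C j y \<beta> \<mu>" "moving_data I J C j' y' \<beta>' \<mu>'"
    and m: "moving_map_data I J C j y \<beta> \<mu> j' y' \<beta>' \<mu>' \<gamma> \<nu>"
  shows "farr (holim_hocolim_map I J \<phi>)
      (moving_arr I J C (moving_obj I J C j y \<beta> \<mu>) (moving_obj I J C j' y' \<beta>' \<mu>') \<gamma> \<nu>) =
    moving_arr I J D (fobj (holim_hocolim_map I J \<phi>) (moving_obj I J C j y \<beta> \<mu>))
      (fobj (holim_hocolim_map I J \<phi>) (moving_obj I J C j' y' \<beta>' \<mu>')) \<gamma>
      (\<lambda>i. farr (ncomp \<phi> (i, j' i)) (\<nu> i))"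
  unfolding holim_hocolim_map_def nsrc ntgt
  by (subst C.holim_map_moving_arr[OF _ _ d m])
    (use holim_hocolim_map_moving_obj[OF d(1)] holim_hocolim_map_moving_obj[OF d(2)] in
      \<open>auto intro!: D.LH.mk_smap_cong simp: holim_hocolim_map_def nsrc ntgt moving_arr_def column_map
        C.moving_dataD[OF d(1)] C.moving_dataD[OF d(2)] C.moving_map_dataD[OF m]\<close>)

lemma map_ftr_simps [simp]:
  "fsrc (hocolim_holim_map I J \<phi>) = hocolim_holim I J C" "ftgt (hocolim_holim_map I J \<phi>) = hocolim_holim I J D"
  "fsrc (holim_hocolim_map I J \<phi>) = holim_hocolim I J C" "ftgt (holim_hocolim_map I J \<phi>) = holim_hocolim I J D"
  by (simp_all add: hocolim_holim_map_def holim_hocolim_map_def hocolim_map_def holim_map_def nsrc ntgt)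

text \<open>
Both composites apply \<open>\<phi>\<close> to the data and make the coordinate constant.
\<close>

lemma comparison_natural_diagram:
  "comparison I J D \<circ>\<^sub>F hocolim_holim_map I J \<phi> = holim_hocolim_map I J \<phi> \<circ>\<^sub>F comparison I J C"
proof (rule comp_ftr_eqI)
  fix a assume "a \<in> Obj (fsrc (hocolim_holim_map I J \<phi>))"
  then have "a \<in> Obj (hocolim_holim I J C)" by simp
  then obtain j x \<rho> where a: "fixed_data I J C j x \<rho>" "a = fixed_obj I J C j x \<rho>"
    by (rule C.fixed_objE)
  show "fobj (comparison I J D) (fobj (hocolim_holim_map I J \<phi>) a) =
      fobj (holim_hocolim_map I J \<phi>) (fobj (comparison I J C) a)"
    unfolding a(2) hocolim_holim_map_fixed_obj(1)[OF a(1)] C.comparison_fixed_obj(2)[OF a(1)]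
      D.comparison_fixed_obj(2)[OF fixed_data_map[OF a(1)]]
      holim_hocolim_map_moving_obj[OF C.moving_data_of_fixed[OF a(1)]] by (rule refl)
next
  fix f assume "f \<in> Arr (fsrc (hocolim_holim_map I J \<phi>))"
  then have "f \<in> Arr (hocolim_holim I J C)" by simp
  then obtain j x \<rho> j' x' \<rho>' \<beta> m where a: "fixed_data I J C j x \<rho>" "fixed_data I J C j' x' \<rho>'"
    "fixed_map_data I J C j x \<rho> j' x' \<rho>' \<beta> m"
    "f = fixed_arr I J C (fixed_obj I J C j x \<rho>) (fixed_obj I J C j' x' \<rho>') \<beta> m"
    by (rule C.fixed_arrE)
  note md = C.moving_data_of_fixed[OF a(1)] C.moving_data_of_fixed[OF a(2)] C.moving_map_data_of_fixed[OF a(1-3)]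
  show "farr (comparison I J D) (farr (hocolim_holim_map I J \<phi>) f) =
      farr (holim_hocolim_map I J \<phi>) (farr (comparison I J C) f)"
    unfolding a(4) hocolim_holim_map_fixed_arr[OF a(1-3)] C.comparison_fixed_arr[OF a(1-3)]
      hocolim_holim_map_fixed_obj(1)[OF a(1)] hocolim_holim_map_fixed_obj(1)[OF a(2)]
      D.comparison_fixed_arr[OF fixed_data_map[OF a(1)] fixed_data_map[OF a(2)] fixed_map_data_map[OF a(1-3)]]
      holim_hocolim_map_moving_arr[OF md] holim_hocolim_map_moving_obj[OF md(1)] holim_hocolim_map_moving_obj[OF md(2)]
    by (rule refl)
qed simp_all

text \<open>
The components of \<open>\<phi>\<close> commute with the pushes, which are transports \<open>C(1, \<beta> (\<epsilon> i))\<close> of the diagram.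
\<close>

lemma retraction_natural_diagram:
  assumes "pseudo_final I e \<epsilon>"
  shows "final_retraction I e \<epsilon> J D \<circ>\<^sub>F holim_hocolim_map I J \<phi> = hocolim_holim_map I J \<phi> \<circ>\<^sub>F final_retraction I e \<epsilon> J C"
proof -
  interpret CF: bidiagram_final I J C e \<epsilon> by unfold_locales fact
  interpret DF: bidiagram_final I J D e \<epsilon> by unfold_locales fact
  show ?thesis
  proof (rule comp_ftr_eqI)
    have obj: "fobj (final_retraction I e \<epsilon> J D) (fobj (holim_hocolim_map I J \<phi>) (moving_obj I J C j y \<beta> \<mu>)) =
        fobj (hocolim_holim_map I J \<phi>) (fobj (final_retraction I e \<epsilon> J C) (moving_obj I J C j y \<beta> \<mu>))"
      if d: "moving_data I J C j y \<beta> \<mu>" for j y \<beta> \<mu>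
      unfolding holim_hocolim_map_moving_obj[OF d] CF.retraction_moving_obj(2)[OF d]
        DF.retraction_moving_obj(2)[OF moving_data_map[OF d]]
        hocolim_holim_map_fixed_obj(1)[OF CF.fixed_data_retraction[OF d]]
      by (rule D.fixed_obj_cong) (simp_all add: C.moving_dataD[OF d])
    {
      fix T assume "T \<in> Obj (fsrc (holim_hocolim_map I J \<phi>))"
      then have "T \<in> Obj (holim_hocolim I J C)" by simp
      then obtain j y \<beta> \<mu> where "moving_data I J C j y \<beta> \<mu>" "T = moving_obj I J C j y \<beta> \<mu>"
        by (rule C.moving_objE)
      then show "fobj (final_retraction I e \<epsilon> J D) (fobj (holim_hocolim_map I J \<phi>) T) =
          fobj (hocolim_holim_map I J \<phi>) (fobj (final_retraction I e \<epsilon> J C) T)"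
        using obj by simp
    next
      fix f assume "f \<in> Arr (fsrc (holim_hocolim_map I J \<phi>))"
      then have f: "f \<in> Arr (holim_hocolim I J C)" by simp
      then obtain j y \<beta> \<mu> j' y' \<beta>' \<mu>' \<gamma> \<nu> where d: "moving_data I J C j y \<beta> \<mu>" "moving_data I J C j' y' \<beta>' \<mu>'"
        and m: "moving_map_data I J C j y \<beta> \<mu> j' y' \<beta>' \<mu>' \<gamma> \<nu>"
        and f': "f = moving_arr I J C (moving_obj I J C j y \<beta> \<mu>) (moving_obj I J C j' y' \<beta>' \<mu>') \<gamma> \<nu>"
        by (rule C.moving_arrE)
      note dD = moving_data_map[OF d(1)] moving_data_map[OF d(2)] moving_map_data_map[OF d m]
      note cr = CF.fixed_data_retraction[OF d(1)] CF.fixed_data_retraction[OF d(2)] CF.fixed_map_data_retraction[OF d m]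
      show "farr (final_retraction I e \<epsilon> J D) (farr (holim_hocolim_map I J \<phi>) f) =
          farr (hocolim_holim_map I J \<phi>) (farr (final_retraction I e \<epsilon> J C) f)"
        unfolding f' holim_hocolim_map_moving_arr[OF d m] CF.retraction_moving_arr[OF d f[unfolded f']]
        unfolding holim_hocolim_map_moving_obj[OF d(1)] holim_hocolim_map_moving_obj[OF d(2)]
          DF.retraction_moving_arr[OF dD(1,2) D.moving_arr_in[OF dD]]
          CF.retraction_moving_obj(2)[OF d(1)] CF.retraction_moving_obj(2)[OF d(2)]
          hocolim_holim_map_fixed_arr[OF cr]
        unfolding CF.retraction_moving_obj(2)[OF d(1), symmetric] CF.retraction_moving_obj(2)[OF d(2), symmetric]
          holim_hocolim_map_moving_obj[OF d(1), symmetric] holim_hocolim_map_moving_obj[OF d(2), symmetric]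
          obj[OF d(1)] obj[OF d(2)]
        unfolding CF.retraction_moving_obj(2)[OF d(1)] CF.retraction_moving_obj(2)[OF d(2)]
          hocolim_holim_map_fixed_obj(1)[OF cr(1)] hocolim_holim_map_fixed_obj(1)[OF cr(2)]
        by (rule D.fixed_arr_cong)
          (simp_all add: C.moving_dataD[OF d(1)] C.moving_dataD[OF d(2)] C.moving_map_dataD(1-6)[OF m])
    }
  qed simp_all
qed

end

section \<open>Naturality in the second index category\<close>

lemma prod_ftr_simps [simp]:
  "fsrc (prod_ftr u v) = prod_cat (fsrc u) (fsrc v)" "ftgt (prod_ftr u v) = prod_cat (ftgt u) (ftgt v)"
  "\<lbrakk>i \<in> Obj (fsrc u); j \<in> Obj (fsrc v)\<rbrakk> \<Longrightarrow> fobj (prod_ftr u v) (i, j) = (fobj u i, fobj v j)"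
  "\<lbrakk>\<alpha> \<in> Arr (fsrc u); \<beta> \<in> Arr (fsrc v)\<rbrakk> \<Longrightarrow> farr (prod_ftr u v) (\<alpha>, \<beta>) = (farr u \<alpha>, farr v \<beta>)"
  "fobj (prod_ftr u v) \<in> extensional (Obj (prod_cat (fsrc u) (fsrc v)))"
  "farr (prod_ftr u v) \<in> extensional (Arr (prod_cat (fsrc u) (fsrc v)))"
  by (simp_all add: prod_ftr_def prod_cat_def)

lemma category_prod_cat:
  assumes "category I" "category J"
  shows "category (prod_cat I J)"
proof -
  interpret I: category I by fact
  interpret J: category J by fact
  show ?thesis
    by unfold_locales
      (auto simp: prod_cat_def I.Dom_in J.Dom_in I.Cod_in J.Cod_in I.Ident_in J.Ident_in
        I.Dom_Ident J.Dom_Ident I.Cod_Ident J.Cod_Ident I.Comp_in J.Comp_in I.Dom_Comp J.Dom_Comp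
        I.Cod_Comp J.Cod_Comp I.Comp_Ident J.Comp_Ident I.Ident_Comp J.Ident_Comp I.Comp_assoc J.Comp_assoc)
qed

lemma is_functor_prod_ftr:
  assumes "is_functor I I' u" "is_functor J J' v"
  shows "is_functor (prod_cat I J) (prod_cat I' J') (prod_ftr u v)"
proof -
  interpret u: is_functor I I' u by fact
  interpret v: is_functor J J' v by fact
  show ?thesis
  proof (rule is_functorI)
    show "fobj (prod_ftr u v) \<in> extensional (Obj (prod_cat I J))"
      "farr (prod_ftr u v) \<in> extensional (Arr (prod_cat I J))"
      using prod_ftr_simps(5,6)[of u v] by (simp_all add: u.fsrc v.fsrc)
  qed (auto simp: category_prod_cat u.A.category_axioms u.B.category_axioms v.A.category_axioms
      v.B.category_axioms u.fsrc u.ftgt v.fsrc v.ftgt u.fobj_closed v.fobj_closed u.farr_closed v.farr_closed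
      u.Dom_farr v.Dom_farr u.Cod_farr v.Cod_farr u.A.Dom_in v.A.Dom_in u.A.Cod_in v.A.Cod_in
      u.A.Ident_in v.A.Ident_in u.farr_Ident v.farr_Ident u.A.Comp_in v.A.Comp_in u.farr_Comp v.farr_Comp)
qed

locale bidiagram_reindex = bidiagram I J' C + v: is_functor J J' v
  for I :: "('i, 'f) cat" and J J' :: "('j, 'g) cat" and C :: "('i \<times> 'j, 'f \<times> 'g, 'c, 'd) diagram" and v
begin

abbreviation "C' \<equiv> C \<circ>\<^sub>F prod_ftr (id_ftr I) v"

declare v.fobj_closed [simp] v.farr_closed [simp] v.Dom_farr [simp] v.Cod_farr [simp]
  v.farr_Ident [simp] v.farr_Comp [simp] v.fsrc [simp] v.ftgt [simp]

sublocale C': bidiagram I J C'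
proof -
  have "is_functor (prod_cat I J) CAT C'"
    by (rule is_functor_comp_ftr[OF is_functor_prod_ftr[OF is_functor_id_ftr[OF I.category_axioms] v.is_functor_axioms]
        is_functor_axioms])
  then show "bidiagram I J C'"
    unfolding bidiagram_def diagram_def using I.category_axioms v.A.category_axioms by simp
qed

lemma reindexed_simps [simp]:
  "\<lbrakk>i \<in> Obj I; j \<in> Obj J\<rbrakk> \<Longrightarrow> fobj C' (i, j) = fobj C (i, fobj v j)"
  "\<lbrakk>\<alpha> \<in> Arr I; \<beta> \<in> Arr J\<rbrakk> \<Longrightarrow> farr C' (\<alpha>, \<beta>) = farr C (\<alpha>, farr v \<beta>)"
  by simp_all

text \<open>
The slices \<open>C(-, v j)\<close> are equal, not just isomorphic, to those of the reindexed diagram. A section for the one is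
therefore literally a section for the other, and only the coordinate changes.
\<close>

lemma slice_reindex:
  "j \<in> Obj J \<Longrightarrow> slice_snd I J C' j = slice_snd I J' C (fobj v j)"
  "i \<in> Obj I \<Longrightarrow> slice_fst J I C' i = slice_fst J' I C i \<circ>\<^sub>F v"
  "\<beta> \<in> Arr J \<Longrightarrow> slice_snd_ntr I J C' \<beta> = slice_snd_ntr I J' C (farr v \<beta>)"
proof -
  show *: "slice_snd I J C' j = slice_snd I J' C (fobj v j)" if "j \<in> Obj J" for j
    by (rule ftr_eqI) (simp_all add: that)
  show "slice_fst J I C' i = slice_fst J' I C i \<circ>\<^sub>F v" if "i \<in> Obj I"
    by (rule ftr_eqI) (simp_all add: that)
  show "slice_snd_ntr I J C' \<beta> = slice_snd_ntr I J' C (farr v \<beta>)" if "\<beta> \<in> Arr J"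
    using that by (simp add: slice_snd_ntr_def * restrict_def fun_eq_iff)
qed

lemma holim_fst_reindex: "holim_fst I J' C \<circ>\<^sub>F v = holim_fst I J C'"
  by (rule ftr_eqI) (simp_all add: slice_reindex)

lemma fixed_data_reindex:
  assumes "fixed_data I J C' j x \<rho>"
  shows "fixed_data I J' C (fobj v j) x \<rho>"
  using assms by (auto simp: fixed_data_def)

lemma fixed_map_data_reindex:
  assumes "fixed_data I J C' j x \<rho>" "fixed_data I J C' j' x' \<rho>'" "fixed_map_data I J C' j x \<rho> j' x' \<rho>' \<beta> m"
  shows "fixed_map_data I J' C (fobj v j) x \<rho> (fobj v j') x' \<rho>' (farr v \<beta>) m"
  using assms(3) C'.fixed_dataD(1)[OF assms(2)] by (auto simp: fixed_map_data_def)

lemma moving_data_reindex: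
  assumes "moving_data I J C' j y \<beta> \<mu>"
  shows "moving_data I J' C (\<lambda>i. fobj v (j i)) y (\<lambda>\<alpha>. farr v (\<beta> \<alpha>)) \<mu>"
  unfolding moving_data_def
  using C'.moving_dataD(1-7,11,12)[OF assms] C'.moving_dataD(8-10)[OF assms _ refl] by simp

lemma moving_map_data_reindex:
  assumes "moving_data I J C' j y \<beta> \<mu>" "moving_data I J C' j' y' \<beta>' \<mu>'"
    "moving_map_data I J C' j y \<beta> \<mu> j' y' \<beta>' \<mu>' \<gamma> \<nu>"
  shows "moving_map_data I J' C (\<lambda>i. fobj v (j i)) y (\<lambda>\<alpha>. farr v (\<beta> \<alpha>)) \<mu>
    (\<lambda>i. fobj v (j' i)) y' (\<lambda>\<alpha>. farr v (\<beta>' \<alpha>)) \<mu>' (\<lambda>i. farr v (\<gamma> i)) \<nu>"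
  unfolding moving_map_data_def
proof (intro conjI ballI)
  note d = C'.moving_dataD[OF assms(1)] C'.moving_dataD[OF assms(2)] C'.moving_map_dataD(1-6)[OF assms(3)]
  fix \<alpha> assume \<alpha>: "\<alpha> \<in> Arr I"
  show "Comp J' (farr v (\<gamma> (Cod I \<alpha>))) (farr v (\<beta> \<alpha>)) = Comp J' (farr v (\<beta>' \<alpha>)) (farr v (\<gamma> (Dom I \<alpha>)))"
    using arg_cong[OF C'.moving_map_dataD(7)[OF assms(3) \<alpha> refl], of "farr v"] \<alpha> by (simp add: d)
  show "Comp (fobj C (Cod I \<alpha>, fobj v (j' (Cod I \<alpha>)))) (\<nu> (Cod I \<alpha>))
      (farr (farr C (Ident I (Cod I \<alpha>), farr v (\<gamma> (Cod I \<alpha>)))) (\<mu> \<alpha>)) =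
    Comp (fobj C (Cod I \<alpha>, fobj v (j' (Cod I \<alpha>)))) (\<mu>' \<alpha>) (farr (farr C (\<alpha>, farr v (\<beta>' \<alpha>))) (\<nu> (Dom I \<alpha>)))"
    using C'.moving_map_dataD(8)[OF assms(3) \<alpha> refl] \<alpha> by (simp add: d)
qed (use C'.moving_dataD[OF assms(1)] C'.moving_dataD[OF assms(2)] C'.moving_map_dataD(1-6)[OF assms(3)] in simp_all)

lemma reindex_ftr_simps [simp]:
  "fsrc (hocolim_holim_reindex I v C) = hocolim_holim I J C'"
  "ftgt (hocolim_holim_reindex I v C) = hocolim_holim I J' C"
  "fsrc (holim_hocolim_reindex I v C) = holim_hocolim I J C'"
  "ftgt (holim_hocolim_reindex I v C) = holim_hocolim I J' C"
  by (simp_all add: hocolim_holim_reindex_def holim_hocolim_reindex_def hocolim_reindex_def holim_map_def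
      holim_fst_reindex)

lemma hocolim_holim_reindex_fixed_obj:
  assumes d: "fixed_data I J C' j x \<rho>"
  shows "fobj (hocolim_holim_reindex I v C) (fixed_obj I J C' j x \<rho>) = fixed_obj I J' C (fobj v j) x \<rho>"
  using C'.fixed_obj_in[OF d] C'.fixed_dataD(1)[OF d]
  by (simp add: hocolim_holim_reindex_def hocolim_reindex_def holim_fst_reindex)
    (simp add: fixed_obj_def slice_reindex)

lemma hocolim_holim_reindex_fixed_arr:
  assumes d: "fixed_data I J C' j x \<rho>" "fixed_data I J C' j' x' \<rho>'" and m: "fixed_map_data I J C' j x \<rho> j' x' \<rho>' \<beta> m"
  shows "farr (hocolim_holim_reindex I v C) (fixed_arr I J C' (fixed_obj I J C' j x \<rho>) (fixed_obj I J C' j' x' \<rho>') \<beta> m) =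
    fixed_arr I J' C (fixed_obj I J' C (fobj v j) x \<rho>) (fixed_obj I J' C (fobj v j') x' \<rho>') (farr v \<beta>) m"
proof -
  note \<beta> = C'.fixed_map_dataD(1-3)[OF m]
  have v\<beta>: "farr v \<beta> \<in> Arr J'" "Dom J' (farr v \<beta>) = fobj v j" "Cod J' (farr v \<beta>) = fobj v j'"
    using \<beta> by simp_all
  have j: "j \<in> Obj J" "j' \<in> Obj J" using d by (auto simp: fixed_data_def)
  show ?thesis
    using C'.fixed_arr_in[OF d m]
    unfolding C'.fixed_arr_eq[OF d(1) \<beta>] fixed_arr_eq[OF fixed_data_reindex[OF d(1)] v\<beta>]
    by (simp add: hocolim_holim_reindex_def hocolim_reindex_def holim_fst_reindex
        del: HL.hocolim_simps C'.HL.hocolim_simps)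
      (simp add: slice_reindex j \<beta>)
qed

lemma column_reindex:
  assumes "i \<in> Obj I"
  shows "\<lbrakk>j \<in> Obj J; y \<in> Obj (fobj C (i, fobj v j))\<rbrakk> \<Longrightarrow>
      fobj (hocolim_reindex v (slice_fst J' I C i)) (j, y) = (fobj v j, y)"
    "\<lbrakk>j \<in> Obj J; j' \<in> Obj J; ((j, y), (\<beta>, \<mu>), (j', y')) \<in> Arr (hocolim (slice_fst J I C' i))\<rbrakk> \<Longrightarrow>
      farr (hocolim_reindex v (slice_fst J' I C i)) ((j, y), (\<beta>, \<mu>), (j', y')) =
        ((fobj v j, y), (farr v \<beta>, \<mu>), (fobj v j', y'))"
  using assms by (simp_all add: hocolim_reindex_def slice_reindex(2)[symmetric])

lemma holim_hocolim_reindex_moving_obj: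
  assumes d: "moving_data I J C' j y \<beta> \<mu>"
  shows "fobj (holim_hocolim_reindex I v C) (moving_obj I J C' j y \<beta> \<mu>) =
    moving_obj I J' C (\<lambda>i. fobj v (j i)) y (\<lambda>\<alpha>. farr v (\<beta> \<alpha>)) \<mu>"
  unfolding holim_hocolim_reindex_def v.fsrc v.ftgt
  by (subst C'.holim_map_moving_obj[OF _ _ d])
    (use C'.moving_dataD(1-7)[OF d] C'.moving_dataD(8-10)[OF d _ refl] in \<open>auto intro!: LH.mk_section_cong simp: moving_obj_def column_reindex\<close>)

lemma holim_hocolim_reindex_moving_arr:
  assumes d: "moving_data I J C' j y \<beta> \<mu>" "moving_data I J C' j' y' \<beta>' \<mu>'"
    and m: "moving_map_data I J C' j y \<beta> \<mu> j' y' \<beta>' \<mu>' \<gamma> \<nu>"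
  shows "farr (holim_hocolim_reindex I v C)
      (moving_arr I J C' (moving_obj I J C' j y \<beta> \<mu>) (moving_obj I J C' j' y' \<beta>' \<mu>') \<gamma> \<nu>) =
    moving_arr I J' C (moving_obj I J' C (\<lambda>i. fobj v (j i)) y (\<lambda>\<alpha>. farr v (\<beta> \<alpha>)) \<mu>)
      (moving_obj I J' C (\<lambda>i. fobj v (j' i)) y' (\<lambda>\<alpha>. farr v (\<beta>' \<alpha>)) \<mu>') (\<lambda>i. farr v (\<gamma> i)) \<nu>"
  unfolding holim_hocolim_reindex_moving_obj[OF d(1), symmetric] holim_hocolim_reindex_moving_obj[OF d(2), symmetric]
  unfolding holim_hocolim_reindex_def v.fsrc v.ftgt
  by (subst C'.holim_map_moving_arr[OF _ _ d m])
    (use holim_hocolim_reindex_moving_obj[OF d(1)] holim_hocolim_reindex_moving_obj[OF d(2)]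
        C'.moving_dataD[OF d(1)] C'.moving_dataD[OF d(2)] C'.moving_map_dataD[OF m] in
      \<open>auto intro!: LH.mk_smap_cong simp: holim_hocolim_reindex_def moving_arr_def column_reindex\<close>)

lemma comparison_natural_reindex:
  "comparison I J' C \<circ>\<^sub>F hocolim_holim_reindex I v C = holim_hocolim_reindex I v C \<circ>\<^sub>F comparison I J C'"
proof (rule comp_ftr_eqI)
  fix a assume "a \<in> Obj (fsrc (hocolim_holim_reindex I v C))"
  then have "a \<in> Obj (hocolim_holim I J C')" by simp
  then obtain j x \<rho> where a: "fixed_data I J C' j x \<rho>" "a = fixed_obj I J C' j x \<rho>"
    by (rule C'.fixed_objE)
  show "fobj (comparison I J' C) (fobj (hocolim_holim_reindex I v C) a) =
      fobj (holim_hocolim_reindex I v C) (fobj (comparison I J C') a)"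
    unfolding a(2) hocolim_holim_reindex_fixed_obj[OF a(1)] C'.comparison_fixed_obj(2)[OF a(1)]
      comparison_fixed_obj(2)[OF fixed_data_reindex[OF a(1)]]
      holim_hocolim_reindex_moving_obj[OF C'.moving_data_of_fixed[OF a(1)]]
    by (simp add: C'.fixed_dataD(1)[OF a(1)])
next
  fix f assume "f \<in> Arr (fsrc (hocolim_holim_reindex I v C))"
  then have "f \<in> Arr (hocolim_holim I J C')" by simp
  then obtain j x \<rho> j' x' \<rho>' \<beta> m where a: "fixed_data I J C' j x \<rho>" "fixed_data I J C' j' x' \<rho>'"
    "fixed_map_data I J C' j x \<rho> j' x' \<rho>' \<beta> m"
    "f = fixed_arr I J C' (fixed_obj I J C' j x \<rho>) (fixed_obj I J C' j' x' \<rho>') \<beta> m"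
    by (rule C'.fixed_arrE)
  note md = C'.moving_data_of_fixed[OF a(1)] C'.moving_data_of_fixed[OF a(2)] C'.moving_map_data_of_fixed[OF a(1-3)]
  show "farr (comparison I J' C) (farr (hocolim_holim_reindex I v C) f) =
      farr (holim_hocolim_reindex I v C) (farr (comparison I J C') f)"
    unfolding a(4) hocolim_holim_reindex_fixed_arr[OF a(1-3)] C'.comparison_fixed_arr[OF a(1-3)]
      comparison_fixed_arr[OF fixed_data_reindex[OF a(1)] fixed_data_reindex[OF a(2)] fixed_map_data_reindex[OF a(1-3)]]
      holim_hocolim_reindex_moving_arr[OF md]
    by (simp add: C'.fixed_dataD(1)[OF a(1)] C'.fixed_dataD(1)[OF a(2)])
qed simp_all

text \<open>
The pushes of the image are along \<open>v (\<beta> (\<epsilon> i))\<close>, and the reindexed diagram acts through exactly these arrows.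
\<close>

lemma retraction_natural_reindex:
  assumes "pseudo_final I e \<epsilon>"
  shows "final_retraction I e \<epsilon> J' C \<circ>\<^sub>F holim_hocolim_reindex I v C = hocolim_holim_reindex I v C \<circ>\<^sub>F final_retraction I e \<epsilon> J C'"
proof -
  interpret CF: bidiagram_final I J' C e \<epsilon> by unfold_locales fact
  interpret CF': bidiagram_final I J C' e \<epsilon> by unfold_locales fact
  show ?thesis
  proof (rule comp_ftr_eqI)
    have obj: "fobj (final_retraction I e \<epsilon> J' C) (moving_obj I J' C (\<lambda>i. fobj v (j i)) y (\<lambda>\<alpha>. farr v (\<beta> \<alpha>)) \<mu>) =
        fobj (hocolim_holim_reindex I v C) (fobj (final_retraction I e \<epsilon> J C') (moving_obj I J C' j y \<beta> \<mu>))"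
      if d: "moving_data I J C' j y \<beta> \<mu>" for j y \<beta> \<mu>
      unfolding CF'.retraction_moving_obj(2)[OF d] CF.retraction_moving_obj(2)[OF moving_data_reindex[OF d]]
        hocolim_holim_reindex_fixed_obj[OF CF'.fixed_data_retraction[OF d]]
      by (rule fixed_obj_cong) (simp_all add: C'.moving_dataD[OF d])
    {
      fix T assume "T \<in> Obj (fsrc (holim_hocolim_reindex I v C))"
      then have "T \<in> Obj (holim_hocolim I J C')" by simp
      then obtain j y \<beta> \<mu> where d: "moving_data I J C' j y \<beta> \<mu>" and T: "T = moving_obj I J C' j y \<beta> \<mu>"
        by (rule C'.moving_objE)
      show "fobj (final_retraction I e \<epsilon> J' C) (fobj (holim_hocolim_reindex I v C) T) =
          fobj (hocolim_holim_reindex I v C) (fobj (final_retraction I e \<epsilon> J C') T)"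
        unfolding T holim_hocolim_reindex_moving_obj[OF d] by (rule obj[OF d])
    next
      fix f assume "f \<in> Arr (fsrc (holim_hocolim_reindex I v C))"
      then have f: "f \<in> Arr (holim_hocolim I J C')" by simp
      then obtain j y \<beta> \<mu> j' y' \<beta>' \<mu>' \<gamma> \<nu> where d: "moving_data I J C' j y \<beta> \<mu>" "moving_data I J C' j' y' \<beta>' \<mu>'"
        and m: "moving_map_data I J C' j y \<beta> \<mu> j' y' \<beta>' \<mu>' \<gamma> \<nu>"
        and f': "f = moving_arr I J C' (moving_obj I J C' j y \<beta> \<mu>) (moving_obj I J C' j' y' \<beta>' \<mu>') \<gamma> \<nu>"
        by (rule C'.moving_arrE)
      note dD = moving_data_reindex[OF d(1)] moving_data_reindex[OF d(2)] moving_map_data_reindex[OF d m]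
      note cr = CF'.fixed_data_retraction[OF d(1)] CF'.fixed_data_retraction[OF d(2)] CF'.fixed_map_data_retraction[OF d m]
      show "farr (final_retraction I e \<epsilon> J' C) (farr (holim_hocolim_reindex I v C) f) =
          farr (hocolim_holim_reindex I v C) (farr (final_retraction I e \<epsilon> J C') f)"
        unfolding f' holim_hocolim_reindex_moving_arr[OF d m] CF'.retraction_moving_arr[OF d f[unfolded f']]
          CF.retraction_moving_arr[OF dD(1,2) moving_arr_in[OF dD]] obj[OF d(1)] obj[OF d(2)]
        unfolding CF'.retraction_moving_obj(2)[OF d(1)] CF'.retraction_moving_obj(2)[OF d(2)]
          hocolim_holim_reindex_fixed_arr[OF cr] hocolim_holim_reindex_fixed_obj[OF cr(1)]
          hocolim_holim_reindex_fixed_obj[OF cr(2)]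
        by (rule fixed_arr_cong)
          (simp_all add: C'.moving_dataD[OF d(1)] C'.moving_dataD[OF d(2)] C'.moving_map_dataD(1-6)[OF m])
    }
  qed simp_all
qed

end

section \<open>Naturality in the first index category\<close>

text \<open>
Restriction of a section along \<open>u\<close> precomposes its data with \<open>u\<close>.
\<close>

lemma (in diagram) holim_restrict_simps:
  assumes u: "is_functor I0 I u"
  shows "section_data D x \<rho> \<Longrightarrow> fobj (holim_restrict u D) (mk_section D x \<rho>) =
      mk_section (D \<circ>\<^sub>F u) (\<lambda>i. x (fobj u i)) (\<lambda>\<alpha>. \<rho> (farr u \<alpha>))"
    "\<lbrakk>section_data D x \<rho>; section_data D x' \<rho>'; smap_data D x \<rho> x' \<rho>' m\<rbrakk> \<Longrightarrow>
      farr (holim_restrict u D) (mk_smap D (mk_section D x \<rho>) (mk_section D x' \<rho>') m) =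
      mk_smap (D \<circ>\<^sub>F u) (mk_section (D \<circ>\<^sub>F u) (\<lambda>i. x (fobj u i)) (\<lambda>\<alpha>. \<rho> (farr u \<alpha>)))
        (mk_section (D \<circ>\<^sub>F u) (\<lambda>i. x' (fobj u i)) (\<lambda>\<alpha>. \<rho>' (farr u \<alpha>))) (\<lambda>i. m (fobj u i))"
proof -
  interpret u: is_functor I0 I u by fact
  have restrict: "restrict_section u D (mk_section D x \<rho>) =
      mk_section (D \<circ>\<^sub>F u) (\<lambda>i. x (fobj u i)) (\<lambda>\<alpha>. \<rho> (farr u \<alpha>))" for x \<rho>
    by (rule ftr_eqI)
      (auto simp: restrict_section_def mk_section_def[of "D \<circ>\<^sub>F u"] Let_def u.fsrc u.fobj_closed u.farr_closed
        u.Dom_farr u.Cod_farr)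
  show "section_data D x \<rho> \<Longrightarrow> fobj (holim_restrict u D) (mk_section D x \<rho>) =
      mk_section (D \<circ>\<^sub>F u) (\<lambda>i. x (fobj u i)) (\<lambda>\<alpha>. \<rho> (farr u \<alpha>))"
    using mk_section_in_holim[of x \<rho>] by (simp add: holim_restrict_def Let_def restrict del: holim_simps)
  assume "section_data D x \<rho>" "section_data D x' \<rho>'" "smap_data D x \<rho> x' \<rho>' m"
  from mk_smap_in_holim[OF this]
  show "farr (holim_restrict u D) (mk_smap D (mk_section D x \<rho>) (mk_section D x' \<rho>') m) =
      mk_smap (D \<circ>\<^sub>F u) (mk_section (D \<circ>\<^sub>F u) (\<lambda>i. x (fobj u i)) (\<lambda>\<alpha>. \<rho> (farr u \<alpha>)))
        (mk_section (D \<circ>\<^sub>F u) (\<lambda>i. x' (fobj u i)) (\<lambda>\<alpha>. \<rho>' (farr u \<alpha>))) (\<lambda>i. m (fobj u i))"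
    by (auto simp: holim_restrict_def Let_def restrict u.fsrc mk_smap_def[of "D \<circ>\<^sub>F u"]
        mk_section_def[of "D \<circ>\<^sub>F u"] u.fobj_closed restrict_def simp del: holim_simps)
qed

locale bidiagram_restrict = bidiagram I' J C + u: is_functor I I' u
  for I I' :: "('i, 'f) cat" and J :: "('j, 'g) cat" and C :: "('i \<times> 'j, 'f \<times> 'g, 'c, 'd) diagram" and u
begin

abbreviation "C' \<equiv> C \<circ>\<^sub>F prod_ftr u (id_ftr J)"

declare u.fobj_closed [simp] u.farr_closed [simp] u.Dom_farr [simp] u.Cod_farr [simp]
  u.farr_Ident [simp] u.farr_Comp [simp] u.fsrc [simp] u.ftgt [simp]

sublocale C': bidiagram I J C'
proof -
  have "is_functor (prod_cat I J) CAT C'"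
    by (rule is_functor_comp_ftr[OF is_functor_prod_ftr[OF u.is_functor_axioms is_functor_id_ftr[OF J.category_axioms]]
        is_functor_axioms])
  then show "bidiagram I J C'"
    unfolding bidiagram_def diagram_def using u.A.category_axioms J.category_axioms by simp
qed

lemma restricted_simps [simp]:
  "\<lbrakk>i \<in> Obj I; j \<in> Obj J\<rbrakk> \<Longrightarrow> fobj C' (i, j) = fobj C (fobj u i, j)"
  "\<lbrakk>\<alpha> \<in> Arr I; \<beta> \<in> Arr J\<rbrakk> \<Longrightarrow> farr C' (\<alpha>, \<beta>) = farr C (farr u \<alpha>, \<beta>)"
  by simp_all

lemma slice_restrict:
  "j \<in> Obj J \<Longrightarrow> slice_snd I' J C j \<circ>\<^sub>F u = slice_snd I J C' j"
  "i \<in> Obj I \<Longrightarrow> slice_fst J I' C (fobj u i) = slice_fst J I C' i"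
  "\<alpha> \<in> Arr I \<Longrightarrow> slice_fst_ntr J I' C (farr u \<alpha>) = slice_fst_ntr J I C' \<alpha>"
proof -
  show "slice_snd I' J C j \<circ>\<^sub>F u = slice_snd I J C' j" if "j \<in> Obj J"
    by (rule ftr_eqI) (simp_all add: that)
  show *: "slice_fst J I' C (fobj u i) = slice_fst J I C' i" if "i \<in> Obj I" for i
    by (rule ftr_eqI) (simp_all add: that)
  show "slice_fst_ntr J I' C (farr u \<alpha>) = slice_fst_ntr J I C' \<alpha>" if "\<alpha> \<in> Arr I"
    using that by (simp add: slice_fst_ntr_def * restrict_def fun_eq_iff)
qed

lemma hocolim_snd_restrict: "hocolim_snd I' J C \<circ>\<^sub>F u = hocolim_snd I J C'"
  by (rule ftr_eqI) (simp_all add: slice_restrict)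

lemma fixed_data_restrict:
  assumes "fixed_data I' J C j x \<rho>"
  shows "fixed_data I J C' j (\<lambda>i. x (fobj u i)) (\<lambda>\<alpha>. \<rho> (farr u \<alpha>))"
  unfolding fixed_data_def using fixed_dataD[OF assms] by simp

lemma fixed_map_data_restrict:
  assumes "fixed_data I' J C j x \<rho>" "fixed_data I' J C j' x' \<rho>'" "fixed_map_data I' J C j x \<rho> j' x' \<rho>' \<beta> m"
  shows "fixed_map_data I J C' j (\<lambda>i. x (fobj u i)) (\<lambda>\<alpha>. \<rho> (farr u \<alpha>))
    j' (\<lambda>i. x' (fobj u i)) (\<lambda>\<alpha>. \<rho>' (farr u \<alpha>)) \<beta> (\<lambda>i. m (fobj u i))"
  unfolding fixed_map_data_def
  using fixed_dataD(1)[OF assms(1)] fixed_dataD(1)[OF assms(2)] fixed_map_dataD[OF assms(3)]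
    fixed_map_dataD(7)[OF assms(3) u.farr_closed u.Cod_farr] by simp

lemma moving_data_restrict:
  assumes "moving_data I' J C j y \<beta> \<mu>"
  shows "moving_data I J C' (\<lambda>i. j (fobj u i)) (\<lambda>i. y (fobj u i)) (\<lambda>\<alpha>. \<beta> (farr u \<alpha>)) (\<lambda>\<alpha>. \<mu> (farr u \<alpha>))"
  unfolding moving_data_def using moving_dataD[OF assms] by simp

lemma moving_map_data_restrict:
  assumes "moving_data I' J C j y \<beta> \<mu>" "moving_data I' J C j' y' \<beta>' \<mu>'"
    "moving_map_data I' J C j y \<beta> \<mu> j' y' \<beta>' \<mu>' \<gamma> \<nu>"
  shows "moving_map_data I J C'
    (\<lambda>i. j (fobj u i)) (\<lambda>i. y (fobj u i)) (\<lambda>\<alpha>. \<beta> (farr u \<alpha>)) (\<lambda>\<alpha>. \<mu> (farr u \<alpha>))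
    (\<lambda>i. j' (fobj u i)) (\<lambda>i. y' (fobj u i)) (\<lambda>\<alpha>. \<beta>' (farr u \<alpha>)) (\<lambda>\<alpha>. \<mu>' (farr u \<alpha>))
    (\<lambda>i. \<gamma> (fobj u i)) (\<lambda>i. \<nu> (fobj u i))"
  unfolding moving_map_data_def
  using moving_dataD[OF assms(1)] moving_dataD[OF assms(2)] moving_map_dataD(1-6)[OF assms(3)]
    moving_map_dataD(7,8)[OF assms(3) u.farr_closed u.Cod_farr] by simp

lemma restrict_ftr_simps [simp]:
  "fsrc (hocolim_holim_restrict u J C) = hocolim_holim I' J C"
  "ftgt (hocolim_holim_restrict u J C) = hocolim_holim I J C'"
  "fsrc (holim_hocolim_restrict u J C) = holim_hocolim I' J C"
  "ftgt (holim_hocolim_restrict u J C) = holim_hocolim I J C'"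
  by (simp_all add: hocolim_holim_restrict_def holim_hocolim_restrict_def hocolim_map_def holim_restrict_def
      Let_def hocolim_snd_restrict)

lemma hocolim_holim_restrict_fixed_obj:
  assumes d: "fixed_data I' J C j x \<rho>"
  shows "fobj (hocolim_holim_restrict u J C) (fixed_obj I' J C j x \<rho>) =
    fixed_obj I J C' j (\<lambda>i. x (fobj u i)) (\<lambda>\<alpha>. \<rho> (farr u \<alpha>))"
proof -
  have j: "j \<in> Obj J" and s: "section_data (slice_snd I' J C j) x \<rho>"
    using d by (simp_all add: fixed_data_iff)
  show ?thesis
    using fixed_obj_in[OF d] j
      diagram.holim_restrict_simps(1)[OF diagram_slice_snd[OF j] u.is_functor_axioms s]
    by (simp add: hocolim_holim_restrict_def hocolim_map_def) (simp add: fixed_obj_def slice_restrict)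
qed

lemma hocolim_holim_restrict_fixed_arr:
  assumes d: "fixed_data I' J C j x \<rho>" "fixed_data I' J C j' x' \<rho>'" and m: "fixed_map_data I' J C j x \<rho> j' x' \<rho>' \<beta> m"
  shows "farr (hocolim_holim_restrict u J C)
      (fixed_arr I' J C (fixed_obj I' J C j x \<rho>) (fixed_obj I' J C j' x' \<rho>') \<beta> m) =
    fixed_arr I J C' (fixed_obj I J C' j (\<lambda>i. x (fobj u i)) (\<lambda>\<alpha>. \<rho> (farr u \<alpha>)))
      (fixed_obj I J C' j' (\<lambda>i. x' (fobj u i)) (\<lambda>\<alpha>. \<rho>' (farr u \<alpha>))) \<beta> (\<lambda>i. m (fobj u i))"
proof -
  note \<beta> = fixed_map_dataD(1-3)[OF m]
  have j: "j \<in> Obj J" "j' \<in> Obj J" using d by (auto simp: fixed_data_def)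
  note tr = fixed_transport[OF d(1) \<beta>]
  note d' = fixed_data_restrict[OF d(1)]
  have s: "section_data (slice_snd I' J C j) x \<rho>"
    "section_data (slice_snd I' J C j') (\<lambda>i. fobj (farr C (Ident I' i, \<beta>)) (x i))
      (\<lambda>\<alpha>. farr (farr C (Ident I' (Cod I' \<alpha>), \<beta>)) (\<rho> \<alpha>))" "section_data (slice_snd I' J C j') x' \<rho>'"
    "smap_data (slice_snd I' J C j') (\<lambda>i. fobj (farr C (Ident I' i, \<beta>)) (x i))
      (\<lambda>\<alpha>. farr (farr C (Ident I' (Cod I' \<alpha>), \<beta>)) (\<rho> \<alpha>)) x' \<rho>' m"
    using tr(1) d m by (simp_all add: fixed_data_iff fixed_map_data_iff)
  note R = diagram.holim_restrict_simps[OF diagram_slice_snd[OF j(1)] u.is_functor_axioms]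
    diagram.holim_restrict_simps[OF diagram_slice_snd[OF j(2)] u.is_functor_axioms]
  have t: "mk_section (slice_snd I J C' j') (\<lambda>i. fobj (farr C (Ident I' (fobj u i), \<beta>)) (x (fobj u i)))
      (\<lambda>\<alpha>. farr (farr C (Ident I' (Cod I' (farr u \<alpha>)), \<beta>)) (\<rho> (farr u \<alpha>))) =
    mk_section (slice_snd I J C' j') (\<lambda>i. fobj (farr C' (Ident I i, \<beta>)) (x (fobj u i)))
      (\<lambda>\<alpha>. farr (farr C' (Ident I (Cod I \<alpha>), \<beta>)) (\<rho> (farr u \<alpha>)))"
    by (rule diagram.mk_section_cong[OF C'.diagram_slice_snd[OF j(2)]]) (simp_all add: \<beta>)
  have "farr (hocolim_holim_restrict u J C)
      (fixed_arr I' J C (fixed_obj I' J C j x \<rho>) (fixed_obj I' J C j' x' \<rho>') \<beta> m) =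
    ((j, fobj (holim_restrict u (slice_snd I' J C j)) (mk_section (slice_snd I' J C j) x \<rho>)),
     (\<beta>, farr (holim_restrict u (slice_snd I' J C j')) (mk_smap (slice_snd I' J C j')
      (mk_section (slice_snd I' J C j') (\<lambda>i. fobj (farr C (Ident I' i, \<beta>)) (x i))
        (\<lambda>\<alpha>. farr (farr C (Ident I' (Cod I' \<alpha>), \<beta>)) (\<rho> \<alpha>))) (mk_section (slice_snd I' J C j') x' \<rho>') m)),
     (j', fobj (holim_restrict u (slice_snd I' J C j')) (mk_section (slice_snd I' J C j') x' \<rho>')))"
    using fixed_arr_in[OF d m] j unfolding fixed_arr_eq[OF d(1) \<beta>] tr(2)
    by (simp add: hocolim_holim_restrict_def hocolim_map_def del: HL.hocolim_simps C'.HL.hocolim_simps)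
  also have "\<dots> = fixed_arr I J C' (fixed_obj I J C' j (\<lambda>i. x (fobj u i)) (\<lambda>\<alpha>. \<rho> (farr u \<alpha>)))
      (fixed_obj I J C' j' (\<lambda>i. x' (fobj u i)) (\<lambda>\<alpha>. \<rho>' (farr u \<alpha>))) \<beta> (\<lambda>i. m (fobj u i))"
    unfolding C'.fixed_arr_eq[OF d' \<beta>] C'.fixed_transport(2)[OF d' \<beta>] R(1)[OF s(1)] R(3)[OF s(3)] R(4)[OF s(2-4)]
      slice_restrict(1)[OF j(1)] slice_restrict(1)[OF j(2)] t by (rule refl)
  finally show ?thesis .
qed

lemma holim_hocolim_restrict_moving_obj:
  assumes d: "moving_data I' J C j y \<beta> \<mu>"
  shows "fobj (holim_hocolim_restrict u J C) (moving_obj I' J C j y \<beta> \<mu>) =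
    moving_obj I J C' (\<lambda>i. j (fobj u i)) (\<lambda>i. y (fobj u i)) (\<lambda>\<alpha>. \<beta> (farr u \<alpha>)) (\<lambda>\<alpha>. \<mu> (farr u \<alpha>))"
  unfolding holim_hocolim_restrict_def u.ftgt moving_obj_def
    LH.holim_restrict_simps(1)[OF u.is_functor_axioms moving_section_data_iff[THEN iffD2, OF d]] hocolim_snd_restrict
  by (rule C'.LH.mk_section_cong) (simp_all add: moving_dataD[OF d])

lemma holim_hocolim_restrict_moving_arr:
  assumes d: "moving_data I' J C j y \<beta> \<mu>" "moving_data I' J C j' y' \<beta>' \<mu>'"
    and m: "moving_map_data I' J C j y \<beta> \<mu> j' y' \<beta>' \<mu>' \<gamma> \<nu>"
  shows "farr (holim_hocolim_restrict u J C)
      (moving_arr I' J C (moving_obj I' J C j y \<beta> \<mu>) (moving_obj I' J C j' y' \<beta>' \<mu>') \<gamma> \<nu>) =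
    moving_arr I J C'
      (moving_obj I J C' (\<lambda>i. j (fobj u i)) (\<lambda>i. y (fobj u i)) (\<lambda>\<alpha>. \<beta> (farr u \<alpha>)) (\<lambda>\<alpha>. \<mu> (farr u \<alpha>)))
      (moving_obj I J C' (\<lambda>i. j' (fobj u i)) (\<lambda>i. y' (fobj u i)) (\<lambda>\<alpha>. \<beta>' (farr u \<alpha>)) (\<lambda>\<alpha>. \<mu>' (farr u \<alpha>)))
      (\<lambda>i. \<gamma> (fobj u i)) (\<lambda>i. \<nu> (fobj u i))"
proof -
  note s = moving_section_data_iff[THEN iffD2, OF d(1)] moving_section_data_iff[THEN iffD2, OF d(2)]
    moving_smap_data_iff[THEN iffD2, OF d m]
  note o = holim_hocolim_restrict_moving_obj[OF d(1), unfolded holim_hocolim_restrict_def u.ftgt moving_obj_def[of I' J C]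
      LH.holim_restrict_simps(1)[OF u.is_functor_axioms s(1)]]
    holim_hocolim_restrict_moving_obj[OF d(2), unfolded holim_hocolim_restrict_def u.ftgt moving_obj_def[of I' J C]
      LH.holim_restrict_simps(1)[OF u.is_functor_axioms s(2)]]
  show ?thesis
    unfolding moving_arr_eq C'.moving_arr_eq
    unfolding holim_hocolim_restrict_def u.ftgt moving_obj_def[of I' J C]
      LH.holim_restrict_simps(2)[OF u.is_functor_axioms s] o
    unfolding hocolim_snd_restrict by (rule refl)
qed

lemma comparison_natural_restrict:
  "comparison I J C' \<circ>\<^sub>F hocolim_holim_restrict u J C = holim_hocolim_restrict u J C \<circ>\<^sub>F comparison I' J C"
proof (rule comp_ftr_eqI)
  fix a assume "a \<in> Obj (fsrc (hocolim_holim_restrict u J C))"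
  then have "a \<in> Obj (hocolim_holim I' J C)" by simp
  then obtain j x \<rho> where a: "fixed_data I' J C j x \<rho>" "a = fixed_obj I' J C j x \<rho>"
    by (rule fixed_objE)
  show "fobj (comparison I J C') (fobj (hocolim_holim_restrict u J C) a) =
      fobj (holim_hocolim_restrict u J C) (fobj (comparison I' J C) a)"
    unfolding a(2) hocolim_holim_restrict_fixed_obj[OF a(1)] comparison_fixed_obj(2)[OF a(1)]
      C'.comparison_fixed_obj(2)[OF fixed_data_restrict[OF a(1)]]
      holim_hocolim_restrict_moving_obj[OF moving_data_of_fixed[OF a(1)]] by (rule refl)
next
  fix f assume "f \<in> Arr (fsrc (hocolim_holim_restrict u J C))"
  then have "f \<in> Arr (hocolim_holim I' J C)" by simp
  then obtain j x \<rho> j' x' \<rho>' \<beta> m where a: "fixed_data I' J C j x \<rho>" "fixed_data I' J C j' x' \<rho>'"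
    "fixed_map_data I' J C j x \<rho> j' x' \<rho>' \<beta> m"
    "f = fixed_arr I' J C (fixed_obj I' J C j x \<rho>) (fixed_obj I' J C j' x' \<rho>') \<beta> m"
    by (rule fixed_arrE)
  note md = moving_data_of_fixed[OF a(1)] moving_data_of_fixed[OF a(2)] moving_map_data_of_fixed[OF a(1-3)]
  show "farr (comparison I J C') (farr (hocolim_holim_restrict u J C) f) =
      farr (holim_hocolim_restrict u J C) (farr (comparison I' J C) f)"
    unfolding a(4) hocolim_holim_restrict_fixed_arr[OF a(1-3)] comparison_fixed_arr[OF a(1-3)]
      C'.comparison_fixed_arr[OF fixed_data_restrict[OF a(1)] fixed_data_restrict[OF a(2)] fixed_map_data_restrict[OF a(1-3)]]
      holim_hocolim_restrict_moving_arr[OF md] by (rule refl)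
qed simp_all

text \<open>
The functor for \<open>I'\<close> pushes the component over \<open>u i\<close> along the value at \<open>\<epsilon>' (u i)\<close> to the coordinate over \<open>e'\<close>, the
functor for \<open>I\<close> along the value at \<open>u (\<epsilon> i)\<close> to the coordinate over \<open>u e\<close>. These agree when \<open>u\<close> preserves the
pseudo-final object and its natural map.
\<close>

lemma retraction_natural_restrict:
  assumes "pseudo_final I e \<epsilon>" "pseudo_final I' e' \<epsilon>'" and pres: "preserves_pseudo_final u e \<epsilon> e' \<epsilon>'"
  shows "final_retraction I e \<epsilon> J C' \<circ>\<^sub>F holim_hocolim_restrict u J C =
    hocolim_holim_restrict u J C \<circ>\<^sub>F final_retraction I' e' \<epsilon>' J C"
proof -
  interpret CF: bidiagram_final I' J C e' \<epsilon>' by unfold_locales fact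
  interpret CF': bidiagram_final I J C' e \<epsilon> by unfold_locales fact
  have ue: "fobj u e = e'" and ueps: "farr u (ncomp \<epsilon> i) = ncomp \<epsilon>' (fobj u i)" if "i \<in> Obj I" for i
    using pres that by (simp_all add: preserves_pseudo_final_def)
  note ue = ue[OF CF'.e_in]
  show ?thesis
  proof (rule comp_ftr_eqI)
    have obj: "fobj (final_retraction I e \<epsilon> J C') (moving_obj I J C' (\<lambda>i. j (fobj u i)) (\<lambda>i. y (fobj u i))
          (\<lambda>\<alpha>. \<beta> (farr u \<alpha>)) (\<lambda>\<alpha>. \<mu> (farr u \<alpha>))) =
        fobj (hocolim_holim_restrict u J C) (fobj (final_retraction I' e' \<epsilon>' J C) (moving_obj I' J C j y \<beta> \<mu>))"
      if d: "moving_data I' J C j y \<beta> \<mu>" for j y \<beta> \<mu>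
      unfolding CF.retraction_moving_obj(2)[OF d] CF'.retraction_moving_obj(2)[OF moving_data_restrict[OF d]]
        hocolim_holim_restrict_fixed_obj[OF CF.fixed_data_retraction[OF d]] ue
      by (rule C'.fixed_obj_cong) (simp_all add: moving_dataD[OF d] ueps del: comp_ftr_simps)
    {
      fix T assume "T \<in> Obj (fsrc (holim_hocolim_restrict u J C))"
      then have "T \<in> Obj (holim_hocolim I' J C)" by simp
      then obtain j y \<beta> \<mu> where d: "moving_data I' J C j y \<beta> \<mu>" and T: "T = moving_obj I' J C j y \<beta> \<mu>"
        by (rule moving_objE)
      show "fobj (final_retraction I e \<epsilon> J C') (fobj (holim_hocolim_restrict u J C) T) =
          fobj (hocolim_holim_restrict u J C) (fobj (final_retraction I' e' \<epsilon>' J C) T)"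
        unfolding T holim_hocolim_restrict_moving_obj[OF d] by (rule obj[OF d])
    next
      fix f assume "f \<in> Arr (fsrc (holim_hocolim_restrict u J C))"
      then have f: "f \<in> Arr (holim_hocolim I' J C)" by simp
      then obtain j y \<beta> \<mu> j' y' \<beta>' \<mu>' \<gamma> \<nu> where d: "moving_data I' J C j y \<beta> \<mu>" "moving_data I' J C j' y' \<beta>' \<mu>'"
        and m: "moving_map_data I' J C j y \<beta> \<mu> j' y' \<beta>' \<mu>' \<gamma> \<nu>"
        and f': "f = moving_arr I' J C (moving_obj I' J C j y \<beta> \<mu>) (moving_obj I' J C j' y' \<beta>' \<mu>') \<gamma> \<nu>"
        by (rule moving_arrE)
      note dD = moving_data_restrict[OF d(1)] moving_data_restrict[OF d(2)] moving_map_data_restrict[OF d m]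
      note cr = CF.fixed_data_retraction[OF d(1)] CF.fixed_data_retraction[OF d(2)] CF.fixed_map_data_retraction[OF d m]
      show "farr (final_retraction I e \<epsilon> J C') (farr (holim_hocolim_restrict u J C) f) =
          farr (hocolim_holim_restrict u J C) (farr (final_retraction I' e' \<epsilon>' J C) f)"
        unfolding f' holim_hocolim_restrict_moving_arr[OF d m] CF.retraction_moving_arr[OF d f[unfolded f']]
          CF'.retraction_moving_arr[OF dD(1,2) C'.moving_arr_in[OF dD]] obj[OF d(1)] obj[OF d(2)]
        unfolding CF.retraction_moving_obj(2)[OF d(1)] CF.retraction_moving_obj(2)[OF d(2)]
          hocolim_holim_restrict_fixed_arr[OF cr] hocolim_holim_restrict_fixed_obj[OF cr(1)]
          hocolim_holim_restrict_fixed_obj[OF cr(2)] ue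
        by (rule C'.fixed_arr_cong)
          (use moving_dataD[OF d(1)] moving_dataD[OF d(2)] moving_map_dataD(1-6)[OF m] ueps in \<open>simp_all del: comp_ftr_simps\<close>)
    }
  qed simp_all
qed

end

section \<open>Classifying spaces\<close>

lemma category_ord_cat: "category (ord_cat n)"
  by unfold_locales (auto simp: ord_cat_def)

lemma ord_cat_simps [simp]:
  "i \<in> Obj (ord_cat n) \<longleftrightarrow> i \<le> n"
  "f \<in> Arr (ord_cat n) \<longleftrightarrow> fst f \<le> snd f \<and> snd f \<le> n"
  "Dom (ord_cat n) = fst" "Cod (ord_cat n) = snd" "Ident (ord_cat n) i = (i, i)"
  "Comp (ord_cat n) g f = (fst f, snd g)"
  by (auto simp: ord_cat_def split: prod.splits)

text \<open>
A functor between finite ordinals is determined by its values on objects. This packages a monotone map as a functor.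
\<close>

definition mono_ftr :: "nat \<Rightarrow> nat \<Rightarrow> (nat \<Rightarrow> nat) \<Rightarrow> (nat, nat \<times> nat, nat, nat \<times> nat) ftr" where
  "mono_ftr m n a = \<lparr>fsrc = ord_cat m, ftgt = ord_cat n, fobj = (\<lambda>i\<in>{..m}. a i),
    farr = (\<lambda>f\<in>Arr (ord_cat m). (a (fst f), a (snd f)))\<rparr>"

lemma mono_ftr_simps [simp]:
  "fsrc (mono_ftr m n a) = ord_cat m" "ftgt (mono_ftr m n a) = ord_cat n"
  "i \<le> m \<Longrightarrow> fobj (mono_ftr m n a) i = a i"
  "i \<le> j \<Longrightarrow> j \<le> m \<Longrightarrow> farr (mono_ftr m n a) (i, j) = (a i, a j)"
  by (simp_all add: mono_ftr_def)

lemma is_functor_mono_ftr: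
  assumes "\<And>i j. i \<le> j \<Longrightarrow> j \<le> m \<Longrightarrow> a i \<le> a j" "\<And>i. i \<le> m \<Longrightarrow> a i \<le> n"
  shows "is_functor (ord_cat m) (ord_cat n) (mono_ftr m n a)"
  by (rule is_functorI) (auto simp: mono_ftr_def category_ord_cat assms extensional_def)

lemma ord_functorD:
  assumes "is_functor (ord_cat m) (ord_cat n) \<theta>"
  shows "i \<le> j \<Longrightarrow> j \<le> m \<Longrightarrow> fobj \<theta> i \<le> fobj \<theta> j" "i \<le> m \<Longrightarrow> fobj \<theta> i \<le> n"
    "i \<le> j \<Longrightarrow> j \<le> m \<Longrightarrow> farr \<theta> (i, j) = (fobj \<theta> i, fobj \<theta> j)"
proof -
  interpret is_functor "ord_cat m" "ord_cat n" \<theta> by fact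
  show "i \<le> m \<Longrightarrow> fobj \<theta> i \<le> n" using fobj_closed[of i] by simp
  show *: "farr \<theta> (i, j) = (fobj \<theta> i, fobj \<theta> j)" if "i \<le> j" "j \<le> m"
    using Dom_farr[of "(i, j)"] Cod_farr[of "(i, j)"] that by (simp add: prod_eq_iff)
  show "fobj \<theta> i \<le> fobj \<theta> j" if "i \<le> j" "j \<le> m"
    using farr_closed[of "(i, j)"] that by (simp add: *)
qed

lemma standard_simplexI:
  assumes "\<And>i. 0 \<le> t i" "\<And>i. i > n \<Longrightarrow> t i = 0" "sum t {..n} = 1"
  shows "t \<in> standard_simplex n"
proof -
  have "t i \<le> 1" for i
    using member_le_sum[of i "{..n}" t] assms by (cases "i \<le> n") auto
  with assms show ?thesis by (simp add: standard_simplex_def)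
qed

text \<open>
Pushing forward adds up coordinates over the fibres of a map, so partial sums of the result are sums over preimages.
\<close>

lemma sum_simplex_push:
  assumes "finite L"
  shows "sum (simplex_push m a t) L = sum t {i. i \<le> m \<and> a i \<in> L}"
proof -
  have "sum (simplex_push m a t) L = (\<Sum>l\<in>L. sum t {i \<in> {i. i \<le> m \<and> a i \<in> L}. a i = l})"
    unfolding simplex_push_def by (intro sum.cong refl) (auto intro!: arg_cong[of _ _ "sum t"])
  also have "\<dots> = sum t {i. i \<le> m \<and> a i \<in> L}"
    by (rule sum.group) (auto simp: assms)
  finally show ?thesis .
qed

lemma simplex_push_in:
  assumes "is_functor (ord_cat m) (ord_cat n) \<theta>" "t \<in> standard_simplex m"
  shows "simplex_push m (fobj \<theta>) t \<in> standard_simplex n"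
proof -
  have t: "0 \<le> t i" "t i \<le> 1" "sum t {..m} = 1" for i
    using assms(2) by (auto simp: standard_simplex_def)
  have nn: "0 \<le> simplex_push m (fobj \<theta>) t j" for j
    by (simp add: simplex_push_def sum_nonneg t)
  have "{i. i \<le> m \<and> fobj \<theta> i \<in> {..n}} = {..m}"
    using ord_functorD(2)[OF assms(1)] by auto
  then have sum: "sum (simplex_push m (fobj \<theta>) t) {..n} = 1"
    by (simp add: sum_simplex_push t)
  have zero: "simplex_push m (fobj \<theta>) t j = 0" if "j > n" for j
  proof -
    have "{i. i \<le> m \<and> fobj \<theta> i = j} = {}"
      using ord_functorD(2)[OF assms(1)] that by fastforce
    then show ?thesis by (simp add: simplex_push_def del: Collect_empty_eq)
  qed
  show ?thesis by (rule standard_simplexI) (use nn zero sum in auto)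
qed

lemma topspace_nerve_coproduct:
  "((n, \<sigma>), t) \<in> topspace (nerve_coproduct C) \<longleftrightarrow> \<sigma> \<in> nerve C n \<and> t \<in> standard_simplex n"
  by (auto simp: nerve_coproduct_def)

lemma equiv_realization_rel: "equiv (topspace (nerve_coproduct C)) (realization_rel C)"
proof (rule equivI)
  show "realization_rel C \<subseteq> topspace (nerve_coproduct C) \<times> topspace (nerve_coproduct C)"
    by (auto simp: realization_rel_def)
  show "refl_on (topspace (nerve_coproduct C)) (realization_rel C)"
    by (auto simp: refl_on_def realization_rel_def)
  show "sym (realization_rel C)"
    by (auto simp: sym_def realization_rel_def intro: equivclp_sym)
  show "trans (realization_rel C)"
    by (auto simp: trans_def realization_rel_def intro: equivclp_trans)
qed

definition point_class :: "('o, 'a) cat \<Rightarrow> ('o, 'a) nerve_point \<Rightarrow> ('o, 'a) nerve_point set" where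
  "point_class C p = realization_rel C `` {p}"

lemma point_class_glue:
  assumes "\<sigma> \<in> nerve C n" "is_functor (ord_cat m) (ord_cat n) \<theta>" "t \<in> standard_simplex m"
  shows "point_class C ((m, \<sigma> \<circ>\<^sub>F \<theta>), t) = point_class C ((n, \<sigma>), simplex_push m (fobj \<theta>) t)"
proof -
  have "nerve_glue C ((m, \<sigma> \<circ>\<^sub>F \<theta>), t) ((n, \<sigma>), simplex_push m (fobj \<theta>) t)"
    using assms by (rule nerve_glue.intros)
  moreover have "\<sigma> \<circ>\<^sub>F \<theta> \<in> nerve C m"
    using assms is_functor_comp_ftr by (auto simp: nerve_def)
  ultimately have "(((m, \<sigma> \<circ>\<^sub>F \<theta>), t), ((n, \<sigma>), simplex_push m (fobj \<theta>) t)) \<in> realization_rel C"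
    using assms simplex_push_in
    by (auto simp: realization_rel_def topspace_nerve_coproduct)
  then show ?thesis
    unfolding point_class_def by (rule equiv_class_eq[OF equiv_realization_rel])
qed

text \<open>
A function on the points of the coproduct descends to the realization as soon as it respects the gluing of one
simplex along one simplicial operator, because the kernel of a function is an equivalence relation.
\<close>

lemma realization_rel_respects:
  assumes "\<And>\<sigma> n m \<theta> t. \<lbrakk>\<sigma> \<in> nerve C n; is_functor (ord_cat m) (ord_cat n) \<theta>; t \<in> standard_simplex m\<rbrakk>
      \<Longrightarrow> h ((m, \<sigma> \<circ>\<^sub>F \<theta>), t) = h ((n, \<sigma>), simplex_push m (fobj \<theta>) t)"
    and "(p, q) \<in> realization_rel C"
  shows "h p = h q"
proof -
  have glue: "h p = h q" if "nerve_glue C p q" for p q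
    using that by cases (simp add: assms(1))
  have "equivclp (nerve_glue C) p q" using assms(2) by (simp add: realization_rel_def)
  then show ?thesis by induction (auto dest: glue)
qed

text \<open>
The open sets of the quotient were defined through unions of classes, and such a union is the preimage under the
projection.
\<close>

lemma quotient_map_quotient_topology:
  assumes "equiv (topspace X) R"
  shows "quotient_map X (quotient_topology X R) (\<lambda>x. R `` {x})"
proof -
  have top: "topspace (quotient_topology X R) = topspace X // R"
  proof -
    have "openin (quotient_topology X R) (topspace X // R)"
      by (simp add: openin_quotient_topology[OF assms] Union_quotient[OF assms])
    moreover have "topspace (quotient_topology X R) \<subseteq> topspace X // R"
      using openin_topspace[of "quotient_topology X R"]
      by (simp only: openin_quotient_topology[OF assms])
    ultimately show ?thesis using openin_subset by blast
  qed
  have pre: "{x \<in> topspace X. R `` {x} \<in> U} = \<Union>U" if "U \<subseteq> topspace X // R" for U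
  proof
    show "{x \<in> topspace X. R `` {x} \<in> U} \<subseteq> \<Union>U"
      using equiv_class_self[OF assms] by auto
    show "\<Union>U \<subseteq> {x \<in> topspace X. R `` {x} \<in> U}"
    proof
      fix x assume "x \<in> \<Union>U"
      then obtain c where c: "c \<in> U" "x \<in> c" by auto
      with that obtain y where y: "y \<in> topspace X" "c = R `` {y}"
        by (auto simp: quotient_def)
      with c have "(y, x) \<in> R" by auto
      then have "R `` {y} = R `` {x}" "x \<in> topspace X"
        using equiv_class_eq[OF assms] equivE[OF assms] by blast+
      with c y show "x \<in> {x \<in> topspace X. R `` {x} \<in> U}" by simp
    qed
  qed
  show ?thesis
    unfolding quotient_map_def top
  proof (intro conjI allI impI)
    show "(\<lambda>x. R `` {x}) ` topspace X = topspace X // R"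
      by (auto simp: quotient_def)
    show "openin X {x \<in> topspace X. R `` {x} \<in> U} = openin (quotient_topology X R) U"
      if "U \<subseteq> topspace X // R" for U
      using that by (simp add: openin_quotient_topology[OF assms] pre)
  qed
qed

lemma quotient_map_point_class:
  "quotient_map (nerve_coproduct C) (classifying_space C) (point_class C)"
  using quotient_map_quotient_topology[OF equiv_realization_rel]
  by (simp add: classifying_space_def point_class_def[abs_def])

lemma topspace_classifying_space:
  "topspace (classifying_space C) = point_class C ` topspace (nerve_coproduct C)"
  using quotient_imp_surjective_map[OF quotient_map_point_class, of C] by simp

lemma nerve_comp: "is_functor C D F \<Longrightarrow> \<sigma> \<in> nerve C n \<Longrightarrow> F \<circ>\<^sub>F \<sigma> \<in> nerve D n"
  by (auto simp: nerve_def intro: is_functor_comp_ftr)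

text \<open>
The image of a class is defined as the union of the classes of the images of all its points. It is a single class,
since composing with \<open>F\<close> commutes with simplicial operators.
\<close>

lemma classifying_map_point_class:
  assumes F: "is_functor C D F" and p: "((n, \<sigma>), t) \<in> topspace (nerve_coproduct C)"
  shows "classifying_map F (point_class C ((n, \<sigma>), t)) = point_class D ((n, F \<circ>\<^sub>F \<sigma>), t)"
proof -
  interpret F: is_functor C D F by fact
  define h where "h p = point_class D (case p of ((n, \<sigma>), t) \<Rightarrow> ((n, F \<circ>\<^sub>F \<sigma>), t))" for p
  have "h ((m, \<sigma> \<circ>\<^sub>F \<theta>), t) = h ((n, \<sigma>), simplex_push m (fobj \<theta>) t)"
    if "\<sigma> \<in> nerve C n" "is_functor (ord_cat m) (ord_cat n) \<theta>" "t \<in> standard_simplex m" for \<sigma> n m \<theta> t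
    using that point_class_glue[OF nerve_comp[OF F that(1)] that(2,3)]
    by (simp add: h_def nerve_def comp_ftr_assoc is_functor.fsrc[of _ _ \<sigma>])
  then have "h q = h ((n, \<sigma>), t)" if "q \<in> point_class C ((n, \<sigma>), t)" for q
    using realization_rel_respects[of C h "((n, \<sigma>), t)" q] that by (simp add: point_class_def)
  moreover have "((n, \<sigma>), t) \<in> point_class C ((n, \<sigma>), t)"
    unfolding point_class_def by (rule equiv_class_self[OF equiv_realization_rel p])
  ultimately have "(\<Union>q\<in>point_class C ((n, \<sigma>), t). h q) = h ((n, \<sigma>), t)" by blast
  moreover have "classifying_map F (point_class C ((n, \<sigma>), t)) = (\<Union>q\<in>point_class C ((n, \<sigma>), t). h q)"
    unfolding classifying_map_def h_def point_class_def F.ftgt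
    by (simp add: Image_eq_UN[of _ "_ ` _"] case_prod_unfold)
  ultimately show ?thesis by (simp add: h_def)
qed

abbreviation simplex_space :: "nat \<Rightarrow> (nat \<Rightarrow> real) topology" where
  "simplex_space n \<equiv> subtopology (powertop_real UNIV) (standard_simplex n)"

lemma continuous_map_point_class:
  assumes "\<sigma> \<in> nerve C n"
  shows "continuous_map (simplex_space n) (classifying_space C) (\<lambda>t. point_class C ((n, \<sigma>), t))"
proof -
  have "continuous_map (simplex_space n) (nerve_coproduct C) (\<lambda>t. ((n, \<sigma>), t))"
    using continuous_map_component_injection[of "(n, \<sigma>)" "SIGMA n:UNIV. nerve C n"
        "\<lambda>(n, \<sigma>). simplex_space n"] assms
    by (simp add: nerve_coproduct_def)
  then show ?thesis
    using continuous_map_compose[OF _ quotient_imp_continuous_map[OF quotient_map_point_class]]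
    by (fastforce simp: o_def)
qed

text \<open>
The summands are open, hence so are the corresponding pieces of the product, and continuity can be tested on each of
them.
\<close>

lemma continuous_map_prod_sum_topology:
  assumes "\<And>i. i \<in> I \<Longrightarrow> continuous_map (prod_topology Z (X i)) Y (\<lambda>(z, x). f (z, i, x))"
  shows "continuous_map (prod_topology Z (sum_topology X I)) Y f"
proof -
  define T where "T i = topspace Z \<times> ({i} \<times> topspace (X i))" for i
  have open_slice: "openin (sum_topology X I) ({i} \<times> U)" if "i \<in> I" "openin (X i) U" for i U
  proof -
    have "{x. (j, x) \<in> {i} \<times> U} = (if j = i then U else {})" for j by auto
    then show ?thesis
      using that openin_subset[OF that(2)] by (auto simp: openin_sum_topology)
  qed
  show ?thesis
  proof (rule pasting_lemma[where I = I and T = T and f = "\<lambda>_. f"])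
    fix i assume i: "i \<in> I"
    show "openin (prod_topology Z (sum_topology X I)) (T i)"
      unfolding T_def openin_prod_Times_iff using open_slice[OF i openin_topspace] by simp
    have "continuous_map (subtopology (sum_topology X I) ({i} \<times> topspace (X i))) (X i) snd"
      unfolding continuous_map_def
    proof (intro conjI allI impI)
      fix U assume U: "openin (X i) U"
      have "{x \<in> topspace (subtopology (sum_topology X I) ({i} \<times> topspace (X i))). snd x \<in> U} =
          {i} \<times> U"
        using i openin_subset[OF U] by auto
      then show "openin (subtopology (sum_topology X I) ({i} \<times> topspace (X i)))
          {x \<in> topspace (subtopology (sum_topology X I) ({i} \<times> topspace (X i))). snd x \<in> U}"
        using open_slice[OF i U] openin_subset[OF U] by (auto simp: openin_subtopology)
    qed auto
    then have "continuous_map (prod_topology Z (subtopology (sum_topology X I) ({i} \<times> topspace (X i))))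
        (prod_topology Z (X i)) (\<lambda>(z, p). (z, snd p))"
      by (simp add: continuous_map_prod_top)
    from continuous_map_compose[OF this assms[OF i]]
    have "continuous_map (prod_topology Z (subtopology (sum_topology X I) ({i} \<times> topspace (X i))))
        Y ((\<lambda>(z, x). f (z, i, x)) \<circ> (\<lambda>(z, p). (z, snd p)))" .
    then have "continuous_map (prod_topology Z (subtopology (sum_topology X I) ({i} \<times> topspace (X i))))
        Y f"
      by (rule continuous_map_eq) auto
    then show "continuous_map (subtopology (prod_topology Z (sum_topology X I)) (T i)) Y f"
      by (simp add: T_def subtopology_Times subtopology_topspace)
  qed (auto simp: T_def)
qed

lemma continuous_map_sum_topology:
  assumes "\<And>i. i \<in> I \<Longrightarrow> continuous_map (X i) Y (\<lambda>x. f (i, x))"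
  shows "continuous_map (sum_topology X I) Y f"
  unfolding continuous_map_def
proof (intro conjI allI impI)
  show "f \<in> topspace (sum_topology X I) \<rightarrow> topspace Y"
    using assms by (fastforce dest: continuous_map_funspace)
  fix U assume U: "openin Y U"
  have "openin (X i) {x \<in> topspace (X i). f (i, x) \<in> U}" if "i \<in> I" for i
    using assms[OF that] U by (auto simp: continuous_map_def)
  then show "openin (sum_topology X I) {x \<in> topspace (sum_topology X I). f x \<in> U}"
    by (auto simp: openin_sum_topology)
qed

lemma continuous_map_classifying_map:
  assumes F: "is_functor C D F"
  shows "continuous_map (classifying_space C) (classifying_space D) (classifying_map F)"
proof -
  have "continuous_map (nerve_coproduct C) (classifying_space D) (classifying_map F \<circ> point_class C)"
    unfolding nerve_coproduct_def
  proof (rule continuous_map_sum_topology)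
    fix i assume i: "i \<in> (SIGMA n:UNIV. nerve C n)"
    obtain n \<sigma> where n: "i = (n, \<sigma>)" and \<sigma>: "\<sigma> \<in> nerve C n"
      using i by auto
    have "continuous_map (simplex_space n) (classifying_space D) (\<lambda>t. point_class D ((n, F \<circ>\<^sub>F \<sigma>), t))"
      by (rule continuous_map_point_class[OF nerve_comp[OF F \<sigma>]])
    then have "continuous_map (simplex_space n) (classifying_space D)
        (\<lambda>t. (classifying_map F \<circ> point_class C) ((n, \<sigma>), t))"
      by (rule continuous_map_eq)
        (simp add: classifying_map_point_class[OF F] topspace_nerve_coproduct \<sigma>)
    then show "continuous_map (case i of (n, \<sigma>) \<Rightarrow> simplex_space n) (classifying_space D)
        (\<lambda>x. (classifying_map F \<circ> point_class C) (i, x))"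
      by (simp add: n)
  qed
  then show ?thesis
    by (simp add: continuous_compose_quotient_map_eq[OF quotient_map_point_class])
qed

lemma classifying_map_comp:
  assumes "is_functor A B F" "is_functor B C G" "c \<in> topspace (classifying_space A)"
  shows "classifying_map (G \<circ>\<^sub>F F) c = classifying_map G (classifying_map F c)"
proof -
  obtain n \<sigma> t where c: "c = point_class A ((n, \<sigma>), t)"
    and p: "((n, \<sigma>), t) \<in> topspace (nerve_coproduct A)"
    using assms(3) by (auto simp: topspace_classifying_space)
  have "is_functor (ord_cat n) A \<sigma>"
    using p by (simp add: topspace_nerve_coproduct nerve_def)
  moreover have "((n, F \<circ>\<^sub>F \<sigma>), t) \<in> topspace (nerve_coproduct B)"
    using p nerve_comp[OF assms(1)] by (simp add: topspace_nerve_coproduct)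
  ultimately show ?thesis
    unfolding c classifying_map_point_class[OF is_functor_comp_ftr[OF assms(1,2)] p]
      classifying_map_point_class[OF assms(1) p]
    using assms(1) by (simp add: classifying_map_point_class[OF assms(2)] comp_ftr_assoc is_functor.fsrc)
qed

lemma classifying_map_id:
  assumes "category A" "c \<in> topspace (classifying_space A)"
  shows "classifying_map (id_ftr A) c = c"
proof -
  obtain n \<sigma> t where c: "c = point_class A ((n, \<sigma>), t)"
    and p: "((n, \<sigma>), t) \<in> topspace (nerve_coproduct A)"
    using assms(2) by (auto simp: topspace_classifying_space)
  then show ?thesis
    unfolding c classifying_map_point_class[OF is_functor_id_ftr[OF assms(1)] p]
    by (auto simp: topspace_nerve_coproduct nerve_def)
qed

section \<open>Cutting a simplex at a height\<close>

text \<open>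
If the pieces of lengths \<open>t 0, t 1, \<dots>\<close> are laid end to end, the height \<open>s\<close> lies in the \<open>k\<close>-th piece, end points
included. At an end point there are several such \<open>k\<close>, and the homotopy must not depend on the choice.
\<close>

definition cuts :: "nat \<Rightarrow> real \<Rightarrow> (nat \<Rightarrow> real) \<Rightarrow> bool" where
  "cuts k s t \<longleftrightarrow> sum t {..<k} \<le> s \<and> s \<le> sum t {..k}"

text \<open>
The lengths after the \<open>k\<close>-th piece has been cut in two at the height \<open>s\<close>.
\<close>

definition split_at :: "nat \<Rightarrow> real \<Rightarrow> (nat \<Rightarrow> real) \<Rightarrow> nat \<Rightarrow> real" where
  "split_at k s t = (\<lambda>j. if j < k then t j else if j = k then s - sum t {..<k}
    else if j = Suc k then sum t {..k} - s else t (j - 1))"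

lemma standard_simplexD:
  assumes "t \<in> standard_simplex n"
  shows "0 \<le> t i" "i > n \<Longrightarrow> t i = 0" "sum t {..n} = 1"
  using assms by (auto simp: standard_simplex_def)

lemma split_at_in:
  assumes "k \<le> n" "t \<in> standard_simplex n" "cuts k s t"
  shows "split_at k s t \<in> standard_simplex (Suc n)"
proof (rule standard_simplexI)
  note t = standard_simplexD[OF assms(2)]
  show "0 \<le> split_at k s t i" for i
    using assms(3) t(1) by (auto simp: split_at_def cuts_def)
  show "split_at k s t i = 0" if "i > Suc n" for i
    using that assms(1) t(2) by (auto simp: split_at_def)
  have "{..Suc n} = {..<k} \<union> ({k, Suc k} \<union> {Suc (Suc k)..Suc n})"
    using assms(1) by auto
  then have "sum (split_at k s t) {..Suc n} = sum (split_at k s t) {..<k} +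
      (sum (split_at k s t) {k, Suc k} + sum (split_at k s t) {Suc (Suc k)..Suc n})"
    by (simp only:) (subst sum.union_disjoint; auto)+
  also have "sum (split_at k s t) {..<k} = sum t {..<k}"
    by (simp add: split_at_def)
  also have "sum (split_at k s t) {k, Suc k} = t k"
    by (simp add: split_at_def lessThan_Suc_atMost[symmetric])
  also have "sum (split_at k s t) {Suc (Suc k)..Suc n} = sum t {Suc k..n}"
    by (subst sum.shift_bounds_cl_Suc_ivl) (simp add: split_at_def)
  also have "sum t {..<k} + (t k + sum t {Suc k..n}) = sum t {..n}"
  proof -
    have "{..n} = {..<k} \<union> ({k} \<union> {Suc k..n})" using assms(1) by auto
    then show ?thesis by (simp only:) (subst sum.union_disjoint; auto)+
  qed
  finally show "sum (split_at k s t) {..Suc n} = 1" using t(3) by simp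
qed

text \<open>
The coface that misses the vertex \<open>k\<close>.
\<close>

definition face :: "nat \<Rightarrow> nat \<Rightarrow> (nat, nat \<times> nat, nat, nat \<times> nat) ftr" where
  "face n k = mono_ftr n (Suc n) (\<lambda>i. if i < k then i else Suc i)"

lemma is_functor_face: "is_functor (ord_cat n) (ord_cat (Suc n)) (face n k)"
  unfolding face_def by (rule is_functor_mono_ftr) auto

lemma simplex_push_face:
  assumes "t \<in> standard_simplex n" "k \<le> Suc n"
  shows "simplex_push n (fobj (face n k)) t = (\<lambda>j. if j < k then t j else if j = k then 0 else t (j - 1))"
proof
  fix j
  note t = standard_simplexD[OF assms(1)]
  have "{i. i \<le> n \<and> fobj (face n k) i = j} =
      (if j < k then {j} else if j = k \<or> j > Suc n then {} else {j - 1})"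
    using assms(2) by (auto simp: face_def split: if_splits)
  then show "simplex_push n (fobj (face n k)) t j = (if j < k then t j else if j = k then 0 else t (j - 1))"
    by (auto simp: simplex_push_def t(2))
qed

lemma sum_disjoint_union:
  assumes "C = A \<union> B" "finite A" "finite B" "A \<inter> B = {}"
  shows "sum f C = sum f A + sum f B"
  using assms by (simp add: sum.union_disjoint)

text \<open>
Cutting commutes with simplicial operators: if \<open>s\<close> lies in piece \<open>k\<close>, then after the operator \<open>a\<close> it lies in piece
\<open>a k\<close>, the first \<open>k\<close> pieces together with the lower part of the cut one are sent below the cut by \<open>a\<close>, and the rest
above it by \<open>a\<close> shifted by one. The proof compares the \<open>l\<close>-th coordinates; only the two next to the cut, at \<open>a k\<close> and
\<open>Suc (a k)\<close>, combine several pieces with one of the two parts.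
\<close>

lemma simplex_push_split_at:
  assumes \<theta>: "\<And>i j. i \<le> j \<Longrightarrow> j \<le> m \<Longrightarrow> a i \<le> (a j :: nat)" and k: "k \<le> m"
  shows "simplex_push (Suc m) (\<lambda>i. if i \<le> k then a i else Suc (a (i - 1))) (split_at k s t) =
    split_at (a k) s (simplex_push m a t)" (is "simplex_push _ ?b _ = _")
proof
  fix l
  have le: "a i \<le> a k" if "i \<le> k" for i
    using \<theta> that k by simp
  have ge: "a k \<le> a i" if "k \<le> i" "i \<le> m" for i
    using \<theta> that by simp
  have low: "i \<le> Suc m \<and> ?b i = l \<longleftrightarrow> i \<le> k \<and> a i = l" if "l \<le> a k" for i
  proof (cases "i \<le> k")
    case False
    then obtain i' where "i = Suc i'" "k \<le> i'" by (cases i) auto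
    then show ?thesis using that ge[of i'] by auto
  qed (use k in auto)
  have high: "{i. i \<le> Suc m \<and> ?b i = l} = Suc ` {i. k \<le> i \<and> i \<le> m \<and> a i = l - 1}" if "a k < l"
    unfolding set_eq_iff
  proof
    fix i
    show "i \<in> {i. i \<le> Suc m \<and> ?b i = l} \<longleftrightarrow> i \<in> Suc ` {i. k \<le> i \<and> i \<le> m \<and> a i = l - 1}"
    proof (cases "i \<le> k")
      case True
      then show ?thesis using le[of i] that by auto
    next
      case False
      then obtain i' where "i = Suc i'" "k \<le> i'" by (cases i) auto
      then show ?thesis using that by auto
    qed
  qed
  consider "l < a k" | "l = a k" | "l = Suc (a k)" | "l > Suc (a k)" by linarith
  then show "simplex_push (Suc m) ?b (split_at k s t) l = split_at (a k) s (simplex_push m a t) l"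
  proof cases
    case 1
    have "i \<le> Suc m \<and> ?b i = l \<longleftrightarrow> i \<le> m \<and> a i = l" for i
      using low[of i] 1 ge[of i] k by (cases "i \<le> k") auto
    then have "simplex_push (Suc m) ?b (split_at k s t) l = sum (split_at k s t) {i. i \<le> m \<and> a i = l}"
      unfolding simplex_push_def by presburger
    also have "\<dots> = sum t {i. i \<le> m \<and> a i = l}"
    proof (rule sum.cong)
      fix i assume "i \<in> {i. i \<le> m \<and> a i = l}"
      then have "i < k" using 1 ge[of i] by force
      then show "split_at k s t i = t i" by (simp add: split_at_def)
    qed simp
    finally show ?thesis using 1 by (simp add: simplex_push_def split_at_def)
  next
    case 2
    let ?E = "{i. i < k \<and> a i = a k}"
    have set: "{i. i \<le> Suc m \<and> ?b i = l} = insert k ?E"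
      using low 2 by (auto simp: le_less)
    have "{..<k} = ?E \<union> {i. i \<le> m \<and> a i \<in> {..<a k}}"
    proof (rule Set.set_eqI)
      fix i show "i \<in> {..<k} \<longleftrightarrow> i \<in> ?E \<union> {i. i \<le> m \<and> a i \<in> {..<a k}}"
        using le[of i] ge[of i] k by (cases "i < k") auto
    qed
    then have "sum t {..<k} = sum t ?E + sum t {i. i \<le> m \<and> a i \<in> {..<a k}}"
      by (rule sum_disjoint_union) auto
    then show ?thesis
      using 2 unfolding simplex_push_def[of "Suc m"] set
      by (simp add: split_at_def sum_simplex_push)
  next
    case 3
    let ?E = "{i. k < i \<and> i \<le> m \<and> a i = a k}"
    have "{i. k \<le> i \<and> i \<le> m \<and> a i = l - 1} = insert k ?E"
      using 3 k by auto
    then have set: "{i. i \<le> Suc m \<and> ?b i = l} = insert (Suc k) (Suc ` ?E)"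
      using high 3 by simp
    have "{i. i \<le> m \<and> a i \<in> {..a k}} = {..k} \<union> ?E"
    proof (rule Set.set_eqI)
      fix i show "i \<in> {i. i \<le> m \<and> a i \<in> {..a k}} \<longleftrightarrow> i \<in> {..k} \<union> ?E"
        using le[of i] ge[of i] k by (cases "i \<le> k") auto
    qed
    then have "sum t {i. i \<le> m \<and> a i \<in> {..a k}} = sum t {..k} + sum t ?E"
      by (rule sum_disjoint_union) auto
    moreover have "sum (split_at k s t) (insert (Suc k) (Suc ` ?E)) =
        split_at k s t (Suc k) + sum (split_at k s t) (Suc ` ?E)"
      by (rule sum.insert) auto
    moreover have "sum (split_at k s t) (Suc ` ?E) = sum t ?E"
      by (subst sum.reindex) (auto simp: split_at_def intro!: sum.cong)
    ultimately show ?thesis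
      using 3 unfolding simplex_push_def[of "Suc m"] set
      by (simp add: split_at_def sum_simplex_push)
  next
    case 4
    have "k \<le> i \<and> i \<le> m \<and> a i = l - 1 \<longleftrightarrow> i \<le> m \<and> a i = l - 1" for i
      using 4 le[of i] by (cases "k \<le> i") auto
    then have set: "{i. i \<le> Suc m \<and> ?b i = l} = Suc ` {i. i \<le> m \<and> a i = l - 1}"
      using high 4 by simp
    have "sum (split_at k s t) (Suc ` {i. i \<le> m \<and> a i = l - 1}) = sum t {i. i \<le> m \<and> a i = l - 1}"
    proof (subst sum.reindex)
      have "split_at k s t (Suc i) = t i" if "i \<le> m" "a i = l - 1" for i
      proof -
        have "k < i" using that 4 le[of i] by force
        then show ?thesis by (simp add: split_at_def)
      qed
      then show "sum (split_at k s t \<circ> Suc) {i. i \<le> m \<and> a i = l - 1} = sum t {i. i \<le> m \<and> a i = l - 1}"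
        by (intro sum.cong) auto
    qed simp
    then show ?thesis
      using 4 unfolding simplex_push_def[of "Suc m"] set
      by (simp add: split_at_def simplex_push_def)
  qed
qed

lemma cuts_simplex_push:
  assumes "t \<in> standard_simplex m" "\<And>i j. i \<le> j \<Longrightarrow> j \<le> m \<Longrightarrow> a i \<le> (a j :: nat)" "k \<le> m" "cuts k s t"
  shows "cuts (a k) s (simplex_push m a t)"
proof -
  note t = standard_simplexD[OF assms(1)]
  have "sum t {i. i \<le> m \<and> a i \<in> {..<a k}} \<le> sum t {..<k}"
    by (rule sum_mono2) (use t(1) assms(2)[of k] in \<open>auto simp: not_le[symmetric]\<close>)
  moreover have "sum t {..k} \<le> sum t {i. i \<le> m \<and> a i \<in> {..a k}}"
    by (rule sum_mono2) (use t(1) assms(2,3) in auto)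
  ultimately show ?thesis
    using assms(4) by (simp add: cuts_def sum_simplex_push)
qed

lemma cuts_exists:
  assumes "t \<in> standard_simplex n" "0 \<le> s" "s \<le> 1"
  shows "cuts (LEAST k. s \<le> sum t {..k}) s t" "(LEAST k. s \<le> sum t {..k}) \<le> n"
proof -
  note t = standard_simplexD[OF assms(1)]
  let ?k = "LEAST k. s \<le> sum t {..k}"
  have n: "s \<le> sum t {..n}" using t(3) assms(3) by simp
  show "?k \<le> n" using n by (rule Least_le)
  have "s \<le> sum t {..?k}" using n by (rule LeastI)
  moreover have "sum t {..<?k} \<le> s"
  proof (cases ?k)
    case 0
    then show ?thesis using assms(2) by simp
  next
    case (Suc k)
    then have "\<not> s \<le> sum t {..k}" using not_less_Least[of k "\<lambda>k. s \<le> sum t {..k}"] by simp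
    then show ?thesis unfolding Suc by (simp add: lessThan_Suc_atMost)
  qed
  ultimately show "cuts ?k s t" by (simp add: cuts_def)
qed

section \<open>Natural transformations induce homotopies\<close>

context nat_transf
begin

text \<open>
The chain \<open>F x\<^sub>0, \<dots>, F x\<^sub>k, G x\<^sub>k, \<dots>, G x\<^sub>n\<close> of length \<open>n + 1\<close>. An arrow that crosses from the first part to the second
applies \<open>\<tau>\<close> at its source and then moves on by \<open>G\<close>. Indices in the second part are shifted down by one.
\<close>

definition prism :: "nat \<Rightarrow> nat \<Rightarrow> ('o, 'a) simplex \<Rightarrow> ('p, 'b) simplex" where
  "prism k n \<sigma> = \<lparr>fsrc = ord_cat (Suc n), ftgt = B,
    fobj = (\<lambda>i\<in>{..Suc n}. if i \<le> k then fobj F (fobj \<sigma> i) else fobj G (fobj \<sigma> (i - 1))),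
    farr = (\<lambda>(i, j)\<in>Arr (ord_cat (Suc n)). if j \<le> k then farr F (farr \<sigma> (i, j))
      else if i \<le> k then Comp B (farr G (farr \<sigma> (i, j - 1))) (ncomp \<tau> (fobj \<sigma> i))
      else farr G (farr \<sigma> (i - 1, j - 1)))\<rparr>"

lemma prism_simps [simp]:
  "fsrc (prism k n \<sigma>) = ord_cat (Suc n)" "ftgt (prism k n \<sigma>) = B"
  "i \<le> Suc n \<Longrightarrow> fobj (prism k n \<sigma>) i = (if i \<le> k then fobj F (fobj \<sigma> i) else fobj G (fobj \<sigma> (i - 1)))"
  "i \<le> j \<Longrightarrow> j \<le> Suc n \<Longrightarrow> farr (prism k n \<sigma>) (i, j) = (if j \<le> k then farr F (farr \<sigma> (i, j))
      else if i \<le> k then Comp B (farr G (farr \<sigma> (i, j - 1))) (ncomp \<tau> (fobj \<sigma> i))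
      else farr G (farr \<sigma> (i - 1, j - 1)))"
  by (simp_all add: prism_def)

lemma prism_ext:
  "fobj (prism k n \<sigma>) \<in> extensional (Obj (ord_cat (Suc n)))"
  "farr (prism k n \<sigma>) \<in> extensional (Arr (ord_cat (Suc n)))"
  by (auto simp: prism_def extensional_def)

lemma ncomp_closed: "x \<in> Obj A \<Longrightarrow> ncomp \<tau> x \<in> Arr B"
  using ncomp_in by (rule PiE_mem)

text \<open>
The composition law is clear within each of the two parts. When a composite crosses, either the second factor does,
and the naturality of \<open>\<tau>\<close> moves \<open>\<tau>\<close> to the source of the first factor, or the first factor does, and associativity
suffices.
\<close>

lemma prism_in_nerve:
  assumes "\<sigma> \<in> nerve A n" "k \<le> n"
  shows "prism k n \<sigma> \<in> nerve B (Suc n)"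
proof -
  interpret S: is_functor "ord_cat n" A \<sigma>
    using assms(1) by (simp add: nerve_def)
  have obj: "fobj \<sigma> i \<in> Obj A" if "i \<le> n" for i
    using S.fobj_closed that by simp
  have arr: "farr \<sigma> (i, j) \<in> Arr A" "Dom A (farr \<sigma> (i, j)) = fobj \<sigma> i" "Cod A (farr \<sigma> (i, j)) = fobj \<sigma> j"
    if "i \<le> j" "j \<le> n" for i j
    using S.farr_closed[of "(i, j)"] S.Dom_farr[of "(i, j)"] S.Cod_farr[of "(i, j)"] that by simp_all
  have ident: "farr \<sigma> (i, i) = Ident A (fobj \<sigma> i)" if "i \<le> n" for i
    using S.farr_Ident[of i] that by simp
  have comp: "Comp A (farr \<sigma> (j, l)) (farr \<sigma> (i, j)) = farr \<sigma> (i, l)" if "i \<le> j" "j \<le> l" "l \<le> n" for i j l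
    using S.farr_Comp[of "(i, j)" "(j, l)"] that by simp
  note clo = obj arr ncomp_closed F.fobj_closed G.fobj_closed F.farr_closed G.farr_closed
    F.Dom_farr F.Cod_farr G.Dom_farr G.Cod_farr Dom_ncomp Cod_ncomp F.B.Comp_in F.B.Dom_Comp F.B.Cod_Comp
  have "is_functor (ord_cat (Suc n)) B (prism k n \<sigma>)"
  proof (rule is_functorI)
    show "fobj (prism k n \<sigma>) \<in> extensional (Obj (ord_cat (Suc n)))"
      "farr (prism k n \<sigma>) \<in> extensional (Arr (ord_cat (Suc n)))"
      by (fact prism_ext)+
    fix i assume "i \<in> Obj (ord_cat (Suc n))"
    then show "fobj (prism k n \<sigma>) i \<in> Obj B"
      "farr (prism k n \<sigma>) (Ident (ord_cat (Suc n)) i) = Ident B (fobj (prism k n \<sigma>) i)"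
      using assms(2) by (auto simp: clo ident F.farr_Ident G.farr_Ident)
  next
    fix f assume f: "f \<in> Arr (ord_cat (Suc n))"
    then show "farr (prism k n \<sigma>) f \<in> Arr B"
      "Dom B (farr (prism k n \<sigma>) f) = fobj (prism k n \<sigma>) (Dom (ord_cat (Suc n)) f)"
      "Cod B (farr (prism k n \<sigma>) f) = fobj (prism k n \<sigma>) (Cod (ord_cat (Suc n)) f)"
      using assms(2) by (cases f; auto simp: clo)+
    fix g assume g: "g \<in> Arr (ord_cat (Suc n))" and fg: "Cod (ord_cat (Suc n)) f = Dom (ord_cat (Suc n)) g"
    obtain i j l where ijl: "f = (i, j)" "g = (j, l)" "i \<le> j" "j \<le> l" "l \<le> Suc n"
      using f g fg by (cases f; cases g) auto
    consider "l \<le> k" | "j \<le> k" "k < l" | "i \<le> k" "k < j" | "k < i" by linarith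
    then have "farr (prism k n \<sigma>) (i, l) = Comp B (farr (prism k n \<sigma>) (j, l)) (farr (prism k n \<sigma>) (i, j))"
    proof cases
      case 1
      then show ?thesis
        using ijl assms(2) F.farr_Comp[of "farr \<sigma> (i, j)" "farr \<sigma> (j, l)"] by (simp add: arr comp)
    next
      case 2
      have "Comp B (Comp B (farr G (farr \<sigma> (j, l - 1))) (ncomp \<tau> (fobj \<sigma> j))) (farr F (farr \<sigma> (i, j)))
        = Comp B (farr G (farr \<sigma> (j, l - 1))) (Comp B (ncomp \<tau> (fobj \<sigma> j)) (farr F (farr \<sigma> (i, j))))"
        using 2 ijl assms(2) by (subst F.B.Comp_assoc) (auto simp: clo)
      also have "Comp B (ncomp \<tau> (fobj \<sigma> j)) (farr F (farr \<sigma> (i, j))) =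
          Comp B (farr G (farr \<sigma> (i, j))) (ncomp \<tau> (fobj \<sigma> i))"
        using naturality[of "farr \<sigma> (i, j)"] 2 ijl assms(2) by (simp add: arr)
      also have "Comp B (farr G (farr \<sigma> (j, l - 1))) \<dots> =
          Comp B (Comp B (farr G (farr \<sigma> (j, l - 1))) (farr G (farr \<sigma> (i, j)))) (ncomp \<tau> (fobj \<sigma> i))"
        using 2 ijl assms(2) by (subst F.B.Comp_assoc) (auto simp: clo)
      also have "Comp B (farr G (farr \<sigma> (j, l - 1))) (farr G (farr \<sigma> (i, j))) = farr G (farr \<sigma> (i, l - 1))"
        using 2 ijl assms(2) G.farr_Comp[of "farr \<sigma> (i, j)" "farr \<sigma> (j, l - 1)"] by (simp add: arr comp)
      finally show ?thesis using 2 ijl by simp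
    next
      case 3
      have "Comp B (farr G (farr \<sigma> (j - 1, l - 1))) (Comp B (farr G (farr \<sigma> (i, j - 1))) (ncomp \<tau> (fobj \<sigma> i)))
        = Comp B (Comp B (farr G (farr \<sigma> (j - 1, l - 1))) (farr G (farr \<sigma> (i, j - 1)))) (ncomp \<tau> (fobj \<sigma> i))"
        using 3 ijl assms(2) by (subst F.B.Comp_assoc) (auto simp: clo)
      also have "Comp B (farr G (farr \<sigma> (j - 1, l - 1))) (farr G (farr \<sigma> (i, j - 1))) = farr G (farr \<sigma> (i, l - 1))"
        using 3 ijl assms(2) G.farr_Comp[of "farr \<sigma> (i, j - 1)" "farr \<sigma> (j - 1, l - 1)"] by (simp add: arr comp)
      finally show ?thesis using 3 ijl by simp
    next
      case 4
      then show ?thesis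
        using ijl assms(2) G.farr_Comp[of "farr \<sigma> (i - 1, j - 1)" "farr \<sigma> (j - 1, l - 1)"]
        by (simp add: arr comp)
    qed
    then show "farr (prism k n \<sigma>) (Comp (ord_cat (Suc n)) g f) =
        Comp B (farr (prism k n \<sigma>) g) (farr (prism k n \<sigma>) f)"
      using ijl by simp
  qed (use F.B.category_axioms category_ord_cat in simp_all)
  then show ?thesis by (simp add: nerve_def)
qed

text \<open>
The counterpart of \<open>simplex_push_split_at\<close> for chains, with the same operator \<open>b\<close>. It rests on the fact that \<open>b i\<close> is
in the first part of the prism at \<open>\<theta> k\<close> exactly when \<open>i\<close> is in the first part of the prism at \<open>k\<close>.
\<close>

lemma prism_comp:
  assumes \<sigma>: "\<sigma> \<in> nerve A n" and \<theta>: "is_functor (ord_cat m) (ord_cat n) \<theta>" and k: "k \<le> m"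
  defines "b \<equiv> \<lambda>i. if i \<le> k then fobj \<theta> i else Suc (fobj \<theta> (i - 1))"
  shows "is_functor (ord_cat (Suc m)) (ord_cat (Suc n)) (mono_ftr (Suc m) (Suc n) b)"
    and "prism (fobj \<theta> k) n \<sigma> \<circ>\<^sub>F mono_ftr (Suc m) (Suc n) b = prism k m (\<sigma> \<circ>\<^sub>F \<theta>)"
proof -
  note th = ord_functorD[OF \<theta>]
  have bb: "b i \<le> b j" if "i \<le> j" "j \<le> Suc m" for i j
  proof (cases "j \<le> k")
    case True
    then show ?thesis using that k th(1)[of i j] by (simp add: b_def)
  next
    case False
    then obtain j' where j': "j = Suc j'" "k \<le> j'" by (cases j) auto
    show ?thesis
    proof (cases "i \<le> k")
      case True
      then show ?thesis using False that j' th(1)[of i j'] by (simp add: b_def)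
    next
      case False
      then obtain i' where "i = Suc i'" "k \<le> i'" by (cases i) auto
      then show ?thesis using j' that th(1)[of i' j'] by (simp add: b_def)
    qed
  qed
  have bn: "b i \<le> Suc n" if "i \<le> Suc m" for i
    using that k th(2)[of i] by (cases i) (auto simp: b_def th(2) le_SucI)
  show "is_functor (ord_cat (Suc m)) (ord_cat (Suc n)) (mono_ftr (Suc m) (Suc n) b)"
    by (rule is_functor_mono_ftr) (auto simp: bb bn)
  have src: "fsrc \<theta> = ord_cat m" using \<theta> by (rule is_functor.fsrc)
  have le: "b i \<le> fobj \<theta> k \<longleftrightarrow> i \<le> k" if "i \<le> Suc m" for i
  proof (cases "i \<le> k")
    case True
    then show ?thesis using th(1)[of i k] k by (simp add: b_def)
  next
    case False
    then obtain i' where "i = Suc i'" "k \<le> i'" by (cases i) auto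
    then show ?thesis using that th(1)[of k i'] by (simp add: b_def)
  qed
  show "prism (fobj \<theta> k) n \<sigma> \<circ>\<^sub>F mono_ftr (Suc m) (Suc n) b = prism k m (\<sigma> \<circ>\<^sub>F \<theta>)"
  proof (rule ftr_eqI)
    fix x assume "x \<in> Obj (fsrc (prism (fobj \<theta> k) n \<sigma> \<circ>\<^sub>F mono_ftr (Suc m) (Suc n) b))"
    then have x: "x \<le> Suc m" by simp
    show "fobj (prism (fobj \<theta> k) n \<sigma> \<circ>\<^sub>F mono_ftr (Suc m) (Suc n) b) x = fobj (prism k m (\<sigma> \<circ>\<^sub>F \<theta>)) x"
    proof (cases x)
      case 0
      then show ?thesis using x le[of x] bn[of x] by (simp add: b_def src)
    next
      case (Suc x')
      then show ?thesis using x k le[of x] bn[of x] by (simp add: b_def src)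
    qed
  next
    fix f assume "f \<in> Arr (fsrc (prism (fobj \<theta> k) n \<sigma> \<circ>\<^sub>F mono_ftr (Suc m) (Suc n) b))"
    then obtain i j where f: "f = (i, j)" "i \<le> j" "j \<le> Suc m" by (cases f) auto
    show "farr (prism (fobj \<theta> k) n \<sigma> \<circ>\<^sub>F mono_ftr (Suc m) (Suc n) b) f = farr (prism k m (\<sigma> \<circ>\<^sub>F \<theta>)) f"
    proof (cases "j \<le> k")
      case True
      then show ?thesis
        using f k le[of i] le[of j] bb[of i j] bn[of j] by (simp add: b_def src th)
    next
      case False
      then obtain j' where j': "j = Suc j'" "k \<le> j'" by (cases j) auto
      show ?thesis
      proof (cases "i \<le> k")
        case True
        then show ?thesis
          using f k j' le[of i] le[of j] bb[of i j] bn[of j] by (simp add: b_def src th)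
      next
        case False
        then obtain i' where "i = Suc i'" "k \<le> i'" by (cases i) auto
        then show ?thesis
          using f k j' le[of i] le[of j] bb[of i j] bn[of j] by (simp add: b_def src th)
      qed
    qed
  next
    show "fobj (prism k m (\<sigma> \<circ>\<^sub>F \<theta>))
        \<in> extensional (Obj (fsrc (prism (fobj \<theta> k) n \<sigma> \<circ>\<^sub>F mono_ftr (Suc m) (Suc n) b)))"
      "farr (prism k m (\<sigma> \<circ>\<^sub>F \<theta>))
        \<in> extensional (Arr (fsrc (prism (fobj \<theta> k) n \<sigma> \<circ>\<^sub>F mono_ftr (Suc m) (Suc n) b)))"
      by (simp_all add: prism_ext)
  qed simp_all
qed

end

lemma simplex_push_cong:
  "(\<And>i. i \<le> m \<Longrightarrow> a i = b i) \<Longrightarrow> simplex_push m a t = simplex_push m b t"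
  unfolding simplex_push_def by (intro ext sum.cong) auto

lemma simplex_push_mono_ftr: "simplex_push m (fobj (mono_ftr m n a)) t = simplex_push m a t"
  by (rule simplex_push_cong) simp

lemma sum_initial_mono:
  assumes "t \<in> standard_simplex n" "i \<le> j"
  shows "sum t {..<i} \<le> sum t {..<j}" "sum t {..i} \<le> sum t {..j}" "sum t {..<i} \<le> sum t {..i}"
  using assms by (auto intro!: sum_mono2 standard_simplexD(1))

context nat_transf
begin

text \<open>
The point at time \<open>s\<close> of the homotopy, computed with the piece \<open>k\<close>.
\<close>

definition cell :: "nat \<Rightarrow> real \<Rightarrow> nat \<Rightarrow> ('o, 'a) simplex \<Rightarrow> (nat \<Rightarrow> real) \<Rightarrow> ('p, 'b) nerve_point set" where
  "cell k s n \<sigma> t = point_class B ((Suc n, prism k n \<sigma>), split_at k s t)"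

text \<open>
If \<open>s\<close> is the common end point of the pieces \<open>k\<close> and \<open>k + 1\<close>, both ways of cutting give the vertex \<open>k + 1\<close> of the prism
the weight zero. Without that vertex the two chains coincide.
\<close>

lemma cell_step:
  assumes \<sigma>: "\<sigma> \<in> nerve A n" and t: "t \<in> standard_simplex n" and k: "Suc k \<le> n"
    and c: "cuts k s t" "cuts (Suc k) s t"
  shows "cell k s n \<sigma> t = cell (Suc k) s n \<sigma> t"
proof -
  have s: "s = sum t {..k}"
    using c by (simp add: cuts_def lessThan_Suc_atMost)
  \<comment> \<open>Either way of cutting gives the missing vertex the weight zero.\<close>
  have push: "split_at k s t = simplex_push n (fobj (face n (Suc k))) t"
    "split_at (Suc k) s t = simplex_push n (fobj (face n (Suc k))) t"
    using k by (auto simp: simplex_push_face[OF t] split_at_def s fun_eq_iff lessThan_Suc_atMost[symmetric] less_Suc_eq)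
  have common: "prism k n \<sigma> \<circ>\<^sub>F face n (Suc k) = prism (Suc k) n \<sigma> \<circ>\<^sub>F face n (Suc k)"
  proof (rule comp_ftr_eqI)
    fix f assume "f \<in> Arr (fsrc (face n (Suc k)))"
    then obtain i j where "f = (i, j)" "i \<le> j" "j \<le> n" by (cases f) (auto simp: face_def)
    then show "farr (prism k n \<sigma>) (farr (face n (Suc k)) f) = farr (prism (Suc k) n \<sigma>) (farr (face n (Suc k)) f)"
      by (simp add: face_def)
  qed (auto simp: face_def)
  have kn: "k \<le> n" using k by simp
  show ?thesis
    unfolding cell_def push
    by (simp add: point_class_glue[OF prism_in_nerve[OF \<sigma> kn] is_functor_face t, symmetric]
        point_class_glue[OF prism_in_nerve[OF \<sigma> k] is_functor_face t, symmetric] common)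
qed

text \<open>
If \<open>s\<close> lies in two pieces, the pieces between them have length zero, so \<open>s\<close> lies in all of them and one can pass from
one to the next.
\<close>

lemma cell_unique:
  assumes \<sigma>: "\<sigma> \<in> nerve A n" and t: "t \<in> standard_simplex n"
    and "k \<le> n" "cuts k s t" "k' \<le> n" "cuts k' s t"
  shows "cell k s n \<sigma> t = cell k' s n \<sigma> t"
proof -
  have *: "cell k s n \<sigma> t = cell k' s n \<sigma> t" if "k \<le> k'" "k' \<le> n" "cuts k s t" "cuts k' s t" for k k'
    using that
  proof (induction rule: inc_induct)
    case (step i)
    note m = sum_initial_mono[OF t]
    have c: "cuts (Suc i) s t"
      using step.prems m(1)[of "Suc i" k'] m(2)[of i "Suc i"] step.hyps
      by (auto simp: cuts_def lessThan_Suc_atMost)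
    then show ?case
      using cell_step[OF \<sigma> t _ step.prems(2) c] step.IH step.prems step.hyps by simp
  qed simp
  show ?thesis
    using nat_le_linear[of k k']
  proof
    assume "k \<le> k'"
    then show ?thesis using assms by (intro *)
  next
    assume "k' \<le> k"
    then show ?thesis using assms by (intro *[symmetric])
  qed
qed

lemma cell_glue:
  assumes \<sigma>: "\<sigma> \<in> nerve A n" and \<theta>: "is_functor (ord_cat m) (ord_cat n) \<theta>"
    and t: "t \<in> standard_simplex m" and k: "k \<le> m" "cuts k s t"
  shows "cell k s m (\<sigma> \<circ>\<^sub>F \<theta>) t = cell (fobj \<theta> k) s n \<sigma> (simplex_push m (fobj \<theta>) t)"
proof -
  note th = ord_functorD[OF \<theta>]
  have push: "split_at (fobj \<theta> k) s (simplex_push m (fobj \<theta>) t) =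
      simplex_push (Suc m) (\<lambda>i. if i \<le> k then fobj \<theta> i else Suc (fobj \<theta> (i - 1))) (split_at k s t)"
    by (rule simplex_push_split_at[symmetric]) (use th(1) k in auto)
  show ?thesis
    unfolding cell_def push prism_comp(2)[OF \<sigma> \<theta> k(1), symmetric]
    by (subst point_class_glue[OF prism_in_nerve[OF \<sigma> th(2)[OF k(1)]] prism_comp(1)[OF \<sigma> \<theta> k(1)]
          split_at_in[OF k(1) t k(2)]])
      (simp only: simplex_push_mono_ftr)
qed

text \<open>
The least admissible piece serves as a definite choice.
\<close>

definition homotopy :: "real \<Rightarrow> ('o, 'a) nerve_point \<Rightarrow> ('p, 'b) nerve_point set" where
  "homotopy s = (\<lambda>((n, \<sigma>), t). cell (LEAST k. s \<le> sum t {..k}) s n \<sigma> t)"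

lemma homotopy_eq_cell:
  assumes "\<sigma> \<in> nerve A n" "t \<in> standard_simplex n" "k \<le> n" "cuts k s t"
  shows "homotopy s ((n, \<sigma>), t) = cell k s n \<sigma> t"
proof -
  have "0 \<le> sum t {..<k}"
    by (intro sum_nonneg standard_simplexD(1)[OF assms(2)])
  then have "0 \<le> s"
    using assms(4) by (simp add: cuts_def)
  moreover have "s \<le> 1"
    using assms(3,4) sum_initial_mono(2)[OF assms(2,3)] standard_simplexD(3)[OF assms(2)]
    by (simp add: cuts_def)
  ultimately show ?thesis
    unfolding homotopy_def 
    by (simp add: cell_unique[OF assms(1,2) cuts_exists(2,1)[OF assms(2)] assms(3,4)])
qed

lemma homotopy_respects:
  assumes "0 \<le> s" "s \<le> 1" "(p, q) \<in> realization_rel A"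
  shows "homotopy s p = homotopy s q"
proof (rule realization_rel_respects[OF _ assms(3)])
  fix \<sigma> n m \<theta> t
  assume \<sigma>: "\<sigma> \<in> nerve A n" and \<theta>: "is_functor (ord_cat m) (ord_cat n) \<theta>" and t: "t \<in> standard_simplex m"
  obtain k where k: "k \<le> m" "cuts k s t"
    using cuts_exists[OF t assms(1,2)] by blast
  note th = ord_functorD[OF \<theta>]
  have "\<sigma> \<circ>\<^sub>F \<theta> \<in> nerve A m"
    using \<sigma> \<theta> by (auto simp: nerve_def intro: is_functor_comp_ftr)
  moreover have "cuts (fobj \<theta> k) s (simplex_push m (fobj \<theta>) t)"
    by (rule cuts_simplex_push[OF t _ k]) (use th(1) in auto)
  ultimately show "homotopy s ((m, \<sigma> \<circ>\<^sub>F \<theta>), t) = homotopy s ((n, \<sigma>), simplex_push m (fobj \<theta>) t)"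
    using cell_glue[OF \<sigma> \<theta> t k] homotopy_eq_cell[OF _ t k]
      homotopy_eq_cell[OF \<sigma> simplex_push_in[OF \<theta> t] th(2)[OF k(1)]]
    by simp
qed

text \<open>
At height \<open>0\<close> the cut is below everything: the lower part has weight zero and leaves \<open>G\<close>. At height \<open>1\<close> the upper part
has weight zero and leaves \<open>F\<close>.
\<close>

lemma homotopy_end:
  assumes \<sigma>: "\<sigma> \<in> nerve A n" and t: "t \<in> standard_simplex n"
  shows "homotopy 0 ((n, \<sigma>), t) = point_class B ((n, G \<circ>\<^sub>F \<sigma>), t)" (is ?zero)
    and "homotopy 1 ((n, \<sigma>), t) = point_class B ((n, F \<circ>\<^sub>F \<sigma>), t)" (is ?one)
proof -
  have src: "fsrc \<sigma> = ord_cat n" using \<sigma> by (simp add: nerve_def is_functor.fsrc)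
  note s = standard_simplexD[OF t]
  have "prism 0 n \<sigma> \<circ>\<^sub>F face n 0 = G \<circ>\<^sub>F \<sigma>"
  proof (rule comp_ftr_eqI)
    fix f assume "f \<in> Arr (fsrc (face n 0))"
    then obtain i j where "f = (i, j)" "i \<le> j" "j \<le> n" by (cases f) (auto simp: face_def)
    then show "farr (prism 0 n \<sigma>) (farr (face n 0) f) = farr G (farr \<sigma> f)"
      by (simp add: face_def)
  qed (auto simp: face_def src G.ftgt)
  moreover have "split_at 0 0 t = simplex_push n (fobj (face n 0)) t"
    by (auto simp: simplex_push_face[OF t] split_at_def fun_eq_iff)
  moreover have "cuts 0 0 t" using s(1)[of 0] by (simp add: cuts_def)
  ultimately show ?zero
    using homotopy_eq_cell[OF \<sigma> t, of 0 0]
      point_class_glue[OF prism_in_nerve[OF \<sigma>, of 0] is_functor_face t, of 0]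
    by (simp add: cell_def)
  have "prism n n \<sigma> \<circ>\<^sub>F face n (Suc n) = F \<circ>\<^sub>F \<sigma>"
  proof (rule comp_ftr_eqI)
    fix f assume "f \<in> Arr (fsrc (face n (Suc n)))"
    then obtain i j where "f = (i, j)" "i \<le> j" "j \<le> n" by (cases f) (auto simp: face_def)
    then show "farr (prism n n \<sigma>) (farr (face n (Suc n)) f) = farr F (farr \<sigma> f)"
      by (simp add: face_def)
  qed (auto simp: face_def src F.ftgt)
  moreover have "split_at n 1 t = simplex_push n (fobj (face n (Suc n))) t"
    using s(2,3) by (auto simp: simplex_push_face[OF t] split_at_def fun_eq_iff lessThan_Suc_atMost[symmetric] less_Suc_eq)
  moreover have "cuts n 1 t"
    using s(1)[of n] s(3) by (simp add: cuts_def lessThan_Suc_atMost[symmetric])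
  ultimately show ?one
    using homotopy_eq_cell[OF \<sigma> t, of n 1]
      point_class_glue[OF prism_in_nerve[OF \<sigma>, of n] is_functor_face t, of "Suc n"]
    by (simp add: cell_def)
qed

end

lemma continuous_map_split_at:
  "continuous_map (prod_topology (top_of_set {0..1}) (simplex_space n)) (powertop_real UNIV)
    (\<lambda>(s, t). split_at k s t)"
proof -
  let ?X = "prod_topology (top_of_set {0..1::real}) (simplex_space n)"
  have fst: "continuous_map ?X euclideanreal fst"
    by (rule continuous_map_into_fulltopology[OF continuous_map_fst])
  have "continuous_map (simplex_space n) euclideanreal (\<lambda>t. t i)" for i
    by (intro continuous_map_from_subtopology continuous_map_product_projection) simp
  from continuous_map_compose[OF continuous_map_snd this]
  have coord: "continuous_map ?X euclideanreal (\<lambda>x. snd x i)" for i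
    by (simp add: o_def)
  have "continuous_map ?X euclideanreal (\<lambda>x. split_at k (fst x) (snd x) j)" for j
    unfolding split_at_def
    by (cases "j < k"; cases "j = k"; cases "j = Suc k")
      (auto intro!: coord continuous_map_diff continuous_map_sum fst)
  then show ?thesis
    by (simp add: continuous_map_componentwise_UNIV case_prod_unfold)
qed

lemma closedin_cuts:
  "closedin (prod_topology (top_of_set {0..1}) (simplex_space n))
    {(s, t) \<in> {0..1} \<times> standard_simplex n. cuts k s t}"
proof -
  let ?X = "prod_topology (top_of_set {0..1::real}) (simplex_space n)"
  have fst: "continuous_map ?X euclideanreal fst"
    by (rule continuous_map_into_fulltopology[OF continuous_map_fst])
  have "continuous_map (simplex_space n) euclideanreal (\<lambda>t. t i)" for i
    by (intro continuous_map_from_subtopology continuous_map_product_projection) simp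
  from continuous_map_compose[OF continuous_map_snd this]
  have coord: "continuous_map ?X euclideanreal (\<lambda>x. snd x i)" for i
    by (simp add: o_def)
  have "continuous_map ?X euclideanreal (\<lambda>x. fst x - sum (snd x) {..<k})"
    "continuous_map ?X euclideanreal (\<lambda>x. sum (snd x) {..k} - fst x)"
    by (intro continuous_map_diff continuous_map_sum fst coord; simp)+
  from closedin_continuous_map_preimage[OF this(1), of "{0..}"] closedin_continuous_map_preimage[OF this(2), of "{0..}"]
  have "closedin ?X ({x \<in> topspace ?X. fst x - sum (snd x) {..<k} \<in> {0..}} \<inter>
      {x \<in> topspace ?X. sum (snd x) {..k} - fst x \<in> {0..}})"
    by (intro closedin_Int) auto
  also have "{x \<in> topspace ?X. fst x - sum (snd x) {..<k} \<in> {0..}} \<inter>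
      {x \<in> topspace ?X. sum (snd x) {..k} - fst x \<in> {0..}} =
      {(s, t) \<in> {0..1} \<times> standard_simplex n. cuts k s t}"
    by (auto simp: cuts_def)
  finally show ?thesis .
qed

context nat_transf
begin

text \<open>
On a single simplex the sets where \<open>s\<close> lies in piece \<open>k\<close> are finitely many closed sets that cover the product with the
interval. On each of them the homotopy is the continuous map \<open>split_at\<close> into one simplex, followed by the
characteristic map of that simplex; on overlaps the formulas agree by \<open>cell_unique\<close>.
\<close>

lemma continuous_map_homotopy:
  "continuous_map (prod_topology (top_of_set {0..1}) (nerve_coproduct A)) (classifying_space B)
    (\<lambda>(s, p). homotopy s p)"
  unfolding nerve_coproduct_def
proof (rule continuous_map_prod_sum_topology)
  fix i assume i: "i \<in> (SIGMA n:UNIV. nerve A n)"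
  obtain n \<sigma> where n: "i = (n, \<sigma>)" and \<sigma>: "\<sigma> \<in> nerve A n"
    using i by auto
  let ?X = "prod_topology (top_of_set {0..1::real}) (simplex_space n)"
  let ?T = "\<lambda>k. {(s, t) \<in> {0..1} \<times> standard_simplex n. cuts k s t}"
  have "continuous_map ?X (classifying_space B) (\<lambda>(s, t). homotopy s ((n, \<sigma>), t))"
  proof (rule pasting_lemma_closed[where I = "{..n}" and T = ?T and f = "\<lambda>k (s, t). cell k s n \<sigma> t"])
    fix k assume k: "k \<in> {..n}"
    show "closedin ?X (?T k)" by (rule closedin_cuts)
    have "continuous_map (subtopology ?X (?T k)) (simplex_space (Suc n)) (\<lambda>(s, t). split_at k s t)"
      unfolding continuous_map_in_subtopology
      using continuous_map_split_at[of n k] k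
      by (auto simp: continuous_map_from_subtopology intro!: split_at_in)
    from continuous_map_compose[OF this continuous_map_point_class[OF prism_in_nerve[OF \<sigma>]]] k
    show "continuous_map (subtopology ?X (?T k)) (classifying_space B) (\<lambda>(s, t). cell k s n \<sigma> t)"
      by (simp add: o_def case_prod_unfold cell_def)
  next
    fix k k' x
    assume "k \<in> {..n}" "k' \<in> {..n}" "x \<in> topspace ?X \<inter> ?T k \<inter> ?T k'"
    then show "(case x of (s, t) \<Rightarrow> cell k s n \<sigma> t) = (case x of (s, t) \<Rightarrow> cell k' s n \<sigma> t)"
      using cell_unique[OF \<sigma>, of "snd x" k "fst x" k'] by (simp add: case_prod_unfold)
  next
    fix x assume "x \<in> topspace ?X"
    then obtain s t where x: "x = (s, t)" "0 \<le> s" "s \<le> 1" "t \<in> standard_simplex n" by auto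
    then obtain k where k: "k \<le> n" "cuts k s t"
      using cuts_exists by blast
    with x homotopy_eq_cell[OF \<sigma> x(4) k]
    show "\<exists>k. k \<in> {..n} \<and> x \<in> ?T k \<and>
        (case x of (s, t) \<Rightarrow> homotopy s ((n, \<sigma>), t)) = (case x of (s, t) \<Rightarrow> cell k s n \<sigma> t)"
      by auto
  qed simp
  then show "continuous_map (prod_topology (top_of_set {0..1}) (case i of (n, \<sigma>) \<Rightarrow> simplex_space n))
      (classifying_space B) (\<lambda>(z, x). case (z, i, x) of (s, p) \<Rightarrow> homotopy s p)"
    by (simp add: n)
qed

text \<open>
The homotopy is constructed on the coproduct of all simplices and must descend to the realization at every time
simultaneously. This is possible because the interval is locally compact, so that its product with the quotient map
is again a quotient map.
\<close>

theorem homotopic_classifying_maps: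
  "homotopic_with (\<lambda>_. True) (classifying_space A) (classifying_space B)
    (classifying_map G) (classifying_map F)"
proof -
  let ?I = "top_of_set {0..1::real}"
  let ?q = "\<lambda>(s, p). (s, point_class A p)"
  have "locally_compact_space ?I"
    by (rule compact_imp_locally_compact_space) (simp add: compact_space_def compactin_subtopology)
  then have q: "quotient_map (prod_topology ?I (nerve_coproduct A)) (prod_topology ?I (classifying_space A)) ?q"
    by (intro quotient_map_prod_right quotient_map_point_class) (auto intro: Hausdorff_space_subtopology)
  have eq: "homotopy s p = homotopy s' p'"
    if "x \<in> topspace (prod_topology ?I (nerve_coproduct A))" "y \<in> topspace (prod_topology ?I (nerve_coproduct A))"
      "?q x = ?q y" "x = (s, p)" "y = (s', p')" for x y s p s' p'
  proof -
    have p: "p \<in> topspace (nerve_coproduct A)" "p' \<in> topspace (nerve_coproduct A)"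
      and eq: "realization_rel A `` {p} = realization_rel A `` {p'}"
      using that by (simp_all add: point_class_def)
    have "(p, p') \<in> realization_rel A"
      using eq_equiv_class_iff[OF equiv_realization_rel p] eq by simp
    moreover have "s = s'" "0 \<le> s" "s \<le> 1" using that by simp_all
    ultimately show ?thesis using homotopy_respects by simp
  qed
  have resp: "(\<lambda>(s, p). homotopy s p) x = (\<lambda>(s, p). homotopy s p) y"
    if "x \<in> topspace (prod_topology ?I (nerve_coproduct A))" "y \<in> topspace (prod_topology ?I (nerve_coproduct A))"
      "?q x = ?q y" for x y
  proof -
    obtain s p s' p' where "x = (s, p)" "y = (s', p')" by (cases x, cases y)
    then show ?thesis using eq[OF that] by simp
  qed
  obtain K where K: "continuous_map (prod_topology ?I (classifying_space A)) (classifying_space B) K"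
    and Kq: "\<And>x. x \<in> topspace (prod_topology ?I (nerve_coproduct A)) \<Longrightarrow> K (?q x) = (\<lambda>(s, p). homotopy s p) x"
    by (rule quotient_map_lift_exists[OF q continuous_map_homotopy]) (erule (2) resp, rule that)
  have ends: "K (0, c) = classifying_map G c" "K (1, c) = classifying_map F c"
    if "c \<in> topspace (classifying_space A)" for c
  proof -
    obtain n \<sigma> t where c: "c = point_class A ((n, \<sigma>), t)"
      and p: "((n, \<sigma>), t) \<in> topspace (nerve_coproduct A)"
      using \<open>c \<in> topspace (classifying_space A)\<close> by (auto simp: topspace_classifying_space)
    have \<sigma>t: "\<sigma> \<in> nerve A n" "t \<in> standard_simplex n"
      using p by (simp_all add: topspace_nerve_coproduct)
    show "K (0, c) = classifying_map G c" "K (1, c) = classifying_map F c"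
      using Kq[of "(0, ((n, \<sigma>), t))"] Kq[of "(1, ((n, \<sigma>), t))"] p
      by (simp_all add: c classifying_map_point_class[OF F.is_functor_axioms p]
          classifying_map_point_class[OF G.is_functor_axioms p] homotopy_end[OF \<sigma>t])
  qed
  show ?thesis
    by (subst homotopic_with) (use K ends in auto)
qed

end

text \<open>
On classifying spaces, a strict left inverse stays a strict left inverse, and the transformation \<open>\<eta>\<close> becomes a
homotopy from the identity.
\<close>

lemma homotopy_equivalenceI:
  assumes F: "is_functor A B F" and P: "is_functor B A P"
    and ret: "P \<circ>\<^sub>F F = id_ftr A" and \<eta>: "nat_transf B B (id_ftr B) (F \<circ>\<^sub>F P) \<eta>"
  shows "homotopy_equivalence F"
proof -
  interpret F: is_functor A B F by fact
  interpret \<eta>: nat_transf B B "id_ftr B" "F \<circ>\<^sub>F P" \<eta> by fact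
  note cont = continuous_map_classifying_map[OF F] continuous_map_classifying_map[OF P]
  have "homotopic_with (\<lambda>_. True) (classifying_space A) (classifying_space A)
      (classifying_map P \<circ> classifying_map F) id"
  proof (rule homotopic_with_equal)
    show "continuous_map (classifying_space A) (classifying_space A) (classifying_map P \<circ> classifying_map F)"
      using cont by (rule continuous_map_compose)
    show "(classifying_map P \<circ> classifying_map F) c = id c" if "c \<in> topspace (classifying_space A)" for c
      using that classifying_map_comp[OF F P that] by (simp add: ret classifying_map_id F.A.category_axioms)
  qed auto
  moreover have "homotopic_with (\<lambda>_. True) (classifying_space B) (classifying_space B)
      (classifying_map F \<circ> classifying_map P) id"
    by (rule homotopic_with_eq[OF \<eta>.homotopic_classifying_maps])
      (auto simp: classifying_map_comp[OF P F] classifying_map_id F.B.category_axioms)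
  ultimately show ?thesis
    using cont unfolding homotopy_equivalence_def homotopy_equivalence_map_def F.fsrc F.ftgt by blast
qed

section \<open>The comparison theorem\<close>

theorem theorem1:
  shows "\<exists>\<iota> :: ('i, 'f) cat \<Rightarrow> ('j, 'g) cat \<Rightarrow> ('i \<times> 'j, 'f \<times> 'g, 'c, 'd) diagram \<Rightarrow>
        (('i, 'f, 'j, 'g, 'c, 'd) hocolim_holim_obj, ('i, 'f, 'j, 'g, 'c, 'd) hocolim_holim_arr,
         ('i, 'f, 'j, 'g, 'c, 'd) holim_hocolim_obj, ('i, 'f, 'j, 'g, 'c, 'd) holim_hocolim_arr) ftr.
    \<comment> \<open>\<open>\<iota>\<close> is a functor; it is faithful for nonempty \<open>I\<close>
        (for \<open>I\<close> empty it is the functor from \<open>J\<close> to the one-arrow category)\<close>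
    (\<forall>I J C. category I \<longrightarrow> category J \<longrightarrow> is_functor (prod_cat I J) CAT C \<longrightarrow>
      is_functor (hocolim_holim I J C) (holim_hocolim I J C) (\<iota> I J C) \<and>
      (Obj I \<noteq> {} \<longrightarrow> faithful (\<iota> I J C))) \<and>
    \<comment> \<open>\<open>\<iota>\<close> is natural in \<open>C\<close>, in \<open>J\<close> and in \<open>I\<close>\<close>
    (\<forall>I J C D \<phi>. category I \<longrightarrow> category J \<longrightarrow> nat_transf (prod_cat I J) CAT C D \<phi> \<longrightarrow>
      \<iota> I J D \<circ>\<^sub>F hocolim_holim_map I J \<phi> = holim_hocolim_map I J \<phi> \<circ>\<^sub>F \<iota> I J C) \<and>
    (\<forall>I J J' v C. category I \<longrightarrow> is_functor J J' v \<longrightarrow> is_functor (prod_cat I J') CAT C \<longrightarrow>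
      \<iota> I J' C \<circ>\<^sub>F hocolim_holim_reindex I v C =
      holim_hocolim_reindex I v C \<circ>\<^sub>F \<iota> I J (C \<circ>\<^sub>F prod_ftr (id_ftr I) v)) \<and>
    (\<forall>I I' J u C. is_functor I I' u \<longrightarrow> category J \<longrightarrow> is_functor (prod_cat I' J) CAT C \<longrightarrow>
      \<iota> I J (C \<circ>\<^sub>F prod_ftr u (id_ftr J)) \<circ>\<^sub>F hocolim_holim_restrict u J C =
      holim_hocolim_restrict u J C \<circ>\<^sub>F \<iota> I' J C) \<and>
    (\<exists>p :: ('i, 'f) cat \<Rightarrow> 'i \<Rightarrow> ('i, 'f, 'i, 'f) ntr \<Rightarrow> ('j, 'g) cat \<Rightarrow>
        ('i \<times> 'j, 'f \<times> 'g, 'c, 'd) diagram \<Rightarrow>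
        (('i, 'f, 'j, 'g, 'c, 'd) holim_hocolim_obj, ('i, 'f, 'j, 'g, 'c, 'd) holim_hocolim_arr,
         ('i, 'f, 'j, 'g, 'c, 'd) hocolim_holim_obj, ('i, 'f, 'j, 'g, 'c, 'd) hocolim_holim_arr) ftr.
      (\<forall>I e \<epsilon> J C. category I \<longrightarrow> pseudo_final I e \<epsilon> \<longrightarrow> category J \<longrightarrow>
        is_functor (prod_cat I J) CAT C \<longrightarrow>
        is_functor (holim_hocolim I J C) (hocolim_holim I J C) (p I e \<epsilon> J C) \<and>
        p I e \<epsilon> J C \<circ>\<^sub>F \<iota> I J C = id_ftr (hocolim_holim I J C) \<and>
        (\<exists>\<eta>. nat_transf (holim_hocolim I J C) (holim_hocolim I J C)
          (id_ftr (holim_hocolim I J C)) (\<iota> I J C \<circ>\<^sub>F p I e \<epsilon> J C) \<eta>)) \<and>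
      \<comment> \<open>\<open>p\<close> is natural in \<open>C\<close>, in \<open>J\<close> and in \<open>(I, e, \<epsilon>)\<close>\<close>
      (\<forall>I e \<epsilon> J C D \<phi>. category I \<longrightarrow> pseudo_final I e \<epsilon> \<longrightarrow> category J \<longrightarrow>
        nat_transf (prod_cat I J) CAT C D \<phi> \<longrightarrow>
        p I e \<epsilon> J D \<circ>\<^sub>F holim_hocolim_map I J \<phi> = hocolim_holim_map I J \<phi> \<circ>\<^sub>F p I e \<epsilon> J C) \<and>
      (\<forall>I e \<epsilon> J J' v C. category I \<longrightarrow> pseudo_final I e \<epsilon> \<longrightarrow> is_functor J J' v \<longrightarrow>
        is_functor (prod_cat I J') CAT C \<longrightarrow>
        p I e \<epsilon> J' C \<circ>\<^sub>F holim_hocolim_reindex I v C =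
        hocolim_holim_reindex I v C \<circ>\<^sub>F p I e \<epsilon> J (C \<circ>\<^sub>F prod_ftr (id_ftr I) v)) \<and>
      (\<forall>I e \<epsilon> I' e' \<epsilon>' J u C. is_functor I I' u \<longrightarrow> pseudo_final I e \<epsilon> \<longrightarrow>
        pseudo_final I' e' \<epsilon>' \<longrightarrow> preserves_pseudo_final u e \<epsilon> e' \<epsilon>' \<longrightarrow> category J \<longrightarrow>
        is_functor (prod_cat I' J) CAT C \<longrightarrow>
        p I e \<epsilon> J (C \<circ>\<^sub>F prod_ftr u (id_ftr J)) \<circ>\<^sub>F holim_hocolim_restrict u J C =
        hocolim_holim_restrict u J C \<circ>\<^sub>F p I' e' \<epsilon>' J C)) \<and>
    (\<forall>I J C. category I \<longrightarrow> (\<exists>e \<epsilon>. pseudo_final I e \<epsilon>) \<longrightarrow> category J \<longrightarrow>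
      is_functor (prod_cat I J) CAT C \<longrightarrow> homotopy_equivalence (\<iota> I J C))"
proof (intro exI[of _ comparison] exI[of _ final_retraction] conjI allI impI)
  fix I :: "('i, 'f) cat" and J :: "('j, 'g) cat" and C :: "('i \<times> 'j, 'f \<times> 'g, 'c, 'd) diagram"
  assume "category I" "category J" "is_functor (prod_cat I J) CAT C"
  then interpret bidiagram I J C
    by (simp add: bidiagram_def diagram_def)
  show "is_functor (hocolim_holim I J C) (holim_hocolim I J C) (comparison I J C)"
    by (rule is_functor_comparison)
  show "faithful (comparison I J C)" if "Obj I \<noteq> {}"
    using that by (rule faithful_comparison)
next
  fix I :: "('i, 'f) cat" and J :: "('j, 'g) cat" and C D :: "('i \<times> 'j, 'f \<times> 'g, 'c, 'd) diagram" and \<phi>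
  assume "category I" "category J" "nat_transf (prod_cat I J) CAT C D \<phi>"
  then interpret bidiagram_map I J C D \<phi>
    by (simp add: bidiagram_map_def diagram_map_def)
  show "comparison I J D \<circ>\<^sub>F hocolim_holim_map I J \<phi> = holim_hocolim_map I J \<phi> \<circ>\<^sub>F comparison I J C"
    by (rule comparison_natural_diagram)
next
  fix I :: "('i, 'f) cat" and J J' :: "('j, 'g) cat" and v and C :: "('i \<times> 'j, 'f \<times> 'g, 'c, 'd) diagram"
  assume "category I" "is_functor J J' v" "is_functor (prod_cat I J') CAT C"
  then interpret bidiagram_reindex I J J' C v
    by (simp add: bidiagram_reindex_def bidiagram_def diagram_def is_functor_def)
  show "comparison I J' C \<circ>\<^sub>F hocolim_holim_reindex I v C =
      holim_hocolim_reindex I v C \<circ>\<^sub>F comparison I J (C \<circ>\<^sub>F prod_ftr (id_ftr I) v)"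
    by (rule comparison_natural_reindex)
next
  fix I I' :: "('i, 'f) cat" and J :: "('j, 'g) cat" and u and C :: "('i \<times> 'j, 'f \<times> 'g, 'c, 'd) diagram"
  assume "is_functor I I' u" "category J" "is_functor (prod_cat I' J) CAT C"
  then interpret bidiagram_restrict I I' J C u
    by (simp add: bidiagram_restrict_def bidiagram_def diagram_def is_functor_def)
  show "comparison I J (C \<circ>\<^sub>F prod_ftr u (id_ftr J)) \<circ>\<^sub>F hocolim_holim_restrict u J C =
      holim_hocolim_restrict u J C \<circ>\<^sub>F comparison I' J C"
    by (rule comparison_natural_restrict)
next
  fix I :: "('i, 'f) cat" and e \<epsilon> and J :: "('j, 'g) cat" and C :: "('i \<times> 'j, 'f \<times> 'g, 'c, 'd) diagram"
  assume "category I" "pseudo_final I e \<epsilon>" "category J" "is_functor (prod_cat I J) CAT C"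
  then interpret bidiagram_final I J C e \<epsilon>
    by (simp add: bidiagram_final_def bidiagram_final_axioms_def bidiagram_def diagram_def)
  show "is_functor (holim_hocolim I J C) (hocolim_holim I J C) (final_retraction I e \<epsilon> J C)"
    by (rule is_functor_retraction)
  show "final_retraction I e \<epsilon> J C \<circ>\<^sub>F comparison I J C = id_ftr (hocolim_holim I J C)"
    by (rule retraction_comparison)
  show "\<exists>\<eta>. nat_transf (holim_hocolim I J C) (holim_hocolim I J C)
      (id_ftr (holim_hocolim I J C)) (comparison I J C \<circ>\<^sub>F final_retraction I e \<epsilon> J C) \<eta>"
    using nat_transf_unit by blast
next
  fix I :: "('i, 'f) cat" and e \<epsilon> and J :: "('j, 'g) cat"
    and C D :: "('i \<times> 'j, 'f \<times> 'g, 'c, 'd) diagram" and \<phi>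
  assume final: "pseudo_final I e \<epsilon>"
    and "category I" "category J" "nat_transf (prod_cat I J) CAT C D \<phi>"
  then interpret bidiagram_map I J C D \<phi>
    by (simp add: bidiagram_map_def diagram_map_def)
  show "final_retraction I e \<epsilon> J D \<circ>\<^sub>F holim_hocolim_map I J \<phi> =
      hocolim_holim_map I J \<phi> \<circ>\<^sub>F final_retraction I e \<epsilon> J C"
    using final by (rule retraction_natural_diagram)
next
  fix I :: "('i, 'f) cat" and e \<epsilon> and J J' :: "('j, 'g) cat" and v
    and C :: "('i \<times> 'j, 'f \<times> 'g, 'c, 'd) diagram"
  assume final: "pseudo_final I e \<epsilon>"
    and "category I" "is_functor J J' v" "is_functor (prod_cat I J') CAT C"
  then interpret bidiagram_reindex I J J' C v
    by (simp add: bidiagram_reindex_def bidiagram_def diagram_def is_functor_def)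
  show "final_retraction I e \<epsilon> J' C \<circ>\<^sub>F holim_hocolim_reindex I v C =
      hocolim_holim_reindex I v C \<circ>\<^sub>F final_retraction I e \<epsilon> J (C \<circ>\<^sub>F prod_ftr (id_ftr I) v)"
    using final by (rule retraction_natural_reindex)
next
  fix I I' :: "('i, 'f) cat" and e \<epsilon> e' \<epsilon>' and J :: "('j, 'g) cat" and u
    and C :: "('i \<times> 'j, 'f \<times> 'g, 'c, 'd) diagram"
  assume final: "pseudo_final I e \<epsilon>" "pseudo_final I' e' \<epsilon>'" "preserves_pseudo_final u e \<epsilon> e' \<epsilon>'"
    and "is_functor I I' u" "category J" "is_functor (prod_cat I' J) CAT C"
  then interpret bidiagram_restrict I I' J C u
    by (simp add: bidiagram_restrict_def bidiagram_def diagram_def is_functor_def)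
  show "final_retraction I e \<epsilon> J (C \<circ>\<^sub>F prod_ftr u (id_ftr J)) \<circ>\<^sub>F holim_hocolim_restrict u J C =
      hocolim_holim_restrict u J C \<circ>\<^sub>F final_retraction I' e' \<epsilon>' J C"
    using final by (rule retraction_natural_restrict)
next
  fix I :: "('i, 'f) cat" and J :: "('j, 'g) cat" and C :: "('i \<times> 'j, 'f \<times> 'g, 'c, 'd) diagram"
  assume "\<exists>e \<epsilon>. pseudo_final I e \<epsilon>"
  then obtain e \<epsilon> where "pseudo_final I e \<epsilon>" by blast
  moreover assume "category I" "category J" "is_functor (prod_cat I J) CAT C"
  ultimately interpret bidiagram_final I J C e \<epsilon>
    by (simp add: bidiagram_final_def bidiagram_final_axioms_def bidiagram_def diagram_def)
  show "homotopy_equivalence (comparison I J C)"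
    using is_functor_comparison is_functor_retraction retraction_comparison nat_transf_unit
    by (rule homotopy_equivalenceI)
qed

end
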